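(* Assume that $\alpha > -1$ and $\alpha+\beta > -1/2$. Let $1 < p < \infty$ and $\delta \in \mathbb{R}$. If $M_{*}^{\alpha,\beta}$ is bounded on $L^p(\mathbb{R}_+,x^{\delta}dx)$, then $$\frac1p<\alpha+\beta+\frac12$$ and, moreover, $$-1 < \delta, \qquad -\beta p \le \delta, \qquad \delta < (2\alpha+2)p-1, \qquad \delta < (2\alpha+\beta+1)p-1.$$
   Context: $\mathbb{R}_+=(0,\infty)$; $\alpha,\beta$ are real. Let $d\mu_\alpha(x)=x^{2\alpha+1}dx$ on $\mathbb{R}_+$, and let $J_\nu$ be the Bessel function of the first kind and order $\nu$. For $\alpha>-1$, $\alpha+\beta>-1/2$ and $t,x,z>0$ with $t\ne|x-z|$, $t\ne x+z$, put $$K_t^{\alpha,\beta}(x,z) = \frac{2^{\alpha+\beta}\Gamma(\alpha+\beta+1)}{t^{\alpha+\beta}(xz)^{\alpha}} \int_0^{\infty} J_{\alpha+\beta}(ty)J_{\alpha}(xy) J_{\alpha}(zy) y^{1-\alpha-\beta}\, dy,$$ where the integral converges absolutely if $\alpha+\beta>1/2$ and otherwise is understood as a conditionally convergent (at $\infty$) improper Riemann integral. Define $$M_t^{\alpha,\beta}f(x)=\int_0^{\infty}K^{\alpha,\beta}_t(x,z)f(z)\, d\mu_{\alpha}(z),\qquad M_*^{\alpha,\beta}f(x)=\sup_{t>0}\big|M_t^{\alpha,\beta}f(x)\big|,\qquad x\in\mathbb{R}_+.$$ Boundedness on $L^p(\mathbb{R}_+,x^\delta dx)$ means (including that the operator is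 well defined there) $\|M_*^{\alpha,\beta}f\|_{L^p(\mathbb{R}_+,x^\delta dx)}\le C\|f\|_{L^p(\mathbb{R}_+,x^\delta dx)}$ with $C$ independent of $f$. *)

theory Defs
  imports "HOL-Analysis.Analysis"
begin

text \<open>Bessel function of the first kind and real order, for arguments \<open>x > 0\<close>.\<close>

definition bessel_J :: "real \<Rightarrow> real \<Rightarrow> real" where
  "bessel_J \<nu> x =
     (\<Sum>k. (- 1) ^ k * rGamma (real k + \<nu> + 1) / fact k * (x / 2) powr (2 * real k + \<nu>))"

text \<open>
  The measure \<open>x\<^sup>\<delta> dx\<close> on \<open>(0, \<infinity>)\<close>; in particular \<open>\<mu>\<^sub>\<alpha>\<close> is \<open>power_measure (2 * \<alpha> + 1)\<close>.
\<close>

definition power_measure :: "real \<Rightarrow> real measure" where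
  "power_measure \<delta> = density (restrict_space lborel {0<..}) (\<lambda>x. ennreal (x powr \<delta>))"

text \<open>
  The integral over \<open>y\<close> is improper at infinity only: near zero the integrand is
  \<open>O(y powr (2 * \<alpha> + 1))\<close>, hence Lebesgue integrable on \<open>(0, R]\<close> when \<open>\<alpha> > -1\<close>. In case of
  absolute convergence the limit is the Lebesgue integral over \<open>(0, \<infinity>)\<close>.
  At \<open>t = \<bar>x - z\<bar>\<close> and \<open>t = x + z\<close> the limit need not exist and the value of the kernel is
  arbitrary; for fixed \<open>t\<close> and \<open>x\<close> this concerns at most two \<open>z\<close>.
\<close>

definition sph_kernel :: "real \<Rightarrow> real \<Rightarrow> real \<Rightarrow> real \<Rightarrow> real \<Rightarrow> real" where
  "sph_kernel \<alpha> \<beta> t x z =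
     2 powr (\<alpha> + \<beta>) * Gamma (\<alpha> + \<beta> + 1) / (t powr (\<alpha> + \<beta>) * (x * z) powr \<alpha>) *
     Lim at_top (\<lambda>R. LINT y:{0<..R}|lborel.
       bessel_J (\<alpha> + \<beta>) (t * y) * bessel_J \<alpha> (x * y) * bessel_J \<alpha> (z * y) * y powr (1 - \<alpha> - \<beta>))"

definition sph_mean :: "real \<Rightarrow> real \<Rightarrow> real \<Rightarrow> (real \<Rightarrow> real) \<Rightarrow> real \<Rightarrow> real" where
  "sph_mean \<alpha> \<beta> t f x = (LINT z|power_measure (2 * \<alpha> + 1). sph_kernel \<alpha> \<beta> t x z * f z)"

definition sph_max :: "real \<Rightarrow> real \<Rightarrow> (real \<Rightarrow> real) \<Rightarrow> real \<Rightarrow> ennreal" where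
  "sph_max \<alpha> \<beta> f x = (SUP t\<in>{0<..}. ennreal \<bar>sph_mean \<alpha> \<beta> t f x\<bar>)"

definition sph_max_defined_at :: "real \<Rightarrow> real \<Rightarrow> (real \<Rightarrow> real) \<Rightarrow> real \<Rightarrow> bool" where
  "sph_max_defined_at \<alpha> \<beta> f x \<longleftrightarrow>
     (\<forall>t>0. integrable (power_measure (2 * \<alpha> + 1)) (\<lambda>z. sph_kernel \<alpha> \<beta> t x z * f z))"

text \<open>Real powers of extended nonnegative reals, for positive exponents.\<close>

definition ennreal_powr :: "ennreal \<Rightarrow> real \<Rightarrow> ennreal" where
  "ennreal_powr a p = (if a = \<infinity> then \<infinity> else ennreal (enn2real a powr p))"

definition Lp_norm :: "real \<Rightarrow> 'a measure \<Rightarrow> ('a \<Rightarrow> ennreal) \<Rightarrow> ennreal" where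
  "Lp_norm p M F = ennreal_powr (\<integral>\<^sup>+ x. ennreal_powr (F x) p \<partial>M) (1 / p)"

definition in_Lp :: "real \<Rightarrow> 'a measure \<Rightarrow> ('a \<Rightarrow> real) \<Rightarrow> bool" where
  "in_Lp p M f \<longleftrightarrow> f \<in> borel_measurable M \<and> Lp_norm p M (\<lambda>x. ennreal \<bar>f x\<bar>) < \<infinity>"

text \<open>
  Boundedness of the maximal operator on \<open>L\<^sup>p((0, \<infinity>), x\<^sup>\<delta> dx)\<close>, including that it is well
  defined there: for almost every \<open>x\<close> all the integrals under the supremum converge.
\<close>

definition sph_max_bounded :: "real \<Rightarrow> real \<Rightarrow> real \<Rightarrow> real \<Rightarrow> bool" where
  "sph_max_bounded \<alpha> \<beta> p \<delta> \<longleftrightarrow>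
     (\<forall>f. in_Lp p (power_measure \<delta>) f \<longrightarrow>
            (AE x in power_measure \<delta>. sph_max_defined_at \<alpha> \<beta> f x)) \<and>
     (\<exists>C\<ge>0. \<forall>f. in_Lp p (power_measure \<delta>) f \<longrightarrow>
        Lp_norm p (power_measure \<delta>) (sph_max \<alpha> \<beta> f)
          \<le> ennreal C * Lp_norm p (power_measure \<delta>) (\<lambda>x. ennreal \<bar>f x\<bar>))"

end

theory Submission
  imports Defs
begin

text \<open>
  All estimates use the Bessel function only through its behaviour at \<open>0\<close> and through
  \<open>J\<^sub>\<nu> w = A * cos (w - \<phi>) / sqrt w + O(w powr (-3/2))\<close> with \<open>A > 0\<close>; the phase is never computed.

  Functions \<open>g z = exp (- z\<^sup>2) * (1 - exp (- z\<^sup>2)) ^ m\<close> with \<open>m\<close> large lie in the weighted space and have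
  explicit Hankel transforms, so their means are absolutely convergent integrals. As \<open>x\<close> tends to \<open>0\<close>,
  \<open>M\<^sub>t g x\<close> has a nonzero limit for some \<open>t\<close>, which forces \<open>-1 < \<delta>\<close>. For \<open>\<beta> < 1\<close> and \<open>t = x + s\<close> with
  suitable \<open>s\<close>, \<open>M\<^sub>t g x\<close> decays exactly like \<open>x powr - (2 * \<alpha> + \<beta> + 1)\<close>, which forces
  \<open>\<delta> < (2 * \<alpha> + \<beta> + 1) * p - 1\<close>. The kernel is symmetric, so \<open>M\<^sub>t\<close> is self-adjoint for \<open>\<mu>\<^sub>\<alpha>\<close>, and the same two
  lower bounds, dualised, give \<open>\<delta> < (2 * \<alpha> + 2) * p - 1\<close> and \<open>- \<beta> * p \<le> \<delta>\<close>. For \<open>\<beta> \<ge> 1\<close> the conditions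
  involving \<open>\<beta>\<close> follow from the other two. Finally, if \<open>\<alpha> + \<beta> < 1/2\<close>, the kernel is singular like
  \<open>\<bar>z - (x - t)\<bar> powr (\<alpha> + \<beta> - 1/2)\<close>; letting \<open>t = x - 1\<close>, all these singularities sit at \<open>z = 1\<close>, and a
  function with a critical singularity there gives \<open>1 / p < \<alpha> + \<beta> + 1/2\<close>.
\<close>

subsection \<open>Asymptotics of Bessel functions\<close>

text \<open>Two obstacles shape the proof. The kernel is a conditionally convergent limit, so
  integrals against it can be rewritten only through truncations; this calls for bounds on the
  truncated kernel that are uniform in the cutoff and integrable in \<open>z\<close>, after which
  Fubini and dominated convergence apply. And no closed form of the kernel is used, so the limits
  attached to the test functions are shown to be nonzero indirectly: each is a function of one
  parameter with a power series whose coefficients contain moments of the Hankel transform, and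
  moments of high order do not vanish. The supremum over \<open>t\<close> is essential in two
  places, where the radius moves with \<open>x\<close>: the decay at infinity
  (\<open>t = x + s\<close>) and the singularity (\<open>t = x - 1\<close>). The bounds at the
  origin use one fixed radius, and \<open>- \<beta> * p \<le> \<delta>\<close> uses only that the
  single means are bounded uniformly in \<open>t\<close>. Strict inequalities come from a logarithm
  that diverges at the critical exponent; \<open>- \<beta> * p \<le> \<delta>\<close> compares two
  powers of \<open>t\<close> instead and therefore includes equality.\<close>

text \<open>\<open>f + K / x\<close> decreases, \<open>f - K / x\<close> increases, and every value
  of the second lies below every value of the first. The supremum \<open>l\<close> of the increasing
  function separates the two, which gives the limit together with its rate.\<close>

lemma inverse_square_derivative_bound_limit:
  fixes f f' :: "real \<Rightarrow> real"
  assumes der: "\<And>x. x > 0 \<Longrightarrow> (f has_real_derivative f' x) (at x)"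
    and bd: "\<And>x. x \<ge> 1 \<Longrightarrow> \<bar>f' x\<bar> \<le> K / x\<^sup>2"
  obtains l where "\<And>x. x \<ge> 1 \<Longrightarrow> \<bar>f x - l\<bar> \<le> K / x"
proof -
  have up: "f y + K / y \<le> f x + K / x" if "1 \<le> x" "x \<le> y" for x y
  proof (rule DERIV_nonpos_imp_nonincreasing[OF that(2)])
    fix z assume "x \<le> z" "z \<le> y"
    then have z: "z \<ge> 1" using that by simp
    have "((\<lambda>x. f x + K / x) has_real_derivative f' z - K / z\<^sup>2) (at z)"
      using der[of z] z by (auto intro!: derivative_eq_intros simp: power2_eq_square)
    moreover have "f' z - K / z\<^sup>2 \<le> 0" using bd[OF z] by linarith
    ultimately show "\<exists>y. ((\<lambda>x. f x + K / x) has_real_derivative y) (at z) \<and> y \<le> 0" by blast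
  qed
  have dn: "f x - K / x \<le> f y - K / y" if "1 \<le> x" "x \<le> y" for x y
  proof (rule DERIV_nonneg_imp_nondecreasing[OF that(2)])
    fix z assume "x \<le> z" "z \<le> y"
    then have z: "z \<ge> 1" using that by simp
    have "((\<lambda>x. f x - K / x) has_real_derivative f' z + K / z\<^sup>2) (at z)"
      using der[of z] z by (auto intro!: derivative_eq_intros simp: power2_eq_square)
    moreover have "f' z + K / z\<^sup>2 \<ge> 0" using bd[OF z] by linarith
    ultimately show "\<exists>y. ((\<lambda>x. f x - K / x) has_real_derivative y) (at z) \<and> 0 \<le> y" by blast
  qed
  have K: "K \<ge> 0" using bd[of 1] by simp
  have cross: "f x - K / x \<le> f y + K / y" if "1 \<le> x" "1 \<le> y" for x y
  proof -
    let ?z = "max x y"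
    have "f x - K / x \<le> f ?z - K / ?z" using that by (intro dn) auto
    also have "\<dots> \<le> f ?z + K / ?z"
    proof -
      have "0 \<le> K / ?z" using K that by (intro divide_nonneg_nonneg) auto
      then show ?thesis by linarith
    qed
    also have "\<dots> \<le> f y + K / y" using that by (intro up) auto
    finally show ?thesis .
  qed
  define l where "l = (SUP x\<in>{1..}. f x - K / x)"
  have "f x - K / x \<le> l" if "x \<ge> 1" for x
    unfolding l_def using that cross[of _ 1] by (intro cSUP_upper bdd_aboveI2) auto
  moreover have "l \<le> f x + K / x" if "x \<ge> 1" for x
    unfolding l_def using that cross[of _ x] by (intro cSUP_least) auto
  ultimately have "\<bar>f x - l\<bar> \<le> K / x" if "x \<ge> 1" for x
    using that by (fastforce simp: abs_le_iff)
  then show ?thesis using that by blast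
qed

text \<open>The energy \<open>u\<^sup>2 + v\<^sup>2\<close> stays bounded and bounded away from \<open>0\<close>, and in the rotating frame the pair
  \<open>(u, v)\<close> has a derivative of order \<open>x\<close> to the power \<open>-2\<close>.\<close>

lemma perturbed_oscillator_asymptotics:
  fixes u v :: "real \<Rightarrow> real"
  assumes u: "\<And>x. x > 0 \<Longrightarrow> (u has_real_derivative v x) (at x)"
    and v: "\<And>x. x > 0 \<Longrightarrow> (v has_real_derivative - (1 - q / x\<^sup>2) * u x) (at x)"
    and x0: "x0 > 0" "u x0 \<noteq> 0"
  obtains A \<phi> C where "A > 0" "\<And>x. x \<ge> 1 \<Longrightarrow> \<bar>u x - A * cos (x - \<phi>)\<bar> \<le> C / x"
proof -
  define E where "E x = (u x)\<^sup>2 + (v x)\<^sup>2" for x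
  have E_der: "(E has_real_derivative 2 * q * u x * v x / x\<^sup>2) (at x)" if "x > 0" for x
    unfolding E_def using that
    by (auto intro!: derivative_eq_intros u[OF that] v[OF that] simp: field_simps power2_eq_square)
  have E_bd: "\<bar>2 * q * u x * v x / x\<^sup>2\<bar> \<le> \<bar>q\<bar> / x\<^sup>2 * E x" for x
  proof -
    have "2 * \<bar>u x\<bar> * \<bar>v x\<bar> \<le> E x"
      unfolding E_def using sum_squares_bound[of "\<bar>u x\<bar>" "\<bar>v x\<bar>"] by simp
    then have "\<bar>q\<bar> * (2 * \<bar>u x\<bar> * \<bar>v x\<bar>) / x\<^sup>2 \<le> \<bar>q\<bar> * E x / x\<^sup>2"
      by (intro divide_right_mono mult_left_mono) auto
    then show ?thesis by (simp add: abs_mult mult_ac)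
  qed
  \<comment> \<open>Gronwall's argument with the integrating factor
    \<open>exp (\<bar>q\<bar> / x)\<close>: its exponent has derivative
    \<open>- \<bar>q\<bar> / x\<^sup>2\<close>, exactly the size allowed by \<open>E_bd\<close>. The
    opposite sign gives the lower bound \<open>E_lo\<close>.\<close>
  have E_up: "E x \<le> E 1 * exp \<bar>q\<bar>" if "x \<ge> 1" for x
  proof -
    have "E x * exp (\<bar>q\<bar> / x) \<le> E 1 * exp (\<bar>q\<bar> / 1)"
    proof (rule DERIV_nonpos_imp_nonincreasing[OF that])
      fix z :: real assume "1 \<le> z" "z \<le> x"
      then have z: "z > 0" by simp
      have "((\<lambda>x. E x * exp (\<bar>q\<bar> / x)) has_real_derivative
              exp (\<bar>q\<bar> / z) * (2 * q * u z * v z / z\<^sup>2 - \<bar>q\<bar> / z\<^sup>2 * E z)) (at z)"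
        using z by (auto intro!: derivative_eq_intros E_der simp: field_simps power2_eq_square)
      moreover have "exp (\<bar>q\<bar> / z) * (2 * q * u z * v z / z\<^sup>2 - \<bar>q\<bar> / z\<^sup>2 * E z) \<le> 0"
        using abs_le_D1[OF E_bd[of z]] by (intro mult_nonneg_nonpos exp_ge_zero) linarith
      ultimately show "\<exists>y. ((\<lambda>x. E x * exp (\<bar>q\<bar> / x)) has_real_derivative y) (at z) \<and> y \<le> 0" by blast
    qed
    moreover have "E x * 1 \<le> E x * exp (\<bar>q\<bar> / x)"
      using that by (intro mult_left_mono) (auto simp: E_def)
    ultimately show ?thesis by simp
  qed
  have E_lo: "E x0 * exp (- \<bar>q\<bar> / x0) \<le> E x" if "x \<ge> x0" for x
  proof -
    have "E x0 * exp (- \<bar>q\<bar> / x0) \<le> E x * exp (- \<bar>q\<bar> / x)"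
    proof (rule DERIV_nonneg_imp_nondecreasing[OF that])
      fix z :: real assume "x0 \<le> z" "z \<le> x"
      then have z: "z > 0" using x0 by simp
      have "((\<lambda>x. E x * exp (- \<bar>q\<bar> / x)) has_real_derivative
              exp (- \<bar>q\<bar> / z) * (2 * q * u z * v z / z\<^sup>2 + \<bar>q\<bar> / z\<^sup>2 * E z)) (at z)"
        using z by (auto intro!: derivative_eq_intros E_der simp: field_simps power2_eq_square)
      moreover have "exp (- \<bar>q\<bar> / z) * (2 * q * u z * v z / z\<^sup>2 + \<bar>q\<bar> / z\<^sup>2 * E z) \<ge> 0"
        using abs_le_D2[OF E_bd[of z]] by (intro mult_nonneg_nonneg exp_ge_zero) linarith
      ultimately show "\<exists>y. ((\<lambda>x. E x * exp (- \<bar>q\<bar> / x)) has_real_derivative y) (at z) \<and> 0 \<le> y" by blast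
    qed
    also have "\<dots> \<le> E x * 1"
      using that x0 by (intro mult_left_mono) (auto simp: E_def divide_nonpos_pos)
    finally show ?thesis by simp
  qed
  define M where "M = sqrt (E 1 * exp \<bar>q\<bar>)"
  have u_bd: "\<bar>u x\<bar> \<le> M" if "x \<ge> 1" for x
  proof -
    have "(u x)\<^sup>2 \<le> E x" by (simp add: E_def)
    with E_up[OF that] have "(u x)\<^sup>2 \<le> E 1 * exp \<bar>q\<bar>" by simp
    then show ?thesis unfolding M_def by (metis real_sqrt_abs real_sqrt_le_mono)
  qed
  have M: "M \<ge> 0" using u_bd[of 1] by simp
  define a where "a x = u x * cos x - v x * sin x" for x
  define b where "b x = u x * sin x + v x * cos x" for x
  define K where "K = \<bar>q\<bar> * M"
  have a_der: "(a has_real_derivative - (q / x\<^sup>2 * u x * sin x)) (at x)" if "x > 0" for x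
    unfolding a_def using that
    by (auto intro!: derivative_eq_intros u[OF that] v[OF that] simp: field_simps)
  have b_der: "(b has_real_derivative q / x\<^sup>2 * u x * cos x) (at x)" if "x > 0" for x
    unfolding b_def using that
    by (auto intro!: derivative_eq_intros u[OF that] v[OF that] simp: field_simps)
  have pbd: "\<bar>q / x\<^sup>2 * u x * c\<bar> \<le> K / x\<^sup>2" if "x \<ge> 1" "\<bar>c\<bar> \<le> 1" for x c
  proof -
    have "\<bar>u x\<bar> * \<bar>c\<bar> \<le> M * 1" using u_bd[OF that(1)] that(2) M by (intro mult_mono) auto
    then have "\<bar>q\<bar> / x\<^sup>2 * (\<bar>u x\<bar> * \<bar>c\<bar>) \<le> \<bar>q\<bar> / x\<^sup>2 * M"
      by (intro mult_left_mono) auto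
    then show ?thesis by (simp add: K_def abs_mult mult_ac)
  qed
  obtain a0 where a0: "\<And>x. x \<ge> 1 \<Longrightarrow> \<bar>a x - a0\<bar> \<le> K / x"
    by (rule inverse_square_derivative_bound_limit[of a "\<lambda>x. - (q / x\<^sup>2 * u x * sin x)" K])
       (use a_der pbd in \<open>auto simp del: abs_mult\<close>)
  obtain b0 where b0: "\<And>x. x \<ge> 1 \<Longrightarrow> \<bar>b x - b0\<bar> \<le> K / x"
    by (rule inverse_square_derivative_bound_limit[of b "\<lambda>x. q / x\<^sup>2 * u x * cos x" K])
       (use b_der pbd in \<open>auto simp del: abs_mult\<close>)
  have K0: "K \<ge> 0" unfolding K_def using M by simp
  \<comment> \<open>The rotation preserves the energy, so if both limits were zero the energy would
    be at most \<open>2 * K\<^sup>2 / x\<^sup>2\<close>, while \<open>E_lo\<close> keeps it above a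
    positive constant. This is where \<open>u x0 \<noteq> 0\<close> enters and why the amplitude is
    positive.\<close>
  have ne: "a0\<^sup>2 + b0\<^sup>2 \<noteq> 0"
  proof
    assume "a0\<^sup>2 + b0\<^sup>2 = 0"
    then have z: "a0 = 0" "b0 = 0" by (auto simp: sum_power2_eq_zero_iff)
    define e where "e = E x0 * exp (- \<bar>q\<bar> / x0)"
    have e: "e > 0" unfolding e_def E_def using x0 by (intro mult_pos_pos add_pos_nonneg) auto
    define x where "x = Max {1, x0, (2 * K\<^sup>2 + 1) / e}"
    have x: "x \<ge> 1" "x \<ge> x0" "x \<ge> (2 * K\<^sup>2 + 1) / e" unfolding x_def by auto
    have "(a x)\<^sup>2 + (b x)\<^sup>2 = ((sin x)\<^sup>2 + (cos x)\<^sup>2) * E x"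
      unfolding a_def b_def E_def by algebra
    then have "E x = (a x)\<^sup>2 + (b x)\<^sup>2" by simp
    also have "\<dots> \<le> (K / x)\<^sup>2 + (K / x)\<^sup>2"
      using a0[OF x(1)] b0[OF x(1)] z x(1) by (intro add_mono) (simp_all add: abs_le_square_iff[symmetric] K0)
    also have "\<dots> = 2 * K\<^sup>2 / x\<^sup>2" by (simp add: power_divide)
    also have "\<dots> \<le> 2 * K\<^sup>2 / x"
      using x by (intro divide_left_mono) (auto simp: power2_eq_square)
    also have "\<dots> < e"
    proof -
      have "(2 * K\<^sup>2 + 1) \<le> x * e" using x(3) e by (simp add: field_simps)
      then show ?thesis using x(1) by (simp add: field_simps)
    qed
    finally show False using E_lo[OF x(2)] e_def by simp
  qed
  define A where "A = sqrt (a0\<^sup>2 + b0\<^sup>2)"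
  have A: "A > 0" unfolding A_def using ne by (simp add: less_le)
  have "(a0 / A)\<^sup>2 + (b0 / A)\<^sup>2 = 1"
  proof -
    have "A\<^sup>2 = a0\<^sup>2 + b0\<^sup>2" unfolding A_def by simp
    then show ?thesis using ne by (simp add: power_divide add_divide_distrib[symmetric])
  qed
  then obtain \<phi> where \<phi>: "a0 / A = cos \<phi>" "b0 / A = sin \<phi>"
    using sincos_total_2pi by metis
  have "\<bar>u x - A * cos (x - \<phi>)\<bar> \<le> 2 * K / x" if x: "x \<ge> 1" for x
  proof -
    have "u x = ((sin x)\<^sup>2 + (cos x)\<^sup>2) * u x" by simp
    also have "\<dots> = a x * cos x + b x * sin x" unfolding a_def b_def by algebra
    finally have "u x = a x * cos x + b x * sin x" .
    moreover have "A * cos (x - \<phi>) = a0 * cos x + b0 * sin x"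
      using \<phi> A by (simp add: cos_diff field_simps)
    ultimately have "u x - A * cos (x - \<phi>) = (a x - a0) * cos x + (b x - b0) * sin x"
      by (simp add: algebra_simps)
    moreover have "\<bar>(a x - a0) * cos x\<bar> \<le> K / x * 1"
      unfolding abs_mult using a0[OF x] by (intro mult_mono) auto
    moreover have "\<bar>(b x - b0) * sin x\<bar> \<le> K / x * 1"
      unfolding abs_mult using b0[OF x] by (intro mult_mono) auto
    moreover have "2 * K / x = K / x + K / x" by simp
    ultimately show ?thesis by linarith
  qed
  with A show ?thesis using that by blast
qed

section \<open>Power series of the Bessel function\<close>

definition bessel_coeff :: "real \<Rightarrow> nat \<Rightarrow> real" where
  "bessel_coeff \<nu> k = (- 1) ^ k * rGamma (real k + \<nu> + 1) / fact k"

text \<open>The entire factor of the Bessel function, as a function of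
  \<open>w = (x / 2)\<^sup>2\<close>; up to the sign of the argument it is the Bessel-Clifford
  function. The only non-analytic part of \<open>bessel_J \<nu> x\<close> is then the factor
  \<open>(x / 2) powr \<nu>\<close>.\<close>

definition bessel_series :: "real \<Rightarrow> real \<Rightarrow> real" where
  "bessel_series \<nu> w = (\<Sum>k. bessel_coeff \<nu> k * w ^ k)"

lemma rGamma_pos: "x > 0 \<Longrightarrow> rGamma (x :: real) > 0"
  by (simp add: rGamma_inverse_Gamma)

lemma bessel_coeff_nonzero: "\<nu> > -1 \<Longrightarrow> bessel_coeff \<nu> k \<noteq> 0"
  using rGamma_pos[of "real k + \<nu> + 1"] by (simp add: bessel_coeff_def)

text \<open>The reciprocal Gamma factor decays faster than any geometric sequence, by the ratio test
  once \<open>k + \<nu> + 1 \<ge> 2 / \<epsilon>\<close>. The freedom to take \<epsilon> small is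
  the point: the series is then dominated by \<open>B * exp (\<epsilon> * w)\<close>, which a
  Gaussian weight can absorb.\<close>

lemma bessel_coeff_bound:
  assumes "\<nu> > -1" "\<epsilon> > 0"
  obtains B where "B > 0" "\<And>k. \<bar>bessel_coeff \<nu> k\<bar> \<le> B * \<epsilon> ^ k / fact k"
proof -
  define d where "d k = rGamma (real k + \<nu> + 1) / \<epsilon> ^ k" for k
  define N where "N = nat \<lceil>2 / \<epsilon> - \<nu> - 1\<rceil>"
  have "summable d"
  proof (rule summable_ratio_test[of "1/2" N])
    fix n assume "n \<ge> N"
    then have n: "real n + \<nu> + 1 \<ge> 2 / \<epsilon>" unfolding N_def by linarith
    have pos: "real n + \<nu> + 1 > 0" using assms by simp
    have "d n = (real n + \<nu> + 1) * \<epsilon> * d (Suc n)"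
    proof -
      have "rGamma (real n + \<nu> + 1) = (real n + \<nu> + 1) * rGamma (real (Suc n) + \<nu> + 1)"
        using rGamma_plus1[of "real n + \<nu> + 1"] by (simp add: add_ac)
      then show ?thesis unfolding d_def using assms by simp
    qed
    moreover have "(real n + \<nu> + 1) * \<epsilon> \<ge> 2" using n assms by (simp add: field_simps)
    moreover have "d (Suc n) \<ge> 0"
      unfolding d_def using assms rGamma_pos[of "real (Suc n) + \<nu> + 1"] by simp
    ultimately have "d n \<ge> 2 * d (Suc n)" using mult_right_mono by fastforce
    with \<open>d (Suc n) \<ge> 0\<close> show "norm (d (Suc n)) \<le> 1 / 2 * norm (d n)" by simp
  qed simp
  then have "Bseq d" using summable_LIMSEQ_zero convergentI convergent_imp_Bseq by blast
  then obtain B where B: "B > 0" "\<And>k. norm (d k) \<le> B" by (auto simp: Bseq_def)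
  have "\<bar>bessel_coeff \<nu> k\<bar> \<le> B * \<epsilon> ^ k / fact k" for k
  proof -
    have "\<bar>bessel_coeff \<nu> k\<bar> = \<bar>d k\<bar> * \<epsilon> ^ k / fact k"
      using assms by (simp add: bessel_coeff_def d_def abs_mult)
    also have "\<dots> \<le> B * \<epsilon> ^ k / fact k"
      using B(2)[of k] assms by (intro divide_right_mono mult_right_mono) auto
    finally show ?thesis .
  qed
  with B(1) show ?thesis using that by blast
qed

lemma summable_bessel_series:
  assumes "\<nu> > -1"
  shows "summable (\<lambda>k. bessel_coeff \<nu> k * w ^ k)"
proof -
  obtain B where B: "\<And>k. \<bar>bessel_coeff \<nu> k\<bar> \<le> B * 1 ^ k / fact k"
    using bessel_coeff_bound[OF assms, of 1] by auto
  show ?thesis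
  proof (rule summable_comparison_test')
    show "summable (\<lambda>k. B * (\<bar>w\<bar> ^ k / fact k))"
      using summable_exp[of "\<bar>w\<bar>"] by (intro summable_mult) (simp add: divide_inverse mult_ac)
    show "norm (bessel_coeff \<nu> k * w ^ k) \<le> B * (\<bar>w\<bar> ^ k / fact k)" for k
      using mult_right_mono[OF B[of k], of "\<bar>w\<bar> ^ k"] by (simp add: abs_mult power_abs)
  qed
qed

lemma bessel_J_eq_series:
  assumes "\<nu> > -1" "x > 0"
  shows "bessel_J \<nu> x = (x / 2) powr \<nu> * bessel_series \<nu> ((x / 2)\<^sup>2)"
proof -
  have "(- 1) ^ k * rGamma (real k + \<nu> + 1) / fact k * (x / 2) powr (2 * real k + \<nu>)
      = (x / 2) powr \<nu> * (bessel_coeff \<nu> k * ((x / 2)\<^sup>2) ^ k)" for k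
    using assms powr_realpow[of "x / 2" "2 * k"]
    by (simp add: powr_add bessel_coeff_def power_mult)
  then show ?thesis
    using suminf_mult[OF summable_bessel_series[OF assms(1)], of "(x / 2) powr \<nu>" "(x / 2)\<^sup>2"]
    by (simp add: bessel_J_def bessel_series_def)
qed

lemma bessel_series_0: "bessel_series \<nu> 0 = rGamma (\<nu> + 1)"
proof -
  have "bessel_series \<nu> 0 = bessel_coeff \<nu> 0"
    unfolding bessel_series_def by (rule powser_zero)
  then show ?thesis by (simp add: bessel_coeff_def)
qed

lemma diffs_bessel_coeff: "diffs (bessel_coeff \<nu>) = (\<lambda>k. - bessel_coeff (\<nu> + 1) k)"
proof
  fix k
  have "real (Suc k) / fact (Suc k) = (1 :: real) / fact k" by (simp del: of_nat_Suc)
  moreover have "real (Suc k) + \<nu> + 1 = real k + (\<nu> + 1) + 1" by simp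
  ultimately have "real (Suc k) * bessel_coeff \<nu> (Suc k)
      = - ((- 1) ^ k * rGamma (real k + (\<nu> + 1) + 1)) * (1 / fact k)"
    unfolding bessel_coeff_def
    by (metis (no_types, lifting) mult.left_commute mult_minus1 power_Suc times_divide_eq_left
        times_divide_eq_right mult_minus_left mult.commute)
  then show "diffs (bessel_coeff \<nu>) k = - bessel_coeff (\<nu> + 1) k"
    unfolding diffs_def bessel_coeff_def by simp
qed

lemma has_derivative_bessel_series:
  assumes "\<nu> > -1"
  shows "(bessel_series \<nu> has_real_derivative - bessel_series (\<nu> + 1) w) (at w)"
proof -
  have "((\<lambda>w. \<Sum>k. bessel_coeff \<nu> k * w ^ k) has_real_derivative
          (\<Sum>k. diffs (bessel_coeff \<nu>) k * w ^ k)) (at w)"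
    by (rule termdiffs_strong_converges_everywhere) (rule summable_bessel_series[OF assms])
  moreover have "(\<Sum>k. diffs (bessel_coeff \<nu>) k * w ^ k) = - bessel_series (\<nu> + 1) w"
    using suminf_minus[OF summable_bessel_series[of "\<nu> + 1" w]] assms
    by (simp add: diffs_bessel_coeff bessel_series_def)
  ultimately show ?thesis unfolding bessel_series_def[abs_def] by simp
qed

text \<open>This is the contiguity relation \<open>J (\<nu> + 2) = 2 * (\<nu> + 1) / x * J (\<nu> +
  1) - J \<nu>\<close>, stripped of powers of \<open>x / 2\<close>. Together with the derivative
  rule it amounts to Bessel's differential equation.\<close>

lemma bessel_series_recurrence:
  assumes "\<nu> > -1"
  shows "w * bessel_series (\<nu> + 2) w = (\<nu> + 1) * bessel_series (\<nu> + 1) w - bessel_series \<nu> w"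
proof -
  have coeff: "bessel_coeff \<nu> (Suc k) - (\<nu> + 1) * bessel_coeff (\<nu> + 1) (Suc k) = - bessel_coeff (\<nu> + 2) k"
    for k
  proof -
    define r where "r = rGamma (real k + \<nu> + 3)"
    have "rGamma (real (Suc k) + \<nu> + 1) = (real (Suc k) + \<nu> + 1) * r"
      using rGamma_plus1[of "real (Suc k) + \<nu> + 1"] by (simp add: r_def add_ac)
    moreover have "rGamma (real (Suc k) + (\<nu> + 1) + 1) = r" "rGamma (real k + (\<nu> + 2) + 1) = r"
      by (simp_all add: r_def add_ac)
    ultimately have "bessel_coeff \<nu> (Suc k) - (\<nu> + 1) * bessel_coeff (\<nu> + 1) (Suc k)
        = - ((- 1) ^ k * r) * (real (Suc k) / fact (Suc k))"
      unfolding bessel_coeff_def by (simp add: diff_divide_distrib add_divide_distrib algebra_simps del: fact_Suc)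
    moreover have "real (Suc k) / fact (Suc k) = (1 :: real) / fact k" by (simp del: of_nat_Suc)
    ultimately have "bessel_coeff \<nu> (Suc k) - (\<nu> + 1) * bessel_coeff (\<nu> + 1) (Suc k)
        = - ((- 1) ^ k * r) * (1 / fact k)" by (simp only:)
    then show ?thesis
      unfolding bessel_coeff_def[of "\<nu> + 2"] \<open>rGamma (real k + (\<nu> + 2) + 1) = r\<close> by simp
  qed
  have "bessel_coeff \<nu> 0 = (\<nu> + 1) * bessel_coeff (\<nu> + 1) 0"
    using rGamma_plus1[of "\<nu> + 1"] by (simp add: bessel_coeff_def field_simps)
  define f where "f k = (bessel_coeff \<nu> k - (\<nu> + 1) * bessel_coeff (\<nu> + 1) k) * w ^ k" for k
  have "(\<lambda>k. bessel_coeff \<nu> k * w ^ k - (\<nu> + 1) * (bessel_coeff (\<nu> + 1) k * w ^ k)) sums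
      (bessel_series \<nu> w - (\<nu> + 1) * bessel_series (\<nu> + 1) w)"
    unfolding bessel_series_def using assms
    by (intro sums_diff sums_mult summable_sums summable_bessel_series) auto
  then have f: "f sums (bessel_series \<nu> w - (\<nu> + 1) * bessel_series (\<nu> + 1) w)"
    by (simp add: f_def[abs_def] algebra_simps)
  have f0: "f 0 = 0" using \<open>bessel_coeff \<nu> 0 = _\<close> by (simp add: f_def)
  have "(\<lambda>k. - w * (bessel_coeff (\<nu> + 2) k * w ^ k)) sums (- w * bessel_series (\<nu> + 2) w)"
    unfolding bessel_series_def using assms
    by (intro sums_mult summable_sums summable_bessel_series) auto
  moreover have "f (Suc k) = - w * (bessel_coeff (\<nu> + 2) k * w ^ k)" for k
    unfolding f_def coeff by simp
  ultimately have "(\<lambda>k. f (Suc k)) sums (- w * bessel_series (\<nu> + 2) w)" by simp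
  then have "f sums (- w * bessel_series (\<nu> + 2) w)" using f0 by (simp add: sums_Suc_iff)
  with f have "bessel_series \<nu> w - (\<nu> + 1) * bessel_series (\<nu> + 1) w = - w * bessel_series (\<nu> + 2) w"
    by (rule sums_unique2)
  then show ?thesis by simp
qed

lemma continuous_bessel_series: "\<nu> > -1 \<Longrightarrow> isCont (bessel_series \<nu>) w"
  using has_derivative_bessel_series DERIV_isCont by blast

text \<open>The Liouville substitution: up to the constant \<open>k\<close>, \<open>u\<close> is
  \<open>sqrt x * bessel_J \<nu> x\<close>, which removes the first-order term from Bessel's
  equation and leaves an oscillator perturbed by \<open>q / x\<^sup>2\<close> with
  \<open>q = a * (a - 1) = \<nu>\<^sup>2 - 1/4\<close>.\<close>

lemma bessel_J_asymptotics_at_infinity: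
  assumes \<nu>: "\<nu> > -1"
  obtains A \<phi> C where "A > 0" "\<And>x. x \<ge> 1 \<Longrightarrow> \<bar>sqrt x * bessel_J \<nu> x - A * cos (x - \<phi>)\<bar> \<le> C / x"
proof -
  define a where "a = \<nu> + 1 / 2"
  define B where "B x = bessel_series \<nu> (x\<^sup>2 / 4)" for x :: real
  define B1 where "B1 x = bessel_series (\<nu> + 1) (x\<^sup>2 / 4)" for x :: real
  define B2 where "B2 x = bessel_series (\<nu> + 2) (x\<^sup>2 / 4)" for x :: real
  define u where "u x = x powr a * B x" for x
  define v where "v x = a * x powr (a - 1) * B x - x powr a * (x / 2) * B1 x" for x
  have dB: "(B has_real_derivative - (x / 2) * B1 x) (at x)" for x
    unfolding B_def B1_def
    by (rule DERIV_cong[OF DERIV_chain2[OF has_derivative_bessel_series[OF \<nu>]]])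
       (auto intro!: derivative_eq_intros)
  have dB1: "(B1 has_real_derivative - (x / 2) * B2 x) (at x)" for x
    unfolding B1_def B2_def
    by (rule DERIV_cong[OF DERIV_chain2[OF has_derivative_bessel_series[of "\<nu> + 1"]]])
       (use \<nu> in \<open>auto intro!: derivative_eq_intros simp: add_ac\<close>)
  have rec: "x\<^sup>2 / 4 * B2 x = (\<nu> + 1) * B1 x - B x" for x
    unfolding B_def B1_def B2_def by (rule bessel_series_recurrence[OF \<nu>])
  have du: "(u has_real_derivative v x) (at x)" if "x > 0" for x
    unfolding u_def v_def using that
    by (auto intro!: derivative_eq_intros dB)
  have dv: "(v has_real_derivative - (1 - a * (a - 1) / x\<^sup>2) * u x) (at x)" if x: "x > 0" for x
  proof -
    have p: "x powr (a - 1) = x powr a / x" "x powr (a - 1 - 1) = x powr a / x / x"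
      using x by (simp_all add: powr_diff power2_eq_square)
    have "(v has_real_derivative
        a * ((a - 1) * x powr (a - 1 - 1) * B x + x powr (a - 1) * (- (x / 2) * B1 x))
        - ((a * x powr (a - 1) * (x / 2) + x powr a / 2) * B1 x
           + x powr a * (x / 2) * (- (x / 2) * B2 x))) (at x)"
      unfolding v_def using x
      by (auto intro!: derivative_eq_intros dB dB1 simp: field_simps)
    also have "a * ((a - 1) * x powr (a - 1 - 1) * B x + x powr (a - 1) * (- (x / 2) * B1 x))
        - ((a * x powr (a - 1) * (x / 2) + x powr a / 2) * B1 x
           + x powr a * (x / 2) * (- (x / 2) * B2 x))
      = x powr a * (a * (a - 1) / x\<^sup>2 * B x - (\<nu> + 1) * B1 x + x\<^sup>2 / 4 * B2 x)"
      unfolding p using x by (simp add: a_def field_simps power2_eq_square)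
    also have "\<dots> = - (1 - a * (a - 1) / x\<^sup>2) * u x"
      unfolding rec u_def by (simp add: algebra_simps)
    finally show ?thesis .
  qed
  \<comment> \<open>Near the origin \<open>B\<close> is close to
    \<open>B 0 = rGamma (\<nu> + 1)\<close>, which is positive; this excludes the zero solution and
    hence a zero amplitude.\<close>
  have "\<exists>x0>0. u x0 \<noteq> 0"
  proof -
    have "isCont B 0" using dB DERIV_isCont by blast
    moreover have "B 0 \<noteq> 0"
      using \<nu> rGamma_pos[of "\<nu> + 1"] by (simp add: B_def bessel_series_0)
    ultimately have "\<forall>\<^sub>F x in at 0. B x \<noteq> 0"
      unfolding isCont_def by (rule tendsto_imp_eventually_ne)
    then have "\<forall>\<^sub>F x in at_right 0. B x \<noteq> 0" by (simp add: eventually_at_split)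
    then obtain b where "b > 0" "\<And>x. 0 < x \<Longrightarrow> x < b \<Longrightarrow> B x \<noteq> 0"
      by (auto simp: eventually_at_right_field)
    then show ?thesis unfolding u_def by (intro exI[of _ "b / 2"]) auto
  qed
  then obtain x0 where "x0 > 0" "u x0 \<noteq> 0" by blast
  from perturbed_oscillator_asymptotics[OF du dv this] obtain A \<phi> C
    where A: "A > 0" and bd: "\<And>x. x \<ge> 1 \<Longrightarrow> \<bar>u x - A * cos (x - \<phi>)\<bar> \<le> C / x" by blast
  define k where "k = (1 / 2) powr \<nu>"
  have k: "k > 0" unfolding k_def by simp
  have J: "sqrt x * bessel_J \<nu> x = k * u x" if "x > 0" for x
  proof -
    have "(x / 2) powr \<nu> = x powr \<nu> * k"
      using that powr_mult[of x "1/2" \<nu>] by (simp add: k_def)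
    moreover have "sqrt x * x powr \<nu> = x powr a"
      using that by (simp add: a_def powr_add powr_half_sqrt)
    ultimately show ?thesis
      using that by (simp add: bessel_J_eq_series[OF \<nu>] u_def B_def power_divide algebra_simps)
  qed
  show ?thesis
  proof (rule that[of "k * A" \<phi> "k * C"])
    show "k * A > 0" using k A by simp
    fix x :: real assume x: "x \<ge> 1"
    have "sqrt x * bessel_J \<nu> x - k * A * cos (x - \<phi>) = k * (u x - A * cos (x - \<phi>))"
      using J[of x] x by (simp add: algebra_simps)
    then show "\<bar>sqrt x * bessel_J \<nu> x - k * A * cos (x - \<phi>)\<bar> \<le> k * C / x"
      using mult_left_mono[OF bd[OF x], of k] k by (simp add: abs_mult)
  qed
qed

subsection \<open>Oscillatory integrals\<close>

lemma set_integrable_lborel_bound: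
  fixes f g :: "real \<Rightarrow> real"
  assumes f: "set_integrable lborel A f" and g: "g \<in> borel_measurable borel" and A: "A \<in> sets borel"
    and le: "\<And>x. x \<in> A \<Longrightarrow> \<bar>g x\<bar> \<le> f x"
  shows "set_integrable lborel A g"
proof (rule set_integrable_bound[OF f])
  show "set_borel_measurable lborel A g"
    unfolding set_borel_measurable_def using g A by simp
  show "AE x in lborel. x \<in> A \<longrightarrow> norm (g x) \<le> norm (f x)"
    using le by (intro AE_I2) fastforce
qed

lemma set_integral_abs_le:
  fixes f g :: "real \<Rightarrow> real"
  assumes f: "set_integrable lborel A f" and g: "set_integrable lborel A g"
    and le: "\<And>x. x \<in> A \<Longrightarrow> \<bar>g x\<bar> \<le> f x"
  shows "\<bar>LINT x:A|lborel. g x\<bar> \<le> (LINT x:A|lborel. f x)"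
proof -
  have "(LINT x:A|lborel. g x) \<le> (LINT x:A|lborel. f x)"
    using le by (intro set_integral_mono f g) fastforce
  moreover have "(LINT x:A|lborel. - g x) \<le> (LINT x:A|lborel. f x)"
    using le g by (intro set_integral_mono f) (auto simp: set_integrable_def abs_le_iff)
  ultimately show ?thesis using set_integral_uminus[OF g] by simp
qed

lemma set_integrable_lborel_of_integrable_on:
  fixes f :: "real \<Rightarrow> real"
  assumes "f integrable_on A" "A \<in> sets borel" "f \<in> borel_measurable borel" "\<And>x. x \<in> A \<Longrightarrow> 0 \<le> f x"
  shows "set_integrable lborel A f"
proof -
  have "f absolutely_integrable_on A" using assms by (intro nonnegative_absolutely_integrable_1) auto
  then have "integrable lebesgue (\<lambda>x. indicator A x *\<^sub>R f x)" by (simp add: set_integrable_def)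
  moreover have "(\<lambda>x. indicator A x *\<^sub>R f x) \<in> borel_measurable lborel" using assms by simp
  ultimately show ?thesis unfolding set_integrable_def by (simp add: integrable_completion)
qed

lemma set_integral_FTC:
  fixes f F :: "real \<Rightarrow> real"
  assumes "a \<le> b" "\<And>x. a \<le> x \<Longrightarrow> x \<le> b \<Longrightarrow> (F has_real_derivative f x) (at x)"
    "\<And>x. a \<le> x \<Longrightarrow> x \<le> b \<Longrightarrow> isCont f x"
  shows "set_integrable lborel {a..b} f" "(LINT x:{a..b}|lborel. f x) = F b - F a"
  using has_bochner_integral_FTC_Icc_real[OF assms]
  by (auto simp: set_integrable_def set_lebesgue_integral_def has_bochner_integral_iff mult.commute)

lemma set_integrable_powr_near_0:
  fixes a c :: real
  assumes "a > -1"
  shows "set_integrable lborel {0<..c} (\<lambda>x. x powr a)"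
proof (cases "c \<ge> 0")
  case True
  then show ?thesis
    using assms by (intro set_integrable_lborel_of_integrable_on integrable_on_powr_from_0') auto
next
  case False
  then have "{0<..c} = {}" by auto
  then show ?thesis by simp
qed

lemma set_integrable_powr_at_top:
  fixes a :: real
  assumes "a < -1"
  shows "set_integrable lborel {1..} (\<lambda>x. x powr a)"
  using assms has_integral_powr_to_inf[of a 1]
  by (intro set_integrable_lborel_of_integrable_on) (auto simp: integrable_on_def)

lemma set_integral_powr:
  fixes a b s :: real
  assumes "0 < a" "a \<le> b" "s \<noteq> -1"
  shows "(LINT y:{a..b}|lborel. y powr s) = (b powr (s + 1) - a powr (s + 1)) / (s + 1)"
proof -
  have "(LINT y:{a..b}|lborel. y powr s) = b powr (s + 1) / (s + 1) - a powr (s + 1) / (s + 1)"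
    using assms by (intro set_integral_FTC) (auto intro!: derivative_eq_intros continuous_intros)
  then show ?thesis by (simp add: diff_divide_distrib)
qed

lemma set_integrable_continuous_Icc:
  fixes f :: "real \<Rightarrow> real"
  assumes "continuous_on {a..b} f"
  shows "set_integrable lborel {a..b} f"
  using borel_integrable_compact[OF _ assms] by (simp add: set_integrable_def)

lemma tendsto_at_top_of_cauchy_bound:
  fixes F e :: "real \<Rightarrow> real"
  assumes bd: "\<And>x y. 1 \<le> x \<Longrightarrow> x \<le> y \<Longrightarrow> \<bar>F y - F x\<bar> \<le> e x" and e: "(e \<longlongrightarrow> 0) at_top"
  obtains l where "(F \<longlongrightarrow> l) at_top" "\<And>x. 1 \<le> x \<Longrightarrow> \<bar>l - F x\<bar> \<le> e x"
proof -
  have ev: "\<forall>\<^sub>F n in sequentially. e (real n) < d" if "d > 0" for d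
    using order_tendstoD(2)[OF filterlim_compose[OF e filterlim_real_sequentially] that] .
  have "Cauchy (\<lambda>n. F (real n))"
  proof (rule metric_CauchyI)
    fix d :: real assume "d > 0"
    then obtain N where N: "\<And>n. n \<ge> N \<Longrightarrow> e (real n) < d / 2"
      using ev[of "d / 2"] by (auto simp: eventually_sequentially)
    define M where "M = max N 1"
    have M: "real M \<ge> 1" "e (real M) < d / 2" using N by (auto simp: M_def)
    have "dist (F (real m)) (F (real n)) < d" if "m \<ge> M" "n \<ge> M" for m n
      using bd[OF M(1), of "real m"] bd[OF M(1), of "real n"] M(2) that
      by (simp add: dist_real_def)
    then show "\<exists>M. \<forall>m\<ge>M. \<forall>n\<ge>M. dist (F (real m)) (F (real n)) < d" by blast
  qed
  then obtain l where l: "(\<lambda>n. F (real n)) \<longlonglongrightarrow> l" using Cauchy_convergent convergent_def by blast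
  have le: "\<bar>l - F x\<bar> \<le> e x" if "1 \<le> x" for x
  proof (rule Lim_bounded[of "\<lambda>n. \<bar>F (real n) - F x\<bar>"])
    show "(\<lambda>n. \<bar>F (real n) - F x\<bar>) \<longlonglongrightarrow> \<bar>l - F x\<bar>" by (intro tendsto_intros l)
    show "\<forall>n\<ge>nat \<lceil>x\<rceil>. \<bar>F (real n) - F x\<bar> \<le> e x"
    proof (intro allI impI)
      fix n assume "n \<ge> nat \<lceil>x\<rceil>"
      then have "x \<le> real n" by linarith
      then show "\<bar>F (real n) - F x\<bar> \<le> e x" by (rule bd[OF that])
    qed
  qed
  have "((\<lambda>x. F x - l) \<longlongrightarrow> 0) at_top"
  proof (rule Lim_null_comparison[OF _ e])
    show "\<forall>\<^sub>F x in at_top. norm (F x - l) \<le> e x"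
      using eventually_ge_at_top[of 1] by eventually_elim (use le in \<open>auto simp: abs_minus_commute\<close>)
  qed
  then have "(F \<longlongrightarrow> l) at_top" by (simp add: LIM_zero_iff)
  with le that show ?thesis by blast
qed

lemma cos_powr_set_integrable:
  fixes \<theta> \<phi> s a b :: real
  assumes "0 < a"
  shows "set_integrable lborel {a..b} (\<lambda>y. cos (\<theta> * y - \<phi>) * y powr - s)"
  using assms by (intro set_integrable_continuous_Icc continuous_intros) auto

text \<open>Integration by parts. The boundary terms contribute at most
  \<open>a powr - s + b powr - s\<close>, the remaining integral at most
  \<open>a powr - s - b powr - s\<close>, both over \<open>\<bar>\<theta>\<bar>\<close>; in the sum
  the upper limit \<open>b\<close> cancels.\<close>

lemma cos_powr_integral_bound:
  fixes \<theta> \<phi> s a b :: real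
  assumes "s > 0" "\<theta> \<noteq> 0" "0 < a" "a \<le> b"
  shows "\<bar>LINT y:{a..b}|lborel. cos (\<theta> * y - \<phi>) * y powr - s\<bar> \<le> 2 * a powr - s / \<bar>\<theta>\<bar>"
proof -
  define h where "h y = cos (\<theta> * y - \<phi>) * y powr - s" for y
  define k where "k y = sin (\<theta> * y - \<phi>) / \<theta> * (- s * y powr (- s - 1))" for y
  define m where "m y = s * y powr (- s - 1) / \<bar>\<theta>\<bar>" for y
  define H where "H y = sin (\<theta> * y - \<phi>) / \<theta> * y powr - s" for y
  have dH: "(H has_real_derivative h y + k y) (at y)" if "a \<le> y" for y
    unfolding H_def h_def k_def using that assms
    by (auto intro!: derivative_eq_intros simp: field_simps)
  have cont: "continuous_on {a..b} h" "continuous_on {a..b} k" "continuous_on {a..b} m"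
    unfolding h_def k_def m_def using assms by (auto intro!: continuous_intros)
  note int = cont[THEN set_integrable_continuous_Icc]
  have "(LINT y:{a..b}|lborel. h y + k y) = H b - H a"
  proof (rule set_integral_FTC[OF assms(4)])
    show "isCont (\<lambda>y. h y + k y) y" if "a \<le> y" "y \<le> b" for y
      unfolding h_def k_def using that assms by (auto intro!: continuous_intros)
  qed (use dH in auto)
  then have "(LINT y:{a..b}|lborel. h y) = H b - H a - (LINT y:{a..b}|lborel. k y)"
    using int by simp
  moreover have "\<bar>LINT y:{a..b}|lborel. k y\<bar> \<le> (LINT y:{a..b}|lborel. m y)"
  proof (rule set_integral_abs_le[OF int(3,2)])
    fix y assume "y \<in> {a..b}"
    have "\<bar>sin (\<theta> * y - \<phi>)\<bar> * (s * y powr (- s - 1) / \<bar>\<theta>\<bar>) \<le> 1 * (s * y powr (- s - 1) / \<bar>\<theta>\<bar>)"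
      using assms by (intro mult_right_mono) auto
    then show "\<bar>k y\<bar> \<le> m y" using assms by (simp add: k_def m_def abs_mult)
  qed
  moreover have "(LINT y:{a..b}|lborel. m y) = (a powr - s - b powr - s) / \<bar>\<theta>\<bar>"
  proof -
    have "(LINT y:{a..b}|lborel. m y) = - (b powr - s) / \<bar>\<theta>\<bar> - - (a powr - s) / \<bar>\<theta>\<bar>"
      unfolding m_def using assms
      by (intro set_integral_FTC) (auto intro!: derivative_eq_intros continuous_intros simp: field_simps)
    then show ?thesis by (simp add: diff_divide_distrib)
  qed
  moreover have "\<bar>H y\<bar> \<le> y powr - s / \<bar>\<theta>\<bar>" for y
  proof -
    have "\<bar>sin (\<theta> * y - \<phi>)\<bar> * (y powr - s / \<bar>\<theta>\<bar>) \<le> 1 * (y powr - s / \<bar>\<theta>\<bar>)"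
      using assms by (intro mult_right_mono) auto
    then show ?thesis by (simp add: H_def abs_mult)
  qed
  from this[of a] this[of b] have "\<bar>H b - H a\<bar> \<le> (a powr - s + b powr - s) / \<bar>\<theta>\<bar>"
    by (simp add: add_divide_distrib)
  ultimately show ?thesis
    by (simp add: h_def[symmetric] add_divide_distrib diff_divide_distrib) linarith
qed

lemma cos_powr_integral_split:
  fixes \<theta> \<phi> s a b c :: real
  assumes "0 < a" "a \<le> b" "b \<le> c"
  shows "(LINT y:{a..c}|lborel. cos (\<theta> * y - \<phi>) * y powr - s) =
    (LINT y:{a..b}|lborel. cos (\<theta> * y - \<phi>) * y powr - s) + (LINT y:{b..c}|lborel. cos (\<theta> * y - \<phi>) * y powr - s)"
proof -
  let ?f = "\<lambda>y. cos (\<theta> * y - \<phi>) * y powr - s"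
  have "(LINT y:{a..c}|lborel. ?f y) = (LINT y:{a..b} \<union> {b<..c}|lborel. ?f y)"
    using assms by (intro arg_cong2[where f="set_lebesgue_integral lborel"]) auto
  also have "\<dots> = (LINT y:{a..b}|lborel. ?f y) + (LINT y:{b<..c}|lborel. ?f y)"
    using assms by (intro set_integral_Un cos_powr_set_integrable)
      (auto intro!: set_integrable_subset[OF cos_powr_set_integrable[of b]])
  also have "(LINT y:{b<..c}|lborel. ?f y) = (LINT y:{b..c}|lborel. ?f y)"
    by (rule set_integral_discrete_difference[of "{b}"]) auto
  finally show ?thesis .
qed

lemma cos_powr_integral_cauchy:
  fixes \<theta> \<phi> s x y :: real
  assumes "s > 0" "\<theta> \<noteq> 0" "1 \<le> x" "x \<le> y"
  shows "\<bar>(LINT y:{1..y}|lborel. cos (\<theta> * y - \<phi>) * y powr - s) - (LINT y:{1..x}|lborel. cos (\<theta> * y - \<phi>) * y powr - s)\<bar>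
    \<le> 2 * x powr - s / \<bar>\<theta>\<bar>"
  using cos_powr_integral_split[of 1 x y \<theta> \<phi> s] cos_powr_integral_bound[of s \<theta> x y \<phi>] assms by simp

lemma cos_powr_integral_convergent:
  fixes \<theta> \<phi> s :: real
  assumes "s > 0" "\<theta> \<noteq> 0"
  obtains l where "((\<lambda>R. LINT y:{1..R}|lborel. cos (\<theta> * y - \<phi>) * y powr - s) \<longlongrightarrow> l) at_top"
proof -
  have "((\<lambda>x. 2 * x powr - s / \<bar>\<theta>\<bar>) \<longlongrightarrow> 2 * 0 / \<bar>\<theta>\<bar>) at_top"
    using assms by (intro tendsto_intros tendsto_neg_powr filterlim_ident) auto
  then have lim: "((\<lambda>x. 2 * x powr - s / \<bar>\<theta>\<bar>) \<longlongrightarrow> 0) at_top" by simp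
  show ?thesis
  proof (rule tendsto_at_top_of_cauchy_bound[OF _ lim])
    fix l assume "((\<lambda>R. LINT y:{1..R}|lborel. cos (\<theta> * y - \<phi>) * y powr - s) \<longlongrightarrow> l) at_top"
    then show ?thesis by (rule that)
  qed (use cos_powr_integral_cauchy[OF assms] in auto)
qed

text \<open>For small frequencies the integral is split at
  \<open>Y = 1 / \<bar>\<theta>\<bar>\<close>: before \<open>Y\<close> the cosine does not oscillate
  and is bounded by 1, after \<open>Y\<close> integration by parts takes over, and both pieces are
  of order \<open>\<bar>\<theta>\<bar> powr - \<gamma>\<close>. The slack
  \<open>1 - \<gamma> \<le> s\<close> covers all \<open>s > 0\<close> at once. Uniformity in
  \<open>R\<close> is what later makes the truncated kernel dominated.\<close>

lemma cos_powr_integral_uniform_bound: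
  fixes \<theta> \<phi> s \<gamma> R :: real
  assumes s: "s > 0" and \<gamma>: "0 < \<gamma>" "\<gamma> < 1" "1 - \<gamma> \<le> s" and "\<theta> \<noteq> 0" "1 \<le> R"
  shows "\<bar>LINT y:{1..R}|lborel. cos (\<theta> * y - \<phi>) * y powr - s\<bar> \<le> (2 + 1 / \<gamma>) * (1 + \<bar>\<theta>\<bar> powr - \<gamma>)"
proof (cases "\<bar>\<theta>\<bar> \<ge> 1")
  case True
  have "\<bar>LINT y:{1..R}|lborel. cos (\<theta> * y - \<phi>) * y powr - s\<bar> \<le> 2 * 1 powr - s / \<bar>\<theta>\<bar>"
    using assms by (intro cos_powr_integral_bound) auto
  also have "\<dots> \<le> 2" using True by (simp add: field_simps)
  also have "\<dots> \<le> (2 + 1 / \<gamma>) * (1 + \<bar>\<theta>\<bar> powr - \<gamma>)"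
  proof -
    have "2 * 1 \<le> (2 + 1 / \<gamma>) * (1 + \<bar>\<theta>\<bar> powr - \<gamma>)"
      using \<gamma> by (intro mult_mono) auto
    then show ?thesis by simp
  qed
  finally show ?thesis .
next
  case False
  define Y where "Y = 1 / \<bar>\<theta>\<bar>"
  have Y: "Y > 1" using False assms by (simp add: Y_def field_simps)
  have Yp: "Y powr \<gamma> = \<bar>\<theta>\<bar> powr - \<gamma>"
    unfolding Y_def using assms by (simp add: powr_divide powr_minus_divide)
  have head: "\<bar>LINT y:{1..r}|lborel. cos (\<theta> * y - \<phi>) * y powr - s\<bar> \<le> 1 / \<gamma> * \<bar>\<theta>\<bar> powr - \<gamma>"
    if r: "1 \<le> r" "r \<le> Y" for r
  proof -
    have "\<bar>LINT y:{1..r}|lborel. cos (\<theta> * y - \<phi>) * y powr - s\<bar> \<le> (LINT y:{1..r}|lborel. y powr (\<gamma> - 1))"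
    proof (rule set_integral_abs_le)
      show "set_integrable lborel {1..r} (\<lambda>y. y powr (\<gamma> - 1))"
        by (intro set_integrable_continuous_Icc continuous_intros) auto
      show "set_integrable lborel {1..r} (\<lambda>y. cos (\<theta> * y - \<phi>) * y powr - s)"
        by (rule cos_powr_set_integrable) simp
      fix y assume "y \<in> {1..r}"
      then have y: "y \<ge> 1" by simp
      have "\<bar>cos (\<theta> * y - \<phi>)\<bar> * y powr - s \<le> 1 * y powr - s" by (intro mult_right_mono) auto
      also have "\<dots> \<le> y powr (\<gamma> - 1)" using y \<gamma> by (auto intro!: powr_mono)
      finally show "\<bar>cos (\<theta> * y - \<phi>) * y powr - s\<bar> \<le> y powr (\<gamma> - 1)" by (simp add: abs_mult)
    qed
    also have "\<dots> = (r powr \<gamma> - 1) / \<gamma>" using set_integral_powr[of 1 r "\<gamma> - 1"] r \<gamma> by simp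
    also have "\<dots> \<le> Y powr \<gamma> / \<gamma>"
      using r \<gamma> powr_mono2[of \<gamma> r Y] by (intro divide_right_mono) auto
    finally show ?thesis using Yp by simp
  qed
  have pos: "\<bar>\<theta>\<bar> powr - \<gamma> \<ge> 0" by simp
  have rhs: "(1 / \<gamma> + 2) * \<bar>\<theta>\<bar> powr - \<gamma> \<le> (2 + 1 / \<gamma>) * (1 + \<bar>\<theta>\<bar> powr - \<gamma>)"
    using \<gamma> by (simp add: algebra_simps)
  show ?thesis
  proof (cases "R \<le> Y")
    case True
    have "1 / \<gamma> * \<bar>\<theta>\<bar> powr - \<gamma> \<le> (1 / \<gamma> + 2) * \<bar>\<theta>\<bar> powr - \<gamma>" by (simp add: algebra_simps)
    then show ?thesis using head[OF assms(6) True] rhs by linarith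
  next
    case False
    have "\<bar>LINT y:{Y..R}|lborel. cos (\<theta> * y - \<phi>) * y powr - s\<bar> \<le> 2 * Y powr - s / \<bar>\<theta>\<bar>"
      using assms Y False by (intro cos_powr_integral_bound) auto
    also have "\<dots> \<le> 2 * Y powr (\<gamma> - 1) / \<bar>\<theta>\<bar>"
      using Y \<gamma> by (intro divide_right_mono mult_left_mono powr_mono) auto
    also have "\<dots> = 2 * Y powr \<gamma>"
      using Y assms by (simp add: powr_diff Y_def)
    finally have "\<bar>LINT y:{Y..R}|lborel. cos (\<theta> * y - \<phi>) * y powr - s\<bar> \<le> 2 * \<bar>\<theta>\<bar> powr - \<gamma>"
      by (simp add: Yp)
    moreover have "(LINT y:{1..R}|lborel. cos (\<theta> * y - \<phi>) * y powr - s)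
      = (LINT y:{1..Y}|lborel. cos (\<theta> * y - \<phi>) * y powr - s) + (LINT y:{Y..R}|lborel. cos (\<theta> * y - \<phi>) * y powr - s)"
      using Y False by (intro cos_powr_integral_split) auto
    moreover have "(1 / \<gamma> + 2) * \<bar>\<theta>\<bar> powr - \<gamma> = 1 / \<gamma> * \<bar>\<theta>\<bar> powr - \<gamma> + 2 * \<bar>\<theta>\<bar> powr - \<gamma>"
      by (simp add: algebra_simps)
    ultimately show ?thesis using head[of Y] Y rhs by linarith
  qed
qed

lemma set_integral_powr_near_0:
  assumes "a > (-1 :: real)" "c \<ge> 0"
  shows "(LINT x:{0<..c}|lborel. x powr a) = c powr (a + 1) / (a + 1)"
proof -
  have "(LINT x:{0<..c}|lborel. x powr a) = integral {0<..c} (\<lambda>x. x powr a)"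
    by (rule set_borel_integral_eq_integral(2)[OF set_integrable_powr_near_0[OF assms(1)]])
  also have "\<dots> = integral {0..c} (\<lambda>x. x powr a)"
    by (rule integral_spike_set) (auto intro: negligible_subset[of "{0}"])
  also have "\<dots> = c powr (a + 1) / (a + 1)"
    by (rule integral_unique[OF has_integral_powr_from_0[OF assms]])
  finally show ?thesis .
qed

lemma cos_powr_set_integrable_near_0:
  fixes \<phi> s c :: real
  assumes "s < 1"
  shows "set_integrable lborel {0<..c} (\<lambda>v. cos (v - \<phi>) * v powr - s)"
proof (rule set_integrable_lborel_bound[OF set_integrable_powr_near_0[of "-s" c]])
  show "\<bar>cos (v - \<phi>) * v powr - s\<bar> \<le> v powr - s" for v
    using mult_right_mono[of "\<bar>cos (v - \<phi>)\<bar>" 1 "v powr - s"] by (simp add: abs_mult)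
qed (use assms in auto)

lemma cos_powr_integral_split_near_0:
  fixes \<phi> s \<epsilon> R :: real
  assumes "s < 1" "0 < \<epsilon>" "\<epsilon> \<le> R"
  shows "(LINT v:{0<..R}|lborel. cos (v - \<phi>) * v powr - s) =
    (LINT v:{0<..\<epsilon>}|lborel. cos (v - \<phi>) * v powr - s) + (LINT v:{\<epsilon>..R}|lborel. cos (v - \<phi>) * v powr - s)"
proof -
  let ?f = "\<lambda>v. cos (v - \<phi>) * v powr - s"
  have sub: "set_integrable lborel A ?f" if "A \<subseteq> {0<..R}" "A \<in> sets borel" for A
    using set_integrable_subset[OF cos_powr_set_integrable_near_0[OF assms(1), of R \<phi>], of A] that by simp
  have "(LINT v:{0<..R}|lborel. ?f v) = (LINT v:{0<..\<epsilon>} \<union> {\<epsilon><..R}|lborel. ?f v)"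
    using assms by (intro arg_cong2[where f="set_lebesgue_integral lborel"]) auto
  also have "\<dots> = (LINT v:{0<..\<epsilon>}|lborel. ?f v) + (LINT v:{\<epsilon><..R}|lborel. ?f v)"
    using assms by (intro set_integral_Un sub) auto
  also have "(LINT v:{\<epsilon><..R}|lborel. ?f v) = (LINT v:{\<epsilon>..R}|lborel. ?f v)"
    by (rule set_integral_discrete_difference[of "{\<epsilon>}"]) auto
  finally show ?thesis .
qed

lemma cos_powr_integral_near_0_bound:
  fixes \<phi> s \<epsilon> :: real
  assumes "s < 1" "0 < \<epsilon>"
  shows "\<bar>LINT v:{0<..\<epsilon>}|lborel. cos (v - \<phi>) * v powr - s\<bar> \<le> \<epsilon> powr (1 - s) / (1 - s)"
proof -
  have "\<bar>LINT v:{0<..\<epsilon>}|lborel. cos (v - \<phi>) * v powr - s\<bar> \<le> (LINT v:{0<..\<epsilon>}|lborel. v powr - s)"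
  proof (rule set_integral_abs_le)
    show "\<bar>cos (v - \<phi>) * v powr - s\<bar> \<le> v powr - s" for v
      using mult_right_mono[of "\<bar>cos (v - \<phi>)\<bar>" 1 "v powr - s"] by (simp add: abs_mult)
  qed (use assms in \<open>auto intro!: set_integrable_powr_near_0 cos_powr_set_integrable_near_0\<close>)
  also have "\<dots> = \<epsilon> powr (1 - s) / (1 - s)"
    using set_integral_powr_near_0[of "-s" \<epsilon>] assms by (simp add: add_ac)
  finally show ?thesis .
qed

text \<open>On each period, \<open>sin v\<close> may be multiplied by \<open>v\<^bsup>-a\<^esup> - c\<close> instead of \<open>v\<^bsup>-a\<^esup>\<close>; with \<open>c\<close> the value
  at the midpoint the product is nonnegative.\<close>

lemma sin_times_decreasing_nonneg:
  fixes v a :: real and N :: nat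
  assumes a: "a > 0" and v: "0 < v" "2 * pi * N \<le> v" "v \<le> 2 * pi * Suc N"
  shows "0 \<le> sin v * (v powr - a - (2 * pi * N + pi) powr - a)"
proof -
  define u where "u = v - 2 * pi * N"
  have u: "0 \<le> u" "u \<le> 2 * pi" using v unfolding u_def by (auto simp: algebra_simps)
  have su: "sin v = sin u"
    using sin.plus_of_nat[of u N] unfolding u_def by (simp add: mult_ac)
  show ?thesis
  proof (cases "u \<le> pi")
    case True
    then have "(2 * pi * N + pi) powr - a \<le> v powr - a"
      using v a unfolding u_def by (intro powr_mono2') auto
    then show ?thesis using True u su by (simp add: sin_ge_zero)
  next
    case False
    then have "v powr - a \<le> (2 * pi * N + pi) powr - a"
      using v a unfolding u_def by (intro powr_mono2') (auto intro: add_nonneg_pos)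
    moreover have "sin u \<le> 0" using False u sin_le_zero[of u] by (cases "u = 2 * pi") auto
    ultimately show ?thesis using su by (simp add: mult_nonpos_nonpos)
  qed
qed

text \<open>The bound must be independent of the number of periods. On a full period the midpoint
  value of the weight can be subtracted for free, and the integrand becomes nonnegative; of the
  first period only the part over \<open>{pi / 4..pi / 2}\<close> is kept, and it produces
  \<open>c\<close>. The cutoff \<epsilon> allows exponents for which the integral diverges
  absolutely at 0.\<close>

lemma sin_powr_integral_lower_bound:
  fixes a :: real
  assumes a: "a > 0"
  obtains c K where "c > 0" "\<And>N \<epsilon>. 0 < \<epsilon> \<Longrightarrow> \<epsilon> \<le> pi / 4 \<Longrightarrow>
    c - K * \<epsilon> \<le> (LINT v:{\<epsilon>..2 * pi * real (Suc N)}|lborel. sin v * v powr - a)"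
proof -
  define w where "w v = sin v * v powr - a" for v :: real
  define c1 where "c1 = (pi / 2) powr - a - pi powr - a"
  define c where "c = c1 * sin (pi / 4) * (pi / 4)"
  have c1: "c1 > 0" unfolding c1_def using a powr_less_mono2_neg[of "-a" "pi / 2" pi] by simp
  have s4: "sin (pi / 4) > 0" by (rule sin_gt_zero) auto
  have c: "c > 0" unfolding c_def using c1 s4 by simp
  have int: "set_integrable lborel {x..y} (\<lambda>v. sin v * (v powr - a - k))" if "x > 0" for x y k
    using that by (intro set_integrable_continuous_Icc continuous_intros) auto
  have intw: "set_integrable lborel {x..y} w" if "x > 0" for x y
    unfolding w_def using that by (intro set_integrable_continuous_Icc continuous_intros) auto
  have ints: "set_integrable lborel {x..y} (\<lambda>v. k * sin v)" for x y k :: real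
    by (intro set_integrable_continuous_Icc continuous_intros)
  have sinint: "(LINT v:{x..y}|lborel. sin v) = cos x - cos y" if "x \<le> y" for x y :: real
    using that by (subst set_integral_FTC(2)[of x y "\<lambda>v. - cos v" sin]) (auto intro!: derivative_eq_intros)
  have shift: "(LINT v:{x..y}|lborel. w v) = (LINT v:{x..y}|lborel. sin v * (v powr - a - k)) + k * (cos x - cos y)"
    if "0 < x" "x \<le> y" for x y k
  proof -
    have "(LINT v:{x..y}|lborel. w v) = (LINT v:{x..y}|lborel. sin v * (v powr - a - k) + k * sin v)"
      unfolding w_def by (simp add: algebra_simps)
    also have "\<dots> = (LINT v:{x..y}|lborel. sin v * (v powr - a - k)) + (LINT v:{x..y}|lborel. k * sin v)"
      using that by (intro set_integral_add int ints)
    finally show ?thesis using sinint[OF that(2)] by simp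
  qed
  have split: "(LINT v:{x..z}|lborel. w v) = (LINT v:{x..y}|lborel. w v) + (LINT v:{y..z}|lborel. w v)"
    if "0 < x" "x \<le> y" "y \<le> z" for x y z
    using cos_powr_integral_split[of x y z 1 "pi / 2" a] that by (simp add: w_def cos_sin_eq)
  have "c - pi powr - a * \<epsilon> \<le> (LINT v:{\<epsilon>..2 * pi * real (Suc N)}|lborel. w v)"
    if \<epsilon>: "0 < \<epsilon>" "\<epsilon> \<le> pi / 4" for N \<epsilon>
  proof (induction N)
    case 0
    have "(LINT v:{\<epsilon>..2 * pi}|lborel. sin v * (v powr - a - pi powr - a)) \<ge>
      (LINT v:{\<epsilon>..2 * pi}|lborel. indicator {pi / 4..pi / 2} v * (c1 * sin (pi / 4)))"
    proof (rule set_integral_mono[OF _ int[OF \<epsilon>(1)]])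
      show "set_integrable lborel {\<epsilon>..2 * pi} (\<lambda>v. indicator {pi / 4..pi / 2} v * (c1 * sin (pi / 4)))"
        by (rule set_integrable_lborel_bound[of _ "\<lambda>_. c1 * sin (pi / 4)"])
           (use c1 s4 in \<open>auto intro!: set_integrable_continuous_Icc simp: indicator_def\<close>)
      fix v assume v: "v \<in> {\<epsilon>..2 * pi}"
      show "indicator {pi / 4..pi / 2} v * (c1 * sin (pi / 4)) \<le> sin v * (v powr - a - pi powr - a)"
      proof (cases "v \<in> {pi / 4..pi / 2}")
        case True
        have "(pi / 2) powr - a \<le> v powr - a" using True a v \<epsilon> by (intro powr_mono2') auto
        moreover have "sin (pi / 4) \<le> sin v" using True by (intro sin_monotone_2pi_le) auto
        ultimately have "sin (pi / 4) * c1 \<le> sin v * (v powr - a - pi powr - a)"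
          using s4 c1 unfolding c1_def by (intro mult_mono) auto
        then show ?thesis using True by (simp add: mult.commute)
      next
        case False
        then show ?thesis using sin_times_decreasing_nonneg[OF a, of v 0] v \<epsilon> by simp
      qed
    qed
    moreover have "(LINT v:{\<epsilon>..2 * pi}|lborel. indicator {pi / 4..pi / 2} v * (c1 * sin (pi / 4))) = c"
    proof -
      have "(LINT v:{\<epsilon>..2 * pi}|lborel. indicator {pi / 4..pi / 2} v * (c1 * sin (pi / 4)))
        = (LINT v|lborel. indicator {pi / 4..pi / 2} v * (c1 * sin (pi / 4)))"
        unfolding set_lebesgue_integral_def using \<epsilon> by (intro Bochner_Integration.integral_cong) (auto simp: indicator_def)
      then show ?thesis by (simp add: c_def)
    qed
    \<comment> \<open>The first period is incomplete, so subtracting the midpoint value leaves the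
      boundary term \<open>pi powr - a * (cos \<epsilon> - 1)\<close>. This is the origin of the
      loss \<open>K * \<epsilon>\<close>, with \<open>K = pi powr - a\<close>.\<close>
    moreover have "1 - cos \<epsilon> \<le> \<epsilon>"
    proof -
      have "1 - cos \<epsilon> = 2 * (sin (\<epsilon> / 2))\<^sup>2" using cos_double_sin[of "\<epsilon> / 2"] by simp
      also have "\<dots> \<le> 2 * (1 * \<bar>sin (\<epsilon> / 2)\<bar>)"
      proof -
        have "(sin (\<epsilon> / 2))\<^sup>2 = \<bar>sin (\<epsilon> / 2)\<bar> * \<bar>sin (\<epsilon> / 2)\<bar>" by (simp add: power2_eq_square)
        also have "\<dots> \<le> 1 * \<bar>sin (\<epsilon> / 2)\<bar>" by (intro mult_right_mono) auto
        finally show ?thesis by simp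
      qed
      also have "\<dots> \<le> \<epsilon>" using abs_sin_x_le_abs_x[of "\<epsilon> / 2"] \<epsilon> by simp
      finally show ?thesis .
    qed
    then have "pi powr - a * (1 - cos \<epsilon>) \<le> pi powr - a * \<epsilon>" by (intro mult_left_mono) auto
    ultimately show ?case
      using shift[of \<epsilon> "2 * pi" "pi powr - a"] \<epsilon> by (simp add: algebra_simps)
  next
    case (Suc N)
    let ?x = "2 * pi * real (Suc N)" and ?y = "2 * pi * real (Suc (Suc N))"
    have xy: "0 < ?x" "?x \<le> ?y" by (auto simp: algebra_simps intro!: add_pos_nonneg)
    have ex: "\<epsilon> \<le> ?x"
    proof -
      have "\<epsilon> \<le> 2 * pi * 1" using \<epsilon> by simp
      also have "\<dots> \<le> ?x" by (intro mult_left_mono) auto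
      finally show ?thesis .
    qed
    have "(LINT v:{?x..?y}|lborel. w v) =
      (LINT v:{?x..?y}|lborel. sin v * (v powr - a - (2 * pi * real (Suc N) + pi) powr - a))"
      using shift[OF xy, of "(2 * pi * real (Suc N) + pi) powr - a"]
        cos_int_2pin[of "int (Suc N)"] cos_int_2pin[of "int (Suc (Suc N))"] by (simp add: mult_ac del: of_nat_Suc)
    also have "\<dots> \<ge> (LINT v:{?x..?y}|lborel. 0 * sin v)"
      using sin_times_decreasing_nonneg[OF a, of _ "Suc N"] xy
      by (intro set_integral_mono int ints) auto
    finally have "(LINT v:{?x..?y}|lborel. w v) \<ge> 0" by simp
    then show ?case using Suc split[of \<epsilon> ?x ?y] xy ex \<epsilon> by linarith
  qed
  with c that show ?thesis unfolding w_def by blast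
qed

lemma cos_powr_integral_scale:
  fixes \<theta> \<phi> s R :: real
  assumes "\<theta> > 0"
  shows "(LINT y:{1..R}|lborel. cos (\<theta> * y - \<phi>) * y powr - s)
    = \<theta> powr (s - 1) * (LINT v:{\<theta>..\<theta> * R}|lborel. cos (v - \<phi>) * v powr - s)"
proof -
  have "(LINT v:{\<theta>..\<theta> * R}|lborel. cos (v - \<phi>) * v powr - s)
    = \<theta> * (\<integral>y. indicator {\<theta>..\<theta> * R} (\<theta> * y) * (cos (\<theta> * y - \<phi>) * (\<theta> * y) powr - s) \<partial>lborel)"
    unfolding set_lebesgue_integral_def
    using lborel_integral_real_affine[of \<theta> "\<lambda>v. indicator {\<theta>..\<theta> * R} v *\<^sub>R (cos (v - \<phi>) * v powr - s)" 0] assms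
    by simp
  also have "(\<integral>y. indicator {\<theta>..\<theta> * R} (\<theta> * y) * (cos (\<theta> * y - \<phi>) * (\<theta> * y) powr - s) \<partial>lborel)
    = (\<integral>y. \<theta> powr - s * (indicator {1..R} y * (cos (\<theta> * y - \<phi>) * y powr - s)) \<partial>lborel)"
    using assms by (intro Bochner_Integration.integral_cong) (auto simp: indicator_def powr_mult)
  also have "\<dots> = \<theta> powr - s * (LINT y:{1..R}|lborel. cos (\<theta> * y - \<phi>) * y powr - s)"
    by (simp add: set_lebesgue_integral_def)
  finally show ?thesis
    using assms by (simp add: powr_diff powr_minus field_simps)
qed

text \<open>\<open>\<kappa> \<phi>\<close> is the improper integral of
  \<open>cos (v - \<phi>) * v powr - s\<close> over the half line. Substituting
  \<open>v = \<theta> * y\<close> turns the oscillatory integral into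
  \<open>\<theta> powr (s - 1)\<close> times \<open>\<kappa> \<phi>\<close> without its part over
  \<open>{0<..\<theta>}\<close>; that part is of order \<open>\<theta> powr (1 - s)\<close>, so it
  contributes only the bounded error \<open>1 / (1 - s)\<close>.\<close>

lemma cos_powr_integral_singularity:
  fixes s :: real
  assumes s: "0 < s" "s < 1"
  obtains \<kappa> :: "real \<Rightarrow> real" where
    "\<And>\<phi> \<theta> l. \<theta> > 0 \<Longrightarrow> ((\<lambda>R. LINT y:{1..R}|lborel. cos (\<theta> * y - \<phi>) * y powr - s) \<longlongrightarrow> l) at_top
      \<Longrightarrow> \<bar>l - \<kappa> \<phi> * \<theta> powr (s - 1)\<bar> \<le> 1 / (1 - s)"
    "\<And>\<phi>. \<kappa> \<phi> \<noteq> 0 \<or> \<kappa> (- \<phi>) \<noteq> 0"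
proof -
  define P where "P \<phi> R = (LINT v:{0<..R}|lborel. cos (v - \<phi>) * v powr - s)" for \<phi> R
  have split: "P \<phi> R = P \<phi> \<epsilon> + (LINT v:{\<epsilon>..R}|lborel. cos (v - \<phi>) * v powr - s)" if "0 < \<epsilon>" "\<epsilon> \<le> R" for \<phi> \<epsilon> R
    unfolding P_def by (rule cos_powr_integral_split_near_0[OF s(2) that])
  have near: "\<bar>P \<phi> \<epsilon>\<bar> \<le> \<epsilon> powr (1 - s) / (1 - s)" if "0 < \<epsilon>" for \<phi> \<epsilon>
    unfolding P_def by (rule cos_powr_integral_near_0_bound[OF s(2) that])
  have "\<exists>l. (P \<phi> \<longlongrightarrow> l) at_top" for \<phi>
  proof -
    obtain l where l: "((\<lambda>R. LINT y:{1..R}|lborel. cos (1 * y - \<phi>) * y powr - s) \<longlongrightarrow> l) at_top"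
      using cos_powr_integral_convergent[of s 1 \<phi>] s by auto
    have "(P \<phi> \<longlongrightarrow> P \<phi> 1 + l) at_top"
    proof (rule Lim_transform_eventually)
      show "((\<lambda>R. P \<phi> 1 + (LINT y:{1..R}|lborel. cos (1 * y - \<phi>) * y powr - s)) \<longlongrightarrow> P \<phi> 1 + l) at_top"
        by (intro tendsto_intros l)
      show "\<forall>\<^sub>F R in at_top. P \<phi> 1 + (LINT y:{1..R}|lborel. cos (1 * y - \<phi>) * y powr - s) = P \<phi> R"
        using eventually_ge_at_top[of 1]
      proof eventually_elim
        case (elim R)
        then show ?case using split[of 1 R \<phi>] by simp
      qed
    qed
    then show ?thesis by blast
  qed
  then obtain \<kappa> where \<kappa>: "\<And>\<phi>. (P \<phi> \<longlongrightarrow> \<kappa> \<phi>) at_top" by metis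
  have asym: "\<bar>l - \<kappa> \<phi> * \<theta> powr (s - 1)\<bar> \<le> 1 / (1 - s)"
    if \<theta>: "\<theta> > 0" and l: "((\<lambda>R. LINT y:{1..R}|lborel. cos (\<theta> * y - \<phi>) * y powr - s) \<longlongrightarrow> l) at_top"
    for \<phi> \<theta> l
  proof -
    have "((\<lambda>R. \<theta> powr (s - 1) * (P \<phi> (\<theta> * R) - P \<phi> \<theta>)) \<longlongrightarrow> \<theta> powr (s - 1) * (\<kappa> \<phi> - P \<phi> \<theta>)) at_top"
      using \<theta> by (intro tendsto_intros filterlim_compose[OF \<kappa>]
          filterlim_tendsto_pos_mult_at_top[OF tendsto_const _ filterlim_ident])
    moreover have "\<forall>\<^sub>F R in at_top. (LINT y:{1..R}|lborel. cos (\<theta> * y - \<phi>) * y powr - s) = \<theta> powr (s - 1) * (P \<phi> (\<theta> * R) - P \<phi> \<theta>)"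
      using eventually_ge_at_top[of 1]
    proof eventually_elim
      case (elim R)
      then show ?case using split[of \<theta> "\<theta> * R" \<phi>] cos_powr_integral_scale[OF \<theta>, of R \<phi> s] \<theta> by simp
    qed
    ultimately have "((\<lambda>R. LINT y:{1..R}|lborel. cos (\<theta> * y - \<phi>) * y powr - s) \<longlongrightarrow> \<theta> powr (s - 1) * (\<kappa> \<phi> - P \<phi> \<theta>)) at_top"
      using tendsto_cong by fast
    then have "l = \<theta> powr (s - 1) * (\<kappa> \<phi> - P \<phi> \<theta>)"
      by (rule tendsto_unique[OF trivial_limit_at_top_linorder l])
    then have "l - \<kappa> \<phi> * \<theta> powr (s - 1) = - (\<theta> powr (s - 1) * P \<phi> \<theta>)"
      by (simp add: algebra_simps)
    then have "\<bar>l - \<kappa> \<phi> * \<theta> powr (s - 1)\<bar> = \<theta> powr (s - 1) * \<bar>P \<phi> \<theta>\<bar>"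
      by (simp add: abs_mult)
    also have "\<dots> \<le> \<theta> powr (s - 1) * (\<theta> powr (1 - s) / (1 - s))"
      by (intro mult_left_mono near \<theta>) auto
    also have "\<dots> = 1 / (1 - s)" using \<theta> by (simp add: powr_add[symmetric])
    finally show ?thesis .
  qed
  \<comment> \<open>By the addition theorem all values of \<kappa> come from the pure cosine and
    pure sine integrals. Both will be positive, so
    \<open>\<kappa> \<phi> = \<kappa> (- \<phi>) = 0\<close> would make sine and cosine of \<phi>
    vanish together.\<close>
  have lin: "\<kappa> \<phi> = cos \<phi> * \<kappa> 0 + sin \<phi> * \<kappa> (pi / 2)" for \<phi>
  proof -
    have "P \<phi> R = cos \<phi> * P 0 R + sin \<phi> * P (pi / 2) R" for R
    proof -
      have "P \<phi> R = (LINT v:{0<..R}|lborel. cos \<phi> * (cos (v - 0) * v powr - s) + sin \<phi> * (cos (v - pi / 2) * v powr - s))"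
        unfolding P_def by (simp add: cos_diff algebra_simps)
      also have "\<dots> = (LINT v:{0<..R}|lborel. cos \<phi> * (cos (v - 0) * v powr - s)) + (LINT v:{0<..R}|lborel. sin \<phi> * (cos (v - pi / 2) * v powr - s))"
        using s by (intro set_integral_add set_integrable_mult_right cos_powr_set_integrable_near_0)
      finally show ?thesis by (simp add: P_def)
    qed
    moreover have "((\<lambda>R. cos \<phi> * P 0 R + sin \<phi> * P (pi / 2) R) \<longlongrightarrow> cos \<phi> * \<kappa> 0 + sin \<phi> * \<kappa> (pi / 2)) at_top"
      by (intro tendsto_intros \<kappa>)
    ultimately have "(P \<phi> \<longlongrightarrow> cos \<phi> * \<kappa> 0 + sin \<phi> * \<kappa> (pi / 2)) at_top" by presburger
    then show ?thesis by (rule tendsto_unique[OF trivial_limit_at_top_linorder \<kappa>])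
  qed
  define X where "X N = 2 * pi * real (Suc N)" for N
  have X: "filterlim X at_top sequentially"
    unfolding X_def
    by (intro filterlim_tendsto_pos_mult_at_top[OF tendsto_const] filterlim_compose[OF filterlim_real_sequentially] filterlim_Suc) simp
  have X1: "X N > 1" for N
  proof -
    have "2 * pi * 1 \<le> X N" unfolding X_def by (intro mult_left_mono) auto
    then show ?thesis using pi_gt3 by simp
  qed
  \<comment> \<open>A common scheme for both integrals: a lower bound along whole periods
    \<open>X N\<close>, with losses that vanish as the cutoff \<epsilon> tends to 0, passes to the
    limit first in \<open>N\<close> and then in \<epsilon>.\<close>
  have pos: "\<kappa> \<phi> > 0"
    if c: "c > 0" and lo: "\<And>N \<epsilon>. 0 < \<epsilon> \<Longrightarrow> \<epsilon> \<le> pi / 4 \<Longrightarrow>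
      c - K * \<epsilon> - M * \<epsilon> powr (1 - s) \<le> (LINT v:{\<epsilon>..X N}|lborel. cos (v - \<phi>) * v powr - s)" for \<phi> c K M
  proof -
    have le: "c - K * \<epsilon> - M * \<epsilon> powr (1 - s) - \<epsilon> powr (1 - s) / (1 - s) \<le> \<kappa> \<phi>"
      if \<epsilon>: "0 < \<epsilon>" "\<epsilon> \<le> pi / 4" for \<epsilon>
    proof (rule LIMSEQ_le_const[OF filterlim_compose[OF \<kappa> X]])
      have "c - K * \<epsilon> - M * \<epsilon> powr (1 - s) - \<epsilon> powr (1 - s) / (1 - s) \<le> P \<phi> (X N)" for N
        using lo[OF \<epsilon>, of N] near[OF \<epsilon>(1), of \<phi>] split[of \<epsilon> "X N" \<phi>] \<epsilon> X1[of N] pi_less_4 by linarith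
      then show "\<exists>N. \<forall>n\<ge>N. c - K * \<epsilon> - M * \<epsilon> powr (1 - s) - \<epsilon> powr (1 - s) / (1 - s) \<le> P \<phi> (X n)" by blast
    qed
    have z: "((\<lambda>\<epsilon>::real. \<epsilon> powr (1 - s)) \<longlongrightarrow> 0) (at_right 0)"
    proof -
      have "((\<lambda>\<epsilon>::real. \<epsilon> powr (1 - s)) \<longlongrightarrow> 0 powr (1 - s)) (at_right 0)"
        using s by (intro tendsto_powr2 tendsto_ident_at tendsto_const)
          (auto simp: eventually_at_right_less intro!: eventually_mono[OF eventually_at_right_less])
      then show ?thesis by simp
    qed
    have "((\<lambda>\<epsilon>. c - K * \<epsilon> - M * \<epsilon> powr (1 - s) - \<epsilon> powr (1 - s) / (1 - s)) \<longlongrightarrow> c - K * 0 - M * 0 - 0 / (1 - s)) (at_right 0)"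
      using s by (intro tendsto_intros z) auto
    moreover have "\<forall>\<^sub>F \<epsilon> in at_right 0. c - K * \<epsilon> - M * \<epsilon> powr (1 - s) - \<epsilon> powr (1 - s) / (1 - s) \<le> \<kappa> \<phi>"
      unfolding eventually_at_right_field using le by (intro exI[of _ "pi / 4"]) auto
    ultimately have "c - K * 0 - M * 0 - 0 / (1 - s) \<le> \<kappa> \<phi>"
      by (intro tendsto_upperbound) auto
    then show ?thesis using c by simp
  qed
  have "\<kappa> (pi / 2) > 0"
  proof -
    obtain c K where c: "c > 0" "\<And>N \<epsilon>. 0 < \<epsilon> \<Longrightarrow> \<epsilon> \<le> pi / 4 \<Longrightarrow>
      c - K * \<epsilon> \<le> (LINT v:{\<epsilon>..2 * pi * real (Suc N)}|lborel. sin v * v powr - s)"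
      using sin_powr_integral_lower_bound[OF s(1)] by blast
    have "cos (v - pi / 2) = sin v" for v :: real by (simp add: cos_diff)
    then show ?thesis using c by (intro pos[of c K 0]) (auto simp: X_def)
  qed
  \<comment> \<open>Integration by parts replaces the cosine integral by \<open>s\<close> times the
    sine integral with exponent \<open>s + 1\<close>. The boundary term vanishes at
    \<open>X N\<close>, a multiple of \<open>2 * pi\<close>, and at \<epsilon> it is at most
    \<open>\<epsilon> powr (1 - s)\<close>; hence the coefficient 1 in the scheme
    \<open>pos\<close>.\<close>
  moreover have "\<kappa> 0 > 0"
  proof -
    obtain c K where c: "c > 0" "\<And>N \<epsilon>. 0 < \<epsilon> \<Longrightarrow> \<epsilon> \<le> pi / 4 \<Longrightarrow>
      c - K * \<epsilon> \<le> (LINT v:{\<epsilon>..2 * pi * real (Suc N)}|lborel. sin v * v powr - (s + 1))"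
      using sin_powr_integral_lower_bound[of "s + 1"] s by auto
    show ?thesis
    proof (rule pos[of "s * c" "s * K" 1])
      show "s * c > 0" using s c by simp
      fix N \<epsilon> assume \<epsilon>: "0 < \<epsilon>" "\<epsilon> \<le> pi / 4"
      have "\<epsilon> \<le> X N" using \<epsilon> X1[of N] pi_less_4 by linarith
      have "(LINT v:{\<epsilon>..X N}|lborel. cos v * v powr - s - s * (sin v * v powr - (s + 1))) = sin (X N) * X N powr - s - sin \<epsilon> * \<epsilon> powr - s"
      proof (rule set_integral_FTC[OF \<open>\<epsilon> \<le> X N\<close>])
        fix v assume "\<epsilon> \<le> v"
        then have "v > 0" using \<epsilon> by simp
        then show "((\<lambda>v. sin v * v powr - s) has_real_derivative cos v * v powr - s - s * (sin v * v powr - (s + 1))) (at v)"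
          by (auto intro!: derivative_eq_intros simp: mult_ac minus_diff_commute[of 1 s])
        show "isCont (\<lambda>v. cos v * v powr - s - s * (sin v * v powr - (s + 1))) v"
          using \<open>v > 0\<close> by (auto intro!: continuous_intros)
      qed
      moreover have "(LINT v:{\<epsilon>..X N}|lborel. cos v * v powr - s - s * (sin v * v powr - (s + 1)))
        = (LINT v:{\<epsilon>..X N}|lborel. cos v * v powr - s) - (LINT v:{\<epsilon>..X N}|lborel. s * (sin v * v powr - (s + 1)))"
        using \<epsilon> by (intro set_integral_diff set_integrable_continuous_Icc continuous_intros) auto
      moreover have "sin (X N) = 0" using sin_int_2pin[of "int (Suc N)"] by (simp add: X_def mult_ac del: of_nat_Suc)
      moreover have "sin \<epsilon> * \<epsilon> powr - s \<le> \<epsilon> powr (1 - s)"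
      proof -
        have "sin \<epsilon> * \<epsilon> powr - s \<le> \<epsilon> * \<epsilon> powr - s" using sin_x_le_x[of \<epsilon>] \<epsilon> by (intro mult_right_mono) auto
        also have "\<dots> = \<epsilon> powr (1 - s)" using \<epsilon> by (simp add: powr_diff powr_minus field_simps)
        finally show ?thesis .
      qed
      moreover have "s * (c - K * \<epsilon>) \<le> s * (LINT v:{\<epsilon>..X N}|lborel. sin v * v powr - (s + 1))"
        using c(2)[OF \<epsilon>, of N] s unfolding X_def by (intro mult_left_mono) auto
      ultimately show "s * c - s * K * \<epsilon> - 1 * \<epsilon> powr (1 - s) \<le> (LINT v:{\<epsilon>..X N}|lborel. cos (v - 0) * v powr - s)"
        by (simp add: algebra_simps)
    qed
  qed
  ultimately have "\<kappa> \<phi> \<noteq> 0 \<or> \<kappa> (- \<phi>) \<noteq> 0" for \<phi>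
  proof (rule_tac ccontr)
    assume k: "\<kappa> 0 > 0" "\<kappa> (pi / 2) > 0" and "\<not> (\<kappa> \<phi> \<noteq> 0 \<or> \<kappa> (- \<phi>) \<noteq> 0)"
    then have "cos \<phi> * \<kappa> 0 = 0" "sin \<phi> * \<kappa> (pi / 2) = 0" using lin[of \<phi>] lin[of "- \<phi>"] by auto
    then have "cos \<phi> = 0" "sin \<phi> = 0" using k by auto
    then show False using sin_cos_squared_add[of \<phi>] by simp
  qed
  with asym that show ?thesis by blast
qed

subsection \<open>The kernel\<close>

lemma borel_measurable_bessel_J [measurable]: "bessel_J \<nu> \<in> borel_measurable borel"
  unfolding bessel_J_def[abs_def] by measurable

text \<open>Both estimates are arranged to hold for every \<open>w > 0\<close>, so that later
  arguments need no case distinction. Below 1 the wave estimate is trivial, because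
  \<open>w powr (-3/2)\<close> dominates the function and its leading wave; above 1 the factor
  \<open>1 + w\<close> makes the growth estimate trivial, because
  \<open>\<nu> + 1 > 0\<close>.\<close>

lemma bessel_J_estimates:
  assumes \<nu>: "\<nu> > -1"
  obtains A \<phi> C where "A > 0" "C > 0"
    "\<And>w. w > 0 \<Longrightarrow> \<bar>bessel_J \<nu> w - A * w powr (-1/2) * cos (w - \<phi>)\<bar> \<le> C * w powr (-3/2)"
    "\<And>w. w > 0 \<Longrightarrow> \<bar>bessel_J \<nu> w\<bar> \<le> C * w powr \<nu> * (1 + w)"
proof -
  obtain A \<phi> C1 where A: "A > 0" and
    far: "\<And>x. x \<ge> 1 \<Longrightarrow> \<bar>sqrt x * bessel_J \<nu> x - A * cos (x - \<phi>)\<bar> \<le> C1 / x"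
    using bessel_J_asymptotics_at_infinity[OF \<nu>] by blast
  have C1: "C1 \<ge> 0" using far[of 1] by simp
  have "compact (bessel_series \<nu> ` {0..1})"
    using continuous_bessel_series[OF \<nu>]
    by (intro compact_continuous_image continuous_at_imp_continuous_on) auto
  then obtain b where b: "\<And>w. w \<in> {0..1} \<Longrightarrow> \<bar>bessel_series \<nu> w\<bar> \<le> b"
    by (fastforce dest!: compact_imp_bounded simp: bounded_iff)
  have b0: "b \<ge> 0" using b[of 0] by simp
  define C2 where "C2 = (1/2) powr \<nu> * b"
  have C2: "C2 \<ge> 0" unfolding C2_def using b0 by simp
  have near: "\<bar>bessel_J \<nu> w\<bar> \<le> C2 * w powr \<nu>" if "0 < w" "w \<le> 1" for w
  proof -
    have "(w / 2)\<^sup>2 \<le> 1" using that by (simp add: power_le_one)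
    have "\<bar>bessel_J \<nu> w\<bar> = (w / 2) powr \<nu> * \<bar>bessel_series \<nu> ((w / 2)\<^sup>2)\<bar>"
      using that by (simp add: bessel_J_eq_series[OF \<nu>] abs_mult)
    also have "\<dots> \<le> (w / 2) powr \<nu> * b"
      using \<open>(w / 2)\<^sup>2 \<le> 1\<close> by (intro mult_left_mono b) auto
    also have "\<dots> = C2 * w powr \<nu>"
      using that powr_mult[of w "1/2" \<nu>] by (simp add: C2_def)
    finally show ?thesis .
  qed
  have far': "\<bar>bessel_J \<nu> w - A * w powr (-1/2) * cos (w - \<phi>)\<bar> \<le> C1 * w powr (-3/2)" if "w \<ge> 1" for w
  proof -
    have w: "w > 0" using that by simp
    have h: "w powr (-1/2) * sqrt w = 1"
      using w by (simp add: powr_half_sqrt[symmetric] powr_add[symmetric])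
    have "bessel_J \<nu> w - A * w powr (-1/2) * cos (w - \<phi>)
      = w powr (-1/2) * sqrt w * bessel_J \<nu> w - A * w powr (-1/2) * cos (w - \<phi>)" by (simp only: h mult_1)
    also have "\<dots> = w powr (-1/2) * (sqrt w * bessel_J \<nu> w - A * cos (w - \<phi>))"
      by (simp add: algebra_simps)
    finally have "\<bar>bessel_J \<nu> w - A * w powr (-1/2) * cos (w - \<phi>)\<bar>
      = w powr (-1/2) * \<bar>sqrt w * bessel_J \<nu> w - A * cos (w - \<phi>)\<bar>" by (simp add: abs_mult)
    also have "\<dots> \<le> w powr (-1/2) * (C1 / w)"
      by (intro mult_left_mono far that) auto
    also have "\<dots> = C1 * w powr (-3/2)" using w powr_diff[of w "-1/2" 1] by simp
    finally show ?thesis .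
  qed
  define C where "C = A + C1 + C2 + 1"
  have C: "C \<ge> A + C1" "C \<ge> A + C2" "C > 0" unfolding C_def using A C1 C2 by auto
  have mono: "w powr a \<le> w powr b" if "0 < w" "w \<le> 1" "b \<le> a" for a b w :: real
    using that by (intro powr_mono') auto
  show ?thesis
  proof (rule that[OF A C(3)])
    fix w :: real assume w: "w > 0"
    have Acos: "\<bar>A * w powr (-1/2) * cos (w - \<phi>)\<bar> \<le> A * w powr (-1/2)"
      using mult_left_mono[of "\<bar>cos (w - \<phi>)\<bar>" 1 "A * w powr (-1/2)"] A by (simp add: abs_mult)
    show "\<bar>bessel_J \<nu> w - A * w powr (-1/2) * cos (w - \<phi>)\<bar> \<le> C * w powr (-3/2)"
    proof (cases "w \<ge> 1")
      case True
      have "C1 * w powr (-3/2) \<le> C * w powr (-3/2)" using C A by (intro mult_right_mono) auto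
      then show ?thesis using far'[OF True] by simp
    next
      case False
      have "C2 * w powr \<nu> \<le> C2 * w powr (-3/2)" using False w \<nu> C2 by (intro mult_left_mono mono) auto
      moreover have "A * w powr (-1/2) \<le> A * w powr (-3/2)" using False w A by (intro mult_left_mono mono) auto
      moreover have "(A + C2) * w powr (-3/2) \<le> C * w powr (-3/2)" using C by (intro mult_right_mono) auto
      moreover have "(A + C2) * w powr (-3/2) = A * w powr (-3/2) + C2 * w powr (-3/2)" by (simp add: algebra_simps)
      ultimately show ?thesis using near[of w] Acos False w by linarith
    qed
    show "\<bar>bessel_J \<nu> w\<bar> \<le> C * w powr \<nu> * (1 + w)"
    proof (cases "w \<ge> 1")
      case True
      have "C1 * w powr (-3/2) \<le> C1 * w powr (\<nu> + 1)" using True \<nu> C1 by (intro mult_left_mono powr_mono) auto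
      moreover have "A * w powr (-1/2) \<le> A * w powr (\<nu> + 1)" using True \<nu> A by (intro mult_left_mono powr_mono) auto
      moreover have "(A + C1) * w powr (\<nu> + 1) \<le> C * w powr (\<nu> + 1)" using C by (intro mult_right_mono) auto
      moreover have "(A + C1) * w powr (\<nu> + 1) = A * w powr (\<nu> + 1) + C1 * w powr (\<nu> + 1)" by (simp add: algebra_simps)
      moreover have "C * w powr \<nu> * (1 + w) = C * w powr \<nu> + C * w powr (\<nu> + 1)"
        using w by (simp add: powr_add algebra_simps)
      moreover have "C * w powr \<nu> \<ge> 0" using C by simp
      ultimately show ?thesis using far'[OF True] Acos by linarith
    next
      case False
      have "\<bar>bessel_J \<nu> w\<bar> \<le> C2 * w powr \<nu>" using False w by (intro near) auto
      also have "\<dots> \<le> C * w powr \<nu>" using C A by (intro mult_right_mono) auto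
      also have "\<dots> * 1 \<le> C * w powr \<nu> * (1 + w)" using C w by (intro mult_left_mono) auto
      finally show ?thesis by simp
    qed
  qed
qed

lemma abs_prod3_diff_le:
  fixes a b c a' b' c' M N :: real
  assumes "\<bar>a\<bar> \<le> k1 * M" "\<bar>b\<bar> \<le> k2 * M" "\<bar>c\<bar> \<le> k3 * M" "\<bar>a'\<bar> \<le> k1 * M" "\<bar>b'\<bar> \<le> k2 * M" "\<bar>c'\<bar> \<le> k3 * M"
    "\<bar>a - a'\<bar> \<le> k1 * N" "\<bar>b - b'\<bar> \<le> k2 * N" "\<bar>c - c'\<bar> \<le> k3 * N"
  shows "\<bar>a * b * c - a' * b' * c'\<bar> \<le> 3 * (k1 * k2 * k3) * (M * M * N)"
proof -
  have nn: "0 \<le> k1 * M" "0 \<le> k2 * M" "0 \<le> k3 * M" "0 \<le> k1 * N" "0 \<le> k2 * N" "0 \<le> k3 * N"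
    using assms[THEN order_trans[OF abs_ge_zero]] by auto
  have "a * b * c - a' * b' * c' = (a - a') * b * c + a' * (b - b') * c + a' * b' * (c - c')"
    by (simp add: algebra_simps)
  moreover have "\<bar>(a - a') * b * c\<bar> \<le> (k1 * N) * (k2 * M) * (k3 * M)"
    unfolding abs_mult by (intro mult_mono mult_nonneg_nonneg assms nn abs_ge_zero)
  moreover have "\<bar>a' * (b - b') * c\<bar> \<le> (k1 * M) * (k2 * N) * (k3 * M)"
    unfolding abs_mult by (intro mult_mono mult_nonneg_nonneg assms nn abs_ge_zero)
  moreover have "\<bar>a' * b' * (c - c')\<bar> \<le> (k1 * M) * (k2 * M) * (k3 * N)"
    unfolding abs_mult by (intro mult_mono mult_nonneg_nonneg assms nn abs_ge_zero)
  moreover have "3 * (k1 * k2 * k3) * (M * M * N) = (k1 * N) * (k2 * M) * (k3 * M) + (k1 * M) * (k2 * N) * (k3 * M) + (k1 * M) * (k2 * M) * (k3 * N)"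
    by (simp add: algebra_simps)
  ultimately show ?thesis by linarith
qed

lemma cos_triple_product:
  fixes a b c :: real
  shows "cos a * cos b * cos c = (cos (a + b + c) + cos (a + b - c) + cos (a - b + c) + cos (a - b - c)) / 4"
proof -
  have "cos a * cos b * cos c = (cos (a - b) * cos c + cos (a + b) * cos c) / 2"
    by (simp add: cos_times_cos[of a b] distrib_right)
  also have "\<dots> = (cos (a + b + c) + cos (a + b - c) + cos (a - b + c) + cos (a - b - c)) / 4"
    using cos_times_cos[of "a - b" c] cos_times_cos[of "a + b" c] by argo
  finally show ?thesis .
qed

text \<open>The locale records all that is used of the asymptotics of the two Bessel functions:
  amplitudes, phases and a common constant. The phases \<phi> and \<psi> stay free parameters, so
  every nonvanishing statement has to hold for arbitrary phases.\<close>

locale spherical_kernel =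
  fixes \<alpha> \<beta> A \<phi> B \<psi> C :: real
  assumes \<alpha>: "\<alpha> > -1" and \<nu>: "\<alpha> + \<beta> > -1/2"
    and A: "A > 0" and B: "B > 0" and C: "C > 0"
    and J\<nu>_wave: "\<And>w. w > 0 \<Longrightarrow> \<bar>bessel_J (\<alpha> + \<beta>) w - A * w powr (-1/2) * cos (w - \<phi>)\<bar> \<le> C * w powr (-3/2)"
    and J\<alpha>_wave: "\<And>w. w > 0 \<Longrightarrow> \<bar>bessel_J \<alpha> w - B * w powr (-1/2) * cos (w - \<psi>)\<bar> \<le> C * w powr (-3/2)"
    and J\<nu>_le: "\<And>w. w > 0 \<Longrightarrow> \<bar>bessel_J (\<alpha> + \<beta>) w\<bar> \<le> C * w powr (\<alpha> + \<beta>) * (1 + w)"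
    and J\<alpha>_le: "\<And>w. w > 0 \<Longrightarrow> \<bar>bessel_J \<alpha> w\<bar> \<le> C * w powr \<alpha> * (1 + w)"
begin

text \<open>A single weight for a Bessel function dilated by \<open>w\<close>: it dominates the
  growth near 0, the amplitude \<open>w powr (-1/2)\<close> of the leading wave, and the size
  \<open>w powr (-3/2)\<close> of its error.\<close>

definition Q :: "real \<Rightarrow> real" where
  "Q w = 1 + w powr \<alpha> * (1 + w) + w powr (-3/2)"

definition integrand :: "real \<Rightarrow> real \<Rightarrow> real \<Rightarrow> real \<Rightarrow> real" where
  "integrand t x z y = bessel_J (\<alpha> + \<beta>) (t * y) * bessel_J \<alpha> (x * y) * bessel_J \<alpha> (z * y) * y powr (1 - \<alpha> - \<beta>)"

definition main_part :: "real \<Rightarrow> real \<Rightarrow> real \<Rightarrow> real \<Rightarrow> real" where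
  "main_part t x z y = A * (t * y) powr (-1/2) * cos (t * y - \<phi>) * (B * (x * y) powr (-1/2) * cos (x * y - \<psi>))
     * (B * (z * y) powr (-1/2) * cos (z * y - \<psi>)) * y powr (1 - \<alpha> - \<beta>)"

text \<open>Three amplitudes of order \<open>y powr (-1/2)\<close> times
  \<open>y powr (1 - \<alpha> - \<beta>)\<close> give the exponent
  \<open>- (\<alpha> + \<beta> + 1/2)\<close>, which is negative; convergence at infinity therefore
  fails only at frequency 0.\<close>

definition osc :: "real \<Rightarrow> real \<Rightarrow> real \<Rightarrow> real" where
  "osc \<theta> \<eta> R = (LINT y:{1..R}|lborel. cos (\<theta> * y - \<eta>) * y powr - (\<alpha> + \<beta> + 1/2))"

definition trunc :: "real \<Rightarrow> real \<Rightarrow> real \<Rightarrow> real \<Rightarrow> real" where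
  "trunc t x z R = (LINT y:{0<..R}|lborel. integrand t x z y)"

text \<open>The true singularity of the kernel has exponent \<open>max 0 (1/2 - \<alpha> - \<beta>)\<close>; the lower bound \<open>1/2\<close>
  absorbs the logarithmic case.\<close>

definition \<gamma> :: real where "\<gamma> = max (1/2) (1/2 - \<alpha> - \<beta>)"

text \<open>The three points are the zeros of the frequencies \<open>t + x - z\<close>,
  \<open>t - x + z\<close> and \<open>t - x - z\<close> of the leading waves. The fourth frequency
  \<open>t + x + z\<close> has no zero for positive arguments.\<close>

definition sing :: "real \<Rightarrow> real \<Rightarrow> real \<Rightarrow> real" where
  "sing t x z = 1 + \<bar>z - (t + x)\<bar> powr - \<gamma> + \<bar>z - (x - t)\<bar> powr - \<gamma> + \<bar>z - (t - x)\<bar> powr - \<gamma>"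

lemma \<gamma>: "0 < \<gamma>" "\<gamma> < 1" "1 - \<gamma> \<le> \<alpha> + \<beta> + 1/2"
  using \<nu> unfolding \<gamma>_def by auto

lemma integrand_measurable [measurable]: "integrand t x z \<in> borel_measurable borel"
  unfolding integrand_def[abs_def] by measurable

lemma main_part_measurable [measurable]: "main_part t x z \<in> borel_measurable borel"
  unfolding main_part_def[abs_def] by measurable

lemma integrand_commute: "integrand t x z = integrand t z x"
  by (simp add: integrand_def[abs_def] mult_ac)

lemma trunc_commute: "trunc t x z R = trunc t z x R"
  by (simp add: trunc_def integrand_commute[of t x z])

lemma Q_ge: "w > 0 \<Longrightarrow> w powr (-3/2) \<le> Q w" "w > 0 \<Longrightarrow> w powr (-1/2) \<le> Q w" "w > 0 \<Longrightarrow> w powr \<alpha> * (1 + w) \<le> Q w"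
  "w > 0 \<Longrightarrow> 1 \<le> Q w"
proof -
  assume w: "w > 0"
  have nn: "0 \<le> w powr (-3/2)" "0 \<le> w powr \<alpha> * (1 + w)" using w by auto
  then show "w powr (-3/2) \<le> Q w" "w powr \<alpha> * (1 + w) \<le> Q w" "1 \<le> Q w" unfolding Q_def by auto
  show "w powr (-1/2) \<le> Q w"
  proof (cases "w \<ge> 1")
    case True
    have "w powr (-1/2) \<le> w powr 0" using True by (intro powr_mono) auto
    then have "w powr (-1/2) \<le> 1" using w by simp
    then show ?thesis unfolding Q_def using nn by linarith
  next
    case False
    have "w powr (-1/2) \<le> w powr (-3/2)" using False w by (intro powr_mono') auto
    then show ?thesis unfolding Q_def using nn by simp
  qed
qed

lemma bessel_le_dilate:
  assumes "0 < w" "0 < y"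
  shows "\<bar>bessel_J \<alpha> (w * y)\<bar> \<le> C * w powr \<alpha> * (1 + w) * (y powr \<alpha> * (1 + y))"
    "\<bar>bessel_J (\<alpha> + \<beta>) (w * y)\<bar> \<le> C * w powr (\<alpha> + \<beta>) * (1 + w) * (y powr (\<alpha> + \<beta>) * (1 + y))"
proof -
  have le: "1 + w * y \<le> (1 + w) * (1 + y)" using assms by (simp add: algebra_simps)
  have "\<bar>bessel_J \<alpha> (w * y)\<bar> \<le> C * (w * y) powr \<alpha> * (1 + w * y)" using assms by (intro J\<alpha>_le) auto
  also have "\<dots> \<le> C * (w * y) powr \<alpha> * ((1 + w) * (1 + y))" using C le by (intro mult_left_mono) auto
  finally show "\<bar>bessel_J \<alpha> (w * y)\<bar> \<le> C * w powr \<alpha> * (1 + w) * (y powr \<alpha> * (1 + y))"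
    using assms by (simp add: powr_mult mult_ac)
  have "\<bar>bessel_J (\<alpha> + \<beta>) (w * y)\<bar> \<le> C * (w * y) powr (\<alpha> + \<beta>) * (1 + w * y)" using assms by (intro J\<nu>_le) auto
  also have "\<dots> \<le> C * (w * y) powr (\<alpha> + \<beta>) * ((1 + w) * (1 + y))" using C le by (intro mult_left_mono) auto
  finally show "\<bar>bessel_J (\<alpha> + \<beta>) (w * y)\<bar> \<le> C * w powr (\<alpha> + \<beta>) * (1 + w) * (y powr (\<alpha> + \<beta>) * (1 + y))"
    using assms by (simp add: powr_mult mult_ac)
qed

lemma integrand_le:
  assumes "0 < t" "0 < x" "0 < z" "0 < y"
  shows "\<bar>integrand t x z y\<bar> \<le> C ^ 3 * (t powr (\<alpha> + \<beta>) * (1 + t)) * (x powr \<alpha> * (1 + x)) * (z powr \<alpha> * (1 + z))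
    * ((1 + y) ^ 3 * y powr (2 * \<alpha> + 1))"
proof -
  have "\<bar>integrand t x z y\<bar> = \<bar>bessel_J (\<alpha> + \<beta>) (t * y)\<bar> * \<bar>bessel_J \<alpha> (x * y)\<bar> * \<bar>bessel_J \<alpha> (z * y)\<bar> * y powr (1 - \<alpha> - \<beta>)"
    by (simp add: integrand_def abs_mult)
  also have "\<dots> \<le> (C * t powr (\<alpha> + \<beta>) * (1 + t) * (y powr (\<alpha> + \<beta>) * (1 + y)))
    * (C * x powr \<alpha> * (1 + x) * (y powr \<alpha> * (1 + y))) * (C * z powr \<alpha> * (1 + z) * (y powr \<alpha> * (1 + y))) * y powr (1 - \<alpha> - \<beta>)"
    using assms C by (intro mult_mono bessel_le_dilate) auto
  also have "\<dots> = C ^ 3 * (t powr (\<alpha> + \<beta>) * (1 + t)) * (x powr \<alpha> * (1 + x)) * (z powr \<alpha> * (1 + z))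
    * ((1 + y) ^ 3 * (y powr (\<alpha> + \<beta>) * y powr \<alpha> * y powr \<alpha> * y powr (1 - \<alpha> - \<beta>)))"
    by (simp add: power3_eq_cube mult_ac)
  also have "y powr (\<alpha> + \<beta>) * y powr \<alpha> * y powr \<alpha> * y powr (1 - \<alpha> - \<beta>) = y powr (2 * \<alpha> + 1)"
    unfolding powr_add[symmetric] by (simp add: algebra_simps)
  finally show ?thesis .
qed

lemma integrand_set_integrable:
  assumes "0 < t" "0 < x" "0 < z"
  shows "set_integrable lborel {0<..R} (integrand t x z)"
proof -
  define K where "K = C ^ 3 * (t powr (\<alpha> + \<beta>) * (1 + t)) * (x powr \<alpha> * (1 + x)) * (z powr \<alpha> * (1 + z))"
  have K: "K \<ge> 0" unfolding K_def using assms C by (intro mult_nonneg_nonneg) auto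
  show ?thesis
  proof (rule set_integrable_lborel_bound)
    show "set_integrable lborel {0<..R} (\<lambda>y. K * (1 + R) ^ 3 * y powr (2 * \<alpha> + 1))"
      using \<alpha> by (intro set_integrable_mult_right set_integrable_powr_near_0) simp
    fix y assume y: "y \<in> {0<..R}"
    have "\<bar>integrand t x z y\<bar> \<le> K * ((1 + y) ^ 3 * y powr (2 * \<alpha> + 1))"
      unfolding K_def using integrand_le[of t x z y] assms y by simp
    also have "\<dots> \<le> K * ((1 + R) ^ 3 * y powr (2 * \<alpha> + 1))"
      using y K by (intro mult_left_mono mult_right_mono power_mono) auto
    finally show "\<bar>integrand t x z y\<bar> \<le> K * (1 + R) ^ 3 * y powr (2 * \<alpha> + 1)" by (simp add: mult_ac)
  qed auto
qed

lemma near_bound: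
  assumes "0 < t" "0 < x" "0 < z"
  shows "\<bar>LINT y:{0<..1}|lborel. integrand t x z y\<bar> \<le> 8 * C ^ 3 / (2 * \<alpha> + 2) * (Q x * Q z * (t powr (\<alpha> + \<beta>) * (1 + t)))"
proof -
  define K where "K = C ^ 3 * (t powr (\<alpha> + \<beta>) * (1 + t)) * (x powr \<alpha> * (1 + x)) * (z powr \<alpha> * (1 + z))"
  have K: "K \<ge> 0" unfolding K_def using assms C by (intro mult_nonneg_nonneg) auto
  have "\<bar>LINT y:{0<..1}|lborel. integrand t x z y\<bar> \<le> (LINT y:{0<..1}|lborel. K * 8 * y powr (2 * \<alpha> + 1))"
  proof (rule set_integral_abs_le)
    show "set_integrable lborel {0<..1} (\<lambda>y. K * 8 * y powr (2 * \<alpha> + 1))"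
      using \<alpha> by (intro set_integrable_mult_right set_integrable_powr_near_0) simp
    show "set_integrable lborel {0<..1} (integrand t x z)" by (rule integrand_set_integrable[OF assms])
    fix y :: real assume y: "y \<in> {0<..1}"
    have "\<bar>integrand t x z y\<bar> \<le> K * ((1 + y) ^ 3 * y powr (2 * \<alpha> + 1))"
      unfolding K_def using integrand_le[of t x z y] assms y by simp
    also have "\<dots> \<le> K * (2 ^ 3 * y powr (2 * \<alpha> + 1))"
      using y K by (intro mult_left_mono mult_right_mono power_mono) auto
    finally show "\<bar>integrand t x z y\<bar> \<le> K * 8 * y powr (2 * \<alpha> + 1)" by (simp add: mult_ac)
  qed
  also have "\<dots> = K * 8 / (2 * \<alpha> + 2)"
    using set_integral_powr_near_0[of "2 * \<alpha> + 1" 1] \<alpha> by (simp add: add_ac)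
  also have "\<dots> \<le> (C ^ 3 * (t powr (\<alpha> + \<beta>) * (1 + t)) * Q x * Q z) * 8 / (2 * \<alpha> + 2)"
    unfolding K_def using assms \<alpha> C Q_ge[of x] Q_ge[of z] by (intro divide_right_mono mult_right_mono mult_mono) auto
  finally show ?thesis by (simp add: mult_ac)
qed

text \<open>These are the hypotheses of \<open>abs_prod3_diff_le\<close> for one dilated factor,
  with amplitude scale \<open>y powr (-1/2)\<close> and error scale \<open>y powr (-3/2)\<close>.
  The constant \<open>A + B + C\<close> serves both Bessel functions.\<close>

lemma far_factor:
  fixes J :: "real \<Rightarrow> real"
  assumes "\<And>w. w > 0 \<Longrightarrow> \<bar>J w - a * w powr (-1/2) * cos (w - \<eta>)\<bar> \<le> C * w powr (-3/2)"
    and "0 < a" "a \<le> A + B" "0 < w" "1 \<le> y"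
  shows "\<bar>J (w * y)\<bar> \<le> ((A + B + C) * Q w) * y powr (-1/2)"
    "\<bar>a * (w * y) powr (-1/2) * cos (w * y - \<eta>)\<bar> \<le> ((A + B + C) * Q w) * y powr (-1/2)"
    "\<bar>J (w * y) - a * (w * y) powr (-1/2) * cos (w * y - \<eta>)\<bar> \<le> ((A + B + C) * Q w) * y powr (-3/2)"
proof -
  have Qw: "Q w > 0" using Q_ge(4)[OF assms(4)] by simp
  have p: "(w * y) powr r = w powr r * y powr r" for r using assms by (simp add: powr_mult)
  have "\<bar>J (w * y) - a * (w * y) powr (-1/2) * cos (w * y - \<eta>)\<bar> \<le> C * (w * y) powr (-3/2)"
    using assms by (intro assms(1)) auto
  also have "\<dots> = C * w powr (-3/2) * y powr (-3/2)" by (simp add: p)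
  also have "\<dots> \<le> C * Q w * y powr (-3/2)"
    using C Q_ge(1)[OF assms(4)] by (intro mult_right_mono mult_left_mono) auto
  finally have 3: "\<bar>J (w * y) - a * (w * y) powr (-1/2) * cos (w * y - \<eta>)\<bar> \<le> C * Q w * y powr (-3/2)" .
  also have "\<dots> \<le> ((A + B + C) * Q w) * y powr (-3/2)"
    using C A B Qw by (intro mult_right_mono) auto
  finally show "\<bar>J (w * y) - a * (w * y) powr (-1/2) * cos (w * y - \<eta>)\<bar> \<le> ((A + B + C) * Q w) * y powr (-3/2)" .
  have "\<bar>a * (w * y) powr (-1/2) * cos (w * y - \<eta>)\<bar> \<le> a * (w * y) powr (-1/2)"
    using mult_left_mono[of "\<bar>cos (w * y - \<eta>)\<bar>" 1 "a * (w * y) powr (-1/2)"] assms by (simp add: abs_mult)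
  also have "\<dots> = a * w powr (-1/2) * y powr (-1/2)" by (simp add: p)
  also have "\<dots> \<le> (A + B) * Q w * y powr (-1/2)"
    using A B Q_ge(2)[OF assms(4)] assms by (intro mult_right_mono mult_mono) auto
  finally have 2: "\<bar>a * (w * y) powr (-1/2) * cos (w * y - \<eta>)\<bar> \<le> (A + B) * Q w * y powr (-1/2)" .
  also have "\<dots> \<le> ((A + B + C) * Q w) * y powr (-1/2)"
    using C Qw by (intro mult_right_mono) auto
  finally show "\<bar>a * (w * y) powr (-1/2) * cos (w * y - \<eta>)\<bar> \<le> ((A + B + C) * Q w) * y powr (-1/2)" .
  have "C * Q w * y powr (-3/2) \<le> C * Q w * y powr (-1/2)"
    using C Qw assms by (intro mult_left_mono powr_mono) auto
  then have "\<bar>J (w * y)\<bar> \<le> C * Q w * y powr (-1/2) + (A + B) * Q w * y powr (-1/2)"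
    using 2 3 by linarith
  then show "\<bar>J (w * y)\<bar> \<le> ((A + B + C) * Q w) * y powr (-1/2)" by (simp add: algebra_simps)
qed

text \<open>Replacing the three factors one by one by their leading waves gains one power of
  \<open>y\<close> over the main part. As \<open>\<alpha> + \<beta> > -1/2\<close>, the error is
  absolutely integrable at infinity, and all conditional convergence is confined to the main
  part.\<close>

lemma error_bound:
  assumes "0 < t" "0 < x" "0 < z" "1 \<le> y"
  shows "\<bar>integrand t x z y - main_part t x z y\<bar> \<le> 3 * (A + B + C) ^ 3 * (Q t * Q x * Q z) * y powr (- (\<alpha> + \<beta>) - 3/2)"
proof -
  let ?D = "A + B + C"
  note ft = far_factor[OF J\<nu>_wave A _ assms(1,4)] and fx = far_factor[OF J\<alpha>_wave B _ assms(2,4)] and fz = far_factor[OF J\<alpha>_wave B _ assms(3,4)]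
  have "\<bar>integrand t x z y - main_part t x z y\<bar> =
    \<bar>bessel_J (\<alpha> + \<beta>) (t * y) * bessel_J \<alpha> (x * y) * bessel_J \<alpha> (z * y)
     - (A * (t * y) powr (-1/2) * cos (t * y - \<phi>)) * (B * (x * y) powr (-1/2) * cos (x * y - \<psi>))
     * (B * (z * y) powr (-1/2) * cos (z * y - \<psi>))\<bar> * y powr (1 - \<alpha> - \<beta>)"
    unfolding integrand_def main_part_def left_diff_distrib[symmetric] by (simp add: abs_mult)
  also have "\<dots> \<le> 3 * ((?D * Q t) * (?D * Q x) * (?D * Q z)) * (y powr (-1/2) * y powr (-1/2) * y powr (-3/2)) * y powr (1 - \<alpha> - \<beta>)"
    using A B by (intro mult_right_mono abs_prod3_diff_le ft fx fz) auto
  also have "\<dots> = 3 * ?D ^ 3 * (Q t * Q x * Q z) * (y powr (-1/2) * y powr (-1/2) * y powr (-3/2) * y powr (1 - \<alpha> - \<beta>))"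
    by (simp add: power3_eq_cube mult_ac)
  also have "y powr (-1/2) * y powr (-1/2) * y powr (-3/2) * y powr (1 - \<alpha> - \<beta>) = y powr (- (\<alpha> + \<beta>) - 3/2)"
    unfolding powr_add[symmetric] by (simp add: algebra_simps)
  finally show ?thesis .
qed

lemma error_set_integrable:
  assumes "0 < t" "0 < x" "0 < z"
  shows "set_integrable lborel {1..} (\<lambda>y. integrand t x z y - main_part t x z y)"
proof (rule set_integrable_lborel_bound)
  show "set_integrable lborel {1..} (\<lambda>y. 3 * (A + B + C) ^ 3 * (Q t * Q x * Q z) * y powr (- (\<alpha> + \<beta>) - 3/2))"
    using \<nu> by (intro set_integrable_mult_right set_integrable_powr_at_top) argo
qed (use error_bound assms in auto)

lemma error_integral_le:
  assumes "0 < t" "0 < x" "0 < z"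
  shows "\<bar>LINT y:{1..R}|lborel. integrand t x z y - main_part t x z y\<bar>
    \<le> 3 * (A + B + C) ^ 3 * (Q t * Q x * Q z) * (LINT y:{1..}|lborel. y powr (- (\<alpha> + \<beta>) - 3/2))"
proof -
  have int: "set_integrable lborel {1..} (\<lambda>y. y powr (- (\<alpha> + \<beta>) - 3/2))"
    using \<nu> by (intro set_integrable_powr_at_top) argo
  have nn: "0 \<le> 3 * (A + B + C) ^ 3 * (Q t * Q x * Q z)"
    using A B C Q_ge(4)[of t] Q_ge(4)[of x] Q_ge(4)[of z] assms by simp
  have "\<bar>LINT y:{1..R}|lborel. integrand t x z y - main_part t x z y\<bar>
    \<le> (LINT y:{1..R}|lborel. 3 * (A + B + C) ^ 3 * (Q t * Q x * Q z) * y powr (- (\<alpha> + \<beta>) - 3/2))"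
    using assms error_bound
    by (intro set_integral_abs_le set_integrable_mult_right set_integrable_subset[OF int]
        set_integrable_subset[OF error_set_integrable]) auto
  also have "\<dots> = 3 * (A + B + C) ^ 3 * (Q t * Q x * Q z) * (LINT y:{1..R}|lborel. y powr (- (\<alpha> + \<beta>) - 3/2))" by simp
  also have "(LINT y:{1..R}|lborel. y powr (- (\<alpha> + \<beta>) - 3/2)) \<le> (LINT y:{1..}|lborel. y powr (- (\<alpha> + \<beta>) - 3/2))"
    unfolding set_lebesgue_integral_def
    using int set_integrable_subset[OF int, of "{1..R}"]
    by (intro integral_mono) (auto simp: set_integrable_def indicator_def)
  finally show ?thesis using nn by (simp add: mult_left_mono)
qed

end

lemma abs_add_le: "\<bar>a\<bar> \<le> p \<Longrightarrow> \<bar>b\<bar> \<le> q \<Longrightarrow> \<bar>a + b\<bar> \<le> p + q" for a b p q :: real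
  by linarith

context spherical_kernel
begin

text \<open>In the two terms where \<open>x\<close> and \<open>z\<close> carry opposite signs the
  phase \<psi> cancels. The singularity at \<open>z = x - t\<close> therefore depends on \<phi>
  alone, which is what \<open>ker_singularity\<close> exploits.\<close>

lemma main_part_eq:
  assumes "0 < t" "0 < x" "0 < z" "0 < y"
  shows "main_part t x z y = A * B * B * (t * x * z) powr (-1/2) / 4 *
    (cos ((t + x + z) * y - (\<phi> + 2 * \<psi>)) * y powr - (\<alpha> + \<beta> + 1/2)
     + cos ((t + x - z) * y - \<phi>) * y powr - (\<alpha> + \<beta> + 1/2)
     + cos ((t - x + z) * y - \<phi>) * y powr - (\<alpha> + \<beta> + 1/2)
     + cos ((t - x - z) * y - (\<phi> - 2 * \<psi>)) * y powr - (\<alpha> + \<beta> + 1/2))"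
proof -
  let ?c = "cos (t * y - \<phi>) * cos (x * y - \<psi>) * cos (z * y - \<psi>)"
  have "y powr (-1/2) * y powr (-1/2) * y powr (-1/2) * y powr (1 - \<alpha> - \<beta>) = y powr - (\<alpha> + \<beta> + 1/2)"
    unfolding powr_add[symmetric] by (simp add: algebra_simps)
  then have "main_part t x z y = A * B * B * (t * x * z) powr (-1/2) * ?c * y powr - (\<alpha> + \<beta> + 1/2)"
    unfolding main_part_def using assms by (simp add: powr_mult mult_ac)
  moreover have "?c = (cos ((t + x + z) * y - (\<phi> + 2 * \<psi>)) + cos ((t + x - z) * y - \<phi>)
      + cos ((t - x + z) * y - \<phi>) + cos ((t - x - z) * y - (\<phi> - 2 * \<psi>))) / 4"
    unfolding cos_triple_product by (simp add: algebra_simps)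
  ultimately have "main_part t x z y = A * B * B * (t * x * z) powr (-1/2) * ((cos ((t + x + z) * y - (\<phi> + 2 * \<psi>)) + cos ((t + x - z) * y - \<phi>)
      + cos ((t - x + z) * y - \<phi>) + cos ((t - x - z) * y - (\<phi> - 2 * \<psi>))) / 4) * y powr - (\<alpha> + \<beta> + 1/2)"
    by (simp only:)
  then show ?thesis by (simp only: distrib_right times_divide_eq_left times_divide_eq_right mult.assoc)
qed

lemma osc_set_integrable:
  "set_integrable lborel {1..R} (\<lambda>y. cos (\<theta> * y - \<eta>) * y powr - (\<alpha> + \<beta> + 1/2))"
  by (rule cos_powr_set_integrable) simp

lemma main_part_integral:
  assumes "0 < t" "0 < x" "0 < z"
  shows "set_integrable lborel {1..R} (main_part t x z)"
    "(LINT y:{1..R}|lborel. main_part t x z y) = A * B * B * (t * x * z) powr (-1/2) / 4 *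
      (osc (t + x + z) (\<phi> + 2 * \<psi>) R + osc (t + x - z) \<phi> R + osc (t - x + z) \<phi> R + osc (t - x - z) (\<phi> - 2 * \<psi>) R)"
proof -
  let ?f = "\<lambda>\<theta> \<eta> y. cos (\<theta> * y - \<eta>) * y powr - (\<alpha> + \<beta> + 1/2)"
  let ?c = "A * B * B * (t * x * z) powr (-1/2) / 4"
  let ?g = "\<lambda>y. ?f (t + x + z) (\<phi> + 2 * \<psi>) y + ?f (t + x - z) \<phi> y + ?f (t - x + z) \<phi> y + ?f (t - x - z) (\<phi> - 2 * \<psi>) y"
  have int: "set_integrable lborel {1..R} ?g"
    by (intro set_integral_add osc_set_integrable)
  have "set_integrable lborel {1..R} (main_part t x z) \<longleftrightarrow> set_integrable lborel {1..R} (\<lambda>y. ?c * ?g y)"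
    by (rule set_integrable_cong) (auto simp: main_part_eq assms)
  with int show "set_integrable lborel {1..R} (main_part t x z)" by simp
  have "(LINT y:{1..R}|lborel. main_part t x z y) = (LINT y:{1..R}|lborel. ?c * ?g y)"
    by (rule set_lebesgue_integral_cong) (auto simp: main_part_eq assms)
  also have "\<dots> = ?c * (LINT y:{1..R}|lborel. ?g y)" by (rule set_integral_mult_right)
  also have "(LINT y:{1..R}|lborel. ?g y) = osc (t + x + z) (\<phi> + 2 * \<psi>) R + osc (t + x - z) \<phi> R + osc (t - x + z) \<phi> R + osc (t - x - z) (\<phi> - 2 * \<psi>) R"
    unfolding osc_def
    by (subst set_integral_add; (intro set_integral_add osc_set_integrable)?)+ (rule refl)
  finally show "(LINT y:{1..R}|lborel. main_part t x z y) = ?c *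
      (osc (t + x + z) (\<phi> + 2 * \<psi>) R + osc (t + x - z) \<phi> R + osc (t - x + z) \<phi> R + osc (t - x - z) (\<phi> - 2 * \<psi>) R)" .
qed

lemma trunc_decomp:
  assumes "0 < t" "0 < x" "0 < z" "1 \<le> R"
  shows "trunc t x z R = (LINT y:{0<..1}|lborel. integrand t x z y)
    + A * B * B * (t * x * z) powr (-1/2) / 4 *
      (osc (t + x + z) (\<phi> + 2 * \<psi>) R + osc (t + x - z) \<phi> R + osc (t - x + z) \<phi> R + osc (t - x - z) (\<phi> - 2 * \<psi>) R)
    + (LINT y:{1..R}|lborel. integrand t x z y - main_part t x z y)"
proof -
  note int = integrand_set_integrable[OF assms(1-3), of R]
  have sub: "set_integrable lborel E (integrand t x z)" if "E \<subseteq> {0<..R}" "E \<in> sets borel" for E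
    using set_integrable_subset[OF int, of E] that by simp
  have "trunc t x z R = (LINT y:{0<..1} \<union> {1<..R}|lborel. integrand t x z y)"
    unfolding trunc_def using assms by (intro arg_cong2[where f="set_lebesgue_integral lborel"]) auto
  also have "\<dots> = (LINT y:{0<..1}|lborel. integrand t x z y) + (LINT y:{1<..R}|lborel. integrand t x z y)"
    using assms by (intro set_integral_Un sub) auto
  also have "(LINT y:{1<..R}|lborel. integrand t x z y) = (LINT y:{1..R}|lborel. integrand t x z y)"
    by (rule set_integral_discrete_difference[of "{1}"]) auto
  also have "\<dots> = (LINT y:{1..R}|lborel. main_part t x z y) + (LINT y:{1..R}|lborel. integrand t x z y - main_part t x z y)"
  proof -
    have "set_integrable lborel {1..R} (integrand t x z)" by (rule sub) auto
    from set_integral_diff(2)[OF this main_part_integral(1)[OF assms(1-3), of R]] show ?thesis by simp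
  qed
  also have "(LINT y:{1..R}|lborel. main_part t x z y) = A * B * B * (t * x * z) powr (-1/2) / 4 *
      (osc (t + x + z) (\<phi> + 2 * \<psi>) R + osc (t + x - z) \<phi> R + osc (t - x + z) \<phi> R + osc (t - x - z) (\<phi> - 2 * \<psi>) R)"
    by (rule main_part_integral(2)[OF assms(1-3)])
  finally show ?thesis by simp
qed

lemma osc_convergent:
  assumes "\<theta> \<noteq> 0"
  obtains l where "(osc \<theta> \<eta> \<longlongrightarrow> l) at_top"
  unfolding osc_def[abs_def] using \<nu> cos_powr_integral_convergent[of "\<alpha> + \<beta> + 1/2" \<theta> \<eta>] assms by auto

lemma osc_bound:
  assumes "\<theta> \<noteq> 0" "1 \<le> R"
  shows "\<bar>osc \<theta> \<eta> R\<bar> \<le> (2 + 1 / \<gamma>) * (1 + \<bar>\<theta>\<bar> powr - \<gamma>)"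
  unfolding osc_def using \<nu> \<gamma> assms by (intro cos_powr_integral_uniform_bound) auto

lemma osc_limit_bound:
  assumes "\<theta> \<noteq> 0" "(osc \<theta> \<eta> \<longlongrightarrow> l) at_top"
  shows "\<bar>l\<bar> \<le> (2 + 1 / \<gamma>) * (1 + \<bar>\<theta>\<bar> powr - \<gamma>)"
proof (rule tendsto_upperbound[OF tendsto_rabs[OF assms(2)]])
  show "\<forall>\<^sub>F R in at_top. \<bar>osc \<theta> \<eta> R\<bar> \<le> (2 + 1 / \<gamma>) * (1 + \<bar>\<theta>\<bar> powr - \<gamma>)"
    using eventually_ge_at_top[of 1] by eventually_elim (rule osc_bound[OF assms(1)])
qed simp

definition tail :: real where
  "tail = (LINT y:{1..}|lborel. y powr (- (\<alpha> + \<beta>) - 3/2))"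

definition regular_bound :: "real \<Rightarrow> real" where
  "regular_bound t = 8 * C ^ 3 / (2 * \<alpha> + 2) * (t powr (\<alpha> + \<beta>) * (1 + t)) + 3 * (A + B + C) ^ 3 * Q t * tail"

lemma tail_nonneg: "tail \<ge> 0"
  unfolding tail_def set_lebesgue_integral_def by (intro Bochner_Integration.integral_nonneg) auto

lemma Q_pos: "w > 0 \<Longrightarrow> Q w > 0"
  using Q_ge(4)[of w] by simp

lemma regular_bound_nonneg: "t > 0 \<Longrightarrow> regular_bound t \<ge> 0"
proof -
  assume t: "t > 0"
  have "0 < 2 * \<alpha> + 2" using \<alpha> by simp
  then have "0 \<le> 8 * C ^ 3 / (2 * \<alpha> + 2)" using C by simp
  then show ?thesis
    unfolding regular_bound_def using A B C tail_nonneg Q_pos[OF t] t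
    by (intro add_nonneg_nonneg mult_nonneg_nonneg) auto
qed

lemma regular_part_le:
  assumes "0 < t" "0 < x" "0 < z"
  shows "\<bar>LINT y:{0<..1}|lborel. integrand t x z y\<bar> + \<bar>LINT y:{1..R}|lborel. integrand t x z y - main_part t x z y\<bar>
    \<le> regular_bound t * (Q x * Q z)"
  using near_bound[OF assms] error_integral_le[OF assms, of R]
  unfolding regular_bound_def tail_def[symmetric] by (simp add: algebra_simps add_divide_distrib)

text \<open>Singles out the one oscillatory integral that is unbounded near
  \<open>z = x - t\<close>. The other three, the part over \<open>{0<..1}\<close> and the error
  integral are absorbed into an explicit bound, which stays finite there as long as the other three
  frequencies are bounded away from 0.\<close>

lemma trunc_limit:
  assumes pos: "0 < t" "0 < x" "0 < z" and z: "z \<noteq> t + x" "z \<noteq> x - t" "z \<noteq> t - x"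
  obtains L l where "(trunc t x z \<longlongrightarrow> L) at_top" "(osc (t - x + z) \<phi> \<longlongrightarrow> l) at_top"
    "\<bar>L - A * B * B * (t * x * z) powr (-1/2) / 4 * l\<bar> \<le> regular_bound t * (Q x * Q z) +
      A * B * B * (t * x * z) powr (-1/2) / 4 * ((2 + 1 / \<gamma>) *
        (3 + \<bar>t + x + z\<bar> powr - \<gamma> + \<bar>t + x - z\<bar> powr - \<gamma> + \<bar>t - x - z\<bar> powr - \<gamma>))"
proof -
  let ?c = "A * B * B * (t * x * z) powr (-1/2) / 4"
  have th: "t + x + z \<noteq> 0" "t + x - z \<noteq> 0" "t - x + z \<noteq> 0" "t - x - z \<noteq> 0" using assms by auto
  obtain l1 where l1: "(osc (t + x + z) (\<phi> + 2 * \<psi>) \<longlongrightarrow> l1) at_top" using osc_convergent[OF th(1)] by blast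
  obtain l2 where l2: "(osc (t + x - z) \<phi> \<longlongrightarrow> l2) at_top" using osc_convergent[OF th(2)] by blast
  obtain l3 where l3: "(osc (t - x + z) \<phi> \<longlongrightarrow> l3) at_top" using osc_convergent[OF th(3)] by blast
  obtain l4 where l4: "(osc (t - x - z) (\<phi> - 2 * \<psi>) \<longlongrightarrow> l4) at_top" using osc_convergent[OF th(4)] by blast
  let ?N = "LINT y:{0<..1}|lborel. integrand t x z y"
  let ?e = "\<lambda>R. LINT y:{1..R}|lborel. integrand t x z y - main_part t x z y"
  define E where "E = (LINT y:{1..}|lborel. integrand t x z y - main_part t x z y)"
  have E: "(?e \<longlongrightarrow> E) at_top"
    unfolding E_def by (rule tendsto_set_lebesgue_integral_at_top[OF _ error_set_integrable[OF pos]]) simp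
  define L where "L = ?N + ?c * (l1 + l2 + l3 + l4) + E"
  have "((\<lambda>R. ?N + ?c * (osc (t + x + z) (\<phi> + 2 * \<psi>) R + osc (t + x - z) \<phi> R + osc (t - x + z) \<phi> R + osc (t - x - z) (\<phi> - 2 * \<psi>) R) + ?e R)
      \<longlongrightarrow> L) at_top"
    unfolding L_def by (intro tendsto_intros l1 l2 l3 l4 E)
  moreover have "\<forall>\<^sub>F R in at_top. ?N + ?c * (osc (t + x + z) (\<phi> + 2 * \<psi>) R + osc (t + x - z) \<phi> R + osc (t - x + z) \<phi> R + osc (t - x - z) (\<phi> - 2 * \<psi>) R) + ?e R = trunc t x z R"
    using eventually_ge_at_top[of 1] by eventually_elim (simp add: trunc_decomp[OF pos])
  ultimately have L: "(trunc t x z \<longlongrightarrow> L) at_top" by (rule Lim_transform_eventually)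
  have NE: "\<bar>?N\<bar> + \<bar>E\<bar> \<le> regular_bound t * (Q x * Q z)"
  proof (rule tendsto_upperbound)
    show "((\<lambda>R. \<bar>?N\<bar> + \<bar>?e R\<bar>) \<longlongrightarrow> \<bar>?N\<bar> + \<bar>E\<bar>) at_top" by (intro tendsto_intros E)
  qed (use regular_part_le[OF pos] in auto)
  have c: "?c \<ge> 0" using A B by simp
  have "\<bar>l1 + l2 + l4\<bar> \<le> (2 + 1 / \<gamma>) * (3 + \<bar>t + x + z\<bar> powr - \<gamma> + \<bar>t + x - z\<bar> powr - \<gamma> + \<bar>t - x - z\<bar> powr - \<gamma>)"
  proof -
    have "(2 + 1 / \<gamma>) * (3 + \<bar>t + x + z\<bar> powr - \<gamma> + \<bar>t + x - z\<bar> powr - \<gamma> + \<bar>t - x - z\<bar> powr - \<gamma>)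
      = (2 + 1 / \<gamma>) * (1 + \<bar>t + x + z\<bar> powr - \<gamma>) + (2 + 1 / \<gamma>) * (1 + \<bar>t + x - z\<bar> powr - \<gamma>) + (2 + 1 / \<gamma>) * (1 + \<bar>t - x - z\<bar> powr - \<gamma>)"
      unfolding distrib_left[symmetric] by simp
    then show ?thesis
      by (simp only:) (intro abs_add_le osc_limit_bound[OF th(1) l1] osc_limit_bound[OF th(2) l2] osc_limit_bound[OF th(4) l4])
  qed
  then have "\<bar>?c * (l1 + l2 + l4)\<bar> \<le> ?c * ((2 + 1 / \<gamma>) * (3 + \<bar>t + x + z\<bar> powr - \<gamma> + \<bar>t + x - z\<bar> powr - \<gamma> + \<bar>t - x - z\<bar> powr - \<gamma>))"
    unfolding abs_mult[of ?c] abs_of_nonneg[OF c] by (rule mult_left_mono[OF _ c])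
  moreover have "L - ?c * l3 = (?N + E) + ?c * (l1 + l2 + l4)" unfolding L_def by argo
  moreover have "\<bar>?N + E\<bar> \<le> regular_bound t * (Q x * Q z)" using NE abs_triangle_ineq order_trans by blast
  ultimately have "\<bar>L - ?c * l3\<bar> \<le> regular_bound t * (Q x * Q z) +
      ?c * ((2 + 1 / \<gamma>) * (3 + \<bar>t + x + z\<bar> powr - \<gamma> + \<bar>t + x - z\<bar> powr - \<gamma> + \<bar>t - x - z\<bar> powr - \<gamma>))"
    by (simp only: abs_add_le)
  then show ?thesis by (rule that[OF L l3])
qed

text \<open>For fixed \<open>t\<close>, a majorant of the truncated kernel that is independent of
  the cutoff. The frequency \<open>t + x + z\<close> exceeds \<open>t\<close> and goes into the
  constant; the other three give \<open>sing\<close>, whose singularities are integrable because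
  \<open>\<gamma> < 1\<close>.\<close>

lemma trunc_bound:
  assumes t: "t > 0"
  obtains M where "M > 0" "\<And>x z R. 0 < x \<Longrightarrow> 0 < z \<Longrightarrow> 1 \<le> R \<Longrightarrow> z \<noteq> t + x \<Longrightarrow> z \<noteq> x - t \<Longrightarrow> z \<noteq> t - x \<Longrightarrow>
    \<bar>trunc t x z R\<bar> \<le> M * (Q x * Q z * sing t x z)"
proof -
  define k where "k = A * B * B * t powr (-1/2) / 4 * ((2 + 1 / \<gamma>) * (4 + t powr - \<gamma>))"
  have k: "k \<ge> 0" unfolding k_def using A B \<gamma> by (intro mult_nonneg_nonneg) auto
  define M where "M = regular_bound t + k + 1"
  show ?thesis
  proof (rule that)
    show "M > 0" unfolding M_def using k regular_bound_nonneg[OF t] by simp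
    fix x z R :: real
    assume *: "0 < x" "0 < z" "1 \<le> R" "z \<noteq> t + x" "z \<noteq> x - t" "z \<noteq> t - x"
    let ?O = "osc (t + x + z) (\<phi> + 2 * \<psi>) R + osc (t + x - z) \<phi> R + osc (t - x + z) \<phi> R + osc (t - x - z) (\<phi> - 2 * \<psi>) R"
    have th: "t + x + z \<noteq> 0" "t + x - z \<noteq> 0" "t - x + z \<noteq> 0" "t - x - z \<noteq> 0" using * t by auto
    have sing1: "sing t x z \<ge> 1" unfolding sing_def by simp
    have Q0: "Q x > 0" "Q z > 0" using * Q_pos by auto
    have "\<bar>t + x + z\<bar> powr - \<gamma> \<le> t powr - \<gamma>" using \<gamma> * t by (intro powr_mono2') auto
    moreover have "(3 + t powr - \<gamma>) * 1 \<le> (3 + t powr - \<gamma>) * sing t x z" using sing1 by (intro mult_left_mono) auto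
    ultimately have "4 + \<bar>t + x + z\<bar> powr - \<gamma> + \<bar>t + x - z\<bar> powr - \<gamma> + \<bar>t - x + z\<bar> powr - \<gamma> + \<bar>t - x - z\<bar> powr - \<gamma>
      \<le> (4 + t powr - \<gamma>) * sing t x z"
    proof -
      have eq: "\<bar>t + x - z\<bar> = \<bar>z - (t + x)\<bar>" "\<bar>t - x + z\<bar> = \<bar>z - (x - t)\<bar>" "\<bar>t - x - z\<bar> = \<bar>z - (t - x)\<bar>" by auto
      have "(4 + t powr - \<gamma>) * sing t x z = (3 + t powr - \<gamma>) * sing t x z + sing t x z" by (simp add: algebra_simps)
      moreover have "sing t x z = 1 + \<bar>t + x - z\<bar> powr - \<gamma> + \<bar>t - x + z\<bar> powr - \<gamma> + \<bar>t - x - z\<bar> powr - \<gamma>"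
        unfolding sing_def eq by simp
      moreover have "3 + \<bar>t + x + z\<bar> powr - \<gamma> \<le> (3 + t powr - \<gamma>) * sing t x z"
        using \<open>\<bar>t + x + z\<bar> powr - \<gamma> \<le> t powr - \<gamma>\<close> \<open>(3 + t powr - \<gamma>) * 1 \<le> _\<close> by simp
      ultimately show ?thesis by simp
    qed
    then have "(2 + 1 / \<gamma>) * (4 + \<bar>t + x + z\<bar> powr - \<gamma> + \<bar>t + x - z\<bar> powr - \<gamma> + \<bar>t - x + z\<bar> powr - \<gamma> + \<bar>t - x - z\<bar> powr - \<gamma>)
      \<le> (2 + 1 / \<gamma>) * ((4 + t powr - \<gamma>) * sing t x z)" using \<gamma> by (intro mult_left_mono) auto
    moreover have "\<bar>?O\<bar> \<le> (2 + 1 / \<gamma>) * (4 + \<bar>t + x + z\<bar> powr - \<gamma> + \<bar>t + x - z\<bar> powr - \<gamma> + \<bar>t - x + z\<bar> powr - \<gamma> + \<bar>t - x - z\<bar> powr - \<gamma>)"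
    proof -
      have "(2 + 1 / \<gamma>) * (4 + \<bar>t + x + z\<bar> powr - \<gamma> + \<bar>t + x - z\<bar> powr - \<gamma> + \<bar>t - x + z\<bar> powr - \<gamma> + \<bar>t - x - z\<bar> powr - \<gamma>)
        = (2 + 1 / \<gamma>) * (1 + \<bar>t + x + z\<bar> powr - \<gamma>) + (2 + 1 / \<gamma>) * (1 + \<bar>t + x - z\<bar> powr - \<gamma>)
        + (2 + 1 / \<gamma>) * (1 + \<bar>t - x + z\<bar> powr - \<gamma>) + (2 + 1 / \<gamma>) * (1 + \<bar>t - x - z\<bar> powr - \<gamma>)"
        unfolding distrib_left[symmetric] by simp
      then show ?thesis
        by (simp only:) (intro abs_add_le osc_bound th *(3))
    qed
    ultimately have O: "\<bar>?O\<bar> \<le> (2 + 1 / \<gamma>) * (4 + t powr - \<gamma>) * sing t x z" by (simp add: mult_ac)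
    have "(t * x * z) powr (-1/2) \<le> t powr (-1/2) * (Q x * Q z)"
      using t * Q_ge(2)[OF *(1)] Q_ge(2)[OF *(2)] Q0 by (auto simp: powr_mult mult.assoc intro!: mult_left_mono mult_mono)
    then have "A * B * B * (t * x * z) powr (-1/2) / 4 \<le> A * B * B * (t powr (-1/2) * (Q x * Q z)) / 4"
      using A B by (intro divide_right_mono mult_left_mono) auto
    then have "\<bar>A * B * B * (t * x * z) powr (-1/2) / 4 * ?O\<bar>
      \<le> (A * B * B * (t powr (-1/2) * (Q x * Q z)) / 4) * ((2 + 1 / \<gamma>) * (4 + t powr - \<gamma>) * sing t x z)"
      unfolding abs_mult[of "A * B * B * (t * x * z) powr (-1/2) / 4"]
      using O A B Q0 by (intro mult_mono) auto
    also have "\<dots> = k * (Q x * Q z * sing t x z)" by (simp add: k_def mult_ac)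
    finally have "\<bar>A * B * B * (t * x * z) powr (-1/2) / 4 * ?O\<bar> \<le> k * (Q x * Q z * sing t x z)" .
    moreover have "regular_bound t * (Q x * Q z) * 1 \<le> regular_bound t * (Q x * Q z) * sing t x z"
      using sing1 Q0 regular_bound_nonneg[OF t] by (intro mult_left_mono) auto
    moreover have "M * (Q x * Q z * sing t x z) = regular_bound t * (Q x * Q z) * sing t x z + k * (Q x * Q z * sing t x z) + Q x * Q z * sing t x z"
      unfolding M_def by (simp add: algebra_simps)
    moreover have "0 \<le> Q x * Q z * sing t x z" using Q0 sing1 by simp
    moreover have "\<bar>trunc t x z R\<bar> \<le> (\<bar>LINT y:{0<..1}|lborel. integrand t x z y\<bar> + \<bar>A * B * B * (t * x * z) powr (-1/2) / 4 * ?O\<bar>)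
        + \<bar>LINT y:{1..R}|lborel. integrand t x z y - main_part t x z y\<bar>"
      unfolding trunc_decomp[OF t *(1-3)] by (intro abs_add_le order_refl)
    ultimately show "\<bar>trunc t x z R\<bar> \<le> M * (Q x * Q z * sing t x z)"
      using regular_part_le[OF t *(1,2), of R] by simp
  qed
qed

text \<open>Unlike \<open>Lim at_top\<close>, the limit along the integers is visibly jointly measurable in \<open>x\<close> and \<open>z\<close>.\<close>

definition ker :: "real \<Rightarrow> real \<Rightarrow> real \<Rightarrow> real" where
  "ker t x z = 2 powr (\<alpha> + \<beta>) * Gamma (\<alpha> + \<beta> + 1) / (t powr (\<alpha> + \<beta>) * (x * z) powr \<alpha>) * lim (\<lambda>n. trunc t x z (real n))"

lemma ker_commute: "ker t x z = ker t z x"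
  by (simp add: ker_def trunc_commute[of t x z] mult.commute)

lemma trunc_tendsto:
  assumes pos: "0 < t" "0 < x" "0 < z" and z: "z \<noteq> t + x" "z \<noteq> x - t" "z \<noteq> t - x"
  shows "(trunc t x z \<longlongrightarrow> lim (\<lambda>n. trunc t x z (real n))) at_top"
    "(\<lambda>n. trunc t x z (real n)) \<longlonglongrightarrow> lim (\<lambda>n. trunc t x z (real n))"
    "sph_kernel \<alpha> \<beta> t x z = ker t x z"
proof -
  obtain L where L: "(trunc t x z \<longlongrightarrow> L) at_top" using trunc_limit[OF assms] by blast
  then have "(\<lambda>n. trunc t x z (real n)) \<longlonglongrightarrow> L" by (rule filterlim_compose[OF _ filterlim_real_sequentially])
  moreover from this have eq: "lim (\<lambda>n. trunc t x z (real n)) = L" by (rule limI)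
  ultimately show "(trunc t x z \<longlongrightarrow> lim (\<lambda>n. trunc t x z (real n))) at_top"
    "(\<lambda>n. trunc t x z (real n)) \<longlonglongrightarrow> lim (\<lambda>n. trunc t x z (real n))" using L by simp_all
  have "Lim at_top (trunc t x z) = L" using L by (intro tendsto_Lim) auto
  then show "sph_kernel \<alpha> \<beta> t x z = ker t x z"
    unfolding ker_def eq by (simp add: sph_kernel_def trunc_def[abs_def] integrand_def[abs_def])
qed

lemma ker_bound:
  assumes t: "t > 0"
  obtains M where "M > 0" "\<And>x z. 0 < x \<Longrightarrow> 0 < z \<Longrightarrow> z \<noteq> t + x \<Longrightarrow> z \<noteq> x - t \<Longrightarrow> z \<noteq> t - x \<Longrightarrow>
    \<bar>ker t x z\<bar> \<le> M * (x powr - \<alpha> * Q x * (z powr - \<alpha> * Q z) * sing t x z)"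
proof -
  obtain M where M: "M > 0" and le: "\<And>x z R. 0 < x \<Longrightarrow> 0 < z \<Longrightarrow> 1 \<le> R \<Longrightarrow> z \<noteq> t + x \<Longrightarrow> z \<noteq> x - t \<Longrightarrow> z \<noteq> t - x \<Longrightarrow>
    \<bar>trunc t x z R\<bar> \<le> M * (Q x * Q z * sing t x z)" using trunc_bound[OF t] by blast
  define c where "c = 2 powr (\<alpha> + \<beta>) * Gamma (\<alpha> + \<beta> + 1) / t powr (\<alpha> + \<beta>)"
  have c: "c > 0" unfolding c_def using t \<nu> by (intro divide_pos_pos mult_pos_pos Gamma_real_pos) auto
  show ?thesis
  proof (rule that)
    show "c * M > 0" using c M by simp
    fix x z :: real
    assume *: "0 < x" "0 < z" "z \<noteq> t + x" "z \<noteq> x - t" "z \<noteq> t - x"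
    have "\<bar>lim (\<lambda>n. trunc t x z (real n))\<bar> \<le> M * (Q x * Q z * sing t x z)"
    proof (rule tendsto_upperbound[OF tendsto_rabs[OF trunc_tendsto(1)[OF t *]]])
      show "\<forall>\<^sub>F R in at_top. \<bar>trunc t x z R\<bar> \<le> M * (Q x * Q z * sing t x z)"
        using eventually_ge_at_top[of 1] by eventually_elim (rule le[OF *(1,2) _ *(3-5)])
    qed simp
    moreover have "\<bar>ker t x z\<bar> = c * (x powr - \<alpha> * z powr - \<alpha>) * \<bar>lim (\<lambda>n. trunc t x z (real n))\<bar>"
      unfolding ker_def c_def using * t \<nu> Gamma_real_pos[of "\<alpha> + \<beta> + 1"] by (simp add: abs_mult powr_mult powr_minus field_simps)
    ultimately have "\<bar>ker t x z\<bar> \<le> c * (x powr - \<alpha> * z powr - \<alpha>) * (M * (Q x * Q z * sing t x z))"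
      using c by (simp add: mult_left_mono)
    then show "\<bar>ker t x z\<bar> \<le> c * M * (x powr - \<alpha> * Q x * (z powr - \<alpha> * Q z) * sing t x z)" by (simp add: mult_ac)
  qed
qed

lemma trunc_measurable [measurable]:
  "(\<lambda>(x, z). trunc t x z R) \<in> borel_measurable (borel \<Otimes>\<^sub>M borel)"
  unfolding trunc_def integrand_def set_lebesgue_integral_def split_beta' by measurable

lemma ker_measurable [measurable]:
  "(\<lambda>(x, z). ker t x z) \<in> borel_measurable (borel \<Otimes>\<^sub>M borel)"
  unfolding ker_def split_beta' by measurable

end

subsection \<open>Test functions with explicit Hankel transforms\<close>

text \<open>The substitution \<open>g y = c * y\<^sup>2\<close> carries Euler's Gamma integral to
  the half line. Such moments supply integrability of nearly all later majorants.\<close>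

lemma gaussian_moment:
  fixes r c :: real
  assumes r: "r > -1" and c: "c > 0"
  shows "set_integrable lborel {0<..} (\<lambda>y. y powr r * exp (- c * y\<^sup>2))"
    "(LINT y:{0<..}|lborel. y powr r * exp (- c * y\<^sup>2)) = Gamma ((r + 1) / 2) / (2 * c powr ((r + 1) / 2))"
proof -
  define a where "a = (r + 1) / 2"
  have a: "a > 0" using r by (simp add: a_def)
  define f where "f t = t powr (a - 1) / exp t" for t :: real
  define g where "g y = c * y\<^sup>2" for y :: real
  have f: "(f has_integral Gamma a) {0<..}"
  proof -
    have "(f has_integral Gamma a) {0..}" unfolding f_def by (rule Gamma_integral_real[OF a])
    then show ?thesis
      by (subst has_integral_spike_set_eq[of _ "{0..}"]) (auto intro: negligible_subset[of "{0}"])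
  qed
  have "f absolutely_integrable_on {0<..}"
    using f by (intro nonnegative_absolutely_integrable_1) (auto simp: f_def)
  moreover have "g ` {0<..} = {0<..}"
  proof (intro equalityI subsetI)
    fix t :: real assume "t \<in> {0<..}"
    then have "t = g (sqrt (t / c))" "sqrt (t / c) \<in> {0<..}" using c by (auto simp: g_def)
    then show "t \<in> g ` {0<..}" by blast
  qed (use c in \<open>auto simp: g_def\<close>)
  moreover have "(\<lambda>y. \<bar>2 * c * y\<bar> * f (g y)) absolutely_integrable_on {0<..} \<and> integral {0<..} (\<lambda>y. \<bar>2 * c * y\<bar> * f (g y)) = Gamma a
    \<longleftrightarrow> f absolutely_integrable_on (g ` {0<..}) \<and> integral (g ` {0<..}) f = Gamma a"
  proof (rule has_absolute_integral_change_of_variables_1')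
    show "inj_on g {0<..}" using c by (auto simp: g_def inj_on_def)
    show "(g has_real_derivative 2 * c * y) (at y within {0<..})" for y
      unfolding g_def by (auto intro!: derivative_eq_intros)
  qed simp
  ultimately have ai: "(\<lambda>y. \<bar>2 * c * y\<bar> * f (g y)) absolutely_integrable_on {0<..}"
    and eq: "integral {0<..} (\<lambda>y. \<bar>2 * c * y\<bar> * f (g y)) = Gamma a"
    using f by (auto intro: integral_unique)
  define h where "h y = 2 * c powr a * (y powr r * exp (- c * y\<^sup>2))" for y
  have h: "\<bar>2 * c * y\<bar> * f (g y) = h y" if "y \<in> {0<..}" for y
  proof -
    have y: "y > 0" using that by simp
    have "(c * y\<^sup>2) powr (a - 1) = c powr a / c * (y powr (2 * a) / y\<^sup>2)"
      using c y powr_powr[of y 2 "a - 1"] by (simp add: powr_mult powr_diff algebra_simps flip: powr_numeral)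
    moreover have "y powr (2 * a) = y powr r * y"
    proof -
      have "2 * a = r + 1" by (simp add: a_def)
      then show ?thesis using y powr_add[of y r 1] by simp
    qed
    ultimately show ?thesis
      using c y by (simp add: f_def g_def h_def exp_minus power2_eq_square field_simps)
  qed
  have "(\<lambda>y. \<bar>2 * c * y\<bar> * f (g y)) absolutely_integrable_on {0<..} \<longleftrightarrow> h absolutely_integrable_on {0<..}"
    by (rule set_integrable_cong[OF refl refl h])
  with ai have hi: "set_integrable lborel {0<..} h"
    by (intro set_integrable_lborel_of_integrable_on)
      (auto simp: h_def[abs_def] absolutely_integrable_on_def intro!: mult_nonneg_nonneg)
  have "(LINT y:{0<..}|lborel. h y) = integral {0<..} h"
    by (rule set_borel_integral_eq_integral(2)[OF hi])
  also have "\<dots> = Gamma a" unfolding eq[symmetric] by (intro integral_cong) (simp add: h)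
  finally have hv: "(LINT y:{0<..}|lborel. h y) = Gamma a" .
  have ca: "c powr a > 0" using c by simp
  have eqf: "y powr r * exp (- c * y\<^sup>2) = inverse (2 * c powr a) * h y" for y
    using ca by (simp add: h_def)
  show "set_integrable lborel {0<..} (\<lambda>y. y powr r * exp (- c * y\<^sup>2))"
    unfolding eqf by (intro set_integrable_mult_right hi)
  show "(LINT y:{0<..}|lborel. y powr r * exp (- c * y\<^sup>2)) = Gamma ((r + 1) / 2) / (2 * c powr ((r + 1) / 2))"
  proof -
    have "(LINT y:{0<..}|lborel. y powr r * exp (- c * y\<^sup>2)) = inverse (2 * c powr a) * Gamma a"
      unfolding eqf hv[symmetric] by (rule set_integral_mult_right)
    then show ?thesis unfolding a_def[symmetric] by (simp only: divide_inverse mult.commute)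
  qed
qed

text \<open>Dominated convergence: all partial sums are bounded by
  \<open>K * exp (\<epsilon> * Y y)\<close>, so it suffices that the weight beats this exponential.
  It serves three times: for Weber's integral, and for expanding the limits of the means at 0 and at
  infinity in a parameter.\<close>

lemma integral_power_series_termwise:
  fixes a :: "nat \<Rightarrow> real" and w Y :: "real \<Rightarrow> real"
  assumes a: "\<And>k. \<bar>a k\<bar> \<le> K * \<epsilon> ^ k / fact k" and \<epsilon>: "\<epsilon> > 0"
    and [measurable]: "w \<in> borel_measurable borel" "Y \<in> borel_measurable borel"
    and Y: "\<And>y. y > 0 \<Longrightarrow> Y y \<ge> 0"
    and int: "set_integrable lborel {0<..} (\<lambda>y. exp (\<epsilon> * Y y) * \<bar>w y\<bar>)"
  shows "(\<lambda>k. a k * (LINT y:{0<..}|lborel. Y y ^ k * w y)) sums (LINT y:{0<..}|lborel. (\<Sum>k. a k * Y y ^ k) * w y)"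
proof -
  have K: "K \<ge> 0" using a[of 0] by simp
  have sm: "(\<lambda>k. \<epsilon> ^ k / fact k * u ^ k) sums exp (\<epsilon> * u)" for u
    using exp_converges[of "\<epsilon> * u"] by (simp add: power_mult_distrib divide_inverse mult_ac)
  have abs_le: "\<bar>a k * u ^ k\<bar> \<le> K * (\<epsilon> ^ k / fact k * u ^ k)" if "u \<ge> 0" for k u
    using mult_right_mono[OF a[of k], of "u ^ k"] that by (simp add: abs_mult power_abs)
  have summ: "summable (\<lambda>k. a k * u ^ k)" if "u \<ge> 0" for u
    by (rule summable_comparison_test'[OF summable_mult[OF sums_summable[OF sm]]]) (use abs_le that in auto)
  have single: "set_integrable lborel {0<..} (\<lambda>y. Y y ^ k * w y)" for k
  proof (rule set_integrable_lborel_bound)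
    show "set_integrable lborel {0<..} (\<lambda>y. fact k / \<epsilon> ^ k * (exp (\<epsilon> * Y y) * \<bar>w y\<bar>))"
      by (intro set_integrable_mult_right int)
    fix y :: real assume "y \<in> {0<..}"
    then have Yy: "Y y \<ge> 0" using Y by simp
    have "\<epsilon> ^ k / fact k * Y y ^ k \<le> exp (\<epsilon> * Y y)"
      using sum_le_suminf[OF sums_summable[OF sm[of "Y y"]], of "{k}"] sums_unique[OF sm[of "Y y"]] Yy \<epsilon> by simp
    then have "fact k / \<epsilon> ^ k * (\<epsilon> ^ k / fact k * Y y ^ k) \<le> fact k / \<epsilon> ^ k * exp (\<epsilon> * Y y)"
      using \<epsilon> by (intro mult_left_mono) auto
    then have "Y y ^ k \<le> fact k / \<epsilon> ^ k * exp (\<epsilon> * Y y)" using \<epsilon> by simp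
    from mult_right_mono[OF this, of "\<bar>w y\<bar>"]
    show "\<bar>Y y ^ k * w y\<bar> \<le> fact k / \<epsilon> ^ k * (exp (\<epsilon> * Y y) * \<bar>w y\<bar>)" using Yy by (simp add: abs_mult)
  qed auto
  define s where "s n y = indicator {0<..} y * ((\<Sum>k<n. a k * Y y ^ k) * w y)" for n y
  have "(\<lambda>n. \<integral>y. s n y \<partial>lborel) \<longlonglongrightarrow> (\<integral>y. indicator {0<..} y * ((\<Sum>k. a k * Y y ^ k) * w y) \<partial>lborel)"
  proof (rule integral_dominated_convergence)
    show "(\<lambda>y. indicator {0<..} y * ((\<Sum>k. a k * Y y ^ k) * w y)) \<in> borel_measurable lborel" by measurable
    show "s n \<in> borel_measurable lborel" for n unfolding s_def by measurable
    show "integrable lborel (\<lambda>y. indicator {0<..} y * (K * (exp (\<epsilon> * Y y) * \<bar>w y\<bar>)))"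
      using set_integrable_mult_right[OF int, of K] by (simp add: set_integrable_def)
    show "AE y in lborel. (\<lambda>n. s n y) \<longlonglongrightarrow> indicator {0<..} y * ((\<Sum>k. a k * Y y ^ k) * w y)"
    proof (intro AE_I2)
      fix y
      show "(\<lambda>n. s n y) \<longlonglongrightarrow> indicator {0<..} y * ((\<Sum>k. a k * Y y ^ k) * w y)"
        unfolding s_def using summable_LIMSEQ[OF summ[OF Y[of y]]]
        by (cases "y > 0") (auto intro!: tendsto_intros)
    qed
    show "AE y in lborel. norm (s n y) \<le> indicator {0<..} y * (K * (exp (\<epsilon> * Y y) * \<bar>w y\<bar>))" for n
    proof (intro AE_I2)
      fix y
      show "norm (s n y) \<le> indicator {0<..} y * (K * (exp (\<epsilon> * Y y) * \<bar>w y\<bar>))"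
      proof (cases "y > 0")
        case True
        have "\<bar>\<Sum>k<n. a k * Y y ^ k\<bar> \<le> (\<Sum>k<n. K * (\<epsilon> ^ k / fact k * Y y ^ k))"
          using abs_le[OF Y[OF True]] by (intro order_trans[OF sum_abs sum_mono])
        also have "\<dots> \<le> K * exp (\<epsilon> * Y y)"
          unfolding sum_distrib_left[symmetric] sums_unique[OF sm] using Y[OF True] \<epsilon> K
          by (intro mult_left_mono sum_le_suminf sums_summable[OF sm]) auto
        finally have "\<bar>\<Sum>k<n. a k * Y y ^ k\<bar> * \<bar>w y\<bar> \<le> K * exp (\<epsilon> * Y y) * \<bar>w y\<bar>" by (intro mult_right_mono) auto
        then show ?thesis using True by (simp add: s_def abs_mult mult_ac)
      qed (simp add: s_def)
    qed
  qed
  moreover have "(\<integral>y. s n y \<partial>lborel) = (\<Sum>k<n. a k * (LINT y:{0<..}|lborel. Y y ^ k * w y))" for n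
  proof -
    have "(\<integral>y. s n y \<partial>lborel) = (\<integral>y. (\<Sum>k<n. a k * (indicator {0<..} y *\<^sub>R (Y y ^ k * w y))) \<partial>lborel)"
      unfolding s_def by (simp add: sum_distrib_left sum_distrib_right mult_ac)
    also have "\<dots> = (\<Sum>k<n. a k * (LINT y:{0<..}|lborel. Y y ^ k * w y))"
      using single by (subst Bochner_Integration.integral_sum) (auto simp: set_integrable_def set_lebesgue_integral_def)
    finally show ?thesis .
  qed
  ultimately show ?thesis by (simp add: sums_def set_lebesgue_integral_def)
qed

text \<open>The parameter is positive in the applications, so vanishing is known only on a one-sided
  interval. By strong induction the earlier coefficients are gone; division by \<open>v ^ k\<close>
  and the limit \<open>v\<close> to 0 from the right isolate the coefficient
  \<open>a k\<close>.\<close>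

lemma power_series_zero_coeffs:
  fixes a :: "nat \<Rightarrow> real"
  assumes r: "r > 0" and z: "\<And>v. 0 < v \<Longrightarrow> v < r \<Longrightarrow> (\<lambda>k. a k * v ^ k) sums 0"
  shows "a k = 0"
proof (induction k rule: less_induct)
  case (less k)
  define b where "b n = a (n + k)" for n
  have b: "(\<lambda>n. b n * v ^ n) sums 0" if v: "0 < v" "v < r" for v
  proof -
    have "(\<Sum>i<k. a i * v ^ i) = 0" using less by simp
    then have "(\<lambda>n. a (n + k) * v ^ (n + k)) sums 0"
      using z[OF v] by (subst sums_iff_shift) simp
    from sums_mult[OF this, of "1 / v ^ k"] show ?thesis
      using v by (simp add: b_def power_add field_simps)
  qed
  have sm: "summable (\<lambda>n. b n * x ^ n)" if "norm x < r / 2" for x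
    using powser_inside[OF sums_summable[OF b[of "r / 2"]], of x] r that by simp
  have "((\<lambda>x. \<Sum>n. b n * x ^ n) \<longlongrightarrow> b 0) (at 0)"
    using r sm by (intro powser_limit_0[of "r / 2"]) (auto intro: summable_sums)
  then have "((\<lambda>x. \<Sum>n. b n * x ^ n) \<longlongrightarrow> b 0) (at_right 0)"
    by (rule filterlim_mono) (auto simp: at_within_le_at)
  moreover have "\<forall>\<^sub>F x in at_right 0. (\<Sum>n. b n * x ^ n) = 0"
    unfolding eventually_at_right_field using b r by (intro exI[of _ r]) (auto simp: sums_iff)
  ultimately have "((\<lambda>x::real. 0::real) \<longlongrightarrow> b 0) (at_right 0)"
    by (rule Lim_transform_eventually)
  then have "b 0 = 0" by (simp add: tendsto_const_iff)
  then show "a k = 0" by (simp add: b_def)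
qed

lemma set_lborel_integral_cong:
  assumes "A \<in> sets borel" "\<And>x. x \<in> A \<Longrightarrow> f x = g x"
  shows "(LINT x:A|lborel. f x) = (LINT x:A|lborel. g x)"
  using assms by (intro set_lebesgue_integral_cong) auto

lemma gaussian_poly_set_integrable:
  fixes r c :: real and k :: nat
  assumes r: "r > -1" and c: "c > 0"
  shows "set_integrable lborel {0<..} (\<lambda>y. y powr r * (1 + y) ^ k * exp (- c * y\<^sup>2))"
proof (rule set_integrable_lborel_bound)
  show "set_integrable lborel {0<..} (\<lambda>y. exp ((real k)\<^sup>2 / (2 * c)) * (y powr r * exp (- (c / 2) * y\<^sup>2)))"
    using r c by (intro set_integrable_mult_right gaussian_moment) auto
  fix y :: real assume "y \<in> {0<..}"
  then have y: "y > 0" by simp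
  have "(1 + y) ^ k \<le> exp y ^ k" using y exp_ge_add_one_self[of y] by (intro power_mono) auto
  also have "\<dots> = exp (real k * y)" by (simp add: exp_of_nat_mult)
  finally have "(1 + y) ^ k * exp (- c * y\<^sup>2) \<le> exp (real k * y) * exp (- c * y\<^sup>2)" by (intro mult_right_mono) auto
  also have "\<dots> = exp (real k * y - c * y\<^sup>2)" by (simp add: exp_add[symmetric])
  also have "\<dots> \<le> exp ((real k)\<^sup>2 / (2 * c) - c / 2 * y\<^sup>2)"
  proof -
    have "0 \<le> (real k - c * y)\<^sup>2 / (2 * c)" using c by simp
    also have "\<dots> = (real k)\<^sup>2 / (2 * c) - real k * y + c / 2 * y\<^sup>2"
      using c by (simp add: power2_diff field_simps power2_eq_square)
    finally show ?thesis by simp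
  qed
  also have "\<dots> = exp ((real k)\<^sup>2 / (2 * c)) * exp (- (c / 2) * y\<^sup>2)" by (simp add: exp_add[symmetric])
  finally have "y powr r * ((1 + y) ^ k * exp (- c * y\<^sup>2)) \<le> y powr r * (exp ((real k)\<^sup>2 / (2 * c)) * exp (- (c / 2) * y\<^sup>2))"
    by (intro mult_left_mono) auto
  then show "\<bar>y powr r * (1 + y) ^ k * exp (- c * y\<^sup>2)\<bar> \<le> exp ((real k)\<^sup>2 / (2 * c)) * (y powr r * exp (- (c / 2) * y\<^sup>2))"
    using y by (simp add: abs_mult mult_ac)
qed auto

text \<open>Weber's first exponential integral: the Hankel transform of a Gaussian is a Gaussian.
  Integrating the Bessel series term by term, the Gamma factor of each moment cancels the one in
  \<open>bessel_coeff\<close>, and an exponential series remains.\<close>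

lemma weber_integral:
  assumes \<alpha>: "\<alpha> > -1" and l: "l > 0" and y: "y > 0"
  shows "set_integrable lborel {0<..} (\<lambda>z. bessel_J \<alpha> (z * y) * (z powr (\<alpha> + 1) * exp (- l * z\<^sup>2)))"
    "(LINT z:{0<..}|lborel. bessel_J \<alpha> (z * y) * (z powr (\<alpha> + 1) * exp (- l * z\<^sup>2)))
      = y powr \<alpha> * (exp (- (y\<^sup>2 / (4 * l))) / (2 * l) powr (\<alpha> + 1))"
proof -
  obtain C where C: "C > 0" and le: "\<And>w. w > 0 \<Longrightarrow> \<bar>bessel_J \<alpha> w\<bar> \<le> C * w powr \<alpha> * (1 + w)"
    by (rule bessel_J_estimates[OF \<alpha>]) (rule that; simp)
  show "set_integrable lborel {0<..} (\<lambda>z. bessel_J \<alpha> (z * y) * (z powr (\<alpha> + 1) * exp (- l * z\<^sup>2)))"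
  proof (rule set_integrable_lborel_bound)
    show "set_integrable lborel {0<..} (\<lambda>z. C * y powr \<alpha> * (1 + y) * (z powr (2 * \<alpha> + 1) * (1 + z) ^ 1 * exp (- l * z\<^sup>2)))"
      using \<alpha> l by (intro set_integrable_mult_right gaussian_poly_set_integrable) auto
    fix z :: real assume "z \<in> {0<..}"
    then have z: "z > 0" by simp
    have "\<bar>bessel_J \<alpha> (z * y)\<bar> \<le> C * (z * y) powr \<alpha> * (1 + z * y)" using y z by (intro le) auto
    also have "\<dots> \<le> C * (z * y) powr \<alpha> * ((1 + y) * (1 + z))"
      using C y z by (intro mult_left_mono) (auto simp: algebra_simps)
    finally have "\<bar>bessel_J \<alpha> (z * y)\<bar> * (z powr (\<alpha> + 1) * exp (- l * z\<^sup>2))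
      \<le> C * (z * y) powr \<alpha> * ((1 + y) * (1 + z)) * (z powr (\<alpha> + 1) * exp (- l * z\<^sup>2))"
      by (intro mult_right_mono) auto
    also have "\<dots> = C * y powr \<alpha> * (1 + y) * ((z powr \<alpha> * z powr (\<alpha> + 1)) * (1 + z) * exp (- l * z\<^sup>2))"
      using y z by (simp add: powr_mult mult_ac)
    also have "z powr \<alpha> * z powr (\<alpha> + 1) = z powr (2 * \<alpha> + 1)"
      unfolding powr_add[symmetric] by (simp add: algebra_simps)
    finally show "\<bar>bessel_J \<alpha> (z * y) * (z powr (\<alpha> + 1) * exp (- l * z\<^sup>2))\<bar>
      \<le> C * y powr \<alpha> * (1 + y) * (z powr (2 * \<alpha> + 1) * (1 + z) ^ 1 * exp (- l * z\<^sup>2))"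
      by (simp add: abs_mult)
  qed auto
  define Y where "Y z = (z * y / 2)\<^sup>2" for z
  define w where "w z = z powr (2 * \<alpha> + 1) * exp (- l * z\<^sup>2)" for z
  \<comment> \<open>With this choice
    \<open>exp (\<epsilon> * Y z) = exp (l / 2 * z\<^sup>2)\<close>, so the majorant uses up half of
    the Gaussian decay and the other half ensures integrability.\<close>
  define \<epsilon> where "\<epsilon> = 2 * l / y\<^sup>2"
  have \<epsilon>: "\<epsilon> > 0" using l y by (simp add: \<epsilon>_def)
  obtain K where K: "\<And>k. \<bar>bessel_coeff \<alpha> k\<bar> \<le> K * \<epsilon> ^ k / fact k" using bessel_coeff_bound[OF \<alpha> \<epsilon>] by blast
  have "(\<lambda>k. bessel_coeff \<alpha> k * (LINT z:{0<..}|lborel. Y z ^ k * w z)) sums (LINT z:{0<..}|lborel. (\<Sum>k. bessel_coeff \<alpha> k * Y z ^ k) * w z)"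
  proof (rule integral_power_series_termwise[OF K \<epsilon>])
    have "exp (\<epsilon> * Y z) * \<bar>w z\<bar> = z powr (2 * \<alpha> + 1) * exp (- (l / 2) * z\<^sup>2)" for z
      using y by (simp add: \<epsilon>_def Y_def w_def abs_mult power_divide power_mult_distrib mult_exp_exp)
    moreover have "set_integrable lborel {0<..} (\<lambda>z. z powr (2 * \<alpha> + 1) * exp (- (l / 2) * z\<^sup>2))"
      using \<alpha> l by (intro gaussian_moment) auto
    ultimately show "set_integrable lborel {0<..} (\<lambda>z. exp (\<epsilon> * Y z) * \<bar>w z\<bar>)" by simp
  qed (auto simp: Y_def w_def[abs_def])
  moreover have "bessel_coeff \<alpha> k * (LINT z:{0<..}|lborel. Y z ^ k * w z) = 1 / (2 * l powr (\<alpha> + 1)) * ((- (y\<^sup>2 / (4 * l))) ^ k /\<^sub>R fact k)" for k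
  proof -
    have "(LINT z:{0<..}|lborel. Y z ^ k * w z) = (LINT z:{0<..}|lborel. (y\<^sup>2 / 4) ^ k * (z powr (2 * real k + 2 * \<alpha> + 1) * exp (- l * z\<^sup>2)))"
    proof (rule set_lborel_integral_cong)
      fix z :: real assume z: "z \<in> {0<..}"
      have "z powr (2 * real k + 2 * \<alpha> + 1) = z powr (2 * real k) * z powr (2 * \<alpha> + 1)"
        unfolding powr_add[symmetric] by (simp add: add_ac)
      also have "z powr (2 * real k) = (z\<^sup>2) ^ k"
        using z powr_realpow[of z "2 * k"] by (simp add: power_mult)
      finally show "Y z ^ k * w z = (y\<^sup>2 / 4) ^ k * (z powr (2 * real k + 2 * \<alpha> + 1) * exp (- l * z\<^sup>2))"
        by (simp add: Y_def w_def power_divide power_mult_distrib mult_ac)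
    qed simp
    also have "\<dots> = (y\<^sup>2 / 4) ^ k * (LINT z:{0<..}|lborel. z powr (2 * real k + 2 * \<alpha> + 1) * exp (- l * z\<^sup>2))"
      by (rule set_integral_mult_right)
    also have "(LINT z:{0<..}|lborel. z powr (2 * real k + 2 * \<alpha> + 1) * exp (- l * z\<^sup>2)) = Gamma (real k + \<alpha> + 1) / (2 * l powr (real k + \<alpha> + 1))"
    proof -
      have "2 * real k + 2 * \<alpha> + 1 > -1" using \<alpha> of_nat_0_le_iff[of k] by linarith
      from gaussian_moment(2)[OF this l] have "(LINT z:{0<..}|lborel. z powr (2 * real k + 2 * \<alpha> + 1) * exp (- l * z\<^sup>2))
        = Gamma ((2 * real k + 2 * \<alpha> + 1 + 1) / 2) / (2 * l powr ((2 * real k + 2 * \<alpha> + 1 + 1) / 2))" .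
      moreover have "(2 * real k + 2 * \<alpha> + 1 + 1) / 2 = real k + \<alpha> + 1" by argo
      ultimately show ?thesis by (simp only:)
    qed
    also have "l powr (real k + \<alpha> + 1) = l ^ k * l powr (\<alpha> + 1)"
      using l by (simp add: powr_add powr_realpow)
    finally have X: "(LINT z:{0<..}|lborel. Y z ^ k * w z) = (y\<^sup>2 / 4) ^ k * (Gamma (real k + \<alpha> + 1) / (2 * (l ^ k * l powr (\<alpha> + 1))))" .
    have G: "Gamma (real k + \<alpha> + 1) \<noteq> 0" using \<alpha>
      by (intro less_imp_neq[OF Gamma_real_pos, symmetric]) linarith
    have N: "(- (y\<^sup>2 / (4 * l))) ^ k = (-1) ^ k * ((y\<^sup>2 / 4) ^ k / l ^ k)"
      by (subst power_minus) (simp add: power_divide power_mult_distrib)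
    show ?thesis
    proof -
      have "\<sigma> * inverse g / f * (p * (g / (2 * (e * h)))) = 1 / (2 * h) * (inverse f * (\<sigma> * (p / e)))" if "g \<noteq> 0"
        for \<sigma> g f p e h :: real using that by (simp add: field_simps)
      from this[OF G] show ?thesis
        unfolding X N bessel_coeff_def rGamma_inverse_Gamma real_scaleR_def .
    qed
  qed
  moreover have "(\<lambda>k. 1 / (2 * l powr (\<alpha> + 1)) * ((- (y\<^sup>2 / (4 * l))) ^ k /\<^sub>R fact k)) sums (1 / (2 * l powr (\<alpha> + 1)) * exp (- (y\<^sup>2 / (4 * l))))"
    by (intro sums_mult exp_converges)
  ultimately have *: "(LINT z:{0<..}|lborel. (\<Sum>k. bessel_coeff \<alpha> k * Y z ^ k) * w z) = 1 / (2 * l powr (\<alpha> + 1)) * exp (- (y\<^sup>2 / (4 * l)))"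
    by (simp add: sums_iff)
  have "(LINT z:{0<..}|lborel. bessel_J \<alpha> (z * y) * (z powr (\<alpha> + 1) * exp (- l * z\<^sup>2)))
    = (LINT z:{0<..}|lborel. (y / 2) powr \<alpha> * ((\<Sum>k. bessel_coeff \<alpha> k * Y z ^ k) * w z))"
  proof (rule set_lborel_integral_cong)
    fix z :: real assume z: "z \<in> {0<..}"
    have "z powr \<alpha> * z powr (\<alpha> + 1) = z powr (2 * \<alpha> + 1)"
      unfolding powr_add[symmetric] by (simp add: algebra_simps)
    moreover have "(z * y / 2) powr \<alpha> = z powr \<alpha> * (y / 2) powr \<alpha>"
      using z y powr_mult[of z "y / 2" \<alpha>] by simp
    ultimately show "bessel_J \<alpha> (z * y) * (z powr (\<alpha> + 1) * exp (- l * z\<^sup>2)) = (y / 2) powr \<alpha> * ((\<Sum>k. bessel_coeff \<alpha> k * Y z ^ k) * w z)"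
      using z y by (simp add: bessel_J_eq_series[OF \<alpha>] bessel_series_def Y_def w_def mult_ac)
  qed simp
  also have "\<dots> = (y / 2) powr \<alpha> * (1 / (2 * l powr (\<alpha> + 1)) * exp (- (y\<^sup>2 / (4 * l))))"
    unfolding set_integral_mult_right * ..
  also have "\<dots> = y powr \<alpha> * (exp (- (y\<^sup>2 / (4 * l))) / (2 * l) powr (\<alpha> + 1))"
    using y l by (simp add: powr_divide powr_mult powr_add field_simps)
  finally show "(LINT z:{0<..}|lborel. bessel_J \<alpha> (z * y) * (z powr (\<alpha> + 1) * exp (- l * z\<^sup>2)))
      = y powr \<alpha> * (exp (- (y\<^sup>2 / (4 * l))) / (2 * l) powr (\<alpha> + 1))" .
qed

text \<open>A test function that vanishes to order \<open>2m\<close> at the origin and, being a combination of Gaussians,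
  has an explicit Hankel transform \<open>ghat\<close>.\<close>

definition gtest :: "nat \<Rightarrow> real \<Rightarrow> real" where
  "gtest m z = exp (- z\<^sup>2) * (1 - exp (- z\<^sup>2)) ^ m"

definition gcoeff :: "real \<Rightarrow> nat \<Rightarrow> nat \<Rightarrow> real" where
  "gcoeff \<alpha> m i = (- 1) ^ i * real (m choose i) / (2 * (1 + real i)) powr (\<alpha> + 1)"

definition ghat :: "real \<Rightarrow> nat \<Rightarrow> real \<Rightarrow> real" where
  "ghat \<alpha> m y = (\<Sum>i\<le>m. gcoeff \<alpha> m i * exp (- (1 / (4 * (1 + real i))) * y\<^sup>2))"

lemma gtest_measurable [measurable]: "gtest m \<in> borel_measurable borel"
  unfolding gtest_def[abs_def] by measurable

lemma ghat_measurable [measurable]: "ghat \<alpha> m \<in> borel_measurable borel"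
  unfolding ghat_def[abs_def] by measurable

lemma gtest_nonneg: "gtest m z \<ge> 0"
  unfolding gtest_def by (intro mult_nonneg_nonneg zero_le_power) auto

lemma gtest_le: "gtest m z \<le> z ^ (2 * m) * exp (- z\<^sup>2)"
proof -
  have "1 - exp (- z\<^sup>2) \<le> z\<^sup>2" using exp_ge_add_one_self[of "- z\<^sup>2"] by simp
  then have "(1 - exp (- z\<^sup>2)) ^ m \<le> (z\<^sup>2) ^ m" by (intro power_mono) auto
  then show ?thesis unfolding gtest_def by (simp add: power_mult)
qed

lemma gtest_eq_sum: "gtest m z = (\<Sum>i\<le>m. (- 1) ^ i * real (m choose i) * exp (- (1 + real i) * z\<^sup>2))"
proof -
  have "(1 - exp (- z\<^sup>2)) ^ m = (- exp (- z\<^sup>2) + 1) ^ m" by simp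
  also have "\<dots> = (\<Sum>i\<le>m. real (m choose i) * (- exp (- z\<^sup>2)) ^ i * 1 ^ (m - i))" by (rule binomial_ring)
  finally have "gtest m z = (\<Sum>i\<le>m. exp (- z\<^sup>2) * (real (m choose i) * (- exp (- z\<^sup>2)) ^ i))"
    unfolding gtest_def by (simp add: sum_distrib_left)
  also have "\<dots> = (\<Sum>i\<le>m. (- 1) ^ i * real (m choose i) * exp (- (1 + real i) * z\<^sup>2))"
  proof (rule sum.cong[OF refl])
    fix i
    have "(- exp (- z\<^sup>2)) ^ i = (-1) ^ i * exp (- (real i * z\<^sup>2))"
      by (subst power_minus) (simp add: exp_of_nat_mult[symmetric])
    moreover have "exp (- (1 + real i) * z\<^sup>2) = exp (- z\<^sup>2) * exp (- (real i * z\<^sup>2))"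
      by (simp add: exp_add[symmetric] algebra_simps)
    ultimately show "exp (- z\<^sup>2) * (real (m choose i) * (- exp (- z\<^sup>2)) ^ i) = (- 1) ^ i * real (m choose i) * exp (- (1 + real i) * z\<^sup>2)"
      by simp
  qed
  finally show ?thesis .
qed

lemma hankel_gtest:
  assumes \<alpha>: "\<alpha> > -1" and y: "y > 0"
  shows "(LINT z:{0<..}|lborel. bessel_J \<alpha> (z * y) * (z powr (\<alpha> + 1) * gtest m z)) = y powr \<alpha> * ghat \<alpha> m y"
proof -
  let ?f = "\<lambda>i z. bessel_J \<alpha> (z * y) * (z powr (\<alpha> + 1) * exp (- (1 + real i) * z\<^sup>2))"
  have "(LINT z:{0<..}|lborel. bessel_J \<alpha> (z * y) * (z powr (\<alpha> + 1) * gtest m z))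
    = (\<integral>z. (\<Sum>i\<le>m. (- 1) ^ i * real (m choose i) * (indicator {0<..} z *\<^sub>R ?f i z)) \<partial>lborel)"
    unfolding set_lebesgue_integral_def gtest_eq_sum by (simp add: sum_distrib_left mult_ac)
  also have "\<dots> = (\<Sum>i\<le>m. (- 1) ^ i * real (m choose i) * (LINT z:{0<..}|lborel. ?f i z))"
  proof (subst Bochner_Integration.integral_sum)
    show "integrable lborel (\<lambda>z. (- 1) ^ i * real (m choose i) * (indicator {0<..} z *\<^sub>R ?f i z))" for i
      using weber_integral(1)[OF \<alpha> _ y, of "1 + real i"]
      by (intro integrable_mult_right) (simp only: set_integrable_def of_nat_0_le_iff add_pos_nonneg zero_less_one)
  qed (simp add: set_lebesgue_integral_def)
  also have "\<dots> = (\<Sum>i\<le>m. y powr \<alpha> * (gcoeff \<alpha> m i * exp (- (1 / (4 * (1 + real i))) * y\<^sup>2)))"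
    by (rule sum.cong[OF refl], subst weber_integral(2)[OF \<alpha> _ y]) (simp_all add: gcoeff_def)
  finally show ?thesis by (simp add: ghat_def sum_distrib_left)
qed

lemma ghat_bound:
  obtains G where "G > 0" "\<And>y. \<bar>ghat \<alpha> m y\<bar> \<le> G * exp (- (1 / (4 * (1 + real m))) * y\<^sup>2)"
proof
  define G where "G = (\<Sum>i\<le>m. \<bar>gcoeff \<alpha> m i\<bar>) + 1"
  have "(\<Sum>i\<le>m. \<bar>gcoeff \<alpha> m i\<bar>) \<ge> 0" by (intro sum_nonneg) auto
  then show "G > 0" unfolding G_def by linarith
  fix y :: real
  have "\<bar>ghat \<alpha> m y\<bar> \<le> (\<Sum>i\<le>m. \<bar>gcoeff \<alpha> m i\<bar> * exp (- (1 / (4 * (1 + real m))) * y\<^sup>2))"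
    unfolding ghat_def
  proof (rule order_trans[OF sum_abs sum_mono])
    fix i assume "i \<in> {..m}"
    then have "1 / (4 * (1 + real m)) \<le> 1 / (4 * (1 + real i))" by (intro divide_left_mono) auto
    then have "1 / (4 * (1 + real m)) * y\<^sup>2 \<le> 1 / (4 * (1 + real i)) * y\<^sup>2" by (intro mult_right_mono) auto
    then show "\<bar>gcoeff \<alpha> m i * exp (- (1 / (4 * (1 + real i))) * y\<^sup>2)\<bar> \<le> \<bar>gcoeff \<alpha> m i\<bar> * exp (- (1 / (4 * (1 + real m))) * y\<^sup>2)"
      unfolding abs_mult by (intro mult_left_mono) auto
  qed
  also have "\<dots> \<le> G * exp (- (1 / (4 * (1 + real m))) * y\<^sup>2)"
    unfolding sum_distrib_right[symmetric] G_def by (intro mult_right_mono) auto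
  finally show "\<bar>ghat \<alpha> m y\<bar> \<le> G * exp (- (1 / (4 * (1 + real m))) * y\<^sup>2)" .
qed

text \<open>After division by \<open>(1 + real m) powr e\<close> all terms except
  \<open>i = m\<close> tend to 0 as \<open>e\<close> grows, and the sum tends to
  \<open>(- 1) ^ m\<close>.\<close>

lemma alternating_power_sum_nonzero:
  obtains e0 where "\<And>e. e \<ge> e0 \<Longrightarrow> (\<Sum>i\<le>m. (- 1) ^ i * real (m choose i) * (1 + real i) powr e) \<noteq> 0"
proof -
  define S where "S e = (\<Sum>i\<le>m. (- 1) ^ i * real (m choose i) * ((1 + real i) / (1 + real m)) powr e)" for e
  have lim: "((\<lambda>e. ((1 + real i) / (1 + real m)) powr e) \<longlongrightarrow> (if i = m then 1 else 0)) at_top" if "i \<le> m" for i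
  proof (cases "i = m")
    case False
    then have b: "0 < (1 + real i) / (1 + real m)" "(1 + real i) / (1 + real m) < 1" using that by (auto simp: field_simps)
    then have "ln ((1 + real i) / (1 + real m)) < 0" by simp
    then have "((\<lambda>e. exp (e * ln ((1 + real i) / (1 + real m)))) \<longlongrightarrow> 0) at_top"
      by (intro filterlim_compose[OF exp_at_bot] filterlim_tendsto_neg_mult_at_bot[OF tendsto_const] filterlim_ident)
         (auto simp: mult.commute[of _ "ln _"] intro!: filterlim_tendsto_neg_mult_at_bot[OF tendsto_const _ filterlim_ident])
    then show ?thesis using False b by (simp add: powr_def)
  qed simp
  have "(S \<longlongrightarrow> (\<Sum>i\<le>m. (- 1) ^ i * real (m choose i) * (if i = m then 1 else 0))) at_top"
    unfolding S_def by (intro tendsto_intros lim) auto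
  also have "(\<Sum>i\<le>m. (- 1) ^ i * real (m choose i) * (if i = m then 1 else 0)) = (-1) ^ m" 
    by (simp add: if_distrib[of "\<lambda>x. _ * x"] cong: if_cong)
  finally have "\<forall>\<^sub>F e in at_top. S e \<noteq> 0" by (rule tendsto_imp_eventually_ne) simp
  then obtain e0 where e0: "\<And>e. e \<ge> e0 \<Longrightarrow> S e \<noteq> 0" by (auto simp: eventually_at_top_linorder)
  have "(\<Sum>i\<le>m. (- 1) ^ i * real (m choose i) * (1 + real i) powr e) = (1 + real m) powr e * S e" for e
    unfolding S_def sum_distrib_left by (intro sum.cong) (auto simp: powr_divide)
  then show ?thesis using e0 by (intro that[of e0]) auto
qed

lemma ghat_moment:
  assumes r: "r > -1"
  shows "set_integrable lborel {0<..} (\<lambda>y. y powr r * ghat \<alpha> m y)"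
    "(LINT y:{0<..}|lborel. y powr r * ghat \<alpha> m y) = Gamma ((r + 1) / 2) / 2 * 4 powr ((r + 1) / 2) / 2 powr (\<alpha> + 1)
      * (\<Sum>i\<le>m. (- 1) ^ i * real (m choose i) * (1 + real i) powr ((r + 1) / 2 - (\<alpha> + 1)))"
proof -
  let ?f = "\<lambda>i y. y powr r * exp (- (1 / (4 * (1 + real i))) * y\<^sup>2)"
  have int: "set_integrable lborel {0<..} (?f i)" for i using r by (intro gaussian_moment) auto
  have eq: "y powr r * ghat \<alpha> m y = (\<Sum>i\<le>m. gcoeff \<alpha> m i * ?f i y)" for y
    unfolding ghat_def by (simp add: sum_distrib_left mult_ac)
  show "set_integrable lborel {0<..} (\<lambda>y. y powr r * ghat \<alpha> m y)"
  proof -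
    have "integrable lborel (\<lambda>y. \<Sum>i\<le>m. gcoeff \<alpha> m i * (indicator {0<..} y *\<^sub>R ?f i y))"
      using int unfolding set_integrable_def by (intro Bochner_Integration.integrable_sum integrable_mult_right)
    then show ?thesis unfolding eq set_integrable_def by (simp add: sum_distrib_left mult_ac)
  qed
  have "(LINT y:{0<..}|lborel. y powr r * ghat \<alpha> m y) = (\<integral>y. (\<Sum>i\<le>m. gcoeff \<alpha> m i * (indicator {0<..} y *\<^sub>R ?f i y)) \<partial>lborel)"
    unfolding set_lebesgue_integral_def eq by (simp add: sum_distrib_left mult_ac)
  also have "\<dots> = (\<Sum>i\<le>m. gcoeff \<alpha> m i * (LINT y:{0<..}|lborel. ?f i y))"
  proof (subst Bochner_Integration.integral_sum)
    show "integrable lborel (\<lambda>y. gcoeff \<alpha> m i * (indicator {0<..} y *\<^sub>R ?f i y))" for i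
      using int[of i] unfolding set_integrable_def by (rule integrable_mult_right)
  qed (simp add: set_lebesgue_integral_def)
  also have "\<dots> = (\<Sum>i\<le>m. Gamma ((r + 1) / 2) / 2 * 4 powr ((r + 1) / 2) / 2 powr (\<alpha> + 1)
      * ((- 1) ^ i * real (m choose i) * (1 + real i) powr ((r + 1) / 2 - (\<alpha> + 1))))"
  proof (rule sum.cong[OF refl])
    fix i
    let ?a = "(r + 1) / 2"
    have "(LINT y:{0<..}|lborel. ?f i y) = Gamma ?a / (2 * (1 / (4 * (1 + real i))) powr ?a)"
      using r by (intro gaussian_moment) auto
    also have "(1 / (4 * (1 + real i))) powr ?a = 1 / (4 powr ?a * (1 + real i) powr ?a)"
      by (simp only: powr_divide powr_mult powr_one_eq_one)
    finally have "(LINT y:{0<..}|lborel. ?f i y) = Gamma ?a / 2 * (4 powr ?a * (1 + real i) powr ?a)" by simp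
    moreover have "gcoeff \<alpha> m i = (- 1) ^ i * real (m choose i) / (2 powr (\<alpha> + 1) * (1 + real i) powr (\<alpha> + 1))"
      unfolding gcoeff_def by (simp only: powr_mult)
    ultimately show "gcoeff \<alpha> m i * (LINT y:{0<..}|lborel. ?f i y) = Gamma ?a / 2 * 4 powr ?a / 2 powr (\<alpha> + 1)
      * ((- 1) ^ i * real (m choose i) * (1 + real i) powr (?a - (\<alpha> + 1)))"
      by (simp only: powr_diff) (simp add: mult_ac)
  qed
  finally show "(LINT y:{0<..}|lborel. y powr r * ghat \<alpha> m y) = Gamma ((r + 1) / 2) / 2 * 4 powr ((r + 1) / 2) / 2 powr (\<alpha> + 1)
      * (\<Sum>i\<le>m. (- 1) ^ i * real (m choose i) * (1 + real i) powr ((r + 1) / 2 - (\<alpha> + 1)))"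
    by (simp add: sum_distrib_left)
qed

text \<open>Low moments can vanish: for \<open>m \<ge> 1\<close> and
  \<open>r = 2 * \<alpha> + 1\<close> the alternating sum is that of the binomial coefficients,
  which reflects that the test function vanishes at 0. Only large orders are therefore claimed, and
  these suffice to exclude an identically vanishing power series.\<close>

lemma ghat_moment_nonzero:
  obtains r0 where "r0 > -1" "\<And>r. r \<ge> r0 \<Longrightarrow> (LINT y:{0<..}|lborel. y powr r * ghat \<alpha> m y) \<noteq> 0"
proof -
  obtain e0 where e0: "\<And>e. e \<ge> e0 \<Longrightarrow> (\<Sum>i\<le>m. (- 1) ^ i * real (m choose i) * (1 + real i) powr e) \<noteq> 0"
    using alternating_power_sum_nonzero by blast
  show ?thesis
  proof (rule that[of "max 0 (2 * (e0 + \<alpha> + 1) - 1)"])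
    fix r assume r: "r \<ge> max 0 (2 * (e0 + \<alpha> + 1) - 1)"
    then have "(\<Sum>i\<le>m. (- 1) ^ i * real (m choose i) * (1 + real i) powr ((r + 1) / 2 - (\<alpha> + 1))) \<noteq> 0"
      by (intro e0) (auto simp: field_simps)
    moreover have "Gamma ((r + 1) / 2) \<noteq> 0" 
      by (rule less_imp_neq[OF Gamma_real_pos, symmetric]) (use r in simp)
    ultimately show "(LINT y:{0<..}|lborel. y powr r * ghat \<alpha> m y) \<noteq> 0"
      using r by (subst ghat_moment(2)) auto
  qed simp
qed

subsection \<open>Means of the test functions\<close>

lemma powr_gaussian_le:
  fixes a z :: real
  assumes "a \<ge> 0" "z > 0"
  shows "z powr a * exp (- z\<^sup>2) \<le> exp (a\<^sup>2 / 2) * exp (- (z\<^sup>2 / 2))"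
proof -
  have "ln z \<le> z" using ln_le_minus_one[OF assms(2)] by simp
  then have "a * ln z \<le> a * z" using assms(1) by (rule mult_left_mono)
  moreover have "0 \<le> (a - z)\<^sup>2" by simp
  then have "a * z \<le> a\<^sup>2 / 2 + z\<^sup>2 / 2" by (simp add: power2_diff)
  ultimately have "a * ln z + - z\<^sup>2 \<le> a\<^sup>2 / 2 + - (z\<^sup>2 / 2)" by simp
  then have "exp (a * ln z + - z\<^sup>2) \<le> exp (a\<^sup>2 / 2 + - (z\<^sup>2 / 2))" by simp
  then show ?thesis using assms(2) by (simp only: exp_add powr_def) auto
qed

lemma lborel_integrable_prod:
  fixes p q :: "real \<Rightarrow> real"
  assumes p: "integrable lborel p" and q: "integrable lborel q"
  shows "integrable (lborel \<Otimes>\<^sub>M lborel) (\<lambda>(x, y). p x * q y)"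
proof -
  have [measurable]: "p \<in> borel_measurable borel" "q \<in> borel_measurable borel"
    using p q by (auto dest: borel_measurable_integrable)
  show ?thesis
  proof (rule lborel_pair.Fubini_integrable)
    show "integrable lborel (\<lambda>x. \<integral>y. norm (case (x, y) of (x, y) \<Rightarrow> p x * q y) \<partial>lborel)"
      using p by (simp add: abs_mult)
    show "AE x in lborel. integrable lborel (\<lambda>y. case (x, y) of (x, y) \<Rightarrow> p x * q y)"
      using q by simp
  qed measurable
qed

text \<open>The bound \<open>S\<close> does not depend on the position \<open>c\<close>: within
  distance 1 of \<open>c\<close> the singularity is a translate of a fixed integrable function, and
  farther away the factor is at most 1 and the Gaussian decides.\<close>

lemma local_singularity_integrable:
  fixes g :: real
  assumes "0 < g" "g < 1"
  obtains S where "S > 0" "\<And>c. set_integrable lborel {0<..} (\<lambda>z. exp (- (z\<^sup>2 / 2)) * \<bar>z - c\<bar> powr - g)"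
    "\<And>c. (LINT z:{0<..}|lborel. exp (- (z\<^sup>2 / 2)) * \<bar>z - c\<bar> powr - g) \<le> S"
proof -
  define h1 where "h1 z = indicator {0<..1} z * z powr - g" for z :: real
  define h where "h z = h1 (0 + 1 * z) + h1 (0 + (-1) * z)" for z
  define e where "e z = indicator {0<..} z * exp (- (z\<^sup>2 / 2))" for z :: real
  have h1: "integrable lborel h1"
    using set_integrable_powr_near_0[of "- g" 1] assms by (simp add: set_integrable_def h1_def[abs_def])
  then have h: "integrable lborel h"
    unfolding h_def by (intro Bochner_Integration.integrable_add lborel_integrable_real_affine) auto
  have e: "integrable lborel e"
    using gaussian_moment(1)[of 0 "1/2"] unfolding set_integrable_def e_def[abs_def]
    by (rule Bochner_Integration.integrable_cong[THEN iffD1, rotated -1]) (auto simp: indicator_def)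
  have hn: "h z \<ge> 0" "e z \<ge> 0" for z unfolding h_def h1_def e_def by auto
  define S where "S = (\<integral>z. h z \<partial>lborel) + (\<integral>z. e z \<partial>lborel) + 1"
  have hc: "integrable lborel (\<lambda>z. h (- c + 1 * z))" "(\<integral>z. h (- c + 1 * z) \<partial>lborel) = (\<integral>z. h z \<partial>lborel)" for c
    using h lborel_integrable_real_affine[of h 1 "- c"] lborel_integral_real_affine[of 1 h "- c"] by auto
  have le: "\<bar>indicator {0<..} z *\<^sub>R (exp (- (z\<^sup>2 / 2)) * \<bar>z - c\<bar> powr - g)\<bar> \<le> h (- c + 1 * z) + e z" for c z
  proof (cases "z > 0")
    case True
    have E: "0 \<le> exp (- (z\<^sup>2 / 2))" "exp (- (z\<^sup>2 / 2)) \<le> 1" by auto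
    show ?thesis
    proof (cases "\<bar>z - c\<bar> \<le> 1")
      case True
      have "exp (- (z\<^sup>2 / 2)) * \<bar>z - c\<bar> powr - g \<le> 1 * \<bar>z - c\<bar> powr - g" using E by (intro mult_right_mono) auto
      also have "\<bar>z - c\<bar> powr - g \<le> h (- c + 1 * z)"
        using True unfolding h_def h1_def by (auto simp: indicator_def abs_if split: if_splits)
      finally show ?thesis using hn(2)[of z] \<open>z > 0\<close> by simp
    next
      case False
      have "\<bar>z - c\<bar> powr - g \<le> 1 powr - g" using False assms by (intro powr_mono2') auto
      then have "exp (- (z\<^sup>2 / 2)) * \<bar>z - c\<bar> powr - g \<le> exp (- (z\<^sup>2 / 2)) * 1" using E by (intro mult_left_mono) auto
      moreover have "e z = exp (- (z\<^sup>2 / 2))" using \<open>z > 0\<close> by (simp add: e_def)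
      ultimately have "exp (- (z\<^sup>2 / 2)) * \<bar>z - c\<bar> powr - g \<le> h (- c + 1 * z) + e z"
        using hn(1)[of "- c + 1 * z"] by linarith
      then show ?thesis using \<open>z > 0\<close> by simp
    qed
  next
    case False
    then show ?thesis using hn[of "- c + 1 * z"] hn[of z] by simp
  qed
  have int: "integrable lborel (\<lambda>z. indicator {0<..} z *\<^sub>R (exp (- (z\<^sup>2 / 2)) * \<bar>z - c\<bar> powr - g))" for c
  proof (rule Bochner_Integration.integrable_bound)
    show "integrable lborel (\<lambda>z. h (- c + 1 * z) + e z)" by (intro Bochner_Integration.integrable_add hc e)
    show "AE z in lborel. norm (indicator {0<..} z *\<^sub>R (exp (- (z\<^sup>2 / 2)) * \<bar>z - c\<bar> powr - g)) \<le> norm (h (- c + 1 * z) + e z)"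
      using le by (intro AE_I2) (metis abs_ge_self order_trans real_norm_def)
  qed simp
  show ?thesis
  proof (rule that)
    have "(\<integral>z. h z \<partial>lborel) \<ge> 0" "(\<integral>z. e z \<partial>lborel) \<ge> 0" using hn by (auto intro!: Bochner_Integration.integral_nonneg)
    then show "S > 0" unfolding S_def by linarith
    fix c
    show "set_integrable lborel {0<..} (\<lambda>z. exp (- (z\<^sup>2 / 2)) * \<bar>z - c\<bar> powr - g)"
      unfolding set_integrable_def by (rule int)
    have "(\<integral>z. indicator {0<..} z *\<^sub>R (exp (- (z\<^sup>2 / 2)) * \<bar>z - c\<bar> powr - g) \<partial>lborel) \<le> (\<integral>z. h (- c + 1 * z) + e z \<partial>lborel)"
      using le by (intro integral_mono int Bochner_Integration.integrable_add hc e) (metis abs_le_D1)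
    also have "\<dots> = (\<integral>z. h z \<partial>lborel) + (\<integral>z. e z \<partial>lborel)"
      using hc[of c] e by simp
    finally show "(LINT z:{0<..}|lborel. exp (- (z\<^sup>2 / 2)) * \<bar>z - c\<bar> powr - g) \<le> S"
      unfolding set_lebesgue_integral_def S_def by simp
  qed
qed

lemma exp_half_square_set_integrable: "set_integrable lborel {0<..} (\<lambda>z::real. exp (- (z\<^sup>2 / 2)))"
proof (rule set_integrable_lborel_bound)
  show "set_integrable lborel {0<..} (\<lambda>z::real. z powr 0 * exp (- (1/2) * z\<^sup>2))" by (rule gaussian_moment) auto
qed auto

context spherical_kernel
begin

lemma sing_pos: "sing t x z > 0"
  unfolding sing_def by (auto intro!: add_pos_nonneg)

text \<open>The bound is uniform in \<open>t\<close> and \<open>x\<close>. This is essential when,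
  after integrating in \<open>z\<close>, the remaining variable \<open>x\<close> is integrated
  against an arbitrary function.\<close>

lemma sing_integral:
  obtains S where "S > 0" "\<And>t x. set_integrable lborel {0<..} (\<lambda>z. exp (- (z\<^sup>2 / 2)) * sing t x z)"
    "\<And>t x. (LINT z:{0<..}|lborel. exp (- (z\<^sup>2 / 2)) * sing t x z) \<le> S"
proof -
  obtain S where S: "S > 0" "\<And>c. set_integrable lborel {0<..} (\<lambda>z. exp (- (z\<^sup>2 / 2)) * \<bar>z - c\<bar> powr - \<gamma>)"
    "\<And>c. (LINT z:{0<..}|lborel. exp (- (z\<^sup>2 / 2)) * \<bar>z - c\<bar> powr - \<gamma>) \<le> S"
    by (rule local_singularity_integrable[OF \<gamma>(1,2)]) (rule that; simp)
  let ?e = "\<lambda>z::real. exp (- (z\<^sup>2 / 2))"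
  have eq: "?e z * sing t x z = ?e z + ?e z * \<bar>z - (t + x)\<bar> powr - \<gamma> + ?e z * \<bar>z - (x - t)\<bar> powr - \<gamma> + ?e z * \<bar>z - (t - x)\<bar> powr - \<gamma>" for t x z
    unfolding sing_def by (simp add: algebra_simps)
  define S' where "S' = \<bar>LINT z:{0<..}|lborel. ?e z\<bar> + 3 * S"
  show ?thesis
  proof (rule that)
    show "S' > 0" unfolding S'_def using S(1) by linarith
    fix t x
    show "set_integrable lborel {0<..} (\<lambda>z. ?e z * sing t x z)"
      unfolding eq by (intro set_integral_add S exp_half_square_set_integrable)
    have "(LINT z:{0<..}|lborel. ?e z * sing t x z) = (LINT z:{0<..}|lborel. ?e z) + (LINT z:{0<..}|lborel. ?e z * \<bar>z - (t + x)\<bar> powr - \<gamma>)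
      + (LINT z:{0<..}|lborel. ?e z * \<bar>z - (x - t)\<bar> powr - \<gamma>) + (LINT z:{0<..}|lborel. ?e z * \<bar>z - (t - x)\<bar> powr - \<gamma>)"
      unfolding eq
      by (subst set_integral_add; (intro set_integral_add S exp_half_square_set_integrable)?)+ (rule refl)
    then show "(LINT z:{0<..}|lborel. ?e z * sing t x z) \<le> S'"
      unfolding S'_def using S(3)[of "t + x"] S(3)[of "x - t"] S(3)[of "t - x"] abs_ge_self[of "LINT z:{0<..}|lborel. ?e z"] by linarith
  qed
qed

text \<open>The worst power near 0 is \<open>z powr (\<alpha> - 1/2)\<close>, with an exponent
  possibly close to \<open>-3/2\<close>. The factor \<open>z ^ (2 * m)\<close> with
  \<open>m \<ge> 1\<close> makes all four exponents nonnegative, and half of the Gaussian then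
  absorbs the powers.\<close>

lemma weight_bound:
  assumes m: "m \<ge> 1"
  obtains W where "W > 0" "\<And>z. z > 0 \<Longrightarrow> z powr (\<alpha> + 1) * Q z * gtest m z \<le> W * exp (- (z\<^sup>2 / 2))"
proof -
  define W where "W = exp ((\<alpha> + 1 + 2 * real m)\<^sup>2 / 2) + exp ((2 * \<alpha> + 1 + 2 * real m)\<^sup>2 / 2)
    + exp ((2 * \<alpha> + 2 + 2 * real m)\<^sup>2 / 2) + exp ((\<alpha> - 1/2 + 2 * real m)\<^sup>2 / 2)"
  have m': "real m \<ge> 1" using m by simp
  show ?thesis
  proof (rule that)
    show "W > 0" unfolding W_def by (intro add_pos_pos) auto
    fix z :: real assume z: "z > 0"
    have zm: "z ^ (2 * m) = z powr (2 * real m)" using z powr_realpow[of z "2 * m"] by simp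
    have p: "z powr a * z powr (2 * real m) = z powr (a + 2 * real m)" for a by (rule powr_add[symmetric])
    have "z powr (\<alpha> + 1) * Q z * gtest m z \<le> z powr (\<alpha> + 1) * Q z * (z powr (2 * real m) * exp (- z\<^sup>2))"
      using gtest_le[of m z] zm Q_pos[OF z] by (intro mult_left_mono) auto
    moreover have wQ: "z powr (\<alpha> + 1) * Q z = z powr (\<alpha> + 1) + z powr (2 * \<alpha> + 1) + z powr (2 * \<alpha> + 2) + z powr (\<alpha> - 1/2)"
    proof -
      have "z powr (\<alpha> + 1) * z powr \<alpha> = z powr (2 * \<alpha> + 1)" "z powr (2 * \<alpha> + 1) * z = z powr (2 * \<alpha> + 2)"
        "z powr (\<alpha> + 1) * z powr (-3/2) = z powr (\<alpha> - 1/2)"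
        using z powr_add[of z "2 * \<alpha> + 1" 1] by (simp_all add: powr_add[symmetric] algebra_simps)
      then have "z powr (\<alpha> + 1) * (z powr \<alpha> * (1 + z)) = z powr (2 * \<alpha> + 1) + z powr (2 * \<alpha> + 2)"
        by (simp add: algebra_simps)
      then show ?thesis unfolding Q_def using \<open>z powr (\<alpha> + 1) * z powr (-3/2) = _\<close> by (simp add: distrib_left)
    qed
    moreover have "z powr (\<alpha> + 1) * Q z * (z powr (2 * real m) * exp (- z\<^sup>2))
      = z powr (\<alpha> + 1 + 2 * real m) * exp (- z\<^sup>2) + z powr (2 * \<alpha> + 1 + 2 * real m) * exp (- z\<^sup>2)
      + z powr (2 * \<alpha> + 2 + 2 * real m) * exp (- z\<^sup>2) + z powr (\<alpha> - 1/2 + 2 * real m) * exp (- z\<^sup>2)"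
      unfolding wQ by (simp only: distrib_right mult.assoc[symmetric] p)
    moreover have "z powr (\<alpha> + 1 + 2 * real m) * exp (- z\<^sup>2) + z powr (2 * \<alpha> + 1 + 2 * real m) * exp (- z\<^sup>2)
      + z powr (2 * \<alpha> + 2 + 2 * real m) * exp (- z\<^sup>2) + z powr (\<alpha> - 1/2 + 2 * real m) * exp (- z\<^sup>2) \<le> exp ((\<alpha> + 1 + 2 * real m)\<^sup>2 / 2) * exp (- (z\<^sup>2 / 2)) + exp ((2 * \<alpha> + 1 + 2 * real m)\<^sup>2 / 2) * exp (- (z\<^sup>2 / 2))
      + exp ((2 * \<alpha> + 2 + 2 * real m)\<^sup>2 / 2) * exp (- (z\<^sup>2 / 2)) + exp ((\<alpha> - 1/2 + 2 * real m)\<^sup>2 / 2) * exp (- (z\<^sup>2 / 2))"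
      using \<alpha> m' by (intro add_mono powr_gaussian_le z) argo+
    moreover have "exp ((\<alpha> + 1 + 2 * real m)\<^sup>2 / 2) * exp (- (z\<^sup>2 / 2)) + exp ((2 * \<alpha> + 1 + 2 * real m)\<^sup>2 / 2) * exp (- (z\<^sup>2 / 2))
      + exp ((2 * \<alpha> + 2 + 2 * real m)\<^sup>2 / 2) * exp (- (z\<^sup>2 / 2)) + exp ((\<alpha> - 1/2 + 2 * real m)\<^sup>2 / 2) * exp (- (z\<^sup>2 / 2))
      = W * exp (- (z\<^sup>2 / 2))" unfolding W_def by (simp only: distrib_right)
    ultimately show "z powr (\<alpha> + 1) * Q z * gtest m z \<le> W * exp (- (z\<^sup>2 / 2))" by linarith
  qed
qed

lemma AE_not_exceptional: "AE z in lborel. z \<noteq> t + x \<and> z \<noteq> x - t \<and> z \<noteq> t - (x::real)"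
proof -
  have "AE z in lborel. z \<notin> {t + x, x - t, t - x}"
    by (intro AE_not_in finite_imp_null_set_lborel) simp
  then show ?thesis by eventually_elim simp
qed

text \<open>For finite \<open>R\<close> the integrand is dominated by a product of a function of
  \<open>z\<close> and a function of \<open>y\<close>, so the order of integration may be exchanged.
  The inner integral over \<open>z\<close> is then the Hankel transform of the test
  function.\<close>

lemma trunc_fubini:
  assumes t: "t > 0" and x: "x > 0"
  shows "(LINT z:{0<..}|lborel. trunc t x z R * (z powr (\<alpha> + 1) * gtest m z)) =
    (LINT y:{0<..R}|lborel. bessel_J (\<alpha> + \<beta>) (t * y) * bessel_J \<alpha> (x * y) * y powr (1 - \<beta>) * ghat \<alpha> m y)"
proof -
  define f where "f z y = indicator {0<..} z * (z powr (\<alpha> + 1) * gtest m z) * (indicator {0<..R} y * integrand t x z y)" for z y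
  define p where "p z = indicator {0<..} z * (z powr \<alpha> * (1 + z) * (z powr (\<alpha> + 1) * gtest m z))" for z
  define q where "q y = indicator {0<..R} y * (C ^ 3 * (t powr (\<alpha> + \<beta>) * (1 + t)) * (x powr \<alpha> * (1 + x)) * ((1 + R) ^ 3 * y powr (2 * \<alpha> + 1)))" for y
  have p: "integrable lborel p"
  proof -
    have "set_integrable lborel {0<..} (\<lambda>z. z powr \<alpha> * (1 + z) * (z powr (\<alpha> + 1) * gtest m z))"
    proof (rule set_integrable_lborel_bound)
      show "set_integrable lborel {0<..} (\<lambda>z. z powr (2 * \<alpha> + 1) * (1 + z) ^ (1 + 2 * m) * exp (- 1 * z\<^sup>2))"
        using \<alpha> by (intro gaussian_poly_set_integrable) auto
      fix z :: real assume "z \<in> {0<..}"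
      then have z: "z > 0" by simp
      have "z ^ (2 * m) \<le> (1 + z) ^ (2 * m)" using z by (intro power_mono) auto
      then have "z ^ (2 * m) * exp (- z\<^sup>2) \<le> (1 + z) ^ (2 * m) * exp (- z\<^sup>2)" by (intro mult_right_mono) auto
      with gtest_le[of m z] have "gtest m z \<le> (1 + z) ^ (2 * m) * exp (- z\<^sup>2)" by linarith
      then have "z powr \<alpha> * (1 + z) * (z powr (\<alpha> + 1) * gtest m z) \<le> z powr \<alpha> * (1 + z) * (z powr (\<alpha> + 1) * ((1 + z) ^ (2 * m) * exp (- z\<^sup>2)))"
        using z by (intro mult_left_mono) auto
      also have "\<dots> = z powr \<alpha> * z powr (\<alpha> + 1) * (1 + z) ^ (1 + 2 * m) * exp (- 1 * z\<^sup>2)" by (simp add: mult_ac)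
      also have "z powr \<alpha> * z powr (\<alpha> + 1) = z powr (2 * \<alpha> + 1)" unfolding powr_add[symmetric] by (simp add: algebra_simps)
      finally show "\<bar>z powr \<alpha> * (1 + z) * (z powr (\<alpha> + 1) * gtest m z)\<bar> \<le> z powr (2 * \<alpha> + 1) * (1 + z) ^ (1 + 2 * m) * exp (- 1 * z\<^sup>2)"
        using z gtest_nonneg[of m z] by simp
    qed auto
    then show ?thesis unfolding p_def[abs_def] set_integrable_def by simp
  qed
  have q: "integrable lborel q"
  proof -
    have "set_integrable lborel {0<..R} (\<lambda>y. C ^ 3 * (t powr (\<alpha> + \<beta>) * (1 + t)) * (x powr \<alpha> * (1 + x)) * ((1 + R) ^ 3 * y powr (2 * \<alpha> + 1)))"
      using \<alpha> by (intro set_integrable_mult_right set_integrable_powr_near_0) simp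
    then show ?thesis unfolding q_def[abs_def] set_integrable_def by simp
  qed
  have f_meas: "case_prod f \<in> borel_measurable (borel \<Otimes>\<^sub>M borel)"
    unfolding f_def[abs_def] integrand_def split_beta' by measurable
  have fpq: "\<bar>f z y\<bar> \<le> p z * q y" for z y
  proof (cases "z > 0 \<and> 0 < y \<and> y \<le> R")
    case True
    have "\<bar>integrand t x z y\<bar> \<le> C ^ 3 * (t powr (\<alpha> + \<beta>) * (1 + t)) * (x powr \<alpha> * (1 + x)) * (z powr \<alpha> * (1 + z)) * ((1 + y) ^ 3 * y powr (2 * \<alpha> + 1))"
      using integrand_le[OF t x] True by simp
    also have "\<dots> \<le> C ^ 3 * (t powr (\<alpha> + \<beta>) * (1 + t)) * (x powr \<alpha> * (1 + x)) * (z powr \<alpha> * (1 + z)) * ((1 + R) ^ 3 * y powr (2 * \<alpha> + 1))"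
      using True t x C by (intro mult_left_mono mult_right_mono power_mono mult_nonneg_nonneg) auto
    finally have "(z powr (\<alpha> + 1) * gtest m z) * \<bar>integrand t x z y\<bar> \<le> (z powr (\<alpha> + 1) * gtest m z) *
      (C ^ 3 * (t powr (\<alpha> + \<beta>) * (1 + t)) * (x powr \<alpha> * (1 + x)) * (z powr \<alpha> * (1 + z)) * ((1 + R) ^ 3 * y powr (2 * \<alpha> + 1)))"
      using gtest_nonneg[of m z] by (intro mult_left_mono) auto
    then show ?thesis using True gtest_nonneg[of m z] by (simp add: f_def p_def q_def abs_mult mult_ac)
  qed (auto simp: f_def p_def q_def indicator_def)
  have f_int: "integrable (lborel \<Otimes>\<^sub>M lborel) (case_prod f)"
  proof (rule Bochner_Integration.integrable_bound[OF lborel_integrable_prod[OF p q]])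
    show "case_prod f \<in> borel_measurable (lborel \<Otimes>\<^sub>M lborel)" using f_meas by (simp cong: measurable_cong_sets)
    show "AE w in lborel \<Otimes>\<^sub>M lborel. norm (case_prod f w) \<le> norm (case w of (z, y) \<Rightarrow> p z * q y)"
      using fpq by (intro AE_I2) (auto intro: order_trans[OF fpq abs_ge_self])
  qed
  have "(LINT z:{0<..}|lborel. trunc t x z R * (z powr (\<alpha> + 1) * gtest m z)) = (\<integral>z. (\<integral>y. f z y \<partial>lborel) \<partial>lborel)"
    unfolding set_lebesgue_integral_def
  proof (rule Bochner_Integration.integral_cong[OF refl])
    fix z
    have "(\<integral>y. f z y \<partial>lborel) = indicator {0<..} z * (z powr (\<alpha> + 1) * gtest m z) * (\<integral>y. indicator {0<..R} y * integrand t x z y \<partial>lborel)"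
      unfolding f_def by (rule integral_mult_right_zero)
    then show "indicator {0<..} z *\<^sub>R (trunc t x z R * (z powr (\<alpha> + 1) * gtest m z)) = (\<integral>y. f z y \<partial>lborel)"
      by (simp add: trunc_def set_lebesgue_integral_def)
  qed
  also have "\<dots> = (\<integral>y. (\<integral>z. f z y \<partial>lborel) \<partial>lborel)"
    by (rule lborel_pair.Fubini_integral[OF f_int, symmetric])
  also have "\<dots> = (LINT y:{0<..R}|lborel. bessel_J (\<alpha> + \<beta>) (t * y) * bessel_J \<alpha> (x * y) * y powr (1 - \<beta>) * ghat \<alpha> m y)"
    unfolding set_lebesgue_integral_def
  proof (rule Bochner_Integration.integral_cong[OF refl])
    fix y :: real
    show "(\<integral>z. f z y \<partial>lborel) = indicator {0<..R} y *\<^sub>R (bessel_J (\<alpha> + \<beta>) (t * y) * bessel_J \<alpha> (x * y) * y powr (1 - \<beta>) * ghat \<alpha> m y)"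
    proof (cases "y \<in> {0<..R}")
      case True
      then have y: "y > 0" by simp
      have "(\<integral>z. f z y \<partial>lborel) = (\<integral>z. bessel_J (\<alpha> + \<beta>) (t * y) * bessel_J \<alpha> (x * y) * y powr (1 - \<alpha> - \<beta>) *
          (indicator {0<..} z *\<^sub>R (bessel_J \<alpha> (z * y) * (z powr (\<alpha> + 1) * gtest m z))) \<partial>lborel)"
        using True by (intro Bochner_Integration.integral_cong) (auto simp: f_def integrand_def indicator_def)
      also have "\<dots> = bessel_J (\<alpha> + \<beta>) (t * y) * bessel_J \<alpha> (x * y) * y powr (1 - \<alpha> - \<beta>) * (y powr \<alpha> * ghat \<alpha> m y)"
        unfolding hankel_gtest[OF \<alpha> y, symmetric] set_lebesgue_integral_def by (rule integral_mult_right_zero)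
      also have "\<dots> = bessel_J (\<alpha> + \<beta>) (t * y) * bessel_J \<alpha> (x * y) * (y powr (1 - \<alpha> - \<beta>) * y powr \<alpha>) * ghat \<alpha> m y" by simp
      also have "y powr (1 - \<alpha> - \<beta>) * y powr \<alpha> = y powr (1 - \<beta>)" unfolding powr_add[symmetric] by simp
      finally show ?thesis using True by simp
    qed (simp add: f_def)
  qed
  finally show ?thesis .
qed

end

section \<open>Weighted measures and an integrated form of boundedness\<close>

lemma sets_power_measure: "sets (power_measure a) = sets (restrict_space lborel {0<..})"
  by (simp add: power_measure_def)

lemma space_power_measure: "space (power_measure a) = {0<..}"
  by (simp add: power_measure_def space_restrict_space)

lemma borel_measurable_power_measure:
  "f \<in> borel_measurable borel \<Longrightarrow> f \<in> borel_measurable (power_measure a)"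
  unfolding power_measure_def by (simp add: measurable_restrict_space1)

lemma integral_power_measure:
  fixes h :: "real \<Rightarrow> real"
  assumes [measurable]: "h \<in> borel_measurable borel"
  shows "(\<integral>x. h x \<partial>power_measure a) = (LINT x:{0<..}|lborel. x powr a * h x)"
proof -
  have "(\<integral>x. h x \<partial>power_measure a) = (\<integral>x. x powr a *\<^sub>R h x \<partial>restrict_space lborel {0<..})"
    unfolding power_measure_def
    by (intro integral_density measurable_restrict_space1) auto
  also have "\<dots> = (LINT x:{0<..}|lborel. x powr a * h x)"
    by (subst integral_restrict_space) (auto simp: set_lebesgue_integral_def)
  finally show ?thesis .
qed

lemma nn_integral_power_measure_le:
  "(\<integral>\<^sup>+x\<in>{0<..}. ennreal (x powr a) * h x \<partial>lborel) \<le> (\<integral>\<^sup>+x. h' x \<partial>power_measure a)"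
  if "h \<in> borel_measurable borel" "\<And>x. x > 0 \<Longrightarrow> h x \<le> h' x"
proof -
  have "(\<integral>\<^sup>+x\<in>{0<..}. ennreal (x powr a) * h x \<partial>lborel) = (\<integral>\<^sup>+x. ennreal (x powr a) * h x \<partial>restrict_space lborel {0<..})"
    by (subst nn_integral_restrict_space) (auto simp: mult_ac)
  also have "\<dots> = (\<integral>\<^sup>+x. h x \<partial>power_measure a)"
    unfolding power_measure_def using that(1) by (intro nn_integral_density[symmetric] measurable_restrict_space1) auto
  also have "\<dots> \<le> (\<integral>\<^sup>+x. h' x \<partial>power_measure a)"
    using that(2) by (intro nn_integral_mono) (auto simp: space_power_measure)
  finally show ?thesis .
qed

lemma nn_integral_power_measure:
  assumes "h \<in> borel_measurable borel"
  shows "(\<integral>\<^sup>+x. h x \<partial>power_measure a) = (\<integral>\<^sup>+x\<in>{0<..}. ennreal (x powr a) * h x \<partial>lborel)"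
proof -
  have "(\<integral>\<^sup>+x. h x \<partial>power_measure a) = (\<integral>\<^sup>+x. ennreal (x powr a) * h x \<partial>restrict_space lborel {0<..})"
    unfolding power_measure_def using assms by (intro nn_integral_density measurable_restrict_space1) auto
  then show ?thesis by (subst (asm) nn_integral_restrict_space) (auto simp: mult_ac)
qed

lemma emeasure_power_measure_singleton: "x > 0 \<Longrightarrow> emeasure (power_measure a) {x} = 0"
proof -
  assume x: "x > 0"
  have s: "{x} \<in> sets (power_measure a)"
    using x unfolding sets_power_measure sets_restrict_space by (auto intro!: image_eqI[of _ _ "{x}"])
  then have "emeasure (power_measure a) {x} = (\<integral>\<^sup>+y. indicator {x} y \<partial>power_measure a)" by simp
  also have "\<dots> = (\<integral>\<^sup>+y\<in>{0<..}. ennreal (y powr a) * indicator {x} y \<partial>lborel)"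
    by (rule nn_integral_power_measure) simp
  also have "\<dots> = (\<integral>\<^sup>+y. 0 \<partial>(lborel :: real measure))"
  proof (rule nn_integral_cong_AE)
    show "AE y in lborel. ennreal (y powr a) * indicator {x} y * indicator {0<..} y = 0"
      using AE_lborel_singleton[of x] by eventually_elim auto
  qed
  finally show ?thesis by simp
qed

lemma ennreal_powr_ennreal: "x \<ge> 0 \<Longrightarrow> ennreal_powr (ennreal x) p = ennreal (x powr p)"
  by (simp add: ennreal_powr_def)

lemma ennreal_powr_mono:
  assumes "a \<le> b" "p > 0"
  shows "ennreal_powr a p \<le> ennreal_powr b p"
proof (cases "b = \<infinity>")
  case False
  then have "a \<noteq> \<infinity>" using assms top.extremum_uniqueI by fastforce
  moreover have "enn2real a \<le> enn2real b" using assms False by (intro enn2real_mono) (auto simp: less_top)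
  ultimately show ?thesis
    using False assms by (auto simp: ennreal_powr_def intro!: ennreal_leI powr_mono2)
qed (simp add: ennreal_powr_def)

lemma ennreal_powr_inverse_le:
  assumes "ennreal_powr X (1 / p) \<le> ennreal c" "p > 0" "c \<ge> 0"
  shows "X \<le> ennreal (c powr p)"
proof -
  have X: "X \<noteq> \<infinity>" using assms(1) by (auto simp: ennreal_powr_def top_unique)
  define x where "x = enn2real X"
  have Xx: "X = ennreal x" "x \<ge> 0" using X by (auto simp: x_def less_top)
  have "x powr (1 / p) \<le> c" using assms(1,3) unfolding Xx(1) ennreal_powr_ennreal[OF Xx(2)] by simp
  then have "(x powr (1 / p)) powr p \<le> c powr p" using assms(2) by (intro powr_mono2) auto
  then have "x \<le> c powr p" using Xx(2) assms(2) by (simp add: powr_powr)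
  then show ?thesis unfolding Xx(1) by (rule ennreal_leI)
qed

text \<open>Boundedness in the form in which it is applied: roots are removed, so that
  \<open>K\<close> is the \<open>p\<close>-th power of the operator bound. The maximal function is a
  supremum over uncountably many radii, so a measurable minorant \<open>h\<close> of its
  \<open>p\<close>-th power is integrated in its place.\<close>

lemma sph_max_bounded_nn_integral:
  assumes bdd: "sph_max_bounded \<alpha> \<beta> p \<delta>" and p: "p > 1"
  obtains K where "K \<ge> 0"
    "\<And>f I h. f \<in> borel_measurable borel \<Longrightarrow> I \<ge> 0 \<Longrightarrow> h \<in> borel_measurable borel \<Longrightarrow>
      (\<integral>\<^sup>+x\<in>{0<..}. ennreal (x powr \<delta> * \<bar>f x\<bar> powr p) \<partial>lborel) \<le> ennreal I \<Longrightarrow>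
      (\<And>x. x > 0 \<Longrightarrow> h x \<le> ennreal_powr (sph_max \<alpha> \<beta> f x) p) \<Longrightarrow>
      (\<integral>\<^sup>+x\<in>{0<..}. ennreal (x powr \<delta>) * h x \<partial>lborel) \<le> ennreal (K * I)"
proof -
  from bdd obtain C where C: "C \<ge> 0" and le: "\<And>f. in_Lp p (power_measure \<delta>) f \<Longrightarrow>
        Lp_norm p (power_measure \<delta>) (sph_max \<alpha> \<beta> f) \<le> ennreal C * Lp_norm p (power_measure \<delta>) (\<lambda>x. ennreal \<bar>f x\<bar>)"
    unfolding sph_max_bounded_def by blast
  show ?thesis
  proof (rule that[of "C powr p"])
    fix f :: "real \<Rightarrow> real" and I :: real and h :: "real \<Rightarrow> ennreal"
    assume f[measurable]: "f \<in> borel_measurable borel" and I: "I \<ge> 0" and h: "h \<in> borel_measurable borel"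
      and int: "(\<integral>\<^sup>+x\<in>{0<..}. ennreal (x powr \<delta> * \<bar>f x\<bar> powr p) \<partial>lborel) \<le> ennreal I"
      and hle: "\<And>x. x > 0 \<Longrightarrow> h x \<le> ennreal_powr (sph_max \<alpha> \<beta> f x) p"
    have "(\<integral>\<^sup>+x. ennreal_powr (ennreal \<bar>f x\<bar>) p \<partial>power_measure \<delta>) = (\<integral>\<^sup>+x. ennreal (\<bar>f x\<bar> powr p) \<partial>power_measure \<delta>)"
      by (simp add: ennreal_powr_ennreal)
    also have "\<dots> = (\<integral>\<^sup>+x\<in>{0<..}. ennreal (x powr \<delta> * \<bar>f x\<bar> powr p) \<partial>lborel)"
      by (subst nn_integral_power_measure) (simp_all add: ennreal_mult)
    finally have "(\<integral>\<^sup>+x. ennreal_powr (ennreal \<bar>f x\<bar>) p \<partial>power_measure \<delta>) \<le> ennreal I" using int by simp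
    from ennreal_powr_mono[OF this, of "1 / p"] have N: "Lp_norm p (power_measure \<delta>) (\<lambda>x. ennreal \<bar>f x\<bar>) \<le> ennreal (I powr (1 / p))"
      using p I by (simp add: Lp_norm_def ennreal_powr_ennreal)
    then have "in_Lp p (power_measure \<delta>) f"
      unfolding in_Lp_def using borel_measurable_power_measure[OF f] by (auto simp: less_top[symmetric] top_unique)
    from le[OF this] have "Lp_norm p (power_measure \<delta>) (sph_max \<alpha> \<beta> f) \<le> ennreal C * ennreal (I powr (1 / p))"
      using N by (meson mult_left_mono order_trans zero_le)
    then have "ennreal_powr (\<integral>\<^sup>+x. ennreal_powr (sph_max \<alpha> \<beta> f x) p \<partial>power_measure \<delta>) (1 / p) \<le> ennreal (C * I powr (1 / p))"
      using C by (simp add: Lp_norm_def ennreal_mult)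
    then have "(\<integral>\<^sup>+x. ennreal_powr (sph_max \<alpha> \<beta> f x) p \<partial>power_measure \<delta>) \<le> ennreal ((C * I powr (1 / p)) powr p)"
      using p C by (intro ennreal_powr_inverse_le) auto
    also have "(C * I powr (1 / p)) powr p = C powr p * I"
      using C I p by (simp add: powr_mult powr_powr)
    finally have "(\<integral>\<^sup>+x. ennreal_powr (sph_max \<alpha> \<beta> f x) p \<partial>power_measure \<delta>) \<le> ennreal (C powr p * I)" .
    with nn_integral_power_measure_le[OF h hle]
    show "(\<integral>\<^sup>+x\<in>{0<..}. ennreal (x powr \<delta>) * h x \<partial>lborel) \<le> ennreal (C powr p * I)" by (rule order_trans)
  qed simp
qed

lemma sph_max_ge: "t > 0 \<Longrightarrow> ennreal \<bar>sph_mean \<alpha> \<beta> t f x\<bar> \<le> sph_max \<alpha> \<beta> f x"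
  unfolding sph_max_def by (rule SUP_upper) simp

context spherical_kernel
begin

definition mean :: "real \<Rightarrow> (real \<Rightarrow> real) \<Rightarrow> real \<Rightarrow> real" where
  "mean t f x = (LINT z:{0<..}|lborel. ker t x z * (z powr (2 * \<alpha> + 1) * f z))"

definition freq :: "nat \<Rightarrow> real \<Rightarrow> real \<Rightarrow> real" where
  "freq m t x = (LINT y:{0<..}|lborel. bessel_J (\<alpha> + \<beta>) (t * y) * bessel_J \<alpha> (x * y) * y powr (1 - \<beta>) * ghat \<alpha> m y)"

lemma ker_section_measurable [measurable]: "ker t x \<in> borel_measurable borel"
  using measurable_compose[OF measurable_Pair1'[of x borel borel] ker_measurable[of t]] by simp

text \<open>For each \<open>t\<close> and \<open>x\<close> the two kernels can differ only at three
  points \<open>z\<close>, which form a null set. The means therefore agree at every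
  \<open>x > 0\<close>, and the arbitrary values of the original kernel disappear.\<close>

lemma sph_mean_eq_mean:
  assumes "t > 0" "x > 0" and f: "f \<in> borel_measurable borel"
  shows "sph_mean \<alpha> \<beta> t f x = mean t f x"
proof -
  let ?X = "{t + x, x - t, t - x} \<inter> {0<..}"
  have "sph_mean \<alpha> \<beta> t f x = (\<integral>z. ker t x z * f z \<partial>power_measure (2 * \<alpha> + 1))"
    unfolding sph_mean_def
  proof (rule integral_discrete_difference[of ?X])
    fix z assume z: "z \<in> space (power_measure (2 * \<alpha> + 1))" "z \<notin> ?X"
    then show "sph_kernel \<alpha> \<beta> t x z * f z = ker t x z * f z"
      using trunc_tendsto(3)[OF assms(1,2), of z] by (simp add: space_power_measure)
  qed (auto simp: emeasure_power_measure_singleton sets_power_measure sets_restrict_space intro!: image_eqI[where x="{_}"])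
  also have "\<dots> = mean t f x"
    unfolding mean_def using f by (subst integral_power_measure) (auto simp: mult_ac)
  finally show ?thesis .
qed

lemma freq_integrand_le:
  obtains G :: real where "G > 0" "\<And>t x y. t > 0 \<Longrightarrow> x > 0 \<Longrightarrow> y > 0 \<Longrightarrow>
    \<bar>bessel_J (\<alpha> + \<beta>) (t * y) * bessel_J \<alpha> (x * y) * y powr (1 - \<beta>) * ghat \<alpha> m y\<bar>
    \<le> t powr (\<alpha> + \<beta>) * (1 + t) * (x powr \<alpha> * (1 + x)) * (G * (y powr (2 * \<alpha> + 1) * (1 + y) ^ 2 * exp (- (1 / (4 * (1 + real m))) * y\<^sup>2)))"
proof -
  obtain G where G: "G > 0" "\<And>y. \<bar>ghat \<alpha> m y\<bar> \<le> G * exp (- (1 / (4 * (1 + real m))) * y\<^sup>2)" using ghat_bound by blast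
  show ?thesis
  proof (rule that[of "C ^ 2 * G"])
    show "C ^ 2 * G > 0" using C G by simp
    fix t x y :: real assume *: "t > 0" "x > 0" "y > 0"
    have "\<bar>bessel_J (\<alpha> + \<beta>) (t * y) * bessel_J \<alpha> (x * y) * y powr (1 - \<beta>) * ghat \<alpha> m y\<bar>
      = \<bar>bessel_J (\<alpha> + \<beta>) (t * y)\<bar> * \<bar>bessel_J \<alpha> (x * y)\<bar> * y powr (1 - \<beta>) * \<bar>ghat \<alpha> m y\<bar>" by (simp add: abs_mult)
    also have "\<dots> \<le> (C * t powr (\<alpha> + \<beta>) * (1 + t) * (y powr (\<alpha> + \<beta>) * (1 + y))) * (C * x powr \<alpha> * (1 + x) * (y powr \<alpha> * (1 + y)))
      * y powr (1 - \<beta>) * (G * exp (- (1 / (4 * (1 + real m))) * y\<^sup>2))"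
      using * C G by (intro mult_mono bessel_le_dilate G) auto
    also have "\<dots> = t powr (\<alpha> + \<beta>) * (1 + t) * (x powr \<alpha> * (1 + x)) * (C ^ 2 * G * ((y powr (\<alpha> + \<beta>) * y powr \<alpha> * y powr (1 - \<beta>)) * (1 + y) ^ 2 * exp (- (1 / (4 * (1 + real m))) * y\<^sup>2)))"
      by (simp add: power2_eq_square mult_ac)
    also have "y powr (\<alpha> + \<beta>) * y powr \<alpha> * y powr (1 - \<beta>) = y powr (2 * \<alpha> + 1)"
      unfolding powr_add[symmetric] by (simp add: algebra_simps)
    finally show "\<bar>bessel_J (\<alpha> + \<beta>) (t * y) * bessel_J \<alpha> (x * y) * y powr (1 - \<beta>) * ghat \<alpha> m y\<bar>
      \<le> t powr (\<alpha> + \<beta>) * (1 + t) * (x powr \<alpha> * (1 + x)) * (C ^ 2 * G * (y powr (2 * \<alpha> + 1) * (1 + y) ^ 2 * exp (- (1 / (4 * (1 + real m))) * y\<^sup>2)))" .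
  qed
qed

lemma freq_set_integrable:
  assumes "t > 0" "x > 0"
  shows "set_integrable lborel {0<..} (\<lambda>y. bessel_J (\<alpha> + \<beta>) (t * y) * bessel_J \<alpha> (x * y) * y powr (1 - \<beta>) * ghat \<alpha> m y)"
proof -
  obtain G where G: "\<And>t x y. t > 0 \<Longrightarrow> x > 0 \<Longrightarrow> y > 0 \<Longrightarrow>
    \<bar>bessel_J (\<alpha> + \<beta>) (t * y) * bessel_J \<alpha> (x * y) * y powr (1 - \<beta>) * ghat \<alpha> m y\<bar>
    \<le> t powr (\<alpha> + \<beta>) * (1 + t) * (x powr \<alpha> * (1 + x)) * (G * (y powr (2 * \<alpha> + 1) * (1 + y) ^ 2 * exp (- (1 / (4 * (1 + real m))) * y\<^sup>2)))"
    by (rule freq_integrand_le) (rule that; simp)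
  show ?thesis
  proof (rule set_integrable_lborel_bound)
    show "set_integrable lborel {0<..} (\<lambda>y. t powr (\<alpha> + \<beta>) * (1 + t) * (x powr \<alpha> * (1 + x)) * (G * (y powr (2 * \<alpha> + 1) * (1 + y) ^ 2 * exp (- (1 / (4 * (1 + real m))) * y\<^sup>2))))"
      using \<alpha> by (intro set_integrable_mult_right gaussian_poly_set_integrable) auto
  qed (use G assms in auto)
qed

text \<open>A Parseval identity: the mean of the test function equals its frequency integral. It
  holds for the truncated kernel by \<open>trunc_fubini\<close>. As the cutoff grows, the left side
  converges by the majorant of \<open>trunc_bound\<close>, and the right side because the Gaussian
  decay of \<open>ghat\<close> makes the frequency integral absolutely convergent.\<close>

lemma mean_gtest:
  assumes t: "t > 0" and x: "x > 0" and m: "m \<ge> 1"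
  shows "set_integrable lborel {0<..} (\<lambda>z. ker t x z * (z powr (2 * \<alpha> + 1) * gtest m z))"
    "mean t (gtest m) x = 2 powr (\<alpha> + \<beta>) * Gamma (\<alpha> + \<beta> + 1) / (t powr (\<alpha> + \<beta>) * x powr \<alpha>) * freq m t x"
proof -
  obtain M where M: "M > 0" and le: "\<And>x z R. 0 < x \<Longrightarrow> 0 < z \<Longrightarrow> 1 \<le> R \<Longrightarrow> z \<noteq> t + x \<Longrightarrow> z \<noteq> x - t \<Longrightarrow> z \<noteq> t - x \<Longrightarrow>
    \<bar>trunc t x z R\<bar> \<le> M * (Q x * Q z * sing t x z)" using trunc_bound[OF t] by blast
  obtain W where W: "W > 0" and wb: "\<And>z. z > 0 \<Longrightarrow> z powr (\<alpha> + 1) * Q z * gtest m z \<le> W * exp (- (z\<^sup>2 / 2))"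
    using weight_bound[OF m] by blast
  obtain S where sint: "\<And>t x. set_integrable lborel {0<..} (\<lambda>z. exp (- (z\<^sup>2 / 2)) * sing t x z)"
    by (rule sing_integral) (rule that; simp)
  define k where "k = 2 powr (\<alpha> + \<beta>) * Gamma (\<alpha> + \<beta> + 1) / (t powr (\<alpha> + \<beta>) * x powr \<alpha>)"
  define L where "L z = lim (\<lambda>n. trunc t x z (real n))" for z
  define w where "w z = z powr (\<alpha> + 1) * gtest m z" for z
  \<comment> \<open>The cutoff is \<open>Suc n\<close> because the uniform bound on the truncated
    kernel requires \<open>R \<ge> 1\<close>.\<close>
  define F where "F n z = indicator {0<..} z *\<^sub>R (trunc t x z (real (Suc n)) * w z)" for n z
  define D where "D z = M * Q x * W * (indicator {0<..} z *\<^sub>R (exp (- (z\<^sup>2 / 2)) * sing t x z))" for z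
  have w_meas [measurable]: "w \<in> borel_measurable borel" unfolding w_def[abs_def] by measurable
  have tr_meas [measurable]: "(\<lambda>z. trunc t x z R) \<in> borel_measurable borel" for R
    using measurable_compose[OF measurable_Pair1'[of x borel borel] trunc_measurable[of t R]] by simp
  have L_meas [measurable]: "L \<in> borel_measurable borel" unfolding L_def[abs_def] by measurable
  have D_int: "integrable lborel D"
    using sint[of t x] unfolding D_def[abs_def] set_integrable_def by (rule integrable_mult_right)
  have conv: "AE z in lborel. (\<lambda>n. F n z) \<longlonglongrightarrow> indicator {0<..} z *\<^sub>R (L z * w z)"
    using AE_not_exceptional[of t x]
  proof eventually_elim
    case (elim z)
    show ?case
    proof (cases "z > 0")
      case True
      have "(\<lambda>n. trunc t x z (real n)) \<longlonglongrightarrow> L z" unfolding L_def using elim True t x by (intro trunc_tendsto(2)) auto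
      then have "(\<lambda>n. trunc t x z (real (Suc n))) \<longlonglongrightarrow> L z" by (rule LIMSEQ_Suc)
      then show ?thesis unfolding F_def by (intro tendsto_intros)
    qed (simp add: F_def)
  qed
  have dom: "AE z in lborel. norm (F n z) \<le> D z" for n
    using AE_not_exceptional[of t x]
  proof eventually_elim
    case (elim z)
    show ?case
    proof (cases "z > 0")
      case True
      have "\<bar>trunc t x z (real (Suc n))\<bar> * w z \<le> M * (Q x * Q z * sing t x z) * w z"
        using elim True x gtest_nonneg[of m z] by (intro mult_right_mono le) (auto simp: w_def)
      also have "\<dots> = M * Q x * sing t x z * (z powr (\<alpha> + 1) * Q z * gtest m z)" by (simp add: w_def mult_ac)
      also have "\<dots> \<le> M * Q x * sing t x z * (W * exp (- (z\<^sup>2 / 2)))"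
        using M Q_pos[OF x] sing_pos[of t x z] by (intro mult_left_mono wb True) auto
      finally show ?thesis using True gtest_nonneg[of m z] by (simp add: F_def D_def w_def abs_mult mult_ac)
    qed (simp add: F_def D_def)
  qed
  have dct: "integrable lborel (\<lambda>z. indicator {0<..} z *\<^sub>R (L z * w z))"
    "(\<lambda>n. \<integral>z. F n z \<partial>lborel) \<longlonglongrightarrow> (\<integral>z. indicator {0<..} z *\<^sub>R (L z * w z) \<partial>lborel)"
    by (rule integrable_dominated_convergence[OF _ _ D_int conv dom] integral_dominated_convergence[OF _ _ D_int conv dom];
        (unfold F_def[abs_def])?, measurable)+
  have kL: "ker t x z * (z powr (2 * \<alpha> + 1) * gtest m z) = k * (L z * w z)" if "z > 0" for z
  proof -
    have "z powr (2 * \<alpha> + 1) = z powr \<alpha> * z powr (\<alpha> + 1)" unfolding powr_add[symmetric] by (simp add: algebra_simps)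
    then show ?thesis using that x t unfolding ker_def k_def L_def w_def by (simp add: powr_mult)
  qed
  have "set_integrable lborel {0<..} (\<lambda>z. k * (L z * w z))"
    using dct(1) unfolding set_integrable_def[symmetric] by simp
  then show "set_integrable lborel {0<..} (\<lambda>z. ker t x z * (z powr (2 * \<alpha> + 1) * gtest m z))"
    by (subst set_integrable_cong[OF refl refl kL]) auto
  let ?g = "\<lambda>y. bessel_J (\<alpha> + \<beta>) (t * y) * bessel_J \<alpha> (x * y) * y powr (1 - \<beta>) * ghat \<alpha> m y"
  have "(\<integral>z. F n z \<partial>lborel) = (\<integral>y. indicator {..real (Suc n)} y *\<^sub>R (indicator {0<..} y *\<^sub>R ?g y) \<partial>lborel)" for n
  proof -
    have "(\<integral>z. F n z \<partial>lborel) = (LINT y:{0<..real (Suc n)}|lborel. ?g y)"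
      unfolding F_def w_def set_lebesgue_integral_def[symmetric] by (rule trunc_fubini[OF t x])
    also have "\<dots> = (\<integral>y. indicator {..real (Suc n)} y *\<^sub>R (indicator {0<..} y *\<^sub>R ?g y) \<partial>lborel)"
      unfolding set_lebesgue_integral_def by (intro Bochner_Integration.integral_cong) (auto simp: indicator_def)
    finally show ?thesis .
  qed
  moreover have "(\<lambda>n. \<integral>y. indicator {..real (Suc n)} y *\<^sub>R (indicator {0<..} y *\<^sub>R ?g y) \<partial>lborel) \<longlonglongrightarrow> freq m t x"
  proof -
    have "((\<lambda>R. \<integral>y. indicator {..R} y *\<^sub>R (indicator {0<..} y *\<^sub>R ?g y) \<partial>lborel) \<longlongrightarrow> (\<integral>y. indicator {0<..} y *\<^sub>R ?g y \<partial>lborel)) at_top"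
      using freq_set_integrable[OF t x, of m] by (intro tendsto_integral_at_top) (auto simp: set_integrable_def)
    from LIMSEQ_Suc[OF filterlim_compose[OF this filterlim_real_sequentially]] show ?thesis
      unfolding freq_def set_lebesgue_integral_def .
  qed
  ultimately have "(\<integral>z. indicator {0<..} z *\<^sub>R (L z * w z) \<partial>lborel) = freq m t x"
    using dct(2) by (simp add: LIMSEQ_unique)
  then have Lw: "(LINT z:{0<..}|lborel. L z * w z) = freq m t x" by (simp add: set_lebesgue_integral_def)
  have "mean t (gtest m) x = (LINT z:{0<..}|lborel. k * (L z * w z))"
    unfolding mean_def by (rule set_lborel_integral_cong) (auto simp: kL)
  then show "mean t (gtest m) x = k * freq m t x" unfolding Lw[symmetric] by simp
qed

end

subsection \<open>Test functions near zero\<close>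

lemma nn_integral_inverse_Icc:
  assumes "0 < a" "a \<le> b"
  shows "(\<integral>\<^sup>+x\<in>{a..b}. ennreal (1 / x) \<partial>lborel) = ennreal (ln (b / a))"
proof -
  have "(\<integral>\<^sup>+x. ennreal (1 / x) * indicator {a..b} x \<partial>lborel) = ennreal (ln b - ln a)"
    using assms by (intro nn_integral_FTC_Icc) (auto intro!: derivative_eq_intros)
  then show ?thesis using assms by (simp add: ln_div)
qed

lemma log_unbounded:
  fixes b k K :: real
  assumes "b > 0" "k > 0"
  obtains a where "0 < a" "a \<le> b" "K < k * ln (b / a)"
proof
  define l where "l = (\<bar>K\<bar> + 1) / k"
  have l: "l > 0" unfolding l_def using assms by (intro divide_pos_pos) auto
  show "0 < b * exp (- l)" using assms by simp
  show "b * exp (- l) \<le> b" using assms l by simp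
  have "ln (b / (b * exp (- l))) = l" using assms by (simp add: ln_div)
  then show "K < k * ln (b / (b * exp (- l)))" using assms unfolding l_def by simp
qed

text \<open>How the critical exponents are excluded: a logarithmic length \<open>l\<close> appears
  linearly in a pairing or a mean, but only to the power \<open>1 / p\<close> in a norm.\<close>

lemma linear_not_le_powr:
  fixes a b c p l0 :: real
  assumes "c > 0" "p > 1" and le: "\<And>l. l \<ge> l0 \<Longrightarrow> c * l \<le> a + b * l powr (1 / p)"
  shows False
proof -
  have "((\<lambda>l. a * (1 / l) + b * l powr (1 / p - 1)) \<longlongrightarrow> a * 0 + b * 0) at_top"
    using assms by (intro tendsto_intros tendsto_neg_powr filterlim_ident tendsto_divide_0[OF tendsto_const] filterlim_at_top_imp_at_infinity)
      (auto simp: field_simps)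
  then have "\<forall>\<^sub>F l in at_top. a * (1 / l) + b * l powr (1 / p - 1) < c"
    by (rule order_tendstoD(2)) (use assms in simp)
  then have "\<forall>\<^sub>F l in at_top. a * (1 / l) + b * l powr (1 / p - 1) < c \<and> l \<ge> l0 \<and> l > 0"
    using eventually_ge_at_top[of l0] eventually_gt_at_top[of 0] by eventually_elim simp
  then obtain l where l: "a * (1 / l) + b * l powr (1 / p - 1) < c" "l \<ge> l0" "l > 0"
    using eventually_happens'[OF trivial_limit_at_top_linorder] by blast
  have "l * (a * (1 / l) + b * l powr (1 / p - 1)) < l * c" using l by (intro mult_strict_left_mono) auto
  moreover have "l * (a * (1 / l) + b * l powr (1 / p - 1)) = a + b * l powr (1 / p)"
    using l(3) by (simp add: powr_diff algebra_simps)
  ultimately show False using le[OF l(2)] by (simp add: mult.commute)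
qed

lemma set_integral_indicator_subset:
  fixes h :: "real \<Rightarrow> real"
  assumes "B \<subseteq> A"
  shows "set_integrable lborel A (\<lambda>x. indicator B x * h x) \<longleftrightarrow> set_integrable lborel B h"
    "(LINT x:A|lborel. indicator B x * h x) = (LINT x:B|lborel. h x)"
proof -
  have eq: "indicator A x *\<^sub>R (indicator B x * h x) = indicator B x *\<^sub>R h x" for x
    using assms by (auto simp: indicator_def)
  show "set_integrable lborel A (\<lambda>x. indicator B x * h x) \<longleftrightarrow> set_integrable lborel B h"
    "(LINT x:A|lborel. indicator B x * h x) = (LINT x:B|lborel. h x)"
    unfolding set_integrable_def set_lebesgue_integral_def eq by simp_all
qed

lemma mult_le_add_powr_conjugate:
  fixes x y p :: real
  assumes "x \<ge> 0" "y \<ge> 0" "p > 1"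
  shows "x * y \<le> x powr p + y powr (p / (p - 1))"
proof -
  define q where "q = p / (p - 1)"
  have q: "q > 1" "1 / p + 1 / q = 1" unfolding q_def using assms by (auto simp: field_simps)
  have "x * y \<le> x powr p / p + y powr q / q" by (intro Youngs_inequality q assms)
  also have "\<dots> \<le> x powr p / 1 + y powr q / 1"
    using assms q by (intro add_mono divide_left_mono) auto
  finally show ?thesis by (simp add: q_def)
qed

lemma gtest_powr_set_integrable:
  fixes a r :: real
  assumes r: "r > 0" and a: "a + 2 * real m * r > -1"
  shows "set_integrable lborel {0<..} (\<lambda>x. x powr a * gtest m x powr r)"
proof (rule set_integrable_lborel_bound)
  show "set_integrable lborel {0<..} (\<lambda>x. x powr (a + 2 * real m * r) * exp (- r * x\<^sup>2))"
    using assms by (intro gaussian_moment)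
  fix x :: real assume "x \<in> {0<..}"
  then have x: "x > 0" by simp
  have "gtest m x powr r \<le> (x ^ (2 * m) * exp (- x\<^sup>2)) powr r"
    using r gtest_nonneg gtest_le by (intro powr_mono2) auto
  also have "\<dots> = x powr (2 * real m * r) * exp (- r * x\<^sup>2)"
  proof -
    have "x ^ (2 * m) = x powr (2 * real m)" using x powr_realpow[of x "2 * m"] by simp
    then show ?thesis using x by (simp add: powr_mult powr_powr exp_powr_real mult_ac)
  qed
  finally have "x powr a * gtest m x powr r \<le> x powr a * (x powr (2 * real m * r) * exp (- r * x\<^sup>2))"
    by (intro mult_left_mono) auto
  then show "\<bar>x powr a * gtest m x powr r\<bar> \<le> x powr (a + 2 * real m * r) * exp (- r * x\<^sup>2)"
    by (simp add: powr_add mult_ac)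
qed auto

context spherical_kernel
begin

text \<open>The limit of \<open>x powr - \<alpha> * freq m t x\<close> as \<open>x\<close> tends to \<open>0\<close>.\<close>

definition freq0 :: "nat \<Rightarrow> real \<Rightarrow> real" where
  "freq0 m t = (LINT y:{0<..}|lborel. bessel_J (\<alpha> + \<beta>) (t * y) * (y / 2) powr \<alpha> * rGamma (\<alpha> + 1) * y powr (1 - \<beta>) * ghat \<alpha> m y)"

text \<open>Otherwise all coefficients of a power series vanish; they are nonzero multiples of the even
  moments of \<open>ghat\<close>, which do not vanish eventually.\<close>

lemma freq0_nonzero:
  obtains t where "t > 0" "freq0 m t \<noteq> 0"
proof (rule ccontr)
  assume "\<not> thesis"
  then have z: "freq0 m t = 0" if "t > 0" for t using that \<open>\<And>t. 0 < t \<Longrightarrow> freq0 m t \<noteq> 0 \<Longrightarrow> thesis\<close> by blast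
  have \<nu>': "\<alpha> + \<beta> > -1" using \<nu> by simp
  define w where "w y = y powr (2 * \<alpha> + 1) * ghat \<alpha> m y" for y
  define mom where "mom k = (LINT y:{0<..}|lborel. y powr (2 * real k + 2 * \<alpha> + 1) * ghat \<alpha> m y)" for k :: nat
  obtain G where G: "G > 0" "\<And>y. \<bar>ghat \<alpha> m y\<bar> \<le> G * exp (- (1 / (4 * (1 + real m))) * y\<^sup>2)" using ghat_bound by blast
  define c where "c = 1 / (4 * (1 + real m))"
  have c: "c > 0" unfolding c_def by simp
  \<comment> \<open>The rate \<open>c / 2\<close> is half of the Gaussian decay rate
    \<open>c\<close> of \<open>ghat\<close>. For \<open>v < 1\<close> the majorant of the series
    then leaves an integrable Gaussian.\<close>
  obtain K where K: "\<And>k. \<bar>bessel_coeff (\<alpha> + \<beta>) k\<bar> \<le> K * (c / 2) ^ k / fact k"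
    using bessel_coeff_bound[OF \<nu>', of "c / 2"] c by auto
  have sums0: "(\<lambda>k. (bessel_coeff (\<alpha> + \<beta>) k * mom k) * v ^ k) sums 0" if v: "0 < v" "v < 1" for v
  proof -
    define Y where "Y y = v * y\<^sup>2" for y :: real
    have "(\<lambda>k. bessel_coeff (\<alpha> + \<beta>) k * (LINT y:{0<..}|lborel. Y y ^ k * w y)) sums (LINT y:{0<..}|lborel. (\<Sum>k. bessel_coeff (\<alpha> + \<beta>) k * Y y ^ k) * w y)"
    proof (rule integral_power_series_termwise[OF K])
      show "set_integrable lborel {0<..} (\<lambda>y. exp (c / 2 * Y y) * \<bar>w y\<bar>)"
      proof (rule set_integrable_lborel_bound)
        show "set_integrable lborel {0<..} (\<lambda>y. G * (y powr (2 * \<alpha> + 1) * exp (- (c / 2) * y\<^sup>2)))"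
          using \<alpha> c by (intro set_integrable_mult_right gaussian_moment) auto
        fix y :: real assume "y \<in> {0<..}"
        have "c / 2 * Y y \<le> c / 2 * y\<^sup>2" unfolding Y_def using v c by (intro mult_left_mono) (auto intro: mult_left_le_one_le)
        then have "exp (c / 2 * Y y) * \<bar>w y\<bar> \<le> exp (c / 2 * y\<^sup>2) * (y powr (2 * \<alpha> + 1) * (G * exp (- c * y\<^sup>2)))"
          unfolding w_def abs_mult using G(2)[of y] c_def by (intro mult_mono) auto
        also have "\<dots> = G * (y powr (2 * \<alpha> + 1) * (exp (c / 2 * y\<^sup>2) * exp (- c * y\<^sup>2)))" by (simp add: mult_ac)
        also have "exp (c / 2 * y\<^sup>2) * exp (- c * y\<^sup>2) = exp (- (c / 2) * y\<^sup>2)" by (simp add: exp_add[symmetric])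
        finally show "\<bar>exp (c / 2 * Y y) * \<bar>w y\<bar>\<bar> \<le> G * (y powr (2 * \<alpha> + 1) * exp (- (c / 2) * y\<^sup>2))" by (simp add: abs_mult)
      qed (auto simp: Y_def w_def[abs_def])
    qed (use c v in \<open>auto simp: Y_def w_def[abs_def]\<close>)
    moreover have "(LINT y:{0<..}|lborel. Y y ^ k * w y) = mom k * v ^ k" for k
    proof -
      have "(LINT y:{0<..}|lborel. Y y ^ k * w y) = (LINT y:{0<..}|lborel. v ^ k * (y powr (2 * real k + 2 * \<alpha> + 1) * ghat \<alpha> m y))"
      proof (rule set_lborel_integral_cong)
        fix y :: real assume "y \<in> {0<..}"
        then have "y powr (2 * real k + 2 * \<alpha> + 1) = (y\<^sup>2) ^ k * y powr (2 * \<alpha> + 1)"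
          using powr_add[of y "2 * real k" "2 * \<alpha> + 1"] powr_realpow[of y "2 * k"] by (simp add: power_mult add_ac)
        then show "Y y ^ k * w y = v ^ k * (y powr (2 * real k + 2 * \<alpha> + 1) * ghat \<alpha> m y)"
          by (simp add: Y_def w_def power_mult_distrib)
      qed simp
      then show ?thesis by (simp add: mom_def)
    qed
    moreover have "(LINT y:{0<..}|lborel. (\<Sum>k. bessel_coeff (\<alpha> + \<beta>) k * Y y ^ k) * w y) = 0"
    proof -
      \<comment> \<open>The entire factor of the Bessel function depends on
        \<open>(t * y / 2)\<^sup>2 = v * y\<^sup>2\<close>, so the natural power series variable is
        \<open>v = (t / 2)\<^sup>2\<close>.\<close>
      define t where "t = 2 * sqrt v"
      have t: "t > 0" using v by (simp add: t_def)
      define k where "k = (t / 2) powr (\<alpha> + \<beta>) * ((1 / 2) powr \<alpha> * rGamma (\<alpha> + 1))"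
      have k: "k > 0" unfolding k_def using t \<alpha> by (intro mult_pos_pos rGamma_pos) auto
      have "freq0 m t = (LINT y:{0<..}|lborel. k * ((\<Sum>k. bessel_coeff (\<alpha> + \<beta>) k * Y y ^ k) * w y))"
        unfolding freq0_def
      proof (rule set_lborel_integral_cong)
        fix y :: real assume "y \<in> {0<..}"
        then have y: "y > 0" by simp
        have 1: "bessel_J (\<alpha> + \<beta>) (t * y) = (t / 2) powr (\<alpha> + \<beta>) * y powr (\<alpha> + \<beta>) * (\<Sum>k. bessel_coeff (\<alpha> + \<beta>) k * Y y ^ k)"
          using t y v powr_mult[of "t / 2" y "\<alpha> + \<beta>"] by (simp add: bessel_J_eq_series[OF \<nu>'] bessel_series_def Y_def t_def power_mult_distrib)
        have 2: "(y / 2) powr \<alpha> = (1 / 2) powr \<alpha> * y powr \<alpha>" using y powr_mult[of "1 / 2" y \<alpha>] by simp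
        have "y powr (\<alpha> + \<beta>) * y powr \<alpha> * y powr (1 - \<beta>) = y powr (2 * \<alpha> + 1)"
          unfolding powr_add[symmetric] by (simp add: algebra_simps)
        then show "bessel_J (\<alpha> + \<beta>) (t * y) * (y / 2) powr \<alpha> * rGamma (\<alpha> + 1) * y powr (1 - \<beta>) * ghat \<alpha> m y
          = k * ((\<Sum>k. bessel_coeff (\<alpha> + \<beta>) k * Y y ^ k) * w y)"
          unfolding 1 2 k_def w_def by (simp add: mult_ac)
      qed simp
      then show ?thesis using z[OF t] k by simp
    qed
    ultimately show ?thesis by (simp add: mult_ac)
  qed
  have "mom k = 0" for k
    using power_series_zero_coeffs[of 1 "\<lambda>k. bessel_coeff (\<alpha> + \<beta>) k * mom k" k] sums0 bessel_coeff_nonzero[OF \<nu>', of k] by simp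
  moreover obtain r0 where r0: "\<And>r. r \<ge> r0 \<Longrightarrow> (LINT y:{0<..}|lborel. y powr r * ghat \<alpha> m y) \<noteq> 0"
    using ghat_moment_nonzero by blast
  have "2 * real (nat \<lceil>\<bar>r0\<bar> + 1\<rceil>) + 2 * \<alpha> + 1 \<ge> r0" using \<alpha> by linarith
  from r0[OF this] have "mom (nat \<lceil>\<bar>r0\<bar> + 1\<rceil>) \<noteq> 0" unfolding mom_def .
  ultimately show False by simp
qed

text \<open>On the frequency side \<open>x powr - \<alpha> * bessel_J \<alpha> (x * y)\<close> tends
  to \<open>(y / 2) powr \<alpha> * rGamma (\<alpha> + 1)\<close>. For \<open>x < 1\<close> the
  growth estimate of the Bessel function together with the Gaussian bound on \<open>ghat\<close>
  gives a majorant independent of \<open>x\<close>.\<close>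

lemma mean_gtest_near_0:
  assumes t: "t > 0" and m: "m \<ge> 1"
  shows "((\<lambda>x. mean t (gtest m) x) \<longlongrightarrow> 2 powr (\<alpha> + \<beta>) * Gamma (\<alpha> + \<beta> + 1) / t powr (\<alpha> + \<beta>) * freq0 m t) (at_right 0)"
proof (rule tendsto_at_right_sequentially[of 0 1])
  fix X :: "nat \<Rightarrow> real"
  assume X: "\<And>n. 0 < X n" "\<And>n. X n < 1" "decseq X" "X \<longlonglongrightarrow> 0"
  obtain G where G: "G > 0" "\<And>t x y. t > 0 \<Longrightarrow> x > 0 \<Longrightarrow> y > 0 \<Longrightarrow>
    \<bar>bessel_J (\<alpha> + \<beta>) (t * y) * bessel_J \<alpha> (x * y) * y powr (1 - \<beta>) * ghat \<alpha> m y\<bar>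
    \<le> t powr (\<alpha> + \<beta>) * (1 + t) * (x powr \<alpha> * (1 + x)) * (G * (y powr (2 * \<alpha> + 1) * (1 + y) ^ 2 * exp (- (1 / (4 * (1 + real m))) * y\<^sup>2)))"
    by (rule freq_integrand_le) (rule that; simp)
  define s where "s n y = indicator {0<..} y *\<^sub>R (X n powr - \<alpha> * (bessel_J (\<alpha> + \<beta>) (t * y) * bessel_J \<alpha> (X n * y) * y powr (1 - \<beta>) * ghat \<alpha> m y))" for n y
  define l where "l y = indicator {0<..} y *\<^sub>R (bessel_J (\<alpha> + \<beta>) (t * y) * (y / 2) powr \<alpha> * rGamma (\<alpha> + 1) * y powr (1 - \<beta>) * ghat \<alpha> m y)" for y
  define D where "D y = t powr (\<alpha> + \<beta>) * (1 + t) * 2 * G * (indicator {0<..} y *\<^sub>R (y powr (2 * \<alpha> + 1) * (1 + y) ^ 2 * exp (- (1 / (4 * (1 + real m))) * y\<^sup>2)))" for y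
  have "(\<lambda>n. \<integral>y. s n y \<partial>lborel) \<longlonglongrightarrow> (\<integral>y. l y \<partial>lborel)"
  proof (rule integral_dominated_convergence)
    have "set_integrable lborel {0<..} (\<lambda>y. y powr (2 * \<alpha> + 1) * (1 + y) ^ 2 * exp (- (1 / (4 * (1 + real m))) * y\<^sup>2))"
      using \<alpha> by (intro gaussian_poly_set_integrable) auto
    then show "integrable lborel D" unfolding D_def[abs_def] set_integrable_def by (rule integrable_mult_right)
    show "AE y in lborel. norm (s n y) \<le> D y" for n
    proof (intro AE_I2)
      fix y
      show "norm (s n y) \<le> D y"
      proof (cases "y > 0")
        case True
        have "X n powr - \<alpha> * \<bar>bessel_J (\<alpha> + \<beta>) (t * y) * bessel_J \<alpha> (X n * y) * y powr (1 - \<beta>) * ghat \<alpha> m y\<bar>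
          \<le> X n powr - \<alpha> * (t powr (\<alpha> + \<beta>) * (1 + t) * (X n powr \<alpha> * (1 + X n)) * (G * (y powr (2 * \<alpha> + 1) * (1 + y) ^ 2 * exp (- (1 / (4 * (1 + real m))) * y\<^sup>2))))"
          by (intro mult_left_mono G(2) t X(1) True) auto
        also have "\<dots> = (X n powr - \<alpha> * X n powr \<alpha>) * (t powr (\<alpha> + \<beta>) * (1 + t) * (1 + X n) * (G * (y powr (2 * \<alpha> + 1) * (1 + y) ^ 2 * exp (- (1 / (4 * (1 + real m))) * y\<^sup>2))))"
          by (simp add: mult_ac)
        also have "X n powr - \<alpha> * X n powr \<alpha> = 1" using X(1)[of n] by (simp add: powr_add[symmetric])
        also have "1 * (t powr (\<alpha> + \<beta>) * (1 + t) * (1 + X n) * (G * (y powr (2 * \<alpha> + 1) * (1 + y) ^ 2 * exp (- (1 / (4 * (1 + real m))) * y\<^sup>2))))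
          \<le> 1 * (t powr (\<alpha> + \<beta>) * (1 + t) * 2 * (G * (y powr (2 * \<alpha> + 1) * (1 + y) ^ 2 * exp (- (1 / (4 * (1 + real m))) * y\<^sup>2))))"
          using t G(1) X(2)[of n] by (intro mult_left_mono mult_right_mono) auto
        finally show ?thesis using True by (simp add: s_def D_def abs_mult mult_ac)
      qed (simp add: s_def D_def)
    qed
    show "AE y in lborel. (\<lambda>n. s n y) \<longlonglongrightarrow> l y"
    proof (intro AE_I2)
      fix y
      show "(\<lambda>n. s n y) \<longlonglongrightarrow> l y"
      proof (cases "y > 0")
        case True
        have "X n powr - \<alpha> * bessel_J \<alpha> (X n * y) = (y / 2) powr \<alpha> * bessel_series \<alpha> ((X n * y / 2)\<^sup>2)" for n
        proof -
          have "(X n * y / 2) powr \<alpha> = X n powr \<alpha> * (y / 2) powr \<alpha>"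
            using X(1)[of n] True powr_mult[of "X n" "y / 2" \<alpha>] by simp
          moreover have "X n powr - \<alpha> * X n powr \<alpha> = 1" using X(1)[of n] by (simp add: powr_add[symmetric])
          ultimately show ?thesis using X(1)[of n] True by (simp add: bessel_J_eq_series[OF \<alpha>] mult.assoc[symmetric])
        qed
        moreover have "(\<lambda>n. bessel_series \<alpha> ((X n * y / 2)\<^sup>2)) \<longlonglongrightarrow> bessel_series \<alpha> ((0 * y / 2)\<^sup>2)"
          by (intro isCont_tendsto_compose[OF continuous_bessel_series[OF \<alpha>]] tendsto_intros X(4)) auto
        ultimately have "(\<lambda>n. X n powr - \<alpha> * bessel_J \<alpha> (X n * y)) \<longlonglongrightarrow> (y / 2) powr \<alpha> * rGamma (\<alpha> + 1)"
          by (simp add: bessel_series_0 tendsto_mult_left)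
        then have "(\<lambda>n. bessel_J (\<alpha> + \<beta>) (t * y) * (X n powr - \<alpha> * bessel_J \<alpha> (X n * y)) * y powr (1 - \<beta>) * ghat \<alpha> m y)
          \<longlonglongrightarrow> bessel_J (\<alpha> + \<beta>) (t * y) * ((y / 2) powr \<alpha> * rGamma (\<alpha> + 1)) * y powr (1 - \<beta>) * ghat \<alpha> m y"
          by (rule tendsto_mult[OF tendsto_mult[OF tendsto_mult[OF tendsto_const] tendsto_const] tendsto_const])
        then show ?thesis using True by (simp add: s_def l_def mult_ac)
      qed (simp add: s_def l_def)
    qed
  qed (auto simp: s_def[abs_def] l_def[abs_def])
  moreover have "(\<integral>y. s n y \<partial>lborel) = X n powr - \<alpha> * freq m t (X n)" for n
  proof -
    have "(\<integral>y. s n y \<partial>lborel) = (LINT y:{0<..}|lborel. X n powr - \<alpha> * (bessel_J (\<alpha> + \<beta>) (t * y) * bessel_J \<alpha> (X n * y) * y powr (1 - \<beta>) * ghat \<alpha> m y))"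
      unfolding s_def set_lebesgue_integral_def ..
    then show ?thesis unfolding freq_def by simp
  qed
  moreover have "(\<integral>y. l y \<partial>lborel) = freq0 m t" unfolding l_def freq0_def set_lebesgue_integral_def ..
  ultimately have "(\<lambda>n. X n powr - \<alpha> * freq m t (X n)) \<longlonglongrightarrow> freq0 m t" by simp
  then have "(\<lambda>n. 2 powr (\<alpha> + \<beta>) * Gamma (\<alpha> + \<beta> + 1) / t powr (\<alpha> + \<beta>) * (X n powr - \<alpha> * freq m t (X n)))
    \<longlonglongrightarrow> 2 powr (\<alpha> + \<beta>) * Gamma (\<alpha> + \<beta> + 1) / t powr (\<alpha> + \<beta>) * freq0 m t" by (rule tendsto_mult_left)
  moreover have "2 powr (\<alpha> + \<beta>) * Gamma (\<alpha> + \<beta> + 1) / t powr (\<alpha> + \<beta>) * (X n powr - \<alpha> * freq m t (X n)) = mean t (gtest m) (X n)" for n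
    using mean_gtest(2)[OF t X(1)[of n] m] by (simp add: powr_minus divide_inverse mult_ac)
  ultimately show "(\<lambda>n. mean t (gtest m) (X n)) \<longlonglongrightarrow> 2 powr (\<alpha> + \<beta>) * Gamma (\<alpha> + \<beta> + 1) / t powr (\<alpha> + \<beta>) * freq0 m t" by simp
qed simp

text \<open>The sign \<sigma> is that of the limit at 0. It is kept instead of an absolute value
  because the dual argument inserts it into a test function, so that the pairing has no
  cancellation.\<close>

lemma mean_gtest_lower_near_0:
  assumes m: "m \<ge> 1"
  obtains t \<sigma> c x0 where "t > 0" "\<bar>\<sigma>\<bar> = 1" "c > 0" "0 < x0" "x0 \<le> 1"
    "\<And>x. 0 < x \<Longrightarrow> x \<le> x0 \<Longrightarrow> c \<le> \<sigma> * mean t (gtest m) x"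
proof -
  obtain t where t: "t > 0" "freq0 m t \<noteq> 0" using freq0_nonzero by blast
  define L where "L = 2 powr (\<alpha> + \<beta>) * Gamma (\<alpha> + \<beta> + 1) / t powr (\<alpha> + \<beta>) * freq0 m t"
  have "Gamma (\<alpha> + \<beta> + 1) > 0" using \<nu> by (intro Gamma_real_pos) simp
  then have L: "L \<noteq> 0" unfolding L_def using t by simp
  define \<sigma> where "\<sigma> = sgn L"
  have \<sigma>: "\<bar>\<sigma>\<bar> = 1" "\<sigma> * L = \<bar>L\<bar>" unfolding \<sigma>_def using L by (auto simp: abs_sgn mult.commute sgn_mult_self_eq abs_mult)
  have "((\<lambda>x. \<sigma> * mean t (gtest m) x) \<longlongrightarrow> \<sigma> * L) (at_right 0)"
    unfolding L_def by (intro tendsto_mult_left mean_gtest_near_0 t m)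
  then have "\<forall>\<^sub>F x in at_right 0. \<bar>L\<bar> / 2 < \<sigma> * mean t (gtest m) x"
    by (rule order_tendstoD(1)) (use L \<sigma> in simp)
  then obtain b where b: "b > 0" "\<And>x. 0 < x \<Longrightarrow> x < b \<Longrightarrow> \<bar>L\<bar> / 2 < \<sigma> * mean t (gtest m) x"
    by (auto simp: eventually_at_right_field)
  show ?thesis
  proof (rule that[of t \<sigma> "\<bar>L\<bar> / 2" "min 1 (b / 2)"])
    fix x assume "0 < x" "x \<le> min 1 (b / 2)"
    then have "x < b" using b(1) by auto
    then show "\<bar>L\<bar> / 2 \<le> \<sigma> * mean t (gtest m) x" using b(2)[of x] \<open>0 < x\<close> by simp
  qed (use t \<sigma> L b in auto)
qed


section \<open>Duality through the symmetry of the kernel\<close>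

lemma mean_measurable [measurable]:
  assumes [measurable]: "f \<in> borel_measurable borel"
  shows "mean t f \<in> borel_measurable borel"
  unfolding mean_def[abs_def] set_lebesgue_integral_def using ker_measurable[of t] by measurable

text \<open>Fubini together with \<open>ker_commute\<close>. The weight in the assumption on
  \<open>f\<close> is the density \<open>x powr (2 * \<alpha> + 1)\<close> times the factor
  \<open>x powr - \<alpha> * Q x\<close> of the kernel bound; the integral over \<open>z\<close> of
  what remains is bounded uniformly in \<open>x\<close> by \<open>sing_integral\<close>.\<close>

lemma mean_pairing:
  assumes t: "t > 0" and m: "m \<ge> 1" and f [measurable]: "f \<in> borel_measurable borel"
    and int: "set_integrable lborel {0<..} (\<lambda>x. x powr (\<alpha> + 1) * Q x * \<bar>f x\<bar>)"
  shows "set_integrable lborel {0<..} (\<lambda>z. z powr (2 * \<alpha> + 1) * gtest m z * mean t f z)"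
    "(LINT z:{0<..}|lborel. z powr (2 * \<alpha> + 1) * gtest m z * mean t f z)
      = (LINT x:{0<..}|lborel. x powr (2 * \<alpha> + 1) * f x * mean t (gtest m) x)"
    "set_integrable lborel {0<..} (\<lambda>x. x powr (2 * \<alpha> + 1) * f x * mean t (gtest m) x)"
proof -
  obtain M where M: "M > 0" and le: "\<And>x z. 0 < x \<Longrightarrow> 0 < z \<Longrightarrow> z \<noteq> t + x \<Longrightarrow> z \<noteq> x - t \<Longrightarrow> z \<noteq> t - x \<Longrightarrow>
    \<bar>ker t x z\<bar> \<le> M * (x powr - \<alpha> * Q x * (z powr - \<alpha> * Q z) * sing t x z)" using ker_bound[OF t] by blast
  obtain W where W: "W > 0" and wb: "\<And>z. z > 0 \<Longrightarrow> z powr (\<alpha> + 1) * Q z * gtest m z \<le> W * exp (- (z\<^sup>2 / 2))"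
    using weight_bound[OF m] by blast
  obtain S where S: "S > 0" "\<And>t x. set_integrable lborel {0<..} (\<lambda>z. exp (- (z\<^sup>2 / 2)) * sing t x z)"
    "\<And>t x. (LINT z:{0<..}|lborel. exp (- (z\<^sup>2 / 2)) * sing t x z) \<le> S"
    by (rule sing_integral) (rule that; simp)
  have km [measurable]: "(\<lambda>(x, z). ker t x z) \<in> borel_measurable (borel \<Otimes>\<^sub>M borel)" by (rule ker_measurable)
  define h where "h x z = (indicator {0<..} x * (x powr (2 * \<alpha> + 1) * f x)) * (ker t x z * (indicator {0<..} z * (z powr (2 * \<alpha> + 1) * gtest m z)))" for x z
  define P where "P x = indicator {0<..} x * (M * W * (x powr (\<alpha> + 1) * Q x * \<bar>f x\<bar>))" for x
  define E where "E x z = indicator {0<..} z * (exp (- (z\<^sup>2 / 2)) * sing t x z)" for x z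
  have h_meas: "case_prod h \<in> borel_measurable (borel \<Otimes>\<^sub>M borel)"
    unfolding h_def[abs_def] split_beta' by measurable
  have P_int: "integrable lborel P"
    using set_integrable_mult_right[OF int, of "M * W"] unfolding P_def[abs_def] set_integrable_def by simp
  have E_int: "integrable lborel (E x)" "(\<integral>z. E x z \<partial>lborel) \<le> S" for x
    using S(2,3)[of t x] unfolding E_def[abs_def] set_integrable_def set_lebesgue_integral_def by simp_all
  have P0: "P x \<ge> 0" for x
    unfolding P_def using M W Q_pos[of x] by (cases "x > 0") auto
  have hPE: "AE z in lborel. \<bar>h x z\<bar> \<le> P x * E x z" for x
    using AE_not_exceptional[of t x]
  proof eventually_elim
    case (elim z)
    show ?case
    proof (cases "x > 0 \<and> z > 0")
      case True
      then have xz: "x > 0" "z > 0" by auto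
      have "\<bar>h x z\<bar> = (x powr (2 * \<alpha> + 1) * \<bar>f x\<bar>) * (\<bar>ker t x z\<bar> * (z powr (2 * \<alpha> + 1) * gtest m z))"
        unfolding h_def using xz gtest_nonneg[of m z] by (simp add: abs_mult)
      also have "\<dots> \<le> (x powr (2 * \<alpha> + 1) * \<bar>f x\<bar>) * (M * (x powr - \<alpha> * Q x * (z powr - \<alpha> * Q z) * sing t x z) * (z powr (2 * \<alpha> + 1) * gtest m z))"
        using elim xz gtest_nonneg[of m z] by (intro mult_left_mono mult_right_mono le) auto
      also have "\<dots> = M * ((x powr (2 * \<alpha> + 1) * x powr - \<alpha>) * Q x * \<bar>f x\<bar>) * sing t x z * ((z powr (2 * \<alpha> + 1) * z powr - \<alpha>) * Q z * gtest m z)"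
        by (simp add: mult_ac)
      also have "x powr (2 * \<alpha> + 1) * x powr - \<alpha> = x powr (\<alpha> + 1)" unfolding powr_add[symmetric] by (simp add: algebra_simps)
      also have "z powr (2 * \<alpha> + 1) * z powr - \<alpha> = z powr (\<alpha> + 1)" unfolding powr_add[symmetric] by (simp add: algebra_simps)
      also have "M * (x powr (\<alpha> + 1) * Q x * \<bar>f x\<bar>) * sing t x z * (z powr (\<alpha> + 1) * Q z * gtest m z)
        \<le> M * (x powr (\<alpha> + 1) * Q x * \<bar>f x\<bar>) * sing t x z * (W * exp (- (z\<^sup>2 / 2)))"
        using M Q_pos[OF xz(1)] sing_pos[of t x z] by (intro mult_left_mono wb xz mult_nonneg_nonneg) auto
      also have "\<dots> = P x * E x z" unfolding P_def E_def using xz by (simp add: mult_ac)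
      finally show ?thesis .
    qed (auto simp: h_def P_def E_def)
  qed
  have h_sec: "integrable lborel (h x)" for x
  proof (rule Bochner_Integration.integrable_bound)
    show "integrable lborel (\<lambda>z. P x * E x z)" by (intro integrable_mult_right E_int)
    show "h x \<in> borel_measurable lborel" using measurable_compose[OF measurable_Pair1'[of x borel borel] h_meas] by simp
    show "AE z in lborel. norm (h x z) \<le> norm (P x * E x z)" using hPE[of x] by eventually_elim simp
  qed
  have h_int: "integrable (lborel \<Otimes>\<^sub>M lborel) (case_prod h)"
  proof (rule lborel_pair.Fubini_integrable)
    show "case_prod h \<in> borel_measurable (lborel \<Otimes>\<^sub>M lborel)" using h_meas by (simp cong: measurable_cong_sets)
    show "AE x in lborel. integrable lborel (\<lambda>y. case (x, y) of (x, y) \<Rightarrow> h x y)" using h_sec by simp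
    show "integrable lborel (\<lambda>x. \<integral>y. norm (case (x, y) of (x, y) \<Rightarrow> h x y) \<partial>lborel)"
    proof (rule Bochner_Integration.integrable_bound)
      show "integrable lborel (\<lambda>x. S * P x)" by (intro integrable_mult_right P_int)
      show "(\<lambda>x. \<integral>y. norm (case (x, y) of (x, y) \<Rightarrow> h x y) \<partial>lborel) \<in> borel_measurable lborel"
        using h_meas by measurable
      show "AE x in lborel. norm (\<integral>y. norm (case (x, y) of (x, y) \<Rightarrow> h x y) \<partial>lborel) \<le> norm (S * P x)"
      proof (intro AE_I2)
        fix x
        have "(\<integral>y. norm (h x y) \<partial>lborel) \<le> (\<integral>y. P x * E x y \<partial>lborel)"
          using hPE[of x] h_sec[of x] E_int(1)[of x] by (intro integral_mono_AE) auto
        also have "\<dots> = P x * (\<integral>y. E x y \<partial>lborel)" by simp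
        also have "\<dots> \<le> P x * S" by (intro mult_left_mono E_int P0)
        finally show "norm (\<integral>y. norm (case (x, y) of (x, y) \<Rightarrow> h x y) \<partial>lborel) \<le> norm (S * P x)"
          using P0[of x] S(1) by (simp add: mult.commute)
      qed
    qed
  qed
  have inner_z: "(\<integral>z. h x z \<partial>lborel) = indicator {0<..} x *\<^sub>R (x powr (2 * \<alpha> + 1) * f x * mean t (gtest m) x)" for x
  proof -
    have "(\<integral>z. h x z \<partial>lborel) = (indicator {0<..} x * (x powr (2 * \<alpha> + 1) * f x)) * (\<integral>z. ker t x z * (indicator {0<..} z * (z powr (2 * \<alpha> + 1) * gtest m z)) \<partial>lborel)"
      unfolding h_def by (rule integral_mult_right_zero)
    also have "(\<integral>z. ker t x z * (indicator {0<..} z * (z powr (2 * \<alpha> + 1) * gtest m z)) \<partial>lborel) = mean t (gtest m) x"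
      unfolding mean_def set_lebesgue_integral_def by (simp add: mult_ac)
    finally show ?thesis by simp
  qed
  have inner_x: "(\<integral>x. h x z \<partial>lborel) = indicator {0<..} z *\<^sub>R (z powr (2 * \<alpha> + 1) * gtest m z * mean t f z)" for z
  proof -
    have "(\<integral>x. h x z \<partial>lborel) = (\<integral>x. (indicator {0<..} z * (z powr (2 * \<alpha> + 1) * gtest m z)) * (indicator {0<..} x *\<^sub>R (ker t z x * (x powr (2 * \<alpha> + 1) * f x))) \<partial>lborel)"
      unfolding h_def by (simp add: mult_ac ker_commute[of t _ z])
    also have "\<dots> = (indicator {0<..} z * (z powr (2 * \<alpha> + 1) * gtest m z)) * mean t f z"
      unfolding mean_def set_lebesgue_integral_def by (rule integral_mult_right_zero)
    finally show ?thesis by simp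
  qed
  show "set_integrable lborel {0<..} (\<lambda>z. z powr (2 * \<alpha> + 1) * gtest m z * mean t f z)"
    using lborel_pair.integrable_snd[OF h_int] unfolding inner_x set_integrable_def .
  show "(LINT z:{0<..}|lborel. z powr (2 * \<alpha> + 1) * gtest m z * mean t f z)
      = (LINT x:{0<..}|lborel. x powr (2 * \<alpha> + 1) * f x * mean t (gtest m) x)"
    using lborel_pair.Fubini_integral[OF h_int] unfolding inner_x inner_z set_lebesgue_integral_def .
  show "set_integrable lborel {0<..} (\<lambda>x. x powr (2 * \<alpha> + 1) * f x * mean t (gtest m) x)"
    using lborel_pair.integrable_fst[OF h_int] unfolding inner_z set_integrable_def .
qed

text \<open>The pairing moves the mean from the test function to \<open>f\<close>, where boundedness applies.\<close>

lemma dual_estimate: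
  assumes bdd: "sph_max_bounded \<alpha> \<beta> p \<delta>" and p: "p > 1" and m: "m \<ge> 1"
    and m_large: "\<delta> + (2 * \<alpha> + 1 - \<delta>) * (p / (p - 1)) + 2 * real m * (p / (p - 1)) > -1"
  obtains K where "K \<ge> 0" "\<And>t f N. t > 0 \<Longrightarrow> f \<in> borel_measurable borel \<Longrightarrow>
    set_integrable lborel {0<..} (\<lambda>x. x powr (\<alpha> + 1) * Q x * \<bar>f x\<bar>) \<Longrightarrow> N > 0 \<Longrightarrow>
    (\<integral>\<^sup>+x\<in>{0<..}. ennreal (x powr \<delta> * \<bar>f x\<bar> powr p) \<partial>lborel) \<le> ennreal (N powr p) \<Longrightarrow>
    (LINT x:{0<..}|lborel. x powr (2 * \<alpha> + 1) * f x * mean t (gtest m) x) \<le> K * N"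
proof -
  define q where "q = p / (p - 1)"
  have q: "q > 0" unfolding q_def using p by simp
  obtain K where K: "K \<ge> 0" and Kle: "\<And>f I h. f \<in> borel_measurable borel \<Longrightarrow> I \<ge> 0 \<Longrightarrow> h \<in> borel_measurable borel \<Longrightarrow>
      (\<integral>\<^sup>+x\<in>{0<..}. ennreal (x powr \<delta> * \<bar>f x\<bar> powr p) \<partial>lborel) \<le> ennreal I \<Longrightarrow>
      (\<And>x. x > 0 \<Longrightarrow> h x \<le> ennreal_powr (sph_max \<alpha> \<beta> f x) p) \<Longrightarrow>
      (\<integral>\<^sup>+x\<in>{0<..}. ennreal (x powr \<delta>) * h x \<partial>lborel) \<le> ennreal (K * I)"
    by (rule sph_max_bounded_nn_integral[OF bdd p]) (rule that; blast)
  \<comment> \<open>\<open>G\<close> is the test function expressed relative to the measure with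
    density \<open>z powr \<delta>\<close>. The assumption \<open>m_large\<close> says that it
    belongs to the dual space with exponent \<open>q\<close>, and its norm enters through
    \<open>J\<close>.\<close>
  define G where "G z = z powr (2 * \<alpha> + 1 - \<delta>) * gtest m z" for z
  have G_meas [measurable]: "G \<in> borel_measurable borel" unfolding G_def[abs_def] by measurable
  have zG: "z powr \<delta> * G z powr q = z powr (\<delta> + (2 * \<alpha> + 1 - \<delta>) * q) * gtest m z powr q" if "z > 0" for z
    using that gtest_nonneg[of m z] by (simp add: G_def powr_mult powr_powr powr_add)
  have Gint: "set_integrable lborel {0<..} (\<lambda>z. z powr \<delta> * G z powr q)"
  proof -
    have "set_integrable lborel {0<..} (\<lambda>z. z powr (\<delta> + (2 * \<alpha> + 1 - \<delta>) * q) * gtest m z powr q)"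
      using m_large q unfolding q_def by (intro gtest_powr_set_integrable) (auto simp: q_def)
    then show ?thesis by (subst set_integrable_cong[OF refl refl zG]) auto
  qed
  define J where "J = (LINT z:{0<..}|lborel. z powr \<delta> * G z powr q)"
  have J0: "J \<ge> 0" unfolding J_def set_lebesgue_integral_def by (intro Bochner_Integration.integral_nonneg) auto
  have J: "(\<integral>\<^sup>+z\<in>{0<..}. ennreal (z powr \<delta> * G z powr q) \<partial>lborel) = ennreal J"
  proof -
    have "(\<integral>\<^sup>+z. ennreal (indicator {0<..} z *\<^sub>R (z powr \<delta> * G z powr q)) \<partial>lborel) = ennreal J"
      unfolding J_def set_lebesgue_integral_def using Gint[unfolded set_integrable_def] by (intro nn_integral_eq_integral) auto
    moreover have "(\<integral>\<^sup>+z. ennreal (indicator {0<..} z *\<^sub>R (z powr \<delta> * G z powr q)) \<partial>lborel) = (\<integral>\<^sup>+z\<in>{0<..}. ennreal (z powr \<delta> * G z powr q) \<partial>lborel)"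
      by (intro nn_integral_cong) (auto simp: indicator_def)
    ultimately show ?thesis by simp
  qed
  show ?thesis
  proof (rule that[of "K + J"])
    show "K + J \<ge> 0" using K J0 by simp
    fix t N :: real and f :: "real \<Rightarrow> real"
    assume t: "t > 0" and f [measurable]: "f \<in> borel_measurable borel"
      and int: "set_integrable lborel {0<..} (\<lambda>x. x powr (\<alpha> + 1) * Q x * \<bar>f x\<bar>)" and N: "N > 0"
      and fN: "(\<integral>\<^sup>+x\<in>{0<..}. ennreal (x powr \<delta> * \<bar>f x\<bar> powr p) \<partial>lborel) \<le> ennreal (N powr p)"
    have "(\<integral>\<^sup>+x\<in>{0<..}. ennreal (x powr \<delta>) * ennreal (\<bar>mean t f x\<bar> powr p) \<partial>lborel) \<le> ennreal (K * N powr p)"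
    proof (rule Kle[OF f _ _ fN])
      fix x :: real assume x: "x > 0"
      have "ennreal_powr (ennreal \<bar>mean t f x\<bar>) p \<le> ennreal_powr (sph_max \<alpha> \<beta> f x) p"
        using sph_max_ge[OF t, of \<alpha> \<beta> f x] p unfolding sph_mean_eq_mean[OF t x f] by (intro ennreal_powr_mono) auto
      then show "ennreal (\<bar>mean t f x\<bar> powr p) \<le> ennreal_powr (sph_max \<alpha> \<beta> f x) p" by (simp add: ennreal_powr_ennreal)
    qed auto
    note mf = this
    \<comment> \<open>Young's inequality after normalising the mean by \<open>N\<close> takes the
      place of Hoelder's inequality. Both resulting integrals are of order \<open>N\<close>: the
      first because \<open>N powr (1 - p)\<close> meets the bound
      \<open>K * N powr p\<close>.\<close>
    have pw: "\<bar>z powr (2 * \<alpha> + 1) * gtest m z * mean t f z\<bar> \<le> N powr (1 - p) * (z powr \<delta> * \<bar>mean t f z\<bar> powr p) + N * (z powr \<delta> * G z powr q)"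
      if z: "z > 0" for z
    proof -
      have G0: "G z \<ge> 0" unfolding G_def using gtest_nonneg[of m z] by simp
      have "\<bar>z powr (2 * \<alpha> + 1) * gtest m z * mean t f z\<bar> = N * z powr \<delta> * (\<bar>mean t f z\<bar> / N * G z)"
      proof -
        have "z powr (2 * \<alpha> + 1) = z powr \<delta> * z powr (2 * \<alpha> + 1 - \<delta>)" unfolding powr_add[symmetric] by simp
        then show ?thesis using N gtest_nonneg[of m z] by (simp add: G_def abs_mult)
      qed
      also have "\<dots> \<le> N * z powr \<delta> * ((\<bar>mean t f z\<bar> / N) powr p + G z powr q)"
        unfolding q_def using N p G0 by (intro mult_left_mono mult_le_add_powr_conjugate) auto
      also have "(\<bar>mean t f z\<bar> / N) powr p = \<bar>mean t f z\<bar> powr p / N powr p" using N by (simp add: powr_divide)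
      also have "N * z powr \<delta> * (\<bar>mean t f z\<bar> powr p / N powr p + G z powr q) = (N / N powr p) * (z powr \<delta> * \<bar>mean t f z\<bar> powr p) + N * (z powr \<delta> * G z powr q)"
        by (simp add: algebra_simps)
      also have "N / N powr p = N powr (1 - p)" using N by (simp add: powr_diff)
      finally show ?thesis .
    qed
    have eq: "(LINT x:{0<..}|lborel. x powr (2 * \<alpha> + 1) * f x * mean t (gtest m) x) = (LINT z:{0<..}|lborel. z powr (2 * \<alpha> + 1) * gtest m z * mean t f z)"
      by (rule mean_pairing(2)[OF t m f int, symmetric])
    have "ennreal (LINT z:{0<..}|lborel. z powr (2 * \<alpha> + 1) * gtest m z * mean t f z) \<le> ennreal (norm (LINT z:{0<..}|lborel. z powr (2 * \<alpha> + 1) * gtest m z * mean t f z))"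
      by (intro ennreal_leI) simp
    also have "\<dots> \<le> (\<integral>\<^sup>+z. ennreal (norm (indicator {0<..} z *\<^sub>R (z powr (2 * \<alpha> + 1) * gtest m z * mean t f z))) \<partial>lborel)"
      unfolding set_lebesgue_integral_def
      using mean_pairing(1)[OF t m f int] by (intro integral_norm_bound_ennreal) (simp add: set_integrable_def)
    also have "\<dots> \<le> (\<integral>\<^sup>+z. ennreal (N powr (1 - p)) * (ennreal (z powr \<delta>) * ennreal (\<bar>mean t f z\<bar> powr p) * indicator {0<..} z)
        + ennreal N * (ennreal (z powr \<delta> * G z powr q) * indicator {0<..} z) \<partial>lborel)"
    proof (rule nn_integral_mono)
      fix z
      show "ennreal (norm (indicator {0<..} z *\<^sub>R (z powr (2 * \<alpha> + 1) * gtest m z * mean t f z)))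
        \<le> ennreal (N powr (1 - p)) * (ennreal (z powr \<delta>) * ennreal (\<bar>mean t f z\<bar> powr p) * indicator {0<..} z)
        + ennreal N * (ennreal (z powr \<delta> * G z powr q) * indicator {0<..} z)"
      proof (cases "z > 0")
        case True
        then show ?thesis using ennreal_leI[OF pw[OF True]] N
          by (simp add: ennreal_mult[symmetric] ennreal_plus[symmetric] del: ennreal_plus)
      qed simp
    qed
    also have "\<dots> = ennreal (N powr (1 - p)) * (\<integral>\<^sup>+z\<in>{0<..}. ennreal (z powr \<delta>) * ennreal (\<bar>mean t f z\<bar> powr p) \<partial>lborel)
        + ennreal N * (\<integral>\<^sup>+z\<in>{0<..}. ennreal (z powr \<delta> * G z powr q) \<partial>lborel)"
      by (subst nn_integral_add; (subst nn_integral_cmult)?; (subst nn_integral_cmult)?; simp?; measurable)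
    also have "\<dots> \<le> ennreal (N powr (1 - p)) * ennreal (K * N powr p) + ennreal N * ennreal J"
      unfolding J by (intro add_mono mult_left_mono mf) auto
    also have "\<dots> = ennreal (N powr (1 - p) * (K * N powr p) + N * J)"
      using N K J0 by (simp add: ennreal_mult[symmetric] ennreal_plus[symmetric] del: ennreal_plus)
    also have "N powr (1 - p) * (K * N powr p) + N * J = (K + J) * N"
    proof -
      have "N powr (1 - p) * N powr p = N" unfolding powr_add[symmetric] using N by simp
      then show ?thesis by (simp add: algebra_simps)
    qed
    finally show "(LINT x:{0<..}|lborel. x powr (2 * \<alpha> + 1) * f x * mean t (gtest m) x) \<le> (K + J) * N"
      unfolding eq using N K J0 by (subst (asm) ennreal_le_iff) auto
  qed
qed


section \<open>Conditions forced by the behaviour near the origin\<close>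

lemma exists_large_nat_multiple:
  fixes a r :: real
  assumes "r > 0"
  obtains m0 where "m0 \<ge> 1" "\<And>m. m \<ge> m0 \<Longrightarrow> a + 2 * real m * r > -1"
proof (rule that[of "nat \<lceil>\<bar>a\<bar> / r\<rceil> + 1"])
  fix m assume "m \<ge> nat \<lceil>\<bar>a\<bar> / r\<rceil> + 1"
  then have "\<bar>a\<bar> / r \<le> real m" by linarith
  then have "\<bar>a\<bar> \<le> real m * r" using assms by (simp add: field_simps)
  moreover have "0 \<le> real m * r" using assms by simp
  ultimately show "a + 2 * real m * r > -1" by linarith
qed simp

lemma gtest_norm_finite:
  assumes "r > 0" "a + 2 * real m * r > -1"
  obtains I where "I \<ge> 0" "(\<integral>\<^sup>+x\<in>{0<..}. ennreal (x powr a * \<bar>gtest m x\<bar> powr r) \<partial>lborel) \<le> ennreal I"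
proof -
  define I where "I = (LINT x:{0<..}|lborel. x powr a * gtest m x powr r)"
  have "(\<integral>\<^sup>+x. ennreal (indicator {0<..} x *\<^sub>R (x powr a * gtest m x powr r)) \<partial>lborel) = ennreal I"
    unfolding I_def set_lebesgue_integral_def
    using gtest_powr_set_integrable[OF assms, unfolded set_integrable_def] by (intro nn_integral_eq_integral) auto
  moreover have "(\<integral>\<^sup>+x. ennreal (indicator {0<..} x *\<^sub>R (x powr a * gtest m x powr r)) \<partial>lborel)
    = (\<integral>\<^sup>+x\<in>{0<..}. ennreal (x powr a * \<bar>gtest m x\<bar> powr r) \<partial>lborel)"
    using gtest_nonneg by (intro nn_integral_cong) (auto simp: indicator_def)
  moreover have "I \<ge> 0" unfolding I_def set_lebesgue_integral_def by (intro Bochner_Integration.integral_nonneg) auto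
  ultimately show ?thesis using that by simp
qed

text \<open>A minorant of size \<open>k / x\<close> on an interval contributes
  \<open>k * ln (b / a)\<close>. Intervals growing towards 0 or towards infinity make this
  unbounded, so the lemma serves at both ends of the half line.\<close>

lemma maximal_lower_bound_integral:
  assumes Kle: "(\<integral>\<^sup>+x\<in>{0<..}. ennreal (x powr \<delta>) * ennreal (indicator E x * h x) \<partial>lborel) \<le> ennreal I"
    and ab: "0 < a" "a \<le> b" "{a..b} \<subseteq> E" and k: "k \<ge> 0" "\<And>x. a \<le> x \<Longrightarrow> x \<le> b \<Longrightarrow> k / x \<le> x powr \<delta> * h x"
    and I: "I \<ge> 0"
  shows "k * ln (b / a) \<le> I"
proof -
  have "ennreal (k * ln (b / a)) = (\<integral>\<^sup>+x. ennreal k * (ennreal (1 / x) * indicator {a..b} x) \<partial>lborel)"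
    using nn_integral_inverse_Icc[OF ab(1,2)] k ab by (subst nn_integral_cmult) (auto simp: ennreal_mult)
  also have "\<dots> \<le> (\<integral>\<^sup>+x\<in>{0<..}. ennreal (x powr \<delta>) * ennreal (indicator E x * h x) \<partial>lborel)"
  proof (rule nn_integral_mono)
    fix x
    show "ennreal k * (ennreal (1 / x) * indicator {a..b} x) \<le> ennreal (x powr \<delta>) * ennreal (indicator E x * h x) * indicator {0<..} x"
    proof (cases "x \<in> {a..b}")
      case True
      then have x: "x > 0" "x \<in> E" using ab by auto
      have "ennreal (k / x) \<le> ennreal (x powr \<delta> * h x)" using True by (intro ennreal_leI k) auto
      then show ?thesis using True x k(1) by (simp add: ennreal_mult'[symmetric])
    qed simp
  qed
  also have "\<dots> \<le> ennreal I" by (rule Kle)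
  finally show ?thesis using I by simp
qed

text \<open>For one fixed radius the mean of the test function stays above a positive constant near
  0, so \<open>x powr \<delta>\<close> would have to be integrable there. If
  \<open>\<delta> + 1 \<le> 0\<close>, the integrand is at least a multiple of \<open>1 / x\<close>.
  A large \<open>m\<close> puts the test function into the space however negative \<delta>
  is.\<close>

lemma bounded_imp_delta_gt:
  assumes bdd: "sph_max_bounded \<alpha> \<beta> p \<delta>" and p: "p > 1"
  shows "\<delta> > -1"
proof (rule ccontr)
  assume "\<not> \<delta> > -1"
  then have \<delta>: "\<delta> + 1 \<le> 0" by simp
  have p0: "p > 0" using p by simp
  obtain m where m: "m \<ge> 1" "\<delta> + 2 * real m * p > -1"
    using exists_large_nat_multiple[OF p0, of \<delta>] by blast
  obtain I where I: "I \<ge> 0" "(\<integral>\<^sup>+x\<in>{0<..}. ennreal (x powr \<delta> * \<bar>gtest m x\<bar> powr p) \<partial>lborel) \<le> ennreal I"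
    using gtest_norm_finite[OF p0 m(2)] by blast
  obtain K where K: "K \<ge> 0" and Kle: "\<And>f I h. f \<in> borel_measurable borel \<Longrightarrow> I \<ge> 0 \<Longrightarrow> h \<in> borel_measurable borel \<Longrightarrow>
      (\<integral>\<^sup>+x\<in>{0<..}. ennreal (x powr \<delta> * \<bar>f x\<bar> powr p) \<partial>lborel) \<le> ennreal I \<Longrightarrow>
      (\<And>x. x > 0 \<Longrightarrow> h x \<le> ennreal_powr (sph_max \<alpha> \<beta> f x) p) \<Longrightarrow>
      (\<integral>\<^sup>+x\<in>{0<..}. ennreal (x powr \<delta>) * h x \<partial>lborel) \<le> ennreal (K * I)"
    by (rule sph_max_bounded_nn_integral[OF bdd p]) (rule that; blast)
  obtain t \<sigma> c x0 where t: "t > 0" and \<sigma>: "\<bar>\<sigma>\<bar> = 1" and c: "c > 0" and x0: "0 < x0" "x0 \<le> 1"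
    and low: "\<And>x. 0 < x \<Longrightarrow> x \<le> x0 \<Longrightarrow> c \<le> \<sigma> * mean t (gtest m) x"
    using mean_gtest_lower_near_0[OF m(1)] by blast
  have *: "(\<integral>\<^sup>+x\<in>{0<..}. ennreal (x powr \<delta>) * ennreal (indicator {0<..x0} x * c powr p) \<partial>lborel) \<le> ennreal (K * I)"
  proof (rule Kle[OF gtest_measurable I(1) _ I(2)])
    fix x :: real assume x: "x > 0"
    show "ennreal (indicator {0<..x0} x * c powr p) \<le> ennreal_powr (sph_max \<alpha> \<beta> (gtest m) x) p"
    proof (cases "x \<le> x0")
      case True
      have "c \<le> \<bar>mean t (gtest m) x\<bar>" using low[OF x True] \<sigma> abs_ge_self[of "\<sigma> * mean t (gtest m) x"] by (simp add: abs_mult)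
      then have "ennreal_powr (ennreal c) p \<le> ennreal_powr (ennreal \<bar>mean t (gtest m) x\<bar>) p"
        using p0 by (intro ennreal_powr_mono ennreal_leI) auto
      also have "\<dots> \<le> ennreal_powr (sph_max \<alpha> \<beta> (gtest m) x) p"
        using sph_max_ge[OF t, of \<alpha> \<beta> "gtest m" x] p0 unfolding sph_mean_eq_mean[OF t x gtest_measurable] by (intro ennreal_powr_mono) auto
      finally show ?thesis using True x c by (simp add: ennreal_powr_ennreal)
    qed simp
  qed measurable
  define k where "k = x0 powr (\<delta> + 1) * c powr p"
  have k: "k > 0" unfolding k_def using x0 c by simp
  obtain a where a: "0 < a" "a \<le> x0" "K * I < k * ln (x0 / a)" using log_unbounded[OF x0(1) k] by blast
  have "k * ln (x0 / a) \<le> K * I"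
  proof (rule maximal_lower_bound_integral[OF *, of a x0])
    fix x assume x: "a \<le> x" "x \<le> x0"
    then have "x > 0" using a by simp
    have "x0 powr (\<delta> + 1) \<le> x powr (\<delta> + 1)" using \<delta> x \<open>x > 0\<close> by (intro powr_mono2') auto
    then have "k \<le> x powr (\<delta> + 1) * c powr p" unfolding k_def by (intro mult_right_mono) auto
    then show "k / x \<le> x powr \<delta> * c powr p" using \<open>x > 0\<close> by (simp add: powr_add field_simps)
  qed (use a k K I in auto)
  with a show False by simp
qed

text \<open>The pairing with \<open>f = x powr - (2 * \<alpha> + 2)\<close> on \<open>{a..x0}\<close> is at least \<open>c * ln (x0 / a)\<close>, while the norm
  of \<open>f\<close> is only \<open>O(ln (x0 / a) powr (1 / p))\<close>.\<close>

lemma bounded_imp_delta_lt: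
  assumes bdd: "sph_max_bounded \<alpha> \<beta> p \<delta>" and p: "p > 1"
  shows "\<delta> < (2 * \<alpha> + 2) * p - 1"
proof (rule ccontr)
  assume "\<not> \<delta> < (2 * \<alpha> + 2) * p - 1"
  \<comment> \<open>In this form the negated claim says that
    \<open>x powr \<delta> * \<bar>f x\<bar> powr p \<le> 1 / x\<close> on the unit interval, so the
    \<open>p\<close>-th power of the norm of \<open>f\<close> is at most the logarithm of the
    interval.\<close>
  then have \<delta>: "\<delta> + - (2 * \<alpha> + 2) * p \<ge> -1" by (simp add: algebra_simps)
  have q: "p / (p - 1) > 0" using p by simp
  obtain m where m: "m \<ge> 1" "\<delta> + (2 * \<alpha> + 1 - \<delta>) * (p / (p - 1)) + 2 * real m * (p / (p - 1)) > -1"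
    using exists_large_nat_multiple[OF q, of "\<delta> + (2 * \<alpha> + 1 - \<delta>) * (p / (p - 1))"] by blast
  obtain K where K: "K \<ge> 0" and Kle: "\<And>t f N. t > 0 \<Longrightarrow> f \<in> borel_measurable borel \<Longrightarrow>
    set_integrable lborel {0<..} (\<lambda>x. x powr (\<alpha> + 1) * Q x * \<bar>f x\<bar>) \<Longrightarrow> N > 0 \<Longrightarrow>
    (\<integral>\<^sup>+x\<in>{0<..}. ennreal (x powr \<delta> * \<bar>f x\<bar> powr p) \<partial>lborel) \<le> ennreal (N powr p) \<Longrightarrow>
    (LINT x:{0<..}|lborel. x powr (2 * \<alpha> + 1) * f x * mean t (gtest m) x) \<le> K * N"
    using dual_estimate[OF bdd p m] by blast
  obtain t \<sigma> c x0 where t: "t > 0" and \<sigma>: "\<bar>\<sigma>\<bar> = 1" and c: "c > 0" and x0: "0 < x0" "x0 \<le> 1"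
    and low: "\<And>x. 0 < x \<Longrightarrow> x \<le> x0 \<Longrightarrow> c \<le> \<sigma> * mean t (gtest m) x"
    using mean_gtest_lower_near_0[OF m(1)] by blast
  have "c * l \<le> 0 + K * l powr (1 / p)" if l: "l \<ge> 1" for l
  proof -
    define a where "a = x0 * exp (- l)"
    have a: "0 < a" "a \<le> x0" unfolding a_def using x0 l by auto
    have ln: "ln (x0 / a) = l" unfolding a_def using x0 by (simp add: ln_div)
    \<comment> \<open>The exponent is chosen so that
      \<open>x powr (2 * \<alpha> + 1) * \<bar>f x\<bar> = 1 / x\<close> on the interval, and
      \<sigma> makes the pairing with the mean at least \<open>c\<close> times the integral of
      \<open>1 / x\<close>.\<close>
    define f where "f x = indicator {a..x0} x * (\<sigma> * x powr - (2 * \<alpha> + 2))" for x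
    have sub: "{a..x0} \<subseteq> {0<..}" using a by auto
    have fm [measurable]: "f \<in> borel_measurable borel" unfolding f_def[abs_def] by measurable
    have "set_integrable lborel {0<..} (\<lambda>x. indicator {a..x0} x * (x powr (\<alpha> + 1) * Q x * x powr - (2 * \<alpha> + 2)))"
      unfolding set_integral_indicator_subset(1)[OF sub] Q_def using a
      by (intro set_integrable_continuous_Icc continuous_intros) auto
    moreover have "x powr (\<alpha> + 1) * Q x * \<bar>f x\<bar> = indicator {a..x0} x * (x powr (\<alpha> + 1) * Q x * x powr - (2 * \<alpha> + 2))" for x
      unfolding f_def by (simp add: abs_mult \<sigma>)
    ultimately have fi: "set_integrable lborel {0<..} (\<lambda>x. x powr (\<alpha> + 1) * Q x * \<bar>f x\<bar>)" by (simp only:)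
    have "(\<integral>\<^sup>+x\<in>{0<..}. ennreal (x powr \<delta> * \<bar>f x\<bar> powr p) \<partial>lborel) \<le> (\<integral>\<^sup>+x\<in>{a..x0}. ennreal (1 / x) \<partial>lborel)"
    proof (rule nn_integral_mono)
      fix x
      show "ennreal (x powr \<delta> * \<bar>f x\<bar> powr p) * indicator {0<..} x \<le> ennreal (1 / x) * indicator {a..x0} x"
      proof (cases "x \<in> {a..x0}")
        case True
        then have x: "x > 0" "x \<le> 1" using a x0 by auto
        have "x powr \<delta> * \<bar>f x\<bar> powr p = x powr (\<delta> + - (2 * \<alpha> + 2) * p)"
          using True x by (simp add: f_def abs_mult \<sigma> powr_powr powr_add[symmetric])
        also have "\<dots> \<le> x powr -1" using x \<delta> by (intro powr_mono') auto
        also have "\<dots> = 1 / x" using x by (simp add: powr_minus_divide)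
        finally show ?thesis using True x by (simp add: ennreal_leI)
      qed (use p in \<open>simp add: f_def\<close>)
    qed
    also have "\<dots> = ennreal ((l powr (1 / p)) powr p)"
      using nn_integral_inverse_Icc[OF a] ln l p by (simp add: powr_powr)
    finally have fN: "(\<integral>\<^sup>+x\<in>{0<..}. ennreal (x powr \<delta> * \<bar>f x\<bar> powr p) \<partial>lborel) \<le> ennreal ((l powr (1 / p)) powr p)" .
    have N: "l powr (1 / p) > 0" using l by simp
    have upper: "(LINT x:{0<..}|lborel. x powr (2 * \<alpha> + 1) * f x * mean t (gtest m) x) \<le> K * l powr (1 / p)"
      by (rule Kle[OF t fm fi N fN])
    have fx: "x powr (2 * \<alpha> + 1) * f x * mean t (gtest m) x = indicator {a..x0} x * (1 / x * (\<sigma> * mean t (gtest m) x))" if "x \<in> {0<..}" for x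
    proof -
      have "x powr (2 * \<alpha> + 1) * x powr - (2 * \<alpha> + 2) = 1 / x"
        unfolding powr_add[symmetric] using that by (simp add: powr_minus_divide)
      then show ?thesis unfolding f_def by (simp add: mult_ac)
    qed
    have "set_integrable lborel {0<..} (\<lambda>x. indicator {a..x0} x * (1 / x * (\<sigma> * mean t (gtest m) x)))"
      by (rule set_integrable_cong[OF refl refl fx, THEN iffD1, OF _ mean_pairing(3)[OF t m(1) fm fi]])
    then have intm: "set_integrable lborel {a..x0} (\<lambda>x. 1 / x * (\<sigma> * mean t (gtest m) x))"
      by (simp only: set_integral_indicator_subset(1)[OF sub])
    have ln': "set_integrable lborel {a..x0} (\<lambda>x. 1 / x)" "(LINT x:{a..x0}|lborel. 1 / x) = ln x0 - ln a"
      by (rule set_integral_FTC[of a x0 ln]; use a in \<open>auto intro!: derivative_eq_intros continuous_intros\<close>)+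
    have "c * l = (LINT x:{a..x0}|lborel. c * (1 / x))"
      unfolding set_integral_mult_right ln' using ln a x0 by (simp add: ln_div)
    also have "\<dots> \<le> (LINT x:{a..x0}|lborel. 1 / x * (\<sigma> * mean t (gtest m) x))"
    proof (rule set_integral_mono[OF set_integrable_mult_right[OF ln'(1)] intm])
      fix x assume "x \<in> {a..x0}"
      then have "1 / x * c \<le> 1 / x * (\<sigma> * mean t (gtest m) x)" using a by (intro mult_left_mono low) auto
      then show "c * (1 / x) \<le> 1 / x * (\<sigma> * mean t (gtest m) x)" by (simp add: mult.commute)
    qed
    also have "\<dots> = (LINT x:{0<..}|lborel. x powr (2 * \<alpha> + 1) * f x * mean t (gtest m) x)"
      unfolding set_integral_indicator_subset(2)[OF sub, symmetric] by (rule set_lborel_integral_cong) (auto simp: fx)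
    finally show ?thesis using upper by simp
  qed
  then show False by (rule linear_not_le_powr[OF c p])
qed

end

subsection \<open>Test functions at infinity\<close>

text \<open>Shifting the variable by half a period reverses the sign of the cosine, so that only the
  \<open>L\<^sup>1\<close> modulus of continuity of \<open>W\<close> matters.\<close>

lemma riemann_lebesgue_cos:
  fixes W :: "real \<Rightarrow> real" and \<theta> :: "nat \<Rightarrow> real"
  assumes W: "integrable lborel W" and cont: "\<And>y. y \<noteq> 0 \<Longrightarrow> isCont W y" and \<theta>: "filterlim \<theta> at_top sequentially"
  shows "(\<lambda>n. \<integral>y. cos (\<theta> n * y - \<eta>) * W y \<partial>lborel) \<longlonglongrightarrow> 0"
proof -
  have [measurable]: "W \<in> borel_measurable borel" using W by (auto dest: borel_measurable_integrable)
  define h where "h n = pi / \<theta> n" for n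
  have h: "h \<longlonglongrightarrow> 0" unfolding h_def
    by (intro tendsto_divide_0[OF tendsto_const] filterlim_at_top_imp_at_infinity \<theta>)
  define F where "F n y = W (h n + 1 * y)" for n y
  define E where "E n = (\<integral>\<^sup>+y. norm (F n y - W y) \<partial>lborel)" for n
  have F: "integrable lborel (F n)" for n
    unfolding F_def by (intro lborel_integrable_real_affine W) auto
  \<comment> \<open>Continuity of translation in the mean, by Scheffe's lemma: the translates
    converge almost everywhere, since \<open>W\<close> is continuous off 0, and they all have the
    norm of \<open>W\<close>.\<close>
  have E: "E \<longlonglongrightarrow> 0"
    unfolding E_def
  proof (rule Scheffe_lemma2[OF _ W])
    show "F n \<in> borel_measurable lborel" for n unfolding F_def[abs_def] by measurable
    show "AE y in lborel. (\<lambda>n. F n y) \<longlonglongrightarrow> W y"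
      using AE_lborel_singleton[of 0]
    proof eventually_elim
      case (elim y)
      have "(\<lambda>n. h n + 1 * y) \<longlonglongrightarrow> 0 + 1 * y" by (intro tendsto_intros h)
      then show ?case unfolding F_def using isCont_tendsto_compose[OF cont[OF elim]] by simp
    qed
    show "(\<integral>\<^sup>+y. norm (F n y) \<partial>lborel) \<le> (\<integral>\<^sup>+y. norm (W y) \<partial>lborel)" for n
      using nn_integral_real_affine[of "\<lambda>y. ennreal (norm (W y))" 1 "h n"] unfolding F_def by simp
  qed
  have "(\<lambda>n. enn2real (E n)) \<longlonglongrightarrow> 0" using E by (intro tendsto_enn2real) auto
  then have E': "(\<lambda>n. enn2real (E n) / 2) \<longlonglongrightarrow> 0" by (simp add: tendsto_divide_zero)
  have "\<forall>\<^sub>F n in sequentially. \<theta> n > 0" using \<theta> by (simp add: filterlim_at_top_dense)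
  then have "\<forall>\<^sub>F n in sequentially. norm (\<integral>y. cos (\<theta> n * y - \<eta>) * W y \<partial>lborel) \<le> enn2real (E n) / 2"
  proof eventually_elim
    case (elim n)
    define I where "I = (\<integral>y. cos (\<theta> n * y - \<eta>) * W y \<partial>lborel)"
    have cosint: "integrable lborel (\<lambda>y. cos (\<theta> n * y - \<eta>) * g y)" if "integrable lborel g" for g :: "real \<Rightarrow> real"
    proof (rule Bochner_Integration.integrable_bound[OF that])
      show "(\<lambda>y. cos (\<theta> n * y - \<eta>) * g y) \<in> borel_measurable lborel" using that by (auto dest: borel_measurable_integrable)
      show "AE y in lborel. norm (cos (\<theta> n * y - \<eta>) * g y) \<le> norm (g y)"
        by (intro AE_I2) (auto simp: abs_mult intro: mult_left_le_one_le)
    qed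
    have "I = (\<integral>y. cos (\<theta> n * (h n + 1 * y) - \<eta>) * W (h n + 1 * y) \<partial>lborel)"
      unfolding I_def using lborel_integral_real_affine[of 1 "\<lambda>y. cos (\<theta> n * y - \<eta>) * W y" "h n"] by simp
    also have "\<dots> = (\<integral>y. - (cos (\<theta> n * y - \<eta>) * F n y) \<partial>lborel)"
    proof (rule Bochner_Integration.integral_cong[OF refl])
      fix y
      have "\<theta> n * (h n + 1 * y) - \<eta> = (\<theta> n * y - \<eta>) + pi" using elim by (simp add: h_def algebra_simps)
      then have "cos (\<theta> n * (h n + 1 * y) - \<eta>) = - cos (\<theta> n * y - \<eta>)" by (simp only: cos_periodic_pi)
      then show "cos (\<theta> n * (h n + 1 * y) - \<eta>) * W (h n + 1 * y) = - (cos (\<theta> n * y - \<eta>) * F n y)" by (simp add: F_def)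
    qed
    finally have I2: "I = - (\<integral>y. cos (\<theta> n * y - \<eta>) * F n y \<partial>lborel)" by simp
    have "- 2 * I = (\<integral>y. cos (\<theta> n * y - \<eta>) * F n y \<partial>lborel) - (\<integral>y. cos (\<theta> n * y - \<eta>) * W y \<partial>lborel)"
      using I2 I_def by simp
    also have "\<dots> = (\<integral>y. cos (\<theta> n * y - \<eta>) * (F n y - W y) \<partial>lborel)"
      using cosint[OF F] cosint[OF W] by (subst Bochner_Integration.integral_diff[symmetric]) (auto simp: algebra_simps)
    finally have eq: "- 2 * I = (\<integral>y. cos (\<theta> n * y - \<eta>) * (F n y - W y) \<partial>lborel)" .
    have "ennreal (norm (- 2 * I)) \<le> (\<integral>\<^sup>+y. norm (cos (\<theta> n * y - \<eta>) * (F n y - W y)) \<partial>lborel)"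
      unfolding eq by (intro integral_norm_bound_ennreal cosint Bochner_Integration.integrable_diff F W)
    also have "\<dots> \<le> E n"
      unfolding E_def by (intro nn_integral_mono ennreal_leI) (auto simp: abs_mult intro: mult_left_le_one_le)
    finally have le: "ennreal (norm (- 2 * I)) \<le> E n" .
    have "integrable lborel (\<lambda>y. F n y - W y)" by (intro Bochner_Integration.integrable_diff F W)
    then have "E n < \<infinity>" unfolding E_def by (simp add: integrable_iff_bounded)
    then have "norm (- 2 * I) \<le> enn2real (E n)" using enn2real_mono[OF le] by simp
    then show ?case unfolding I_def by simp
  qed
  then show ?thesis by (rule Lim_null_comparison[OF _ E'])
qed

context spherical_kernel
begin

definition \<omega> :: "nat \<Rightarrow> real \<Rightarrow> real" where
  "\<omega> m y = y powr - \<beta> * ghat \<alpha> m y"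

text \<open>Up to a constant, the limit of \<open>x powr (2 * \<alpha> + \<beta> + 1) * mean t (gtest m) x\<close> as \<open>x\<close> tends to
  infinity and \<open>t - x\<close> to \<open>s\<close>.\<close>

definition profile :: "nat \<Rightarrow> real \<Rightarrow> real" where
  "profile m s = (LINT y:{0<..}|lborel. cos (s * y - (\<phi> - \<psi>)) * \<omega> m y)"

lemma \<omega>_measurable [measurable]: "\<omega> m \<in> borel_measurable borel"
  unfolding \<omega>_def[abs_def] by measurable

text \<open>Expand \<open>cos (s * y - \<eta>)\<close> in powers of \<open>s\<close>: the
  coefficients are Taylor coefficients \<open>a n\<close> times moments of \<open>ghat\<close>,
  integrable at 0 because \<open>\<beta> < 1\<close>. If the profile vanished identically, all
  products would be 0; high moments are nonzero, so \<open>a n\<close> would vanish for all large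
  \<open>n\<close>, which forces sine and cosine of \<eta> to be 0.\<close>

lemma profile_nonzero:
  assumes \<beta>: "\<beta> < 1"
  obtains s where "profile m s \<noteq> 0"
proof (rule ccontr)
  assume "\<not> thesis"
  then have z: "profile m s = 0" for s using that by blast
  define \<eta> where "\<eta> = \<phi> - \<psi>"
  define a where "a n = cos \<eta> * cos_coeff n + sin \<eta> * sin_coeff n" for n
  define mom where "mom n = (LINT y:{0<..}|lborel. y powr (real n - \<beta>) * ghat \<alpha> m y)" for n :: nat
  obtain G where G: "G > 0" "\<And>y. \<bar>ghat \<alpha> m y\<bar> \<le> G * exp (- (1 / (4 * (1 + real m))) * y\<^sup>2)" using ghat_bound by blast
  define c where "c = 1 / (4 * (1 + real m))"
  have c: "c > 0" unfolding c_def by simp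
  have a_le: "\<bar>a n\<bar> \<le> 1 * 1 ^ n / fact n" for n
    unfolding a_def cos_coeff_def sin_coeff_def by (auto simp: abs_mult divide_right_mono)
  have cosr: "(\<Sum>n. a n * r ^ n) = cos (r - \<eta>)" for r
  proof -
    have "(\<lambda>n. cos \<eta> * (cos_coeff n * r ^ n) + sin \<eta> * (sin_coeff n * r ^ n)) sums (cos \<eta> * cos r + sin \<eta> * sin r)"
      using cos_converges[of r] sin_converges[of r] by (intro sums_add sums_mult) (simp_all only: real_scaleR_def)
    moreover have "a n * r ^ n = cos \<eta> * (cos_coeff n * r ^ n) + sin \<eta> * (sin_coeff n * r ^ n)" for n
      unfolding a_def by (simp add: algebra_simps)
    ultimately show ?thesis by (simp add: sums_iff cos_diff mult.commute)
  qed
  have sums0: "(\<lambda>n. (a n * mom n) * s ^ n) sums 0" if s: "0 < s" "s < 1" for s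
  proof -
    have "(\<lambda>n. a n * (LINT y:{0<..}|lborel. (s * y) ^ n * \<omega> m y)) sums (LINT y:{0<..}|lborel. (\<Sum>n. a n * (s * y) ^ n) * \<omega> m y)"
    proof (rule integral_power_series_termwise[OF a_le])
      show "set_integrable lborel {0<..} (\<lambda>y. exp (1 * (s * y)) * \<bar>\<omega> m y\<bar>)"
      proof (rule set_integrable_lborel_bound)
        show "set_integrable lborel {0<..} (\<lambda>y. (G * exp (1 / (2 * c))) * (y powr - \<beta> * exp (- (c / 2) * y\<^sup>2)))"
          using \<beta> c by (intro set_integrable_mult_right gaussian_moment) auto
        fix y :: real assume "y \<in> {0<..}"
        then have y: "y > 0" by simp
        have "s * y \<le> 1 * y" using s y by (intro mult_right_mono) auto
        moreover have "0 \<le> (1 - c * y)\<^sup>2 / (2 * c)" using c by simp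
        moreover have "(1 - c * y)\<^sup>2 / (2 * c) = 1 / (2 * c) - y + c / 2 * y\<^sup>2"
          using c by (simp add: power2_diff field_simps power2_eq_square)
        ultimately have "s * y + - c * y\<^sup>2 \<le> 1 / (2 * c) + - (c / 2) * y\<^sup>2" by simp
        then have ex: "exp (s * y) * exp (- c * y\<^sup>2) \<le> exp (1 / (2 * c)) * exp (- (c / 2) * y\<^sup>2)"
          unfolding exp_add[symmetric] by simp
        have "exp (s * y) * (y powr - \<beta> * \<bar>ghat \<alpha> m y\<bar>) \<le> exp (s * y) * (y powr - \<beta> * (G * exp (- c * y\<^sup>2)))"
          using G(2)[of y] c_def by (intro mult_left_mono) auto
        also have "\<dots> = G * y powr - \<beta> * (exp (s * y) * exp (- c * y\<^sup>2))" by (simp add: mult_ac)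
        also have "\<dots> \<le> G * y powr - \<beta> * (exp (1 / (2 * c)) * exp (- (c / 2) * y\<^sup>2))"
          using G(1) by (intro mult_left_mono ex) auto
        finally show "\<bar>exp (1 * (s * y)) * \<bar>\<omega> m y\<bar>\<bar> \<le> (G * exp (1 / (2 * c))) * (y powr - \<beta> * exp (- (c / 2) * y\<^sup>2))"
          by (simp add: \<omega>_def abs_mult mult_ac)
      qed auto
    qed (use s in auto)
    moreover have "(LINT y:{0<..}|lborel. (s * y) ^ n * \<omega> m y) = mom n * s ^ n" for n
    proof -
      have "(LINT y:{0<..}|lborel. (s * y) ^ n * \<omega> m y) = (LINT y:{0<..}|lborel. s ^ n * (y powr (real n - \<beta>) * ghat \<alpha> m y))"
      proof (rule set_lborel_integral_cong)
        fix y :: real assume "y \<in> {0<..}"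
        then have "y powr (real n - \<beta>) = y ^ n * y powr - \<beta>"
          using powr_add[of y "real n" "- \<beta>"] by (simp add: powr_realpow)
        then show "(s * y) ^ n * \<omega> m y = s ^ n * (y powr (real n - \<beta>) * ghat \<alpha> m y)"
          by (simp add: \<omega>_def power_mult_distrib)
      qed simp
      then show ?thesis by (simp add: mom_def)
    qed
    moreover have "(LINT y:{0<..}|lborel. (\<Sum>n. a n * (s * y) ^ n) * \<omega> m y) = 0"
      using z[of s] unfolding cosr profile_def \<eta>_def .
    ultimately show ?thesis by (simp add: mult_ac)
  qed
  have am: "a n * mom n = 0" for n
    using power_series_zero_coeffs[of 1 "\<lambda>n. a n * mom n" n] sums0 by simp
  obtain r0 where r0: "\<And>r. r \<ge> r0 \<Longrightarrow> (LINT y:{0<..}|lborel. y powr r * ghat \<alpha> m y) \<noteq> 0"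
    using ghat_moment_nonzero by blast
  \<comment> \<open>An even index, so that \<open>a n\<close> contains only
    \<open>cos \<eta>\<close> and \<open>a (Suc n)\<close> only \<open>sin \<eta>\<close>.\<close>
  define n where "n = 2 * nat \<lceil>\<bar>r0\<bar> + \<bar>\<beta>\<bar>\<rceil>"
  have "real n \<ge> \<bar>r0\<bar> + \<bar>\<beta>\<bar>" unfolding n_def by linarith
  then have "mom n \<noteq> 0" "mom (Suc n) \<noteq> 0" unfolding mom_def by (auto intro!: r0)
  then have "a n = 0" "a (Suc n) = 0" using am by auto
  moreover have "even n" unfolding n_def by simp
  ultimately have "cos \<eta> = 0" "sin \<eta> = 0" unfolding a_def cos_coeff_def sin_coeff_def by auto
  then show False using sin_cos_squared_add[of \<eta>] by simp
qed

text \<open>The two orders behave differently near 0. Since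
  \<open>\<alpha> + \<beta> > -1/2\<close>, the first normalised function is bounded everywhere,
  whereas \<alpha> may lie below \<open>-1/2\<close> and the second is claimed to be bounded only
  for \<open>w \<ge> 1\<close>.\<close>

lemma sqrt_bessel_bounds:
  assumes w: "w > 0"
  shows "\<bar>w powr (1/2) * bessel_J (\<alpha> + \<beta>) w - A * cos (w - \<phi>)\<bar> \<le> C / w"
    "\<bar>w powr (1/2) * bessel_J \<alpha> w - B * cos (w - \<psi>)\<bar> \<le> C / w"
    "\<bar>w powr (1/2) * bessel_J (\<alpha> + \<beta>) w\<bar> \<le> A + B + 2 * C"
    "w \<ge> 1 \<Longrightarrow> \<bar>w powr (1/2) * bessel_J \<alpha> w\<bar> \<le> A + B + 2 * C"
    "w \<le> 1 \<Longrightarrow> \<bar>w powr (1/2) * bessel_J (\<alpha> + \<beta>) w\<bar> \<le> (A + B + 2 * C) * w powr (\<alpha> + \<beta> + 1/2)"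
    "w \<le> 1 \<Longrightarrow> \<bar>w powr (1/2) * bessel_J \<alpha> w\<bar> \<le> (A + B + 2 * C) * w powr (\<alpha> + 1/2)"
proof -
  have wave: "\<bar>w powr (1/2) * J - a * cos (w - \<eta>)\<bar> \<le> C / w"
    if "\<bar>J - a * w powr (-1/2) * cos (w - \<eta>)\<bar> \<le> C * w powr (-3/2)" for J a \<eta>
  proof -
    have 1: "w powr (1/2) * w powr (-1/2) = 1" using w by (simp add: powr_add[symmetric])
    have "w powr (1/2) * w powr (-3/2) = w powr (1/2 + -3/2)" by (rule powr_add[symmetric])
    then have 2: "w powr (1/2) * w powr (-3/2) = 1 / w" using w by (simp add: powr_minus_divide)
    have "w powr (1/2) * J - a * cos (w - \<eta>) = w powr (1/2) * J - a * (w powr (1/2) * w powr (-1/2)) * cos (w - \<eta>)" unfolding 1 by simp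
    also have "\<dots> = w powr (1/2) * (J - a * w powr (-1/2) * cos (w - \<eta>))" by (simp add: algebra_simps)
    finally have "\<bar>w powr (1/2) * J - a * cos (w - \<eta>)\<bar> = w powr (1/2) * \<bar>J - a * w powr (-1/2) * cos (w - \<eta>)\<bar>" by (simp add: abs_mult)
    also have "\<dots> \<le> w powr (1/2) * (C * w powr (-3/2))" by (intro mult_left_mono that) auto
    also have "\<dots> = C * (w powr (1/2) * w powr (-3/2))" by simp
    also have "\<dots> = C / w" unfolding 2 by simp
    finally show ?thesis .
  qed
  show n1: "\<bar>w powr (1/2) * bessel_J (\<alpha> + \<beta>) w - A * cos (w - \<phi>)\<bar> \<le> C / w" by (rule wave[OF J\<nu>_wave[OF w]])
  show a1: "\<bar>w powr (1/2) * bessel_J \<alpha> w - B * cos (w - \<psi>)\<bar> \<le> C / w" by (rule wave[OF J\<alpha>_wave[OF w]])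
  have acos: "\<bar>a * cos u\<bar> \<le> a" if "a > 0" for a u :: real
    using mult_left_mono[of "\<bar>cos u\<bar>" 1 a] that by (simp add: abs_mult)
  have large: "C / w \<le> C" if "w \<ge> 1" using that C w by (simp add: field_simps)
  have small: "\<bar>w powr (1/2) * J\<bar> \<le> (A + B + 2 * C) * w powr (r + 1/2)"
    if "w \<le> 1" "\<bar>J\<bar> \<le> C * w powr r * (1 + w)" for J r
  proof -
    have "C * w powr r * (1 + w) \<le> C * w powr r * 2" using that(1) C by (intro mult_left_mono) auto
    with that(2) have "\<bar>J\<bar> \<le> C * w powr r * 2" by (rule order_trans)
    then have "w powr (1/2) * \<bar>J\<bar> \<le> w powr (1/2) * (C * w powr r * 2)" by (intro mult_left_mono) auto
    also have "\<dots> = 2 * C * w powr (r + 1/2)" by (simp add: powr_add)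
    also have "\<dots> \<le> (A + B + 2 * C) * w powr (r + 1/2)" using A B by (intro mult_right_mono) auto
    finally show ?thesis by (simp add: abs_mult)
  qed
  show n5: "w \<le> 1 \<Longrightarrow> \<bar>w powr (1/2) * bessel_J (\<alpha> + \<beta>) w\<bar> \<le> (A + B + 2 * C) * w powr (\<alpha> + \<beta> + 1/2)"
    by (rule small[OF _ J\<nu>_le[OF w]])
  show "w \<le> 1 \<Longrightarrow> \<bar>w powr (1/2) * bessel_J \<alpha> w\<bar> \<le> (A + B + 2 * C) * w powr (\<alpha> + 1/2)"
    by (rule small[OF _ J\<alpha>_le[OF w]])
  show "\<bar>w powr (1/2) * bessel_J \<alpha> w\<bar> \<le> A + B + 2 * C" if "w \<ge> 1"
    using a1 large[OF that] acos[OF B, of "w - \<psi>"] A C by linarith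
  show "\<bar>w powr (1/2) * bessel_J (\<alpha> + \<beta>) w\<bar> \<le> A + B + 2 * C"
  proof (cases "w \<ge> 1")
    case True
    then show ?thesis using n1 large acos[OF A, of "w - \<phi>"] B C by linarith
  next
    case False
    have "w powr (\<alpha> + \<beta> + 1/2) \<le> 1 powr (\<alpha> + \<beta> + 1/2)" using False w \<nu> by (intro powr_mono2) auto
    then have "(A + B + 2 * C) * w powr (\<alpha> + \<beta> + 1/2) \<le> (A + B + 2 * C) * 1" using A B C by (intro mult_left_mono) auto
    then show ?thesis using n5 False by simp
  qed
qed

definition bprod :: "real \<Rightarrow> real \<Rightarrow> real \<Rightarrow> real" where
  "bprod t x y = ((t * y) powr (1/2) * bessel_J (\<alpha> + \<beta>) (t * y)) * ((x * y) powr (1/2) * bessel_J \<alpha> (x * y))"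

text \<open>The majorant does not depend on \<open>t\<close> and \<open>x\<close>. When
  \<open>x * y < 1\<close>, the assumption \<open>t \<le> 2 * x\<close> lets both factors be
  measured in powers of \<open>x * y\<close>, with total exponent
  \<open>2 * \<alpha> + \<beta> + 1\<close>; if this is negative, \<open>x \<ge> 1\<close> turns
  \<open>x * y\<close> into \<open>y\<close>.\<close>

lemma bprod_bound:
  assumes x: "x \<ge> 1" and t: "0 < t" "t \<le> 2 * x" and y: "y > 0"
  shows "\<bar>bprod t x y\<bar> \<le> (A + B + 2 * C) ^ 2 * 2 powr (\<alpha> + \<beta> + 1/2) * (1 + y powr (2 * \<alpha> + \<beta> + 1))"
proof -
  let ?D = "A + B + 2 * C" and ?n = "\<alpha> + \<beta> + 1/2"
  have D: "?D > 0" using A B C by simp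
  have n: "?n > 0" using \<nu> by simp
  have two: "2 powr ?n \<ge> 1" using n by (intro ge_one_powr_ge_zero) auto
  have pos: "t * y > 0" "x * y > 0" using x t y by auto
  let ?u = "(t * y) powr (1/2) * bessel_J (\<alpha> + \<beta>) (t * y)" and ?v = "(x * y) powr (1/2) * bessel_J \<alpha> (x * y)"
  show ?thesis
  proof (cases "x * y \<ge> 1")
    case True
    have "\<bar>?u\<bar> * \<bar>?v\<bar> \<le> ?D * ?D"
      using sqrt_bessel_bounds(3)[OF pos(1)] sqrt_bessel_bounds(4)[OF pos(2) True] D by (intro mult_mono) auto
    also have "\<dots> \<le> ?D * ?D * (2 powr ?n * (1 + y powr (2 * \<alpha> + \<beta> + 1)))"
    proof -
      have "1 * 1 \<le> 2 powr ?n * (1 + y powr (2 * \<alpha> + \<beta> + 1))" using two by (intro mult_mono) auto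
      then have "?D * ?D * 1 \<le> ?D * ?D * (2 powr ?n * (1 + y powr (2 * \<alpha> + \<beta> + 1)))" using D by (intro mult_left_mono) auto
      then show ?thesis by simp
    qed
    finally show ?thesis unfolding bprod_def abs_mult by (simp add: power2_eq_square mult_ac)
  next
    case False
    have u: "\<bar>?u\<bar> \<le> ?D * (2 powr ?n * (x * y) powr ?n)"
    proof -
      have e: "2 powr ?n * (x * y) powr ?n = (2 * (x * y)) powr ?n" using pos by (simp add: powr_mult)
      show ?thesis
      proof (cases "t * y \<le> 1")
        case True
        have "(t * y) powr ?n \<le> (2 * (x * y)) powr ?n" using t y n pos by (intro powr_mono2) auto
        then have "?D * (t * y) powr ?n \<le> ?D * (2 * (x * y)) powr ?n" using D by (intro mult_left_mono) auto
        then show ?thesis unfolding e using sqrt_bessel_bounds(5)[OF pos(1) True] by linarith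
      next
        case False
        have "t * y \<le> 2 * x * y" using t y by (intro mult_right_mono) auto
        then have "1 \<le> 2 * (x * y)" using False by simp
        then have "1 \<le> (2 * (x * y)) powr ?n" using n by (intro ge_one_powr_ge_zero) auto
        then have "?D * 1 \<le> ?D * (2 * (x * y)) powr ?n" using D by (intro mult_left_mono) auto
        then show ?thesis unfolding e by (intro order_trans[OF sqrt_bessel_bounds(3)[OF pos(1)]]) simp
      qed
    qed
    have v: "\<bar>?v\<bar> \<le> ?D * (x * y) powr (\<alpha> + 1/2)" using sqrt_bessel_bounds(6)[OF pos(2)] False by simp
    have "\<bar>?u\<bar> * \<bar>?v\<bar> \<le> (?D * (2 powr ?n * (x * y) powr ?n)) * (?D * (x * y) powr (\<alpha> + 1/2))"
      using u v D by (intro mult_mono) auto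
    also have "\<dots> = ?D ^ 2 * 2 powr ?n * ((x * y) powr ?n * (x * y) powr (\<alpha> + 1/2))" by (simp add: power2_eq_square mult_ac)
    also have "(x * y) powr ?n * (x * y) powr (\<alpha> + 1/2) = (x * y) powr (2 * \<alpha> + \<beta> + 1)"
      unfolding powr_add[symmetric] by (simp add: algebra_simps)
    also have "(x * y) powr (2 * \<alpha> + \<beta> + 1) \<le> 1 + y powr (2 * \<alpha> + \<beta> + 1)"
    proof (cases "2 * \<alpha> + \<beta> + 1 \<ge> 0")
      case True
      have "(x * y) powr (2 * \<alpha> + \<beta> + 1) \<le> 1 powr (2 * \<alpha> + \<beta> + 1)" using True pos False by (intro powr_mono2) auto
      then show ?thesis by (simp add: add_increasing2)
    next
      case neg: False
      have "y \<le> x * y" using x y by simp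
      then have "(x * y) powr (2 * \<alpha> + \<beta> + 1) \<le> y powr (2 * \<alpha> + \<beta> + 1)" using neg y by (intro powr_mono2') auto
      then show ?thesis by simp
    qed
    finally show ?thesis unfolding bprod_def abs_mult using D by (simp add: mult_left_mono)
  qed
qed


lemma \<omega>_set_integrable: "\<beta> < 1 \<Longrightarrow> set_integrable lborel {0<..} (\<omega> m)"
  unfolding \<omega>_def[abs_def] by (rule ghat_moment(1)) simp

lemma cos_\<omega>_set_integrable:
  assumes "\<beta> < 1"
  shows "set_integrable lborel {0<..} (\<lambda>y. cos (s * y - \<eta>) * \<omega> m y)"
proof (rule set_integrable_lborel_bound)
  show "set_integrable lborel {0<..} (\<lambda>y. \<bar>\<omega> m y\<bar>)" by (intro set_integrable_abs \<omega>_set_integrable assms)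
  show "\<bar>cos (s * y - \<eta>) * \<omega> m y\<bar> \<le> \<bar>\<omega> m y\<bar>" for y by (auto simp: abs_mult intro: mult_left_le_one_le)
qed auto

text \<open>The form suited to the limit at infinity: both Bessel functions are normalised to waves
  of constant amplitude, and the only remaining dependence on the scale is the factor
  \<open>(x / t) powr (\<alpha> + \<beta> + 1/2)\<close>, which tends to 1 when \<open>t - x\<close>
  converges.\<close>

lemma mean_gtest_scaled:
  assumes t: "t > 0" and x: "x > 0" and m: "m \<ge> 1"
  shows "x powr (2 * \<alpha> + \<beta> + 1) * mean t (gtest m) x = 2 powr (\<alpha> + \<beta>) * Gamma (\<alpha> + \<beta> + 1) * (x / t) powr (\<alpha> + \<beta> + 1/2)
    * (LINT y:{0<..}|lborel. bprod t x y * \<omega> m y)"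
proof -
  have "(LINT y:{0<..}|lborel. bprod t x y * \<omega> m y) = (LINT y:{0<..}|lborel. (t powr (1/2) * x powr (1/2)) *
    (bessel_J (\<alpha> + \<beta>) (t * y) * bessel_J \<alpha> (x * y) * y powr (1 - \<beta>) * ghat \<alpha> m y))"
  proof (rule set_lborel_integral_cong)
    fix y :: real assume "y \<in> {0<..}"
    then have y: "y > 0" by simp
    have e: "y powr (1/2) * y powr (1/2) * y powr - \<beta> = y powr (1 - \<beta>)" unfolding powr_add[symmetric] by simp
    have "bprod t x y * \<omega> m y = (t powr (1/2) * x powr (1/2)) *
      (bessel_J (\<alpha> + \<beta>) (t * y) * bessel_J \<alpha> (x * y) * (y powr (1/2) * y powr (1/2) * y powr - \<beta>) * ghat \<alpha> m y)"
      unfolding bprod_def \<omega>_def powr_mult by (simp only: mult_ac)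
    then show "bprod t x y * \<omega> m y = (t powr (1/2) * x powr (1/2)) *
      (bessel_J (\<alpha> + \<beta>) (t * y) * bessel_J \<alpha> (x * y) * y powr (1 - \<beta>) * ghat \<alpha> m y)"
      unfolding e .
  qed simp
  then have L: "(LINT y:{0<..}|lborel. bprod t x y * \<omega> m y) = t powr (1/2) * x powr (1/2) * freq m t x"
    unfolding freq_def by simp
  have "x powr (2 * \<alpha> + \<beta> + 1) = x powr (\<alpha> + \<beta> + 1/2) * x powr (1/2) * x powr \<alpha>"
    unfolding powr_add[symmetric] by (simp add: algebra_simps)
  moreover have "t powr (\<alpha> + \<beta> + 1/2) = t powr (\<alpha> + \<beta>) * t powr (1/2)" by (rule powr_add)
  ultimately show ?thesis
    unfolding L mean_gtest(2)[OF t x m] using t x by (simp add: powr_divide)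
qed

text \<open>The product of the leading waves is the half sum of a slow cosine with frequency
  \<open>T n - X n\<close>, which converges, and a fast one with frequency \<open>T n + X n\<close>.
  The remainder \<open>r\<close> tends to 0 pointwise and is dominated by \<open>M\<close>, which is
  integrable because \<open>\<beta> < 1\<close> and \<open>\<alpha> > -1\<close>.\<close>

lemma bprod_integral_limit:
  assumes \<beta>: "\<beta> < 1" and X: "filterlim X at_top sequentially" and X1: "\<And>n. X n \<ge> 1"
    and T: "\<And>n. T n > 0" "\<And>n. T n \<le> 2 * X n" and TX: "(\<lambda>n. T n - X n) \<longlonglongrightarrow> s"
  shows "(\<lambda>n. LINT y:{0<..}|lborel. bprod (T n) (X n) y * \<omega> m y) \<longlonglongrightarrow> A * B / 2 * profile m s"
proof -
  define e where "e = 2 * \<alpha> + \<beta> + 1"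
  define D where "D = (A + B + 2 * C) ^ 2 * 2 powr (\<alpha> + \<beta> + 1/2)"
  have D: "D > 0" unfolding D_def using A B C by simp
  define c where "c = 1 / (4 * (1 + real m))"
  have c: "c > 0" unfolding c_def by simp
  obtain G where G: "G > 0" "\<And>y. \<bar>ghat \<alpha> m y\<bar> \<le> G * exp (- c * y\<^sup>2)" using ghat_bound unfolding c_def by blast
  have XT: "filterlim T at_top sequentially"
    using filterlim_tendsto_add_at_top[OF TX X] by simp
  have Xy: "(\<lambda>n. k / (X n * y)) \<longlonglongrightarrow> 0" "(\<lambda>n. k / (T n * y)) \<longlonglongrightarrow> 0" if "y > 0" for y k
    using that by (auto intro!: tendsto_divide_0[OF tendsto_const] filterlim_at_top_imp_at_infinity
        filterlim_at_top_mult_tendsto_pos[OF tendsto_const] X XT)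
  define cc where "cc n y = A * cos (T n * y - \<phi>) * (B * cos (X n * y - \<psi>))" for n y
  define r where "r n y = indicator {0<..} y *\<^sub>R ((bprod (T n) (X n) y - cc n y) * \<omega> m y)" for n y
  define M where "M y = (D + A * B) * G * (indicator {0<..} y *\<^sub>R (y powr - \<beta> * exp (- c * y\<^sup>2)))
    + D * G * (indicator {0<..} y *\<^sub>R (y powr (2 * \<alpha> + 1) * exp (- c * y\<^sup>2)))" for y
  have cc_le: "\<bar>cc n y\<bar> \<le> A * B" for n y
  proof -
    have "\<bar>A * cos (T n * y - \<phi>)\<bar> \<le> A * 1" "\<bar>B * cos (X n * y - \<psi>)\<bar> \<le> B * 1"
      using A B unfolding abs_mult by (auto intro!: mult_mono)
    then have "\<bar>A * cos (T n * y - \<phi>)\<bar> * \<bar>B * cos (X n * y - \<psi>)\<bar> \<le> A * B" using A B by (intro mult_mono) auto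
    then show ?thesis unfolding cc_def abs_mult[of "A * cos (T n * y - \<phi>)"] .
  qed
  have bound: "\<bar>(bprod (T n) (X n) y - cc n y) * \<omega> m y\<bar> \<le> (D + A * B) * G * (y powr - \<beta> * exp (- c * y\<^sup>2)) + D * G * (y powr (2 * \<alpha> + 1) * exp (- c * y\<^sup>2))"
    if y: "y > 0" for n y
  proof -
    have "\<bar>bprod (T n) (X n) y - cc n y\<bar> \<le> D * (1 + y powr e) + A * B"
      using bprod_bound[OF X1[of n] T(1)[of n] T(2)[of n] y] cc_le[of n y] unfolding D_def e_def by linarith
    moreover have "\<bar>\<omega> m y\<bar> \<le> y powr - \<beta> * (G * exp (- c * y\<^sup>2))"
      unfolding \<omega>_def abs_mult using G(2)[of y] by (simp add: mult_left_mono)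
    ultimately have "\<bar>bprod (T n) (X n) y - cc n y\<bar> * \<bar>\<omega> m y\<bar> \<le> (D * (1 + y powr e) + A * B) * (y powr - \<beta> * (G * exp (- c * y\<^sup>2)))"
      using D A B by (intro mult_mono) auto
    also have "\<dots> = (D + A * B) * G * (y powr - \<beta> * exp (- c * y\<^sup>2)) + D * G * ((y powr e * y powr - \<beta>) * exp (- c * y\<^sup>2))"
      by (simp add: algebra_simps)
    also have "y powr e * y powr - \<beta> = y powr (2 * \<alpha> + 1)" unfolding e_def powr_add[symmetric] by simp
    finally show ?thesis by (simp add: abs_mult)
  qed
  have Mint: "integrable lborel M"
    unfolding M_def[abs_def]
    using gaussian_moment(1)[of "- \<beta>" c] gaussian_moment(1)[of "2 * \<alpha> + 1" c] \<beta> \<alpha> c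
    by (intro Bochner_Integration.integrable_add integrable_mult_right) (auto simp: set_integrable_def)
  have r_meas [measurable]: "r n \<in> borel_measurable borel" for n
    unfolding r_def[abs_def] bprod_def cc_def by measurable
  have rM: "norm (r n y) \<le> M y" for n y
    using bound[of y n] unfolding r_def M_def by (cases "y > 0") auto
  have r_int: "integrable lborel (r n)" for n
    by (rule Bochner_Integration.integrable_bound[OF Mint]) (use rM in \<open>auto intro!: AE_I2 intro: order_trans[OF _ abs_ge_self]\<close>)
  have "(\<lambda>n. \<integral>y. r n y \<partial>lborel) \<longlonglongrightarrow> (\<integral>y. 0 \<partial>(lborel :: real measure))"
  proof (rule integral_dominated_convergence[OF _ _ Mint])
    show "AE y in lborel. (\<lambda>n. r n y) \<longlonglongrightarrow> 0"
    proof (intro AE_I2)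
      fix y
      show "(\<lambda>n. r n y) \<longlonglongrightarrow> 0"
      proof (cases "y > 0")
        case True
        have "(\<lambda>n. bprod (T n) (X n) y - cc n y) \<longlonglongrightarrow> 0"
        proof (rule Lim_null_comparison)
          show "\<forall>\<^sub>F n in sequentially. norm (bprod (T n) (X n) y - cc n y)
            \<le> C / (T n * y) * (C / (X n * y)) + C / (T n * y) * B + A * (C / (X n * y))"
          proof (intro always_eventually allI)
            fix n
            have pos: "T n * y > 0" "X n * y > 0" using True T(1)[of n] X1[of n] by auto
            define u v u' v' where "u = (T n * y) powr (1/2) * bessel_J (\<alpha> + \<beta>) (T n * y)" and "v = (X n * y) powr (1/2) * bessel_J \<alpha> (X n * y)"
              and "u' = A * cos (T n * y - \<phi>)" and "v' = B * cos (X n * y - \<psi>)"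
            have uv: "\<bar>u - u'\<bar> \<le> C / (T n * y)" "\<bar>v - v'\<bar> \<le> C / (X n * y)"
              unfolding u_def v_def u'_def v'_def using sqrt_bessel_bounds(1)[OF pos(1)] sqrt_bessel_bounds(2)[OF pos(2)] by auto
            have uv': "\<bar>u'\<bar> \<le> A * 1" "\<bar>v'\<bar> \<le> B * 1"
              using A B unfolding u'_def v'_def abs_mult by (auto intro!: mult_mono)
            have "u * v - u' * v' = (u - u') * (v - v') + (u - u') * v' + u' * (v - v')" by (simp add: algebra_simps)
            moreover have "\<bar>(u - u') * (v - v')\<bar> \<le> C / (T n * y) * (C / (X n * y))"
              unfolding abs_mult using uv C pos by (intro mult_mono) auto
            moreover have "\<bar>(u - u') * v'\<bar> \<le> C / (T n * y) * B"
              unfolding abs_mult using uv uv' C pos by (intro mult_mono) auto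
            moreover have "\<bar>u' * (v - v')\<bar> \<le> A * (C / (X n * y))"
              unfolding abs_mult using uv uv' A by (intro mult_mono) auto
            ultimately have "\<bar>u * v - u' * v'\<bar> \<le> C / (T n * y) * (C / (X n * y)) + C / (T n * y) * B + A * (C / (X n * y))"
              by (simp only: abs_add_le)
            then show "norm (bprod (T n) (X n) y - cc n y) \<le> C / (T n * y) * (C / (X n * y)) + C / (T n * y) * B + A * (C / (X n * y))"
              unfolding bprod_def cc_def u_def v_def u'_def v'_def by simp
          qed
          have "(\<lambda>n. C / (T n * y) * (C / (X n * y)) + C / (T n * y) * B + A * (C / (X n * y))) \<longlonglongrightarrow> 0 * 0 + 0 * B + A * 0"
            by (intro tendsto_intros Xy True)
          then show "(\<lambda>n. C / (T n * y) * (C / (X n * y)) + C / (T n * y) * B + A * (C / (X n * y))) \<longlonglongrightarrow> 0" by simp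
        qed
        then show ?thesis unfolding r_def using tendsto_mult_right[of _ 0 sequentially "\<omega> m y"] True by simp
      qed (simp add: r_def)
    qed
  qed (use rM in auto)
  then have r0: "(\<lambda>n. \<integral>y. r n y \<partial>lborel) \<longlonglongrightarrow> 0" by simp
  define W where "W y = indicator {0<..} y *\<^sub>R \<omega> m y" for y
  have Wint: "integrable lborel W" using \<omega>_set_integrable[OF \<beta>] unfolding W_def[abs_def] set_integrable_def .
  have Wcont: "isCont W y" if "y \<noteq> 0" for y
  proof (cases "y > 0")
    case True
    have "\<forall>\<^sub>F z in nhds y. W z = \<omega> m z"
      using eventually_nhds_in_open[of "{0<..}" y] True by (auto elim!: eventually_mono simp: W_def)
    moreover have "isCont (\<omega> m) y" unfolding \<omega>_def[abs_def] ghat_def using True by (auto intro!: continuous_intros)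
    ultimately show ?thesis using isCont_cong by blast
  next
    case False
    have "\<forall>\<^sub>F z in nhds y. W z = 0"
      using eventually_nhds_in_open[of "{..<0}" y] False that by (auto elim!: eventually_mono simp: W_def)
    then show ?thesis using isCont_cong[of W "\<lambda>_. 0" y] by simp
  qed
  \<comment> \<open>The fast cosine is removed by the Riemann-Lebesgue lemma. \<open>W\<close> may
    be unbounded at 0 when \<open>\<beta> > 0\<close>, which is why that lemma asks for continuity
    only off 0.\<close>
  have S: "(\<lambda>n. \<integral>y. cos ((T n + X n) * y - (\<phi> + \<psi>)) * W y \<partial>lborel) \<longlonglongrightarrow> 0"
    by (rule riemann_lebesgue_cos[OF Wint Wcont filterlim_at_top_add_at_top[OF XT X]])
  have R: "(\<lambda>n. \<integral>y. cos ((T n - X n) * y - (\<phi> - \<psi>)) * W y \<partial>lborel) \<longlonglongrightarrow> (\<integral>y. cos (s * y - (\<phi> - \<psi>)) * W y \<partial>lborel)"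
  proof (rule integral_dominated_convergence)
    show "integrable lborel (\<lambda>y. norm (W y))" using Wint by simp
    show "AE y in lborel. (\<lambda>n. cos ((T n - X n) * y - (\<phi> - \<psi>)) * W y) \<longlonglongrightarrow> cos (s * y - (\<phi> - \<psi>)) * W y"
      by (intro AE_I2 tendsto_intros TX)
    show "AE y in lborel. norm (cos ((T n - X n) * y - (\<phi> - \<psi>)) * W y) \<le> norm (W y)" for n
      by (intro AE_I2) (auto simp: abs_mult intro: mult_left_le_one_le)
  qed (use Wint in \<open>auto dest: borel_measurable_integrable\<close>)
  have conv: "(LINT y:{0<..}|lborel. cos (\<theta> * y - \<eta>) * \<omega> m y) = (\<integral>y. cos (\<theta> * y - \<eta>) * W y \<partial>lborel)" for \<theta> \<eta>
    unfolding set_lebesgue_integral_def W_def by (simp add: mult_ac)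
  have main: "(LINT y:{0<..}|lborel. bprod (T n) (X n) y * \<omega> m y) = (\<integral>y. r n y \<partial>lborel)
    + A * B / 2 * ((\<integral>y. cos ((T n - X n) * y - (\<phi> - \<psi>)) * W y \<partial>lborel) + (\<integral>y. cos ((T n + X n) * y - (\<phi> + \<psi>)) * W y \<partial>lborel))" for n
  proof -
    have cceq: "cc n y = A * B / 2 * (cos ((T n - X n) * y - (\<phi> - \<psi>)) + cos ((T n + X n) * y - (\<phi> + \<psi>)))" for y
    proof -
      have "cos (T n * y - \<phi>) * cos (X n * y - \<psi>) = (cos ((T n - X n) * y - (\<phi> - \<psi>)) + cos ((T n + X n) * y - (\<phi> + \<psi>))) / 2"
        unfolding cos_times_cos by (simp add: algebra_simps)
      then show ?thesis unfolding cc_def by (simp add: mult_ac)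
    qed
    let ?f1 = "\<lambda>y. cos ((T n - X n) * y - (\<phi> - \<psi>)) * \<omega> m y" and ?f2 = "\<lambda>y. cos ((T n + X n) * y - (\<phi> + \<psi>)) * \<omega> m y"
    have i1: "set_integrable lborel {0<..} (\<lambda>y. (bprod (T n) (X n) y - cc n y) * \<omega> m y)"
      using r_int[of n] unfolding r_def[abs_def] set_integrable_def .
    have i2: "set_integrable lborel {0<..} (\<lambda>y. A * B / 2 * (?f1 y + ?f2 y))"
      by (intro set_integrable_mult_right set_integral_add cos_\<omega>_set_integrable \<beta>)
    have "(LINT y:{0<..}|lborel. bprod (T n) (X n) y * \<omega> m y) = (LINT y:{0<..}|lborel. (bprod (T n) (X n) y - cc n y) * \<omega> m y + A * B / 2 * (?f1 y + ?f2 y))"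
      by (rule set_lborel_integral_cong) (simp_all add: cceq algebra_simps)
    also have "\<dots> = (LINT y:{0<..}|lborel. (bprod (T n) (X n) y - cc n y) * \<omega> m y) + (LINT y:{0<..}|lborel. A * B / 2 * (?f1 y + ?f2 y))"
      by (rule set_integral_add(2)[OF i1 i2])
    also have "(LINT y:{0<..}|lborel. A * B / 2 * (?f1 y + ?f2 y)) = A * B / 2 * (LINT y:{0<..}|lborel. ?f1 y + ?f2 y)"
      by (rule set_integral_mult_right)
    also have "(LINT y:{0<..}|lborel. ?f1 y + ?f2 y) = (LINT y:{0<..}|lborel. ?f1 y) + (LINT y:{0<..}|lborel. ?f2 y)"
      by (intro set_integral_add cos_\<omega>_set_integrable \<beta>)
    finally show ?thesis unfolding conv unfolding r_def[abs_def] set_lebesgue_integral_def .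
  qed
  have "(\<lambda>n. (\<integral>y. r n y \<partial>lborel)
    + A * B / 2 * ((\<integral>y. cos ((T n - X n) * y - (\<phi> - \<psi>)) * W y \<partial>lborel) + (\<integral>y. cos ((T n + X n) * y - (\<phi> + \<psi>)) * W y \<partial>lborel)))
    \<longlonglongrightarrow> 0 + A * B / 2 * ((\<integral>y. cos (s * y - (\<phi> - \<psi>)) * W y \<partial>lborel) + 0)"
    by (intro tendsto_add tendsto_mult_left r0 R S)
  then show ?thesis unfolding main profile_def conv by simp
qed

text \<open>Arguing by contradiction with sequences turns the joint limit, \<open>x\<close> to
  infinity and \<open>t - x\<close> to \<open>s\<close>, into a bound on a whole region. The
  tolerance in \<open>t - x\<close> matters for duality, where \<open>t\<close> is fixed and
  \<open>x\<close> runs through an interval of positive length.\<close>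

lemma mean_gtest_lower_far:
  assumes \<beta>: "\<beta> < 1" and m: "m \<ge> 1"
  obtains s \<sigma> c k where "\<bar>\<sigma>\<bar> = 1" "c > 0" "k \<ge> 1" "k \<ge> \<bar>s\<bar> + 2"
    "\<And>x t. x \<ge> k \<Longrightarrow> \<bar>t - x - s\<bar> \<le> 1 / k \<Longrightarrow> c \<le> \<sigma> * (x powr (2 * \<alpha> + \<beta> + 1) * mean t (gtest m) x)"
proof -
  obtain s where s: "profile m s \<noteq> 0" using profile_nonzero[OF \<beta>] by blast
  define K where "K = 2 powr (\<alpha> + \<beta>) * Gamma (\<alpha> + \<beta> + 1)"
  have K: "K > 0" unfolding K_def using \<nu> by (intro mult_pos_pos Gamma_real_pos) auto
  define L where "L = K * 1 powr (\<alpha> + \<beta> + 1/2) * (A * B / 2 * profile m s)"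
  have L: "L \<noteq> 0" unfolding L_def using K s A B by simp
  define \<sigma> where "\<sigma> = sgn L"
  have \<sigma>: "\<bar>\<sigma>\<bar> = 1" "\<sigma> * L = \<bar>L\<bar>" unfolding \<sigma>_def using L by (auto simp: abs_sgn mult.commute sgn_mult_self_eq abs_mult)
  \<comment> \<open>One parameter is both the threshold for \<open>x\<close> and the reciprocal of
    the tolerance. The summand \<open>\<bar>s\<bar> + 2\<close> ensures \<open>0 < t\<close> and
    \<open>t \<le> 2 * x\<close> throughout the region, as \<open>bprod_bound\<close>
    requires.\<close>
  define k where "k n = \<bar>s\<bar> + 2 + real n" for n
  have "\<exists>n. \<forall>x t. x \<ge> k n \<longrightarrow> \<bar>t - x - s\<bar> \<le> 1 / k n \<longrightarrow> \<bar>L\<bar> / 2 \<le> \<sigma> * (x powr (2 * \<alpha> + \<beta> + 1) * mean t (gtest m) x)"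
  proof (rule ccontr)
    assume "\<not> ?thesis"
    then have "\<forall>n. \<exists>x t. x \<ge> k n \<and> \<bar>t - x - s\<bar> \<le> 1 / k n \<and> \<sigma> * (x powr (2 * \<alpha> + \<beta> + 1) * mean t (gtest m) x) < \<bar>L\<bar> / 2"
      by (simp add: not_le)
    then obtain X T where X: "\<And>n. X n \<ge> k n" and T: "\<And>n. \<bar>T n - X n - s\<bar> \<le> 1 / k n"
      and less: "\<And>n. \<sigma> * (X n powr (2 * \<alpha> + \<beta> + 1) * mean (T n) (gtest m) (X n)) < \<bar>L\<bar> / 2" by metis
    have k1: "k n \<ge> 1" "1 / k n \<le> 1" for n unfolding k_def by auto
    have klim: "filterlim k at_top sequentially"
      unfolding k_def by (intro filterlim_tendsto_add_at_top[OF tendsto_const] filterlim_real_sequentially)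
    have Xlim: "filterlim X at_top sequentially"
      by (rule filterlim_at_top_mono[OF klim]) (use X in auto)
    have X1: "X n \<ge> 1" for n using X[of n] k1[of n] by linarith
    have Tb: "T n > 0" "T n \<le> 2 * X n" for n
    proof -
      have "X n \<ge> \<bar>s\<bar> + 2" using X[of n] unfolding k_def by linarith
      moreover have "\<bar>T n - X n - s\<bar> \<le> 1" using T[of n] k1[of n] by linarith
      ultimately show "T n \<le> 2 * X n" "T n > 0" by linarith+
    qed
    have "(\<lambda>n. 1 / k n) \<longlonglongrightarrow> 0"
      by (intro tendsto_divide_0[OF tendsto_const] filterlim_at_top_imp_at_infinity klim)
    then have "(\<lambda>n. T n - X n - s) \<longlonglongrightarrow> 0"
      by (rule Lim_null_comparison[rotated]) (use T in \<open>auto intro!: always_eventually\<close>)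
    then have TX: "(\<lambda>n. T n - X n) \<longlonglongrightarrow> s" by (simp add: LIM_zero_iff)
    have ratio: "(\<lambda>n. X n / T n) \<longlonglongrightarrow> 1"
    proof -
      have "(\<lambda>n. (T n - X n) / X n) \<longlonglongrightarrow> 0"
        by (intro tendsto_divide_0[OF TX] filterlim_at_top_imp_at_infinity Xlim)
      then have "(\<lambda>n. 1 / (1 + (T n - X n) / X n)) \<longlonglongrightarrow> 1 / (1 + 0)" by (intro tendsto_intros) auto
      moreover have "1 / (1 + (T n - X n) / X n) = X n / T n" for n
        using X1[of n] Tb(1)[of n] by (simp add: field_simps)
      ultimately show ?thesis by simp
    qed
    have "(\<lambda>n. \<sigma> * (K * (X n / T n) powr (\<alpha> + \<beta> + 1/2) * (LINT y:{0<..}|lborel. bprod (T n) (X n) y * \<omega> m y))) \<longlonglongrightarrow> \<sigma> * L"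
      unfolding L_def by (intro tendsto_mult tendsto_const tendsto_powr ratio bprod_integral_limit[OF \<beta> Xlim X1 Tb TX]) auto
    moreover have "\<sigma> * (X n powr (2 * \<alpha> + \<beta> + 1) * mean (T n) (gtest m) (X n))
      = \<sigma> * (K * (X n / T n) powr (\<alpha> + \<beta> + 1/2) * (LINT y:{0<..}|lborel. bprod (T n) (X n) y * \<omega> m y))" for n
      using mean_gtest_scaled[OF Tb(1)[of n] _ m, of "X n"] X1[of n] unfolding K_def by simp
    ultimately have lim: "(\<lambda>n. \<sigma> * (X n powr (2 * \<alpha> + \<beta> + 1) * mean (T n) (gtest m) (X n))) \<longlonglongrightarrow> \<bar>L\<bar>"
      unfolding \<sigma>(2) by (simp only:)
    have "\<bar>L\<bar> \<le> \<bar>L\<bar> / 2"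
      by (rule LIMSEQ_le_const2[OF lim]) (use less in \<open>auto intro: less_imp_le\<close>)
    then show False using L by simp
  qed
  then obtain n where n: "\<And>x t. x \<ge> k n \<Longrightarrow> \<bar>t - x - s\<bar> \<le> 1 / k n \<Longrightarrow> \<bar>L\<bar> / 2 \<le> \<sigma> * (x powr (2 * \<alpha> + \<beta> + 1) * mean t (gtest m) x)"
    by blast
  show ?thesis
  proof (rule that[OF \<sigma>(1) _ _ _ n])
    show "\<bar>L\<bar> / 2 > 0" using L by simp
    show "k n \<ge> 1" "k n \<ge> \<bar>s\<bar> + 2" unfolding k_def by auto
  qed
qed

end

lemma powr_between:
  fixes x b r :: real
  assumes "b \<ge> 1" "1 / b \<le> x" "x \<le> b"
  shows "b powr - \<bar>r\<bar> \<le> x powr r" "x powr r \<le> b powr \<bar>r\<bar>"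
proof -
  have b: "b > 0" "1 / b > 0" using assms by auto
  have x: "x > 0" using b assms by linarith
  have up: "x powr s \<le> b powr \<bar>s\<bar>" for s
  proof (cases "s \<ge> 0")
    case True
    then show ?thesis using assms x by (auto intro!: powr_mono2)
  next
    case False
    then have "x powr s \<le> (1 / b) powr s" using assms b by (intro powr_mono2') auto
    also have "\<dots> = b powr \<bar>s\<bar>" using False b by (simp add: powr_divide powr_minus_divide)
    finally show ?thesis .
  qed
  show "x powr r \<le> b powr \<bar>r\<bar>" by (rule up)
  have "x powr - r \<le> b powr \<bar>r\<bar>" using up[of "- r"] by simp
  then have "1 / b powr \<bar>r\<bar> \<le> 1 / x powr - r" using x b by (intro divide_left_mono) auto
  then show "b powr - \<bar>r\<bar> \<le> x powr r" by (simp add: powr_minus_divide)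
qed

context spherical_kernel
begin

section \<open>Conditions forced by the behaviour at infinity\<close>

text \<open>The radius \<open>t = x + s\<close> moves with \<open>x\<close>, so this uses the
  supremum pointwise: the maximal function is at least \<open>c * x powr - e\<close> for all large
  \<open>x\<close>. Its weighted \<open>p\<close>-th power is integrable at infinity only if
  \<open>\<delta> - e * p < -1\<close>; otherwise it is at least a multiple of
  \<open>1 / x\<close>.\<close>

lemma bounded_imp_delta_lt_far:
  assumes bdd: "sph_max_bounded \<alpha> \<beta> p \<delta>" and p: "p > 1" and \<beta>: "\<beta> < 1"
  shows "\<delta> < (2 * \<alpha> + \<beta> + 1) * p - 1"
proof (rule ccontr)
  define e where "e = 2 * \<alpha> + \<beta> + 1"
  assume "\<not> \<delta> < (2 * \<alpha> + \<beta> + 1) * p - 1"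
  then have \<delta>: "\<delta> + - e * p + 1 \<ge> 0" by (simp add: e_def algebra_simps)
  have p0: "p > 0" using p by simp
  obtain m where m: "m \<ge> 1" "\<delta> + 2 * real m * p > -1"
    using exists_large_nat_multiple[OF p0, of \<delta>] by blast
  obtain I where I: "I \<ge> 0" "(\<integral>\<^sup>+x\<in>{0<..}. ennreal (x powr \<delta> * \<bar>gtest m x\<bar> powr p) \<partial>lborel) \<le> ennreal I"
    using gtest_norm_finite[OF p0 m(2)] by blast
  obtain K where K: "K \<ge> 0" and Kle: "\<And>f I h. f \<in> borel_measurable borel \<Longrightarrow> I \<ge> 0 \<Longrightarrow> h \<in> borel_measurable borel \<Longrightarrow>
      (\<integral>\<^sup>+x\<in>{0<..}. ennreal (x powr \<delta> * \<bar>f x\<bar> powr p) \<partial>lborel) \<le> ennreal I \<Longrightarrow>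
      (\<And>x. x > 0 \<Longrightarrow> h x \<le> ennreal_powr (sph_max \<alpha> \<beta> f x) p) \<Longrightarrow>
      (\<integral>\<^sup>+x\<in>{0<..}. ennreal (x powr \<delta>) * h x \<partial>lborel) \<le> ennreal (K * I)"
    by (rule sph_max_bounded_nn_integral[OF bdd p]) (rule that; blast)
  obtain s \<sigma> c k where \<sigma>: "\<bar>\<sigma>\<bar> = 1" and c: "c > 0" and k: "k \<ge> 1" "k \<ge> \<bar>s\<bar> + 2"
    and low: "\<And>x t. x \<ge> k \<Longrightarrow> \<bar>t - x - s\<bar> \<le> 1 / k \<Longrightarrow> c \<le> \<sigma> * (x powr (2 * \<alpha> + \<beta> + 1) * mean t (gtest m) x)"
    by (rule mean_gtest_lower_far[OF \<beta> m(1)]) (rule that; blast)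
  have *: "(\<integral>\<^sup>+x\<in>{0<..}. ennreal (x powr \<delta>) * ennreal (indicator {k..} x * (c * x powr - e) powr p) \<partial>lborel) \<le> ennreal (K * I)"
  proof (rule Kle[OF gtest_measurable I(1) _ I(2)])
    fix x :: real assume x: "x > 0"
    show "ennreal (indicator {k..} x * (c * x powr - e) powr p) \<le> ennreal_powr (sph_max \<alpha> \<beta> (gtest m) x) p"
    proof (cases "x \<ge> k")
      case True
      define t where "t = x + s"
      have t: "t > 0" unfolding t_def using True k(2) by linarith
      have "c \<le> \<sigma> * (x powr e * mean t (gtest m) x)" unfolding e_def using k(1) by (intro low True) (simp add: t_def)
      also have "\<dots> \<le> \<bar>\<sigma> * (x powr e * mean t (gtest m) x)\<bar>" by simp
      also have "\<dots> = x powr e * \<bar>mean t (gtest m) x\<bar>" using \<sigma> by (simp add: abs_mult)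
      finally have "c * x powr - e \<le> \<bar>mean t (gtest m) x\<bar>" using x by (simp add: powr_minus field_simps)
      then have "ennreal_powr (ennreal (c * x powr - e)) p \<le> ennreal_powr (ennreal \<bar>mean t (gtest m) x\<bar>) p"
        using p0 by (intro ennreal_powr_mono ennreal_leI) auto
      also have "\<dots> \<le> ennreal_powr (sph_max \<alpha> \<beta> (gtest m) x) p"
        using sph_max_ge[OF t, of \<alpha> \<beta> "gtest m" x] p0 unfolding sph_mean_eq_mean[OF t x gtest_measurable] by (intro ennreal_powr_mono) auto
      finally show ?thesis using True x c by (simp add: ennreal_powr_ennreal)
    qed simp
  qed measurable
  define q where "q = c powr p * k powr (\<delta> + - e * p + 1)"
  have q: "q > 0" unfolding q_def using k c by simp
  \<comment> \<open>On the interval from \<open>k\<close> to \<open>k * exp l\<close> the lower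
    bound equals \<open>q * l = K * I + 1\<close>, just above what boundedness allows.\<close>
  define l where "l = (K * I + 1) / q"
  have l: "l > 0" unfolding l_def using K I q by (intro divide_pos_pos add_nonneg_pos) auto
  have "q * ln (k * exp l / k) \<le> K * I"
  proof (rule maximal_lower_bound_integral[OF *, of k "k * exp l"])
    fix x assume x: "k \<le> x" "x \<le> k * exp l"
    then have x0: "x > 0" using k by linarith
    have "k powr (\<delta> + - e * p + 1) \<le> x powr (\<delta> + - e * p + 1)" using \<delta> x k by (intro powr_mono2) auto
    then have "q \<le> c powr p * x powr (\<delta> + - e * p + 1)" unfolding q_def by (intro mult_left_mono) auto
    also have "\<dots> = x powr \<delta> * (c powr p * x powr (- e * p)) * x"
      unfolding powr_add using x0 by simp
    also have "c powr p * x powr (- e * p) = (c * x powr - e) powr p"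
      using c x0 by (simp add: powr_mult powr_powr)
    finally show "q / x \<le> x powr \<delta> * (c * x powr - e) powr p" using x0 by (simp add: field_simps)
  qed (use k q K I l in auto)
  then have "q * l \<le> K * I" using k by simp
  then show False unfolding l_def using q by simp
qed

text \<open>The mean \<open>M\<^sub>t\<close> of the indicator of a short interval near \<open>t\<close>, paired with the test function, is
  bounded below by a multiple of \<open>t powr - \<beta>\<close>; the norm of the indicator is of order \<open>t powr (\<delta> / p)\<close>.\<close>

lemma bounded_imp_delta_ge:
  assumes bdd: "sph_max_bounded \<alpha> \<beta> p \<delta>" and p: "p > 1" and \<beta>: "\<beta> < 1"
  shows "- \<beta> * p \<le> \<delta>"
proof (rule ccontr)
  assume neg: "\<not> - \<beta> * p \<le> \<delta>"
  \<comment> \<open>The gap between the exponent of the pairing, \<open>- \<beta>\<close>, and that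
    of the norm, \<open>\<delta> / p\<close>. At gap 0 both sides have the same order in
    \<open>t\<close> and no contradiction arises, which is why equality is not excluded.\<close>
  define \<epsilon> where "\<epsilon> = - \<beta> - \<delta> / p"
  have \<epsilon>: "\<epsilon> > 0" using neg p unfolding \<epsilon>_def by (simp add: field_simps)
  have q: "p / (p - 1) > 0" using p by simp
  obtain m where m: "m \<ge> 1" "\<delta> + (2 * \<alpha> + 1 - \<delta>) * (p / (p - 1)) + 2 * real m * (p / (p - 1)) > -1"
    using exists_large_nat_multiple[OF q, of "\<delta> + (2 * \<alpha> + 1 - \<delta>) * (p / (p - 1))"] by blast
  obtain K where K: "K \<ge> 0" and Kle: "\<And>t f N. t > 0 \<Longrightarrow> f \<in> borel_measurable borel \<Longrightarrow>
    set_integrable lborel {0<..} (\<lambda>x. x powr (\<alpha> + 1) * Q x * \<bar>f x\<bar>) \<Longrightarrow> N > 0 \<Longrightarrow>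
    (\<integral>\<^sup>+x\<in>{0<..}. ennreal (x powr \<delta> * \<bar>f x\<bar> powr p) \<partial>lborel) \<le> ennreal (N powr p) \<Longrightarrow>
    (LINT x:{0<..}|lborel. x powr (2 * \<alpha> + 1) * f x * mean t (gtest m) x) \<le> K * N"
    using dual_estimate[OF bdd p m] by blast
  obtain s \<sigma> c k where \<sigma>: "\<bar>\<sigma>\<bar> = 1" and c: "c > 0" and k: "k \<ge> 1" "k \<ge> \<bar>s\<bar> + 2"
    and low: "\<And>x t. x \<ge> k \<Longrightarrow> \<bar>t - x - s\<bar> \<le> 1 / k \<Longrightarrow> c \<le> \<sigma> * (x powr (2 * \<alpha> + \<beta> + 1) * mean t (gtest m) x)"
    by (rule mean_gtest_lower_far[OF \<beta> m(1)]) (rule that; blast)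
  \<comment> \<open>The length \<open>2 / k\<close> of the interval times the pointwise lower bound;
    the power of 2 pays for replacing \<open>x\<close> by \<open>t\<close>, which is legitimate
    because \<open>t / 2 \<le> x \<le> 2 * t\<close> there.\<close>
  define c1 where "c1 = 2 / k * (c * 2 powr - \<bar>\<beta>\<bar>)"
  have c1: "c1 > 0" unfolding c1_def using k c by simp
  define N0 where "N0 = (2 / k * 2 powr \<bar>\<delta>\<bar>) powr (1 / p)"
  have N0: "N0 > 0" unfolding N0_def using k by simp
  have main: "c1 * t powr \<epsilon> \<le> K * N0" if t: "t \<ge> 2 * (\<bar>s\<bar> + 1 + k)" for t
  proof -
    have t0: "t > 0" using t k abs_ge_zero[of s] by argo
    \<comment> \<open>Exactly the points \<open>x\<close> with
      \<open>\<bar>t - x - s\<bar> \<le> 1 / k\<close>, where the lower bound at infinity is valid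
      for this one radius.\<close>
    define a b where "a = t - s - 1 / k" and "b = t - s + 1 / k"
    have k1: "0 < 1 / k" "1 / k \<le> 1" using k by auto
    have ab: "a \<le> b" "b - a = 2 / k" unfolding a_def b_def using k1 by auto
    have in_ab: "k \<le> x \<and> \<bar>t - x - s\<bar> \<le> 1 / k \<and> t / 2 \<le> x \<and> x \<le> 2 * t" if "x \<in> {a..b}" for x
    proof -
      define i where "i = 1 / k"
      have "0 < i" "i \<le> 1" "t - s - i \<le> x" "x \<le> t - s + i"
        using that k1 unfolding a_def b_def i_def by auto
      moreover have "s \<le> \<bar>s\<bar>" "- s \<le> \<bar>s\<bar>" by auto
      ultimately show ?thesis
        using t k unfolding i_def[symmetric] abs_le_iff by argo
    qed
    have a0: "a > 0" using in_ab[of a] ab k by auto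
    have sub: "{a..b} \<subseteq> {0<..}" using a0 by auto
    have scale: "2 powr - \<bar>r\<bar> * t powr r \<le> x powr r" "x powr r \<le> 2 powr \<bar>r\<bar> * t powr r" if "x \<in> {a..b}" for x r
    proof -
      have "1 / 2 \<le> x / t" "x / t \<le> 2" using in_ab[OF that] t0 by (auto simp: field_simps)
      then have "2 powr - \<bar>r\<bar> \<le> (x / t) powr r" "(x / t) powr r \<le> 2 powr \<bar>r\<bar>" by (auto intro: powr_between)
      then have "2 powr - \<bar>r\<bar> * t powr r \<le> (x / t) powr r * t powr r" "(x / t) powr r * t powr r \<le> 2 powr \<bar>r\<bar> * t powr r"
        by (auto intro: mult_right_mono)
      moreover have "(x / t) powr r * t powr r = x powr r" using t0 by (simp add: powr_divide)
      ultimately show "2 powr - \<bar>r\<bar> * t powr r \<le> x powr r" "x powr r \<le> 2 powr \<bar>r\<bar> * t powr r" by simp_all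
    qed
    define f where "f x = indicator {a..b} x * \<sigma>" for x
    have fm [measurable]: "f \<in> borel_measurable borel" unfolding f_def[abs_def] by measurable
    have fi: "set_integrable lborel {0<..} (\<lambda>x. x powr (\<alpha> + 1) * Q x * \<bar>f x\<bar>)"
    proof -
      have "set_integrable lborel {0<..} (\<lambda>x. indicator {a..b} x * (x powr (\<alpha> + 1) * Q x))"
        unfolding set_integral_indicator_subset(1)[OF sub] Q_def using a0
        by (intro set_integrable_continuous_Icc continuous_intros) auto
      moreover have "x powr (\<alpha> + 1) * Q x * \<bar>f x\<bar> = indicator {a..b} x * (x powr (\<alpha> + 1) * Q x)" for x
        unfolding f_def by (simp add: abs_mult \<sigma>)
      ultimately show ?thesis by (simp only:)
    qed
    define N where "N = N0 * t powr (\<delta> / p)"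
    have N: "N > 0" unfolding N_def using N0 t0 by simp
    have Np: "N powr p = 2 / k * (2 powr \<bar>\<delta>\<bar> * t powr \<delta>)"
      unfolding N_def N0_def using p k t0 by (simp add: powr_mult powr_powr)
    have "(\<integral>\<^sup>+x\<in>{0<..}. ennreal (x powr \<delta> * \<bar>f x\<bar> powr p) \<partial>lborel) \<le> (\<integral>\<^sup>+x. ennreal (2 powr \<bar>\<delta>\<bar> * t powr \<delta>) * indicator {a..b} x \<partial>lborel)"
    proof (rule nn_integral_mono)
      fix x
      show "ennreal (x powr \<delta> * \<bar>f x\<bar> powr p) * indicator {0<..} x \<le> ennreal (2 powr \<bar>\<delta>\<bar> * t powr \<delta>) * indicator {a..b} x"
      proof (cases "x \<in> {a..b}")
        case True
        then show ?thesis using scale(2)[OF True, of \<delta>] sub by (auto simp: f_def \<sigma> intro!: ennreal_leI)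
      qed (use p in \<open>simp add: f_def\<close>)
    qed
    also have "\<dots> = ennreal (2 powr \<bar>\<delta>\<bar> * t powr \<delta>) * ennreal (b - a)"
      using ab by (subst nn_integral_cmult_indicator) auto
    also have "\<dots> = ennreal (N powr p)"
      unfolding Np ab(2) using k by (simp add: ennreal_mult[symmetric] mult.commute)
    finally have fN: "(\<integral>\<^sup>+x\<in>{0<..}. ennreal (x powr \<delta> * \<bar>f x\<bar> powr p) \<partial>lborel) \<le> ennreal (N powr p)" .
    have upper: "(LINT x:{0<..}|lborel. x powr (2 * \<alpha> + 1) * f x * mean t (gtest m) x) \<le> K * N"
      by (rule Kle[OF t0 fm fi N fN])
    have fx: "x powr (2 * \<alpha> + 1) * f x * mean t (gtest m) x = indicator {a..b} x * (x powr (2 * \<alpha> + 1) * (\<sigma> * mean t (gtest m) x))" for x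
      unfolding f_def by simp
    have intm: "set_integrable lborel {a..b} (\<lambda>x. x powr (2 * \<alpha> + 1) * (\<sigma> * mean t (gtest m) x))"
      using mean_pairing(3)[OF t0 m(1) fm fi] unfolding fx set_integral_indicator_subset(1)[OF sub] .
    have "c1 * t powr - \<beta> = (LINT x:{a..b}|lborel. c * (2 powr - \<bar>\<beta>\<bar> * t powr - \<beta>))"
      using ab by (simp add: c1_def set_lebesgue_integral_def mult_ac)
    also have "\<dots> \<le> (LINT x:{a..b}|lborel. x powr (2 * \<alpha> + 1) * (\<sigma> * mean t (gtest m) x))"
    proof (rule set_integral_mono[OF _ intm])
      show "set_integrable lborel {a..b} (\<lambda>x. c * (2 powr - \<bar>\<beta>\<bar> * t powr - \<beta>))"
        by (intro set_integrable_continuous_Icc continuous_intros)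
      fix x assume x: "x \<in> {a..b}"
      then have x0: "x > 0" using sub by auto
      have "c * (2 powr - \<bar>\<beta>\<bar> * t powr - \<beta>) \<le> c * x powr - \<beta>" using scale(1)[OF x, of "- \<beta>"] c by simp
      also have "\<dots> = x powr - \<beta> * c" by simp
      also have "\<dots> \<le> x powr - \<beta> * (\<sigma> * (x powr (2 * \<alpha> + \<beta> + 1) * mean t (gtest m) x))"
        using in_ab[OF x] by (intro mult_left_mono low) auto
      also have "\<dots> = (x powr - \<beta> * x powr (2 * \<alpha> + \<beta> + 1)) * (\<sigma> * mean t (gtest m) x)" by simp
      also have "x powr - \<beta> * x powr (2 * \<alpha> + \<beta> + 1) = x powr (2 * \<alpha> + 1)" unfolding powr_add[symmetric] by (simp add: algebra_simps)
      finally show "c * (2 powr - \<bar>\<beta>\<bar> * t powr - \<beta>) \<le> x powr (2 * \<alpha> + 1) * (\<sigma> * mean t (gtest m) x)" .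
    qed
    also have "\<dots> = (LINT x:{0<..}|lborel. x powr (2 * \<alpha> + 1) * f x * mean t (gtest m) x)"
      unfolding fx set_integral_indicator_subset(2)[OF sub] ..
    also have "\<dots> \<le> K * N" by (rule upper)
    finally have "c1 * t powr - \<beta> \<le> K * (N0 * t powr (\<delta> / p))" unfolding N_def .
    then have "c1 * t powr - \<beta> * t powr - (\<delta> / p) \<le> K * (N0 * t powr (\<delta> / p)) * t powr - (\<delta> / p)"
      by (intro mult_right_mono) auto
    moreover have "t powr - \<beta> * t powr - (\<delta> / p) = t powr \<epsilon>" "t powr (\<delta> / p) * t powr - (\<delta> / p) = 1"
      unfolding \<epsilon>_def powr_add[symmetric] using t0 by simp_all
    ultimately show ?thesis by (simp add: mult.assoc)
  qed
  define t where "t = max (2 * (\<bar>s\<bar> + 1 + k)) ((K * N0 / c1 + 1) powr (1 / \<epsilon>))"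
  have pos: "K * N0 / c1 + 1 > 0" using K N0 c1 by (intro add_nonneg_pos divide_nonneg_pos) auto
  have "K * N0 / c1 + 1 = ((K * N0 / c1 + 1) powr (1 / \<epsilon>)) powr \<epsilon>" using \<epsilon> pos by (simp add: powr_powr)
  also have "\<dots> \<le> t powr \<epsilon>" unfolding t_def using \<epsilon> by (intro powr_mono2) auto
  finally have "c1 * (K * N0 / c1 + 1) \<le> c1 * t powr \<epsilon>" using c1 by (intro mult_left_mono) auto
  also have "\<dots> \<le> K * N0" by (rule main) (simp add: t_def)
  finally have "c1 * (K * N0 / c1 + 1) \<le> K * N0" .
  moreover have "c1 * (K * N0 / c1 + 1) = K * N0 + c1" using c1 by (simp add: distrib_left)
  ultimately show False using c1 by simp
qed

end

subsection \<open>Singularity of the kernel\<close>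

lemma cos_negative_frequency: "cos (\<theta> * y - \<eta>) = cos (\<bar>\<theta>\<bar> * y - (- \<eta>))" if "\<theta> < 0" for \<theta> y \<eta> :: real
proof -
  have "\<bar>\<theta>\<bar> * y - (- \<eta>) = - (\<theta> * y - \<eta>)" using that by simp
  then show ?thesis by (simp only: cos_minus)
qed

context spherical_kernel
begin

lemma Q_le: "1 / 4 \<le> w \<Longrightarrow> w \<le> 4 \<Longrightarrow> Q w \<le> 1 + 4 powr \<bar>\<alpha>\<bar> * 5 + 4 powr (3/2)"
proof -
  assume w: "1 / 4 \<le> w" "w \<le> 4"
  have "w powr \<alpha> * (1 + w) \<le> 4 powr \<bar>\<alpha>\<bar> * 5"
    using w by (intro mult_mono powr_between) auto
  moreover have "w powr (-3/2) \<le> 4 powr \<bar>-3/2\<bar>" using w by (intro powr_between) auto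
  ultimately show ?thesis unfolding Q_def by simp
qed

text \<open>The integral governing the singularity at \<open>z = x - t\<close> has frequency \<open>t - x + z = \<tau> * v\<close>. Its
  leading coefficient depends on the unspecified phase \<open>\<phi>\<close> and may vanish on one side of \<open>z = 1\<close>, but
  not on both.\<close>

lemma ker_singularity:
  assumes small: "\<alpha> + \<beta> < 1/2"
  obtains \<tau> \<sigma> c E where "\<bar>\<tau>\<bar> = 1" "\<bar>\<sigma>\<bar> = 1" "c > 0" "E \<ge> 0"
    "\<And>x v. 3 \<le> x \<Longrightarrow> x \<le> 4 \<Longrightarrow> 0 < v \<Longrightarrow> v \<le> 1/2 \<Longrightarrow>
      c * v powr (\<alpha> + \<beta> - 1/2) - E \<le> \<sigma> * (ker (x - 1) x (1 + \<tau> * v) * (1 + \<tau> * v) powr (2 * \<alpha> + 1))"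
proof -
  define s where "s = \<alpha> + \<beta> + 1/2"
  have s: "0 < s" "s < 1" using \<nu> small unfolding s_def by auto
  obtain \<kappa> :: "real \<Rightarrow> real" where
    \<kappa>: "\<And>\<phi> \<theta> l. \<theta> > 0 \<Longrightarrow> ((\<lambda>R. LINT y:{1..R}|lborel. cos (\<theta> * y - \<phi>) * y powr - s) \<longlongrightarrow> l) at_top
      \<Longrightarrow> \<bar>l - \<kappa> \<phi> * \<theta> powr (s - 1)\<bar> \<le> 1 / (1 - s)" and
    nz: "\<And>\<phi>. \<kappa> \<phi> \<noteq> 0 \<or> \<kappa> (- \<phi>) \<noteq> 0"
    using cos_powr_integral_singularity[OF s] by blast
  define \<tau> where "\<tau> = (if \<kappa> \<phi> \<noteq> 0 then 1 else -1 :: real)"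
  have \<tau>: "\<bar>\<tau>\<bar> = 1" unfolding \<tau>_def by auto
  have k0: "\<kappa> (\<tau> * \<phi>) \<noteq> 0" unfolding \<tau>_def using nz[of \<phi>] by auto
  have oscl: "\<bar>l - \<kappa> (\<tau> * \<phi>) * v powr (s - 1)\<bar> \<le> 1 / (1 - s)"
    if v: "v > 0" and l: "(osc (\<tau> * v) \<phi> \<longlongrightarrow> l) at_top" for v l
  proof (rule \<kappa>[OF v])
    \<comment> \<open>On the left of \<open>z = 1\<close> the frequency is negative. As the cosine
      is even, this reverses the phase and not only the frequency, so the leading coefficient is
      \<open>\<kappa> (\<tau> * \<phi>)\<close> at positive frequency \<open>v\<close>.\<close>
    have "cos (\<tau> * v * y - \<phi>) = cos (v * y - \<tau> * \<phi>)" for y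
      using cos_negative_frequency[of "- v" y \<phi>] v unfolding \<tau>_def by auto
    then show "((\<lambda>R. LINT y:{1..R}|lborel. cos (v * y - \<tau> * \<phi>) * y powr - s) \<longlongrightarrow> l) at_top"
      using l unfolding osc_def[abs_def] s_def by simp
  qed
  define \<sigma> where "\<sigma> = sgn (\<kappa> (\<tau> * \<phi>))"
  have \<sigma>: "\<bar>\<sigma>\<bar> = 1" "\<sigma> * \<kappa> (\<tau> * \<phi>) = \<bar>\<kappa> (\<tau> * \<phi>)\<bar>"
    unfolding \<sigma>_def using k0 by (auto simp: abs_sgn mult.commute sgn_mult_self_eq abs_mult)
  \<comment> \<open>For \<open>x\<close> in \<open>{3..4}\<close> and \<open>t = x - 1\<close>, all
    of \<open>t\<close>, \<open>x\<close> and \<open>z\<close> lie between \<open>1 / 4\<close> and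
    \<open>4\<close>. The constants from here to \<open>m2\<close> bound the powers, weights and
    prefactors uniformly on that range.\<close>
  define qb where "qb = 1 + 4 powr \<bar>\<alpha>\<bar> * 5 + 4 powr (3/2)"
  define rb where "rb = 8 * C ^ 3 / (2 * \<alpha> + 2) * (4 powr \<bar>\<alpha> + \<beta>\<bar> * 5) + 3 * (A + B + C) ^ 3 * qb * tail"
  define a1 where "a1 = A * B * B * (4 powr (1/2)) ^ 3 / 4"
  define a0 where "a0 = A * B * B * (4 powr (-1/2)) ^ 3 / 4"
  have a01: "a0 > 0" "a1 > 0" unfolding a0_def a1_def using A B by simp_all
  define e where "e = rb * (qb * qb) + a1 * ((2 + 1 / \<gamma>) * 6) + a1 * (1 / (1 - s))"
  define w0 where "w0 = 2 powr (\<alpha> + \<beta>) * Gamma (\<alpha> + \<beta> + 1)"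
  have w0: "w0 > 0" unfolding w0_def using \<nu> by (intro mult_pos_pos Gamma_real_pos) auto
  define q where "q = \<bar>- (\<alpha> + \<beta>)\<bar> + \<bar>- \<alpha>\<bar> + \<bar>\<alpha> + 1\<bar>"
  define m1 where "m1 = w0 * 4 powr - q"
  define m2 where "m2 = w0 * 4 powr q"
  have m12: "m1 > 0" "m2 > 0" unfolding m1_def m2_def using w0 by simp_all
  have main: "m1 * a0 * \<bar>\<kappa> (\<tau> * \<phi>)\<bar> * v powr (s - 1) - m2 * e \<le> \<sigma> * (ker (x - 1) x (1 + \<tau> * v) * (1 + \<tau> * v) powr (2 * \<alpha> + 1)) \<and> e \<ge> 0"
    if x: "3 \<le> x" "x \<le> 4" and v: "0 < v" "v \<le> 1/2" for x v
  proof -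
    define t where "t = x - 1"
    define z where "z = 1 + \<tau> * v"
    have \<tau>v: "- v \<le> \<tau> * v" "\<tau> * v \<le> v" "\<tau> * v \<noteq> 0" using v unfolding \<tau>_def by auto
    have z: "1 / 2 \<le> z" "z \<le> 3 / 2" "z \<noteq> 1" unfolding z_def using \<tau>v v by linarith+
    have t: "2 \<le> t" "t \<le> 3" unfolding t_def using x by auto
    have pos: "0 < t" "0 < x" "0 < z" using t x z by auto
    have ne: "z \<noteq> t + x" "z \<noteq> x - t" "z \<noteq> t - x" using z t x unfolding t_def by auto
    obtain L l where L: "(trunc t x z \<longlongrightarrow> L) at_top" and l: "(osc (t - x + z) \<phi> \<longlongrightarrow> l) at_top" and
      Ll: "\<bar>L - A * B * B * (t * x * z) powr (-1/2) / 4 * l\<bar> \<le> regular_bound t * (Q x * Q z) +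
      A * B * B * (t * x * z) powr (-1/2) / 4 * ((2 + 1 / \<gamma>) *
        (3 + \<bar>t + x + z\<bar> powr - \<gamma> + \<bar>t + x - z\<bar> powr - \<gamma> + \<bar>t - x - z\<bar> powr - \<gamma>))"
      using trunc_limit[OF pos ne] by blast
    have eqL: "lim (\<lambda>n. trunc t x z (real n)) = L"
      by (rule limI[OF filterlim_compose[OF L filterlim_real_sequentially]])
    have "t - x + z = \<tau> * v" unfolding t_def z_def by simp
    then have lk: "\<bar>l - \<kappa> (\<tau> * \<phi>) * v powr (s - 1)\<bar> \<le> 1 / (1 - s)" using oscl[OF v(1)] l by simp
    define a where "a = A * B * B * (t * x * z) powr (-1/2) / 4"
    have r4: "4 powr - \<bar>r\<bar> \<le> u powr r" "u powr r \<le> 4 powr \<bar>r\<bar>" if "u \<in> {t, x, z}" for u r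
      using that t x z by (auto intro!: powr_between)
    have a: "a0 \<le> a" "a \<le> a1"
    proof -
      have p: "(t * x * z) powr (-1/2) = t powr (-1/2) * x powr (-1/2) * z powr (-1/2)" by (simp only: powr_mult)
      have lo: "4 powr (-1/2) \<le> u powr (-1/2)" and hi: "u powr (-1/2) \<le> 4 powr (1/2)" if "u \<in> {t, x, z}" for u
        using r4[OF that, of "-1/2"] by simp_all
      have "(4 powr (-1/2)) ^ 3 \<le> (t * x * z) powr (-1/2)"
        unfolding p power3_eq_cube by (intro mult_mono lo) auto
      then show "a0 \<le> a" unfolding a0_def a_def using A B by (intro divide_right_mono mult_left_mono) auto
      have "(t * x * z) powr (-1/2) \<le> (4 powr (1/2)) ^ 3"
        unfolding p power3_eq_cube by (intro mult_mono hi) auto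
      then show "a \<le> a1" unfolding a1_def a_def using A B by (intro divide_right_mono mult_left_mono) auto
    qed
    have qz: "Q x \<le> qb" "Q z \<le> qb" "Q t \<le> qb" unfolding qb_def by (rule Q_le; use x z t in linarith)+
    have Q0: "Q x > 0" "Q z > 0" "Q t > 0" using pos Q_pos by auto
    have rbt: "regular_bound t \<le> rb"
      unfolding regular_bound_def rb_def
    proof (intro add_mono mult_left_mono mult_right_mono)
      have "t powr (\<alpha> + \<beta>) * (1 + t) \<le> 4 powr \<bar>\<alpha> + \<beta>\<bar> * 5" using t by (intro mult_mono r4) auto
      then show "t powr (\<alpha> + \<beta>) * (1 + t) \<le> 4 powr \<bar>\<alpha> + \<beta>\<bar> * 5" .
      have "2 * \<alpha> + 2 > 0" using \<alpha> by simp
      then show "0 \<le> 8 * C ^ 3 / (2 * \<alpha> + 2)" using C by simp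
    qed (use qz A B C tail_nonneg in auto)
    have rb0: "rb \<ge> 0" using rbt regular_bound_nonneg[OF pos(1)] by linarith
    have g1: "\<bar>u\<bar> powr - \<gamma> \<le> 1" if "\<bar>u\<bar> \<ge> 1" for u
    proof -
      have "\<bar>u\<bar> powr - \<gamma> \<le> 1 powr - \<gamma>" using that \<gamma> by (intro powr_mono2') auto
      then show ?thesis by simp
    qed
    \<comment> \<open>With \<open>t = x - 1\<close> the other three frequencies keep distance at
      least 1 from 0; for instance \<open>t - x - z = - 1 - z\<close>. Only the singled-out term is
      singular near \<open>z = 1\<close>.\<close>
    have three: "\<bar>t + x + z\<bar> powr - \<gamma> \<le> 1" "\<bar>t + x - z\<bar> powr - \<gamma> \<le> 1" "\<bar>t - x - z\<bar> powr - \<gamma> \<le> 1"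
      by (rule g1; use t x z t_def in linarith)+
    have "regular_bound t * (Q x * Q z) \<le> rb * (qb * qb)"
      using rbt qz Q0 rb0 by (intro mult_mono) auto
    moreover have "a * ((2 + 1 / \<gamma>) * (3 + \<bar>t + x + z\<bar> powr - \<gamma> + \<bar>t + x - z\<bar> powr - \<gamma> + \<bar>t - x - z\<bar> powr - \<gamma>)) \<le> a1 * ((2 + 1 / \<gamma>) * 6)"
      using three a a01 \<gamma> by (intro mult_mono mult_left_mono) auto
    ultimately have e1: "\<bar>L - a * l\<bar> \<le> rb * (qb * qb) + a1 * ((2 + 1 / \<gamma>) * 6)"
      using Ll unfolding a_def[symmetric] by (rule order_trans[OF _ add_mono, rotated])
    have e2: "\<bar>a * l - a * (\<kappa> (\<tau> * \<phi>) * v powr (s - 1))\<bar> \<le> a1 * (1 / (1 - s))"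
    proof -
      have "\<bar>a * l - a * (\<kappa> (\<tau> * \<phi>) * v powr (s - 1))\<bar> = a * \<bar>l - \<kappa> (\<tau> * \<phi>) * v powr (s - 1)\<bar>"
        unfolding right_diff_distrib[symmetric] abs_mult using a a01 by simp
      also have "\<dots> \<le> a1 * (1 / (1 - s))" using a a01 lk by (intro mult_mono) auto
      finally show ?thesis .
    qed
    have e0: "e \<ge> 0" using order_trans[OF abs_ge_zero e1] order_trans[OF abs_ge_zero e2] unfolding e_def by linarith
    have "\<bar>L - a * (\<kappa> (\<tau> * \<phi>) * v powr (s - 1))\<bar> \<le> e"
      using abs_add_le[OF e1 e2] unfolding e_def by (simp add: algebra_simps)
    then have "\<bar>\<sigma> * (L - a * (\<kappa> (\<tau> * \<phi>) * v powr (s - 1)))\<bar> \<le> e" unfolding abs_mult[of \<sigma>] \<sigma> by simp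
    moreover have "\<sigma> * (L - a * (\<kappa> (\<tau> * \<phi>) * v powr (s - 1))) = \<sigma> * L - a * (\<sigma> * \<kappa> (\<tau> * \<phi>)) * v powr (s - 1)"
      by (simp add: algebra_simps)
    ultimately have "a * \<bar>\<kappa> (\<tau> * \<phi>)\<bar> * v powr (s - 1) - e \<le> \<sigma> * L" unfolding \<sigma>(2) by linarith
    moreover have "a0 * \<bar>\<kappa> (\<tau> * \<phi>)\<bar> * v powr (s - 1) \<le> a * \<bar>\<kappa> (\<tau> * \<phi>)\<bar> * v powr (s - 1)"
      using a by (intro mult_right_mono) auto
    ultimately have sL: "a0 * \<bar>\<kappa> (\<tau> * \<phi>)\<bar> * v powr (s - 1) - e \<le> \<sigma> * L" by linarith
    \<comment> \<open>All positive prefactors of the kernel combined with the density in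
      \<open>z\<close>. Since \<open>w\<close> lies between two positive constants, the singularity
      of \<open>L\<close> carries over to the weighted kernel.\<close>
    define w where "w = w0 * (t powr - (\<alpha> + \<beta>) * x powr - \<alpha> * z powr (\<alpha> + 1))"
    have keq: "ker t x z * z powr (2 * \<alpha> + 1) = w * L"
    proof -
      have zz: "z powr (\<alpha> + 1) = z powr - \<alpha> * z powr (2 * \<alpha> + 1)" unfolding powr_add[symmetric] by (simp add: algebra_simps)
      show ?thesis unfolding w_def zz ker_def eqL w0_def powr_minus powr_mult by (simp add: divide_inverse mult_ac)
    qed
    have w: "m1 \<le> w" "w \<le> m2"
    proof -
      have q1: "4 powr - q = 4 powr - \<bar>- (\<alpha> + \<beta>)\<bar> * 4 powr - \<bar>- \<alpha>\<bar> * 4 powr - \<bar>\<alpha> + 1\<bar>"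
        unfolding powr_add[symmetric] q_def by (simp only: minus_add_distrib)
      show "m1 \<le> w" unfolding m1_def w_def q1 using w0 by (intro mult_left_mono mult_mono r4) auto
      have q2: "4 powr q = 4 powr \<bar>- (\<alpha> + \<beta>)\<bar> * 4 powr \<bar>- \<alpha>\<bar> * 4 powr \<bar>\<alpha> + 1\<bar>"
        unfolding powr_add[symmetric] q_def by (rule refl)
      show "w \<le> m2" unfolding m2_def w_def q2 using w0 by (intro mult_left_mono mult_mono r4) auto
    qed
    have "m1 * (a0 * \<bar>\<kappa> (\<tau> * \<phi>)\<bar> * v powr (s - 1)) \<le> w * (a0 * \<bar>\<kappa> (\<tau> * \<phi>)\<bar> * v powr (s - 1))"
      using w a01 by (intro mult_right_mono) auto
    moreover have "w * e \<le> m2 * e" using w e0 by (intro mult_right_mono) auto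
    moreover have "w * (a0 * \<bar>\<kappa> (\<tau> * \<phi>)\<bar> * v powr (s - 1) - e) \<le> w * (\<sigma> * L)"
      using w m12 by (intro mult_left_mono sL) auto
    moreover have "w * (a0 * \<bar>\<kappa> (\<tau> * \<phi>)\<bar> * v powr (s - 1) - e) = w * (a0 * \<bar>\<kappa> (\<tau> * \<phi>)\<bar> * v powr (s - 1)) - w * e"
      by (rule right_diff_distrib)
    ultimately have "m1 * (a0 * \<bar>\<kappa> (\<tau> * \<phi>)\<bar> * v powr (s - 1)) - m2 * e \<le> w * (\<sigma> * L)" by linarith
    also have "w * (\<sigma> * L) = \<sigma> * (ker t x z * z powr (2 * \<alpha> + 1))" unfolding keq by simp
    finally show ?thesis using e0 unfolding t_def z_def by (simp add: mult.assoc)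
  qed
  show ?thesis
  proof (rule that[OF \<tau> \<sigma>(1)])
    show "m1 * a0 * \<bar>\<kappa> (\<tau> * \<phi>)\<bar> > 0" using m12 a01 k0 by simp
    have "e \<ge> 0" using main[of 3 "1/2"] by simp
    then show "m2 * e \<ge> 0" using m12 by simp
    have "s - 1 = \<alpha> + \<beta> - 1/2" unfolding s_def by simp
    then show "m1 * a0 * \<bar>\<kappa> (\<tau> * \<phi>)\<bar> * v powr (\<alpha> + \<beta> - 1/2) - m2 * e \<le> \<sigma> * (ker (x - 1) x (1 + \<tau> * v) * (1 + \<tau> * v) powr (2 * \<alpha> + 1))"
      if "3 \<le> x" "x \<le> 4" "0 < v" "v \<le> 1/2" for x v
      using main[OF that] by simp
  qed
qed


text \<open>The function \<open>\<bar>z - 1\<bar> powr - (\<alpha> + \<beta> + 1/2)\<close>, cut off at distance \<open>exp (- l) / 2\<close> from \<open>z = 1\<close>, has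
  norm \<open>O(l powr (1 / p))\<close>, but its mean over the sphere of radius \<open>t = x - 1\<close> is of order \<open>l\<close>.\<close>

lemma bounded_imp_inverse_p_lt:
  assumes bdd: "sph_max_bounded \<alpha> \<beta> p \<delta>" and p: "p > 1" and small: "\<alpha> + \<beta> < 1/2"
  shows "1 / p < \<alpha> + \<beta> + 1/2"
proof (rule ccontr)
  assume neg: "\<not> 1 / p < \<alpha> + \<beta> + 1/2"
  define s where "s = \<alpha> + \<beta> + 1/2"
  have s: "0 < s" "s < 1" using \<nu> small unfolding s_def by auto
  have p0: "p > 0" using p by simp
  have "s \<le> 1 / p" using neg unfolding s_def by simp
  \<comment> \<open>In this form the negated claim makes \<open>v powr - s\<close> affordable: its
    \<open>p\<close>-th power is at most \<open>1 / v\<close> for \<open>v \<le> 1\<close>, so the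
    norm of the truncated function costs only a logarithm.\<close>
  then have sp: "s * p \<le> 1" using p0 by (simp add: pos_le_divide_eq)
  obtain K where K: "K \<ge> 0" and Kle: "\<And>f I h. f \<in> borel_measurable borel \<Longrightarrow> I \<ge> 0 \<Longrightarrow> h \<in> borel_measurable borel \<Longrightarrow>
      (\<integral>\<^sup>+x\<in>{0<..}. ennreal (x powr \<delta> * \<bar>f x\<bar> powr p) \<partial>lborel) \<le> ennreal I \<Longrightarrow>
      (\<And>x. x > 0 \<Longrightarrow> h x \<le> ennreal_powr (sph_max \<alpha> \<beta> f x) p) \<Longrightarrow>
      (\<integral>\<^sup>+x\<in>{0<..}. ennreal (x powr \<delta>) * h x \<partial>lborel) \<le> ennreal (K * I)"
    by (rule sph_max_bounded_nn_integral[OF bdd p]) (rule that; blast)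
  obtain \<tau> \<sigma> c E where \<tau>: "\<bar>\<tau>\<bar> = 1" and \<sigma>: "\<bar>\<sigma>\<bar> = 1" and c: "c > 0" and E: "E \<ge> 0"
    and low: "\<And>x v. 3 \<le> x \<Longrightarrow> x \<le> 4 \<Longrightarrow> 0 < v \<Longrightarrow> v \<le> 1/2 \<Longrightarrow>
      c * v powr (\<alpha> + \<beta> - 1/2) - E \<le> \<sigma> * (ker (x - 1) x (1 + \<tau> * v) * (1 + \<tau> * v) powr (2 * \<alpha> + 1))"
    by (rule ker_singularity[OF small]) (rule that; blast)
  have \<tau>0: "\<tau> \<noteq> 0" using \<tau> by auto
  have \<tau>\<tau>: "\<tau> * (\<tau> * v) = v" for v
    using \<tau> by (metis abs_mult_self_eq mult.assoc mult_1)
  have near: "1 / 2 \<le> 1 + \<tau> * v" "1 + \<tau> * v \<le> 2" if "0 < v" "v \<le> 1/2" for v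
  proof -
    have "\<bar>\<tau> * v\<bar> = v" using \<tau> that by (simp add: abs_mult)
    then show "1 / 2 \<le> 1 + \<tau> * v" "1 + \<tau> * v \<le> 2" using that by (auto simp: abs_if split: if_splits)
  qed
  define c2 where "c2 = E / (1 - s)"
  have c2: "c2 \<ge> 0" unfolding c2_def using E s by simp
  have main: "4 powr - \<bar>\<delta>\<bar> * (c * l - c2) powr p \<le> K * (2 powr \<bar>\<delta>\<bar> * l)" if l: "l > 0" "c * l - c2 \<ge> 0" for l
  proof -
    \<comment> \<open>The cutoff is parametrised so that the integral of \<open>1 / v\<close> over
      \<open>{\<epsilon>..1/2}\<close> is exactly \<open>l\<close>.\<close>
    define \<epsilon> where "\<epsilon> = exp (- l) / 2"
    have \<epsilon>: "0 < \<epsilon>" "\<epsilon> \<le> 1/2" unfolding \<epsilon>_def using l by auto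
    have ln\<epsilon>: "ln (1 / 2 / \<epsilon>) = l" "ln (1/2) - ln \<epsilon> = l"
      unfolding \<epsilon>_def by (simp_all add: ln_div exp_minus ln_inverse)
    \<comment> \<open>\<open>v = \<tau> * (z - 1)\<close> is the distance from 1 on the side where
      the coefficient is nonzero; since \<open>\<tau>\<close> squares to 1, the inverse substitution
      is \<open>z = 1 + \<tau> * v\<close>. The function depends on \<open>l\<close> but not on
      \<open>x\<close>, so one \<open>f\<close> serves all radii \<open>x - 1\<close>.\<close>
    define f where "f z = indicator {\<epsilon>..1/2} (\<tau> * (z - 1)) * (\<sigma> * \<bar>z - 1\<bar> powr - s)" for z
    have fm [measurable]: "f \<in> borel_measurable borel" unfolding f_def[abs_def] by measurable
    have f\<tau>: "f (1 + \<tau> * v) = indicator {\<epsilon>..1/2} v * (\<sigma> * v powr - s)" for v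
      using \<epsilon> \<tau> unfolding f_def by (auto simp: \<tau>\<tau> abs_mult indicator_def)
    have norm: "(\<integral>\<^sup>+x\<in>{0<..}. ennreal (x powr \<delta> * \<bar>f x\<bar> powr p) \<partial>lborel) \<le> ennreal (2 powr \<bar>\<delta>\<bar> * l)"
    proof -
      have "(\<integral>\<^sup>+x\<in>{0<..}. ennreal (x powr \<delta> * \<bar>f x\<bar> powr p) \<partial>lborel)
          = (\<integral>\<^sup>+v. ennreal ((1 + \<tau> * v) powr \<delta> * \<bar>f (1 + \<tau> * v)\<bar> powr p) * indicator {0<..} (1 + \<tau> * v) \<partial>lborel)"
        using \<tau> by (subst nn_integral_real_affine[OF _ \<tau>0, of _ 1]) auto
      also have "\<dots> \<le> (\<integral>\<^sup>+v. ennreal (2 powr \<bar>\<delta>\<bar>) * (ennreal (1 / v) * indicator {\<epsilon>..1/2} v) \<partial>lborel)"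
      proof (intro nn_integral_mono)
        fix v :: real
        show "ennreal ((1 + \<tau> * v) powr \<delta> * \<bar>f (1 + \<tau> * v)\<bar> powr p) * indicator {0<..} (1 + \<tau> * v)
            \<le> ennreal (2 powr \<bar>\<delta>\<bar>) * (ennreal (1 / v) * indicator {\<epsilon>..1/2} v)"
        proof (cases "v \<in> {\<epsilon>..1/2}")
          case True
          then have v: "0 < v" "v \<le> 1/2" using \<epsilon> by auto
          have "(v powr - s) powr p = v powr (- (s * p))" by (simp add: powr_powr)
          also have "\<dots> \<le> v powr - 1" using sp v by (intro powr_mono') auto
          also have "\<dots> = 1 / v" using v by (simp add: powr_minus_divide)
          finally have "(1 + \<tau> * v) powr \<delta> * (v powr - s) powr p \<le> 2 powr \<bar>\<delta>\<bar> * (1 / v)"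
            using near[OF v] by (intro mult_mono powr_between) auto
          moreover have "\<bar>f (1 + \<tau> * v)\<bar> = v powr - s" using True \<sigma> unfolding f\<tau> by (simp add: abs_mult)
          ultimately show ?thesis using True near[OF v] v
            by (simp add: ennreal_mult[symmetric] ennreal_leI)
        next
          case False
          then show ?thesis unfolding f\<tau> using p0 by simp
        qed
      qed
      also have "\<dots> = ennreal (2 powr \<bar>\<delta>\<bar>) * (\<integral>\<^sup>+v\<in>{\<epsilon>..1/2}. ennreal (1 / v) \<partial>lborel)"
        by (rule nn_integral_cmult) measurable
      also have "\<dots> = ennreal (2 powr \<bar>\<delta>\<bar> * l)"
        unfolding nn_integral_inverse_Icc[OF \<epsilon>] ln\<epsilon> using l by (simp add: ennreal_mult)
      finally show ?thesis .
    qed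
    have ge: "c * l - c2 \<le> mean (x - 1) f x" if x: "3 \<le> x" "x \<le> 4" for x
    proof -
      define t where "t = x - 1"
      have t: "t > 0" using x unfolding t_def by simp
      have x0: "x > 0" using x by simp
      define g where "g v = \<sigma> * (ker t x (1 + \<tau> * v) * (1 + \<tau> * v) powr (2 * \<alpha> + 1)) * v powr - s" for v
      have gm [measurable]: "g \<in> borel_measurable borel" unfolding g_def[abs_def] by measurable
      have "mean t f x = (LINT v|lborel. indicator {0<..} (1 + \<tau> * v) * (ker t x (1 + \<tau> * v) * ((1 + \<tau> * v) powr (2 * \<alpha> + 1) * f (1 + \<tau> * v))))"
        unfolding mean_def set_lebesgue_integral_def
        using \<tau> by (subst lborel_integral_real_affine[OF \<tau>0, of _ 1]) simp
      also have "\<dots> = (LINT v:{\<epsilon>..1/2}|lborel. g v)"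
        unfolding set_lebesgue_integral_def
      proof (intro Bochner_Integration.integral_cong refl)
        fix v :: real
        show "indicator {0<..} (1 + \<tau> * v) * (ker t x (1 + \<tau> * v) * ((1 + \<tau> * v) powr (2 * \<alpha> + 1) * f (1 + \<tau> * v)))
          = indicator {\<epsilon>..1/2} v *\<^sub>R g v"
        proof (cases "v \<in> {\<epsilon>..1/2}")
          case True
          then have "0 < 1 + \<tau> * v" using near(1)[of v] \<epsilon> by auto
          with True show ?thesis unfolding f\<tau> g_def by simp
        qed (simp add: f\<tau>)
      qed
      finally have meq: "mean t f x = (LINT v:{\<epsilon>..1/2}|lborel. g v)" .
      obtain M where M: "M > 0" and kM: "\<And>x z. 0 < x \<Longrightarrow> 0 < z \<Longrightarrow> z \<noteq> t + x \<Longrightarrow> z \<noteq> x - t \<Longrightarrow> z \<noteq> t - x \<Longrightarrow>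
          \<bar>ker t x z\<bar> \<le> M * (x powr - \<alpha> * Q x * (z powr - \<alpha> * Q z) * sing t x z)"
        by (rule ker_bound[OF t]) (rule that; blast)
      \<comment> \<open>The kernel bound, used only for integrability. On the range of the cutoff,
        \<open>z\<close> stays away from the three singular points, so the bound is continuous
        there.\<close>
      define b where "b z = M * (x powr - \<alpha> * Q x * (z powr - \<alpha> * Q z) * sing t x z) * z powr (2 * \<alpha> + 1)" for z
      have sep: "0 < 1 + \<tau> * v" "1 + \<tau> * v \<noteq> t + x" "1 + \<tau> * v \<noteq> x - t" "1 + \<tau> * v \<noteq> t - x" if "v \<in> {\<epsilon>..1/2}" for v
      proof -
        have v: "0 < v" "v \<le> 1/2" using that \<epsilon> by auto
        show "0 < 1 + \<tau> * v" "1 + \<tau> * v \<noteq> t + x" "1 + \<tau> * v \<noteq> t - x"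
          using near[OF v] x unfolding t_def by auto
        show "1 + \<tau> * v \<noteq> x - t" using v \<tau>0 unfolding t_def by simp
      qed
      have "continuous_on {\<epsilon>..1/2} (\<lambda>v. b (1 + \<tau> * v) * v powr - s)"
        unfolding b_def Q_def sing_def using \<epsilon>
        by (intro continuous_intros ballI) (use sep in \<open>force simp: less_le\<close>)+
      then have bi: "set_integrable lborel {\<epsilon>..1/2} (\<lambda>v. b (1 + \<tau> * v) * v powr - s)"
        by (rule set_integrable_continuous_Icc)
      have gi: "set_integrable lborel {\<epsilon>..1/2} g"
      proof (rule set_integrable_lborel_bound[OF bi gm])
        fix v assume v: "v \<in> {\<epsilon>..1/2}"
        have "\<bar>g v\<bar> = \<bar>ker t x (1 + \<tau> * v)\<bar> * (1 + \<tau> * v) powr (2 * \<alpha> + 1) * v powr - s"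
          unfolding g_def abs_mult \<sigma> by simp
        also have "\<dots> \<le> b (1 + \<tau> * v) * v powr - s"
          unfolding b_def by (intro mult_right_mono kM x0 sep[OF v]) auto
        finally show "\<bar>g v\<bar> \<le> b (1 + \<tau> * v) * v powr - s" .
      qed simp
      \<comment> \<open>An antiderivative of the lower bound: the logarithm yields
        \<open>c * l\<close>, while the term with \<open>E\<close> stays bounded by
        \<open>c2\<close> independently of the cutoff because \<open>s < 1\<close>.\<close>
      define F where "F v = c * ln v - E / (1 - s) * v powr (1 - s)" for v
      have li: "set_integrable lborel {\<epsilon>..1/2} (\<lambda>v. c / v - E * v powr - s)"
        using \<epsilon> by (intro set_integrable_continuous_Icc continuous_intros) auto
      have le: "c / v - E * v powr - s \<le> g v" if "v \<in> {\<epsilon>..1/2}" for v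
      proof -
        have v: "0 < v" "v \<le> 1/2" using that \<epsilon> by auto
        \<comment> \<open>The exponent of \<open>f\<close> is tuned to the kernel:
          \<open>v powr (s - 1)\<close> from the singularity times \<open>v powr - s\<close> is
          \<open>1 / v\<close>, the critical case.\<close>
        have "v powr (\<alpha> + \<beta> - 1/2) * v powr - s = v powr (-1)"
          unfolding powr_add[symmetric] s_def by simp
        also have "\<dots> = 1 / v" using v by (simp add: powr_minus_divide)
        finally have "c / v - E * v powr - s = (c * v powr (\<alpha> + \<beta> - 1/2) - E) * v powr - s"
          by (simp add: left_diff_distrib mult.assoc)
        also have "\<dots> \<le> g v" unfolding g_def t_def by (intro mult_right_mono low x v) auto
        finally show ?thesis .
      qed
      have "(LINT v:{\<epsilon>..1/2}|lborel. c / v - E * v powr - s) = F (1/2) - F \<epsilon>"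
      proof (rule set_integral_FTC)
        show "(F has_real_derivative c / v - E * v powr - s) (at v)" if "\<epsilon> \<le> v" "v \<le> 1/2" for v
          using that \<epsilon> s unfolding F_def by (auto intro!: derivative_eq_intros)
      qed (use \<epsilon> in \<open>auto intro!: continuous_intros\<close>)
      also have "F (1/2) - F \<epsilon> = c * (ln (1/2) - ln \<epsilon>) - c2 * ((1/2) powr (1 - s) - \<epsilon> powr (1 - s))"
        unfolding F_def c2_def by (simp only: right_diff_distrib)
      finally have I: "(LINT v:{\<epsilon>..1/2}|lborel. c / v - E * v powr - s) = c * l - c2 * ((1/2) powr (1 - s) - \<epsilon> powr (1 - s))"
        unfolding ln\<epsilon> .
      have "(1/2) powr (1 - s) \<le> (1/2) powr (0::real)" using s by (intro powr_mono') auto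
      also have "(1/2) powr (0::real) = (1::real)" by simp
      finally have "(1/2) powr (1 - s) - \<epsilon> powr (1 - s) \<le> 1"
        using powr_ge_zero[of \<epsilon> "1 - s"] by argo
      then have "c2 * ((1/2) powr (1 - s) - \<epsilon> powr (1 - s)) \<le> c2 * 1" using c2 by (rule mult_left_mono)
      then have "c * l - c2 \<le> (LINT v:{\<epsilon>..1/2}|lborel. c / v - E * v powr - s)" unfolding I by simp
      also have "\<dots> \<le> (LINT v:{\<epsilon>..1/2}|lborel. g v)" by (rule set_integral_mono[OF li gi le])
      finally show ?thesis unfolding meq[symmetric] t_def .
    qed
    define d where "d = (c * l - c2) powr p"
    have "(\<integral>\<^sup>+x\<in>{0<..}. ennreal (x powr \<delta>) * ennreal (indicator {3..4} x * d) \<partial>lborel) \<le> ennreal (K * (2 powr \<bar>\<delta>\<bar> * l))"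
    proof (rule Kle[OF fm _ _ norm])
      show "0 \<le> 2 powr \<bar>\<delta>\<bar> * l" using l by simp
      fix x :: real assume x: "x > 0"
      show "ennreal (indicator {3..4} x * d) \<le> ennreal_powr (sph_max \<alpha> \<beta> f x) p"
      proof (cases "x \<in> {3..4}")
        case True
        then have x1: "x - 1 > 0" "3 \<le> x" "x \<le> 4" by auto
        have "c * l - c2 \<le> \<bar>mean (x - 1) f x\<bar>" using ge[OF x1(2,3)] by simp
        then have "ennreal_powr (ennreal (c * l - c2)) p \<le> ennreal_powr (ennreal \<bar>mean (x - 1) f x\<bar>) p"
          using p0 by (intro ennreal_powr_mono ennreal_leI) auto
        also have "\<dots> \<le> ennreal_powr (sph_max \<alpha> \<beta> f x) p"
          using sph_max_ge[OF x1(1), of \<alpha> \<beta> f x] p0 unfolding sph_mean_eq_mean[OF x1(1) x fm] by (intro ennreal_powr_mono) auto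
        finally show ?thesis using True l unfolding d_def by (simp add: ennreal_powr_ennreal)
      qed simp
    qed measurable
    moreover have "ennreal (4 powr - \<bar>\<delta>\<bar> * d) \<le> (\<integral>\<^sup>+x\<in>{0<..}. ennreal (x powr \<delta>) * ennreal (indicator {3..4} x * d) \<partial>lborel)"
    proof -
      have "ennreal (4 powr - \<bar>\<delta>\<bar> * d) = (\<integral>\<^sup>+x. ennreal (4 powr - \<bar>\<delta>\<bar> * d) * indicator {3..4::real} x \<partial>lborel)"
        by (simp add: nn_integral_cmult_indicator)
      also have "\<dots> \<le> (\<integral>\<^sup>+x\<in>{0<..}. ennreal (x powr \<delta>) * ennreal (indicator {3..4} x * d) \<partial>lborel)"
      proof (intro nn_integral_mono)
        fix x :: real
        have "4 powr - \<bar>\<delta>\<bar> * d \<le> x powr \<delta> * d" if "x \<in> {3..4}"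
          using that unfolding d_def by (intro mult_right_mono powr_between) auto
        then show "ennreal (4 powr - \<bar>\<delta>\<bar> * d) * indicator {3..4} x \<le> ennreal (x powr \<delta>) * ennreal (indicator {3..4} x * d) * indicator {0<..} x"
          by (auto simp: indicator_def ennreal_mult''[symmetric] d_def intro!: ennreal_leI)
      qed
      finally show ?thesis .
    qed
    ultimately have "ennreal (4 powr - \<bar>\<delta>\<bar> * d) \<le> ennreal (K * (2 powr \<bar>\<delta>\<bar> * l))" by (rule order_trans[rotated])
    then show ?thesis using K l unfolding d_def by simp
  qed
  \<comment> \<open>Taking the \<open>p\<close>-th root in \<open>main\<close> compares
    \<open>c * l - c2\<close> with a multiple of \<open>l powr (1 / p)\<close>. The interval of
    radii has fixed length, so it contributes only constants.\<close>
  define b where "b = (K * 2 powr \<bar>\<delta>\<bar> / 4 powr - \<bar>\<delta>\<bar>) powr (1 / p)"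
  have "c * l \<le> c2 + b * l powr (1 / p)" if l: "l \<ge> 1 + c2 / c" for l
  proof -
    have "c2 / c \<ge> 0" using c c2 by simp
    then have l0: "l > 0" "c2 / c \<le> l" using l by auto
    then have d: "c * l - c2 \<ge> 0" using c by (simp add: field_simps)
    have "(c * l - c2) powr p \<le> K * 2 powr \<bar>\<delta>\<bar> / 4 powr - \<bar>\<delta>\<bar> * l"
      using main[OF l0(1) d] by (simp add: field_simps)
    then have "((c * l - c2) powr p) powr (1 / p) \<le> (K * 2 powr \<bar>\<delta>\<bar> / 4 powr - \<bar>\<delta>\<bar> * l) powr (1 / p)"
      using p0 by (intro powr_mono2) auto
    also have "\<dots> = b * l powr (1 / p)" unfolding b_def by (rule powr_mult)
    finally have "c * l - c2 \<le> b * l powr (1 / p)" using d p0 by (simp add: powr_powr)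
    then show ?thesis by simp
  qed
  then show False by (rule linear_not_le_powr[OF c p])
qed

end

theorem proposition1p6:
  fixes \<alpha> \<beta> p \<delta> :: real
  assumes "\<alpha> > -1" and "\<alpha> + \<beta> > -1/2"
    and "1 < p"
    and "sph_max_bounded \<alpha> \<beta> p \<delta>"
  shows "1 / p < \<alpha> + \<beta> + 1/2 \<and>
    -1 < \<delta> \<and> - \<beta> * p \<le> \<delta> \<and>
    \<delta> < (2 * \<alpha> + 2) * p - 1 \<and> \<delta> < (2 * \<alpha> + \<beta> + 1) * p - 1"
proof -
  have \<nu>: "\<alpha> + \<beta> > -1" using assms(2) by simp
  obtain A \<phi> C1 where A: "A > 0" "C1 > 0"
    "\<And>w. w > 0 \<Longrightarrow> \<bar>bessel_J (\<alpha> + \<beta>) w - A * w powr (-1/2) * cos (w - \<phi>)\<bar> \<le> C1 * w powr (-3/2)"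
    "\<And>w. w > 0 \<Longrightarrow> \<bar>bessel_J (\<alpha> + \<beta>) w\<bar> \<le> C1 * w powr (\<alpha> + \<beta>) * (1 + w)"
    by (rule bessel_J_estimates[OF \<nu>]) (rule that; blast)
  obtain B \<psi> C2 where B: "B > 0" "C2 > 0"
    "\<And>w. w > 0 \<Longrightarrow> \<bar>bessel_J \<alpha> w - B * w powr (-1/2) * cos (w - \<psi>)\<bar> \<le> C2 * w powr (-3/2)"
    "\<And>w. w > 0 \<Longrightarrow> \<bar>bessel_J \<alpha> w\<bar> \<le> C2 * w powr \<alpha> * (1 + w)"
    by (rule bessel_J_estimates[OF assms(1)]) (rule that; blast)
  interpret spherical_kernel \<alpha> \<beta> A \<phi> B \<psi> "max C1 C2"
  proof
    fix w :: real assume w: "w > 0"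
    show "\<bar>bessel_J (\<alpha> + \<beta>) w - A * w powr (-1/2) * cos (w - \<phi>)\<bar> \<le> max C1 C2 * w powr (-3/2)"
      by (rule order_trans[OF A(3)[OF w]], rule mult_right_mono) auto
    show "\<bar>bessel_J \<alpha> w - B * w powr (-1/2) * cos (w - \<psi>)\<bar> \<le> max C1 C2 * w powr (-3/2)"
      by (rule order_trans[OF B(3)[OF w]], rule mult_right_mono) auto
    show "\<bar>bessel_J (\<alpha> + \<beta>) w\<bar> \<le> max C1 C2 * w powr (\<alpha> + \<beta>) * (1 + w)"
      by (rule order_trans[OF A(4)[OF w]], intro mult_right_mono) (use w in auto)
    show "\<bar>bessel_J \<alpha> w\<bar> \<le> max C1 C2 * w powr \<alpha> * (1 + w)"
      by (rule order_trans[OF B(4)[OF w]], intro mult_right_mono) (use w in auto)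
  qed (use assms A B in auto)
  note bdd = assms(4) and p = assms(3)
  have "1 / p < \<alpha> + \<beta> + 1/2"
  proof (cases "\<alpha> + \<beta> < 1/2")
    case True
    then show ?thesis by (rule bounded_imp_inverse_p_lt[OF bdd p])
  next
    case False
    \<comment> \<open>For \<open>\<alpha> + \<beta> \<ge> 1/2\<close> the right-hand side of the
      first condition is at least 1, so the condition reduces to \<open>p > 1\<close>.\<close>
    have "1 / p < 1" using p by simp
    then show ?thesis using False by simp
  qed
  moreover have gt: "-1 < \<delta>" by (rule bounded_imp_delta_gt[OF bdd p])
  moreover have lt: "\<delta> < (2 * \<alpha> + 2) * p - 1" by (rule bounded_imp_delta_lt[OF bdd p])
  moreover have "- \<beta> * p \<le> \<delta> \<and> \<delta> < (2 * \<alpha> + \<beta> + 1) * p - 1"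
  proof (cases "\<beta> < 1")
    case True
    then show ?thesis using bounded_imp_delta_ge[OF bdd p] bounded_imp_delta_lt_far[OF bdd p] by simp
  next
    case False
    \<comment> \<open>For \<open>\<beta> \<ge> 1\<close> one has
      \<open>- \<beta> * p \<le> - p < -1 < \<delta>\<close>, and
      \<open>2 * \<alpha> + 2 \<le> 2 * \<alpha> + \<beta> + 1\<close>; the profile at infinity,
      which needs \<open>\<beta> < 1\<close>, is not involved.\<close>
    then have "p \<le> \<beta> * p" using p mult_right_mono[of 1 \<beta> p] by simp
    then have "- \<beta> * p \<le> \<delta>" using gt p unfolding mult_minus_left by argo
    moreover have "(2 * \<alpha> + 2) * p \<le> (2 * \<alpha> + \<beta> + 1) * p" using False p by (intro mult_right_mono) auto
    then have "\<delta> < (2 * \<alpha> + \<beta> + 1) * p - 1" using lt by argo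
    ultimately show ?thesis by blast
  qed
  ultimately show ?thesis by blast
qed

end
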